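(* Let $N\ge 2$ be an integer and let $G$ be a subgroup of $\mathrm{GL}_2(\mathbb{Z}/N\mathbb{Z})$ containing $-1$. Assume that the modular curve $X_G$ is defined over $\mathbb{Q}$, and that the absolute Galois group $\mathrm{Gal}(\bar{\mathbb{Q}}/\mathbb{Q})$ acts non-transitively on the set of cusps of $X_G$. Then for every $P\in Y_G(\mathbb{Z})$ we have $$\log|j(P)|\le 12|G|N^2\log(3N).$$
   Context: $X_G$ denotes the modular curve attached to $G$: over $\mathbb{C}$ it is $\bar{\mathcal{H}}/\Gamma$, where $\mathcal{H}$ is the upper half-plane, $\bar{\mathcal{H}}=\mathcal{H}\cup\mathbb{Q}\cup\{i\infty\}$ and $\Gamma$ is the pull-back of $G\cap\mathrm{SL}_2(\mathbb{Z}/N\mathbb{Z})$ to $\mathrm{SL}_2(\mathbb{Z})$; it is defined (has a geometrically integral model) over $\mathbb{Q}(\zeta_N)^{\det G}$, in particular over $\mathbb{Q}$ when $\det G=(\mathbb{Z}/N\mathbb{Z})^\times$. $Y_G$ is $X_G$ with the cusps removed, $j$ is the modular invariant (a rational function on $X_G$), and $Y_G(\mathbb{Z})$ denotes the set of points $P\in Y_G(\mathbb{Q})$ with $j(P)\in\mathbb{Z}$. *)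

theory Defs
  imports
    "HOL-Analysis.Analysis"
    "HOL-Complex_Analysis.Complex_Analysis"
    "HOL-Algebra.Group"
begin

section \<open>The groups $\mathrm{SL}_2(\mathbb{Z})$ and $\mathrm{GL}_2(\mathbb{Z}/N\mathbb{Z})$\<close>

definition SL2Z :: "(int^2^2) set" where
  "SL2Z = {A. det A = 1}"

definition mat_mod :: "nat \<Rightarrow> int^2^2 \<Rightarrow> int^2^2" where
  "mat_mod N A = (\<chi> i j. A $ i $ j mod int N)"

text \<open>
  A matrix over $\mathbb{Z}/N\mathbb{Z}$ is represented by its unique integer lift with
  all entries in $\{0,\dots,N-1\}$.
\<close>

definition GL2 :: "nat \<Rightarrow> (int^2^2) monoid" where
  "GL2 N = \<lparr>carrier = {A. mat_mod N A = A \<and> coprime (det A) (int N)},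
            monoid.mult = (\<lambda>A B. mat_mod N (A ** B)),
            one = mat_mod N (mat 1)\<rparr>"

text \<open>The pull-back $\Gamma$ of $G\cap\mathrm{SL}_2(\mathbb{Z}/N\mathbb{Z})$ to $\mathrm{SL}_2(\mathbb{Z})$.\<close>

definition Gamma_of :: "nat \<Rightarrow> (int^2^2) set \<Rightarrow> (int^2^2) set" where
  "Gamma_of N G = {A \<in> SL2Z. mat_mod N A \<in> G}"


section \<open>The extended upper half-plane and the points of $X_G$\<close>

definition uhp :: "complex set" where
  "uhp = {\<tau>. Im \<tau> > 0}"

datatype ext_point = Pt complex | I_inf

definition uhp_bar :: "ext_point set" where
  "uhp_bar = Pt ` uhp \<union> Pt ` \<rat> \<union> {I_inf}"

definition mob :: "int^2^2 \<Rightarrow> complex \<Rightarrow> complex" where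
  "mob A \<tau> = (of_int (A$1$1) * \<tau> + of_int (A$1$2)) / (of_int (A$2$1) * \<tau> + of_int (A$2$2))"

fun mob_ext :: "int^2^2 \<Rightarrow> ext_point \<Rightarrow> ext_point" where
  "mob_ext A (Pt z) =
     (if of_int (A$2$1) * z + of_int (A$2$2) = 0 then I_inf else Pt (mob A z))"
| "mob_ext A I_inf =
     (if A$2$1 = 0 then I_inf else Pt (of_int (A$1$1) / of_int (A$2$1)))"

definition orbit_rel :: "nat \<Rightarrow> (int^2^2) set \<Rightarrow> (ext_point \<times> ext_point) set" where
  "orbit_rel N G =
     {(p, q). p \<in> uhp_bar \<and> q \<in> uhp_bar \<and> (\<exists>\<gamma>\<in>Gamma_of N G. mob_ext \<gamma> p = q)}"

text \<open>The complex points of $X_G$, its cusps, and the complex points of $Y_G$.\<close>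

definition X_curve :: "nat \<Rightarrow> (int^2^2) set \<Rightarrow> ext_point set set" where
  "X_curve N G = uhp_bar // orbit_rel N G"

definition cusps :: "nat \<Rightarrow> (int^2^2) set \<Rightarrow> ext_point set set" where
  "cusps N G = (Pt ` \<rat> \<union> {I_inf}) // orbit_rel N G"

definition Y_curve :: "nat \<Rightarrow> (int^2^2) set \<Rightarrow> ext_point set set" where
  "Y_curve N G = X_curve N G - cusps N G"


section \<open>The modular invariant\<close>

definition Eisenstein_G :: "nat \<Rightarrow> complex \<Rightarrow> complex" where
  "Eisenstein_G k \<tau> =
     (\<Sum>\<^sub>\<infinity>(m, n) \<in> UNIV - {(0::int, 0::int)}. 1 / (of_int m * \<tau> + of_int n) ^ k)"

definition j_inv :: "complex \<Rightarrow> complex" where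
  "j_inv \<tau> = (let g2 = 60 * Eisenstein_G 4 \<tau>; g3 = 140 * Eisenstein_G 6 \<tau>
              in 1728 * g2 ^ 3 / (g2 ^ 3 - 27 * g3 ^ 2))"

text \<open>
  The value of \<open>j\<close> at a point of $Y_G$; by $\mathrm{SL}_2(\mathbb{Z})$-invariance of
  \<open>j_inv\<close> the set below has exactly one element.
\<close>

definition j_at :: "ext_point set \<Rightarrow> complex" where
  "j_at P = the_elem {j_inv \<tau> |\<tau>. Pt \<tau> \<in> P}"


section \<open>Galois theory of $\bar{\mathbb{Q}}$ and of $\mathbb{Q}(\zeta_N)$\<close>

definition Qbar :: "complex set" where
  "Qbar = {x. algebraic x}"

text \<open>
  Elements of $\mathrm{Gal}(\bar{\mathbb{Q}}/\mathbb{Q})$ are represented by functions on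
  \<^typ>\<open>complex\<close>; their values outside \<^const>\<open>Qbar\<close> are irrelevant.
\<close>

definition Gal_Q :: "(complex \<Rightarrow> complex) set" where
  "Gal_Q = {\<sigma>. bij_betw \<sigma> Qbar Qbar \<and>
      (\<forall>x\<in>Qbar. \<forall>y\<in>Qbar. \<sigma> (x + y) = \<sigma> x + \<sigma> y \<and> \<sigma> (x * y) = \<sigma> x * \<sigma> y)}"

definition zeta :: "nat \<Rightarrow> complex" where
  "zeta N = exp (2 * of_real pi * \<i> / of_nat N)"

definition Q_zeta :: "nat \<Rightarrow> complex set" where
  "Q_zeta N = range (\<lambda>p :: rat poly. poly (map_poly of_rat p) (zeta N))"

text \<open>
  The fixed field $\mathbb{Q}(\zeta_N)^{\det G}$, where $d\in(\mathbb{Z}/N\mathbb{Z})^\times$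
  acts by $\zeta_N\mapsto\zeta_N^d$. This is the field over which $X_G$ is defined.
\<close>

definition field_of_def :: "nat \<Rightarrow> (int^2^2) set \<Rightarrow> complex set" where
  "field_of_def N G = {x \<in> Q_zeta N.
      \<forall>g\<in>G. \<forall>\<sigma>\<in>Gal_Q. \<sigma> (zeta N) = zeta N powi det g \<longrightarrow> \<sigma> x = x}"

definition defined_over_Q :: "nat \<Rightarrow> (int^2^2) set \<Rightarrow> bool" where
  "defined_over_Q N G \<longleftrightarrow> field_of_def N G = \<rat>"


section \<open>Modular functions and the function field of the model of $X_G$\<close>

abbreviation at_i_inf :: "complex filter" where
  "at_i_inf \<equiv> filtercomap Im at_top"

text \<open>\<open>F\<close> is the expansion of \<open>f\<close> at $i\infty$ in powers of $q^{1/N}=e^{2\pi i\tau/N}$.\<close>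

definition has_q_expansion :: "nat \<Rightarrow> (complex \<Rightarrow> complex) \<Rightarrow> complex fls \<Rightarrow> bool" where
  "has_q_expansion N f F \<longleftrightarrow> fls_conv_radius F > 0 \<and>
     (\<forall>\<^sub>F \<tau> in at_i_inf. f \<tau> = eval_fls F (exp (2 * of_real pi * \<i> * \<tau> / of_nat N)))"

text \<open>
  The field $F_N$ of modular functions of level $N$ whose Fourier coefficients at $i\infty$ lie
  in $\mathbb{Q}(\zeta_N)$. The library convention for nicely meromorphic functions
  (removable singularities removed, value 0 at poles) makes equality of modular functions
  the same as pointwise equality on the upper half-plane.
\<close>

definition modular_fun :: "nat \<Rightarrow> (complex \<Rightarrow> complex) \<Rightarrow> bool" where
  "modular_fun N f \<longleftrightarrow> f nicely_meromorphic_on uhp \<and>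
     (\<forall>\<gamma>\<in>SL2Z. mat_mod N \<gamma> = mat_mod N (mat 1) \<longrightarrow> (\<forall>\<tau>\<in>uhp. f (mob \<gamma> \<tau>) = f \<tau>)) \<and>
     (\<forall>\<gamma>\<in>SL2Z. \<exists>F. has_q_expansion N (\<lambda>\<tau>. f (mob \<gamma> \<tau>)) F)"

definition F_field :: "nat \<Rightarrow> (complex \<Rightarrow> complex) set" where
  "F_field N = {f. modular_fun N f \<and>
     (\<exists>F. has_q_expansion N f F \<and> (\<forall>n. fls_nth F n \<in> Q_zeta N))}"

definition diag1 :: "int \<Rightarrow> int^2^2" where
  "diag1 d = (\<chi> i j. if i = j then (if i = 1 then 1 else d) else 0)"

text \<open>
  The right action of $\mathrm{GL}_2(\mathbb{Z}/N\mathbb{Z})$ on $F_N$ (Shimura): the matrix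
  $\mathrm{diag}(1,d)$ acts on the Fourier coefficients by $\zeta_N\mapsto\zeta_N^d$ and
  (the reduction of) $\gamma\in\mathrm{SL}_2(\mathbb{Z})$ acts by $f\mapsto f\circ\gamma$.
  \<open>GL2_maps N g f h\<close> says that $f^g=h$, with $g$ decomposed as $\mathrm{diag}(1,\det g)\,\gamma$;
  \<open>u\<close> is the image of \<open>f\<close> under $\mathrm{diag}(1,\det g)$.
\<close>

definition GL2_maps ::
  "nat \<Rightarrow> int^2^2 \<Rightarrow> (complex \<Rightarrow> complex) \<Rightarrow> (complex \<Rightarrow> complex) \<Rightarrow> bool" where
  "GL2_maps N g f h \<longleftrightarrow>
     (\<exists>\<gamma>\<in>SL2Z. \<exists>\<sigma>\<in>Gal_Q. \<exists>u\<in>F_field N. \<exists>F U.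
        mat_mod N (diag1 (det g) ** \<gamma>) = mat_mod N g \<and>
        \<sigma> (zeta N) = zeta N powi det g \<and>
        has_q_expansion N f F \<and> has_q_expansion N u U \<and>
        (\<forall>n. fls_nth U n = \<sigma> (fls_nth F n)) \<and>
        (\<forall>\<tau>\<in>uhp. h \<tau> = u (mob \<gamma> \<tau>)))"

text \<open>
  The fixed field $F_N^G$. It is the function field of the model of $X_G$ over
  $\mathbb{Q}(\zeta_N)^{\det G}$.
\<close>

definition function_field :: "nat \<Rightarrow> (int^2^2) set \<Rightarrow> (complex \<Rightarrow> complex) set" where
  "function_field N G = {f \<in> F_field N. \<forall>g\<in>G. GL2_maps N g f f}"


section \<open>Rational points and the Galois action on points\<close>

text \<open>
  \<open>has_value f p v\<close>: the modular function \<open>f\<close> is regular at \<open>p\<close> with value \<open>v\<close>. At a cusp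
  $\gamma(i\infty)$ this is the limit of $f\circ\gamma$ at $i\infty$.
\<close>

definition has_value :: "(complex \<Rightarrow> complex) \<Rightarrow> ext_point \<Rightarrow> complex \<Rightarrow> bool" where
  "has_value f p v \<longleftrightarrow>
     (\<exists>\<tau>\<in>uhp. p = Pt \<tau> \<and> (f \<longlongrightarrow> v) (at \<tau>)) \<or>
     (\<exists>\<gamma>\<in>SL2Z. p = mob_ext \<gamma> I_inf \<and> ((\<lambda>\<tau>. f (mob \<gamma> \<tau>)) \<longlongrightarrow> v) at_i_inf)"

definition has_value_at :: "(complex \<Rightarrow> complex) \<Rightarrow> ext_point set \<Rightarrow> complex \<Rightarrow> bool" where
  "has_value_at f P v \<longleftrightarrow> (\<exists>p\<in>P. has_value f p v)"

text \<open>
  When the model of $X_G$ is over $\mathbb{Q}$: the values at a complex point \<open>P\<close> of the elements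
  of the local ring at \<open>P\<close> form (the image in $\mathbb{C}$ of) its residue field, so \<open>P\<close> is a
  $\mathbb{Q}$-point iff all these values are rational; and the conjugate $P^\sigma$ of a
  $\bar{\mathbb{Q}}$-point \<open>P\<close> (every cusp is one) is the point \<open>P'\<close> with $f(P')=\sigma(f(P))$ for
  every \<open>f\<close> in the local ring at \<open>P\<close>.
\<close>

definition rational_point :: "nat \<Rightarrow> (int^2^2) set \<Rightarrow> ext_point set \<Rightarrow> bool" where
  "rational_point N G P \<longleftrightarrow>
     (\<forall>f\<in>function_field N G. \<forall>v. has_value_at f P v \<longrightarrow> v \<in> \<rat>)"

definition galois_maps ::
  "nat \<Rightarrow> (int^2^2) set \<Rightarrow> (complex \<Rightarrow> complex) \<Rightarrow> ext_point set \<Rightarrow> ext_point set \<Rightarrow> bool" where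
  "galois_maps N G \<sigma> P P' \<longleftrightarrow>
     (\<forall>f\<in>function_field N G. \<forall>v. has_value_at f P v \<longrightarrow> has_value_at f P' (\<sigma> v))"

definition galois_transitive_on_cusps :: "nat \<Rightarrow> (int^2^2) set \<Rightarrow> bool" where
  "galois_transitive_on_cusps N G \<longleftrightarrow>
     (\<forall>C\<in>cusps N G. \<forall>C'\<in>cusps N G. \<exists>\<sigma>\<in>Gal_Q. galois_maps N G \<sigma> C C')"

definition Y_rational :: "nat \<Rightarrow> (int^2^2) set \<Rightarrow> ext_point set set" where
  "Y_rational N G = {P \<in> Y_curve N G. rational_point N G P}"

definition Y_integral :: "nat \<Rightarrow> (int^2^2) set \<Rightarrow> ext_point set set" where
  "Y_integral N G = {P \<in> Y_rational N G. j_at P \<in> \<int>}"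

end

(* Write q = e^(2 pi i tau) and let h_a, for a row vector a modulo N, be the 12N-th power of the
   Siegel function: a unit on the upper half-plane whose order at infinity in q^(1/N) is
   6 N^2 B_2. For each a the product U_a of the h_(ag) over g in G lies in the function field, and
   U_a and N^(12N|G|) / U_a are integral over Z[zeta_N][j]; so at an integral point P both values
   are nonzero rational integers. If U_a has a zero or a pole at the cusp closest to P (its order
   is even, since -1 is in G), then the product expansion bounds log(1/|q|), hence log|j(P)|.

   It remains to see that all U_a can be regular at a cusp only if Galois is transitive on the
   cusps. The orders of the U_a at the cusp of the column vector v are sums of B_2 over the orbit
   G v; since the Fourier coefficients of B_2 are positive and those of index 1 and -1 outweigh the
   others, all orders vanish only if the orbit contains every primitive vector. If G is transitive on
   primitive vectors, then any two cusps are conjugate: this needs the compatibility of the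
   Galois action on expansions at infinity with expansions at the other cusps, which is proved by
   Lagrange interpolation of a modular function in a combination theta of Siegel functions
   that separates the matrices up to sign, followed by linear algebra over Q(zeta_N). *)
theory Submission
  imports Defs "HOL-Real_Asymp.Real_Asymp" "HOL-Number_Theory.Cong"
begin

text \<open>Twelfth powers make the S-law of theta exact, since its constant c satisfies c^12 = 1;
  the factor N removes the roots of unity that arise when a characteristic is shifted by an integer.
  So h_a depends only on a modulo N, and SL2(Z) acts on it exactly through a.

  \<open>GL2_maps\<close> asks for a lift of g and for an automorphism of Qbar with prescribed
  effect on zeta_N. Both are read off from any element of the function field; if there were none,
  any two cusps would be conjugate vacuously.

  The obstacle is that the Galois action is defined by coefficients at infinity, while conjugate
  cusps concern values elsewhere. The bridge is a relation: D(j) times a Lagrange denominator times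
  f is a polynomial in theta over Q(zeta_N)[j]. It can be conjugated coefficientwise at infinity
  and, being an identity of functions, carried to any other cusp.

  A nonzero even order is at least 2 in absolute value, which halves the bound for log(1/|q|). Of
  N^2, one N is in the exponent 12N and one comes from q = (q^(1/N))^N. The 3 in log(3N) pays for
  comparing log|j| with log(1/|q|).\<close>

no_notation fps_nth (infixl "$" 75)

section \<open>Two-by-two integer matrices and their reduction modulo N\<close>

definition mat2 :: "int \<Rightarrow> int \<Rightarrow> int \<Rightarrow> int \<Rightarrow> int^2^2" where
  "mat2 a b c d = (\<chi> i j. if i = 1 then (if j = 1 then a else b) else (if j = 1 then c else d))"

lemma mat2_nth [simp]:
  "mat2 a b c d $ 1 $ 1 = a" "mat2 a b c d $ 1 $ 2 = b"
  "mat2 a b c d $ 2 $ 1 = c" "mat2 a b c d $ 2 $ 2 = d"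
  by (simp_all add: mat2_def)

lemma mat2_eq_iff:
  "(A :: int^2^2) = B \<longleftrightarrow> A$1$1 = B$1$1 \<and> A$1$2 = B$1$2 \<and> A$2$1 = B$2$1 \<and> A$2$2 = B$2$2"
  by (auto simp: vec_eq_iff forall_2)

lemma mat2_collapse: "mat2 (A$1$1) (A$1$2) (A$2$1) (A$2$2) = A"
  by (simp add: mat2_eq_iff)

lemma mult_nth2:
  "((A :: int^2^2) ** B) $ i $ j = A$i$1 * B$1$j + A$i$2 * B$2$j"
  by (simp add: matrix_matrix_mult_def sum_2)

lemma mat_1_nth [simp]:
  "(mat 1 :: int^2^2) $ 1 $ 1 = 1" "(mat 1 :: int^2^2) $ 1 $ 2 = 0"
  "(mat 1 :: int^2^2) $ 2 $ 1 = 0" "(mat 1 :: int^2^2) $ 2 $ 2 = 1"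
  by (simp_all add: mat_def)

lemma mat_mod_nth [simp]: "mat_mod N A $ i $ j = A $ i $ j mod int N"
  by (simp add: mat_mod_def)

lemma diag1_nth [simp]:
  "diag1 d $ 1 $ 1 = 1" "diag1 d $ 1 $ 2 = 0" "diag1 d $ 2 $ 1 = 0" "diag1 d $ 2 $ 2 = d"
  by (simp_all add: diag1_def)

lemma mat_mod_idem [simp]: "mat_mod N (mat_mod N A) = mat_mod N A"
  by (simp add: mat2_eq_iff)

lemma mat_mod_mult_cong:
  assumes "mat_mod N A = mat_mod N A'" "mat_mod N B = mat_mod N B'"
  shows "mat_mod N (A ** B) = mat_mod N (A' ** B')"
proof -
  have "(A $ i $ k * B $ k $ j) mod int N = (A' $ i $ k * B' $ k $ j) mod int N" for i j k
    using assms by (intro mod_mult_cong) (auto simp: vec_eq_iff)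
  then show ?thesis
    by (auto simp: mat2_eq_iff mult_nth2 intro!: mod_add_cong)
qed

lemma mat_mod_mult_left [simp]: "mat_mod N (mat_mod N A ** B) = mat_mod N (A ** B)"
  and mat_mod_mult_right [simp]: "mat_mod N (A ** mat_mod N B) = mat_mod N (A ** B)"
  by (rule mat_mod_mult_cong; simp)+

lemma det_mat_mod: "det (mat_mod N A) mod int N = det A mod int N"
proof -
  have "(x mod n * (y mod n) - z mod n * (w mod n)) mod n = (x * y - z * w) mod n" for x y z w n :: int
    by (metis mod_diff_eq mod_mult_eq)
  then show ?thesis by (simp add: det_2)
qed

section \<open>The modular group\<close>

lemma SL2Z_iff: "A \<in> SL2Z \<longleftrightarrow> A$1$1 * A$2$2 - A$1$2 * A$2$1 = 1"
  by (simp add: SL2Z_def det_2)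

lemma SL2Z_mult [intro]: "A \<in> SL2Z \<Longrightarrow> B \<in> SL2Z \<Longrightarrow> A ** B \<in> SL2Z"
  by (simp add: SL2Z_def det_mul)

lemma SL2Z_1 [simp, intro]: "mat 1 \<in> SL2Z"
  by (simp add: SL2Z_iff)

lemma SL2Z_inv:
  assumes "A \<in> SL2Z"
  obtains B where "B \<in> SL2Z" "A ** B = mat 1" "B ** A = mat 1"
proof (rule that[of "mat2 (A$2$2) (-A$1$2) (-A$2$1) (A$1$1)"])
  show "mat2 (A$2$2) (-A$1$2) (-A$2$1) (A$1$1) \<in> SL2Z"
    using assms by (simp add: SL2Z_iff algebra_simps)
qed (use assms in \<open>simp_all add: SL2Z_iff mat2_eq_iff mult_nth2 algebra_simps\<close>)

definition Smat :: "int^2^2" where "Smat = mat2 0 (-1) 1 0"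
definition Tmat :: "int \<Rightarrow> int^2^2" where "Tmat k = mat2 1 k 0 1"

lemma Smat_SL2Z [simp, intro]: "Smat \<in> SL2Z" and Tmat_SL2Z [simp, intro]: "Tmat k \<in> SL2Z"
  by (simp_all add: Smat_def Tmat_def SL2Z_iff)

text \<open>Euclid's algorithm on the bottom row (c, d): a suitable \<open>Tmat k\<close> followed
  by \<open>Smat\<close> replaces c by d mod c, so |c| drops until the matrix is upper triangular.
  Generators are multiplied on the right, which matches
  \<open>mob (A ** Smat) \<tau> = mob A (-1 / \<tau>)\<close> in the later inductions.\<close>

lemma SL2Z_induct [consumes 1, case_names one S T]:
  assumes "A \<in> SL2Z" and one: "P (mat 1)"
    and S: "\<And>A. A \<in> SL2Z \<Longrightarrow> P A \<Longrightarrow> P (A ** Smat)"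
    and T: "\<And>A k. A \<in> SL2Z \<Longrightarrow> P A \<Longrightarrow> P (A ** Tmat k)"
  shows "P A"
  using assms(1)
proof (induction "nat \<bar>A$2$1\<bar>" arbitrary: A rule: less_induct)
  case less
  show ?case
  proof (cases "A$2$1 = 0")
    case True
    with less.prems have "A$1$1 * A$2$2 = 1" by (simp add: SL2Z_iff)
    then consider "A$1$1 = 1" "A$2$2 = 1" | "A$1$1 = -1" "A$2$2 = -1"
      by (auto simp: zmult_eq_1_iff)
    then show ?thesis
    proof cases
      case 1
      then have "A = mat 1 ** Tmat (A$1$2)"
        using True by (simp add: mat2_eq_iff mult_nth2 Tmat_def)
      then show ?thesis using T[OF SL2Z_1 one] by metis
    next
      case 2
      \<comment> \<open>S^2 = -1 supplies the sign.\<close>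
      then have "A = mat 1 ** Tmat (- A$1$2) ** Smat ** Smat"
        using True by (simp add: mat2_eq_iff mult_nth2 Tmat_def Smat_def)
      then show ?thesis
        using S[OF _ S[OF _ T[OF SL2Z_1 one]]] SL2Z_mult Smat_SL2Z Tmat_SL2Z SL2Z_1 by metis
    qed
  next
    case False
    define k where "k = - (A$2$2 div A$2$1)"
    define B where "B = A ** Tmat k ** Smat"
    have B: "B \<in> SL2Z" unfolding B_def using less.prems by blast
    have "B$2$1 = A$2$2 - A$2$2 div A$2$1 * A$2$1"
      by (simp add: B_def mult_nth2 Tmat_def Smat_def k_def)
    then have "B$2$1 = A$2$2 mod A$2$1" by (simp add: minus_div_mult_eq_mod)
    then have "nat \<bar>B$2$1\<bar> < nat \<bar>A$2$1\<bar>"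
      using False abs_mod_less[of "A$2$1" "A$2$2"] by auto
    from less.hyps[OF this B] have "P B" .
    \<comment> \<open>The inverse of S is S^3, so undoing the reduction uses only the two allowed
      kinds of steps.\<close>
    moreover have "A = B ** Smat ** Smat ** Smat ** Tmat (-k)"
      by (simp add: B_def mat2_eq_iff mult_nth2 Tmat_def Smat_def algebra_simps)
    ultimately show ?thesis using S T B SL2Z_mult Smat_SL2Z by metis
  qed
qed

lemma uhp_denom_nonzero:
  assumes "\<tau> \<in> uhp" "c \<noteq> 0 \<or> d \<noteq> 0"
  shows "of_int c * \<tau> + of_int d \<noteq> 0"
proof
  assume *: "of_int c * \<tau> + of_int d = 0"
  then have "Im (of_int c * \<tau> + of_int d) = 0" by simp
  then have "c = 0" using assms(1) by (simp add: uhp_def)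
  with * assms show False by simp
qed

lemma SL2Z_row_nonzero: "A \<in> SL2Z \<Longrightarrow> A$2$1 \<noteq> 0 \<or> A$2$2 \<noteq> 0"
  by (auto simp: SL2Z_iff)

lemma mob_denom_nonzero:
  "A \<in> SL2Z \<Longrightarrow> \<tau> \<in> uhp \<Longrightarrow> of_int (A$2$1) * \<tau> + of_int (A$2$2) \<noteq> 0"
  by (rule uhp_denom_nonzero) (use SL2Z_row_nonzero in auto)

lemma Im_mob:
  assumes "A \<in> SL2Z" "\<tau> \<in> uhp"
  shows "Im (mob A \<tau>) = Im \<tau> / (cmod (of_int (A$2$1) * \<tau> + of_int (A$2$2)))\<^sup>2"
proof -
  have det: "real_of_int (A$1$1) * A$2$2 - A$1$2 * A$2$1 = 1"
    using assms(1) unfolding SL2Z_iff by (metis of_int_1 of_int_diff of_int_mult)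
  have "Im (mob A \<tau>) = Im \<tau> * (real_of_int (A$1$1) * A$2$2 - A$1$2 * A$2$1) / (cmod (of_int (A$2$1) * \<tau> + of_int (A$2$2)))\<^sup>2"
    unfolding mob_def Im_divide cmod_power2 by (simp add: algebra_simps)
  then show ?thesis unfolding det by simp
qed

lemma mob_in_uhp [intro]: "A \<in> SL2Z \<Longrightarrow> \<tau> \<in> uhp \<Longrightarrow> mob A \<tau> \<in> uhp"
  using Im_mob[of A \<tau>] mob_denom_nonzero[of A \<tau>] by (simp add: uhp_def)

lemma mob_mult:
  assumes "B \<in> SL2Z" "\<tau> \<in> uhp"
  shows "mob (A ** B) \<tau> = mob A (mob B \<tau>)"
proof -
  have nz: "of_int (B$2$1) * \<tau> + of_int (B$2$2) \<noteq> 0"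
    using mob_denom_nonzero[OF assms] .
  have *: "(a * (x / w) + b) / (c * (x / w) + d) = (a * x + b * w) / (c * x + d * w)"
    if "w \<noteq> 0" for a b c d x w :: complex
  proof -
    have "a * (x / w) + b = (a * x + b * w) / w" "c * (x / w) + d = (c * x + d * w) / w"
      using that by (simp_all add: field_simps)
    then show ?thesis using that by simp
  qed
  show ?thesis unfolding mob_def mult_nth2 *[OF nz] by (simp add: algebra_simps)
qed

lemma mob_1 [simp]: "mob (mat 1) \<tau> = \<tau>"
  by (simp add: mob_def)

lemma mob_Smat: "mob Smat \<tau> = -1 / \<tau>" and mob_Tmat: "mob (Tmat k) \<tau> = \<tau> + of_int k"
  by (simp_all add: mob_def Smat_def Tmat_def)

section \<open>Reduction to a fundamental region\<close>

lemma finite_small_denoms: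
  assumes "\<tau> \<in> uhp"
  shows "finite {(c :: int, d :: int). cmod (of_int c * \<tau> + of_int d) \<le> 1}"
proof -
  define y where "y = Im \<tau>"
  have y: "y > 0" using assms by (simp add: uhp_def y_def)
  define M where "M = \<lceil>1 / y\<rceil>"
  define K where "K = \<lceil>1 + of_int M * \<bar>Re \<tau>\<bar>\<rceil>"
  have "{(c :: int, d :: int). cmod (of_int c * \<tau> + of_int d) \<le> 1} \<subseteq> {-M..M} \<times> {-K..K}"
  proof clarify
    fix c d :: int assume le: "cmod (of_int c * \<tau> + of_int d) \<le> 1"
    have "\<bar>Im (of_int c * \<tau> + of_int d)\<bar> \<le> 1" using abs_Im_le_cmod le order_trans by blast
    then have "\<bar>of_int c\<bar> * y \<le> 1" using y by (simp add: abs_mult y_def)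
    then have "real_of_int \<bar>c\<bar> \<le> 1 / y" using y by (simp add: field_simps)
    then have c: "\<bar>c\<bar> \<le> M" unfolding M_def by linarith
    have "\<bar>Re (of_int c * \<tau> + of_int d)\<bar> \<le> 1" using abs_Re_le_cmod le order_trans by blast
    then have "\<bar>of_int d\<bar> \<le> 1 + \<bar>of_int c * Re \<tau>\<bar>" by simp
    also have "\<bar>of_int c * Re \<tau>\<bar> \<le> of_int M * \<bar>Re \<tau>\<bar>"
      unfolding abs_mult using c by (intro mult_right_mono) (auto simp flip: of_int_abs)
    finally have "\<bar>d\<bar> \<le> K" unfolding K_def by linarith
    with c show "c \<in> {-M..M} \<and> d \<in> {-K..K}" by auto
  qed
  then show ?thesis by (rule finite_subset) auto
qed

text \<open>A half-strip containing the classical fundamental domain. Only the possibility of moving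
  a point into it is used, never the uniqueness of the image; below any given height it is
  compact.\<close>

definition fund_region :: "complex set" where
  "fund_region = {\<tau>. \<bar>Re \<tau>\<bar> \<le> 1/2 \<and> Im \<tau> \<ge> sqrt 3 / 2}"

lemma fund_region_subset: "fund_region \<subseteq> uhp"
proof
  fix \<tau> assume "\<tau> \<in> fund_region"
  then have "Im \<tau> \<ge> sqrt 3 / 2" by (simp add: fund_region_def)
  moreover have "sqrt 3 / 2 > (0::real)" by simp
  ultimately have "Im \<tau> > 0" by linarith
  then show "\<tau> \<in> uhp" by (simp add: uhp_def)
qed

text \<open>Choose the bottom row with |c \<tau> + d| minimal, which makes the imaginary part of the
  image maximal, and translate into |Re| <= 1/2. If the image t had |t| < 1, then applying S would
  give a smaller row; so |t| >= 1 and (Im t)^2 >= 1 - 1/4.\<close>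

lemma ex_fund_region:
  assumes "\<tau> \<in> uhp"
  obtains A where "A \<in> SL2Z" "mob A \<tau> \<in> fund_region"
proof -
  define f where "f = (\<lambda>(c :: int, d :: int). cmod (of_int c * \<tau> + of_int d))"
  \<comment> \<open>Rows with |c \<tau> + d| > 1 lose against the row (0, 1) of the identity, so the
    minimum may be taken over this finite set.\<close>
  define D where "D = {(A$2$1, A$2$2) | A. A \<in> SL2Z} \<inter> {(c, d). cmod (of_int c * \<tau> + of_int d) \<le> 1}"
  have fin: "finite D" unfolding D_def using finite_small_denoms[OF assms] by auto
  have "(0, 1) \<in> D" unfolding D_def using SL2Z_1 by (force intro!: exI[of _ "mat 1"])
  then have "D \<noteq> {}" by auto
  obtain p where p: "p \<in> D" and min: "\<And>r. r \<in> D \<Longrightarrow> f p \<le> f r"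
    using ex_min_if_finite[of "f ` D"] fin \<open>D \<noteq> {}\<close>
    by (metis (no_types, opaque_lifting) finite_imageI image_iff image_is_empty linorder_not_le)
  obtain A where A: "A \<in> SL2Z" "p = (A$2$1, A$2$2)" using p by (auto simp: D_def)
  have minA: "cmod (of_int (A$2$1) * \<tau> + of_int (A$2$2)) \<le> cmod (of_int (B$2$1) * \<tau> + of_int (B$2$2))"
    if B: "B \<in> SL2Z" for B
  proof (cases "cmod (of_int (B$2$1) * \<tau> + of_int (B$2$2)) \<le> 1")
    case True
    then show ?thesis using min[of "(B$2$1, B$2$2)"] B A by (auto simp: D_def f_def)
  next
    case False
    moreover have "f p \<le> 1" using p by (auto simp: D_def f_def)
    ultimately show ?thesis using A by (simp add: f_def)
  qed
  define k where "k = - round (Re (mob A \<tau>))"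
  define C where "C = Tmat k ** A"
  have C: "C \<in> SL2Z" using A by (auto simp: C_def)
  have row: "C$2$1 = A$2$1" "C$2$2 = A$2$2" by (auto simp: C_def mult_nth2 Tmat_def)
  have mobC: "mob C \<tau> = mob A \<tau> + of_int k" 
    unfolding C_def by (subst mob_mult) (use A assms in \<open>auto simp: mob_Tmat\<close>)
  define t where "t = mob C \<tau>"
  have t: "t \<in> uhp" using C assms by (auto simp: t_def)
  have Re: "\<bar>Re t\<bar> \<le> 1/2"
    using of_int_round_abs_le[of "Re (mob A \<tau>)"] by (simp add: t_def mobC k_def abs_minus_commute)
  have "cmod t \<ge> 1"
  proof (rule ccontr)
    assume "\<not> cmod t \<ge> 1"
    then have lt: "cmod t < 1" by simp
    have nz: "of_int (C$2$1) * \<tau> + of_int (C$2$2) \<noteq> 0" by (rule mob_denom_nonzero[OF C assms])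
    have "t = (of_int (C$1$1) * \<tau> + of_int (C$1$2)) / (of_int (C$2$1) * \<tau> + of_int (C$2$2))"
      by (simp add: t_def mob_def)
    then have "of_int (C$1$1) * \<tau> + of_int (C$1$2) = t * (of_int (C$2$1) * \<tau> + of_int (C$2$2))"
      using nz by (simp add: field_simps)
    then have "cmod (of_int (C$1$1) * \<tau> + of_int (C$1$2)) < cmod (of_int (C$2$1) * \<tau> + of_int (C$2$2))"
      using lt nz by (simp add: norm_mult)
    moreover have "(Smat ** C)$2$1 = C$1$1" "(Smat ** C)$2$2 = C$1$2"
      by (auto simp: mult_nth2 Smat_def)
    ultimately show False using minA[of "Smat ** C"] C row by fastforce
  qed
  then have "1 \<le> (Re t)\<^sup>2 + (Im t)\<^sup>2"
    by (metis cmod_power2 one_le_power)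
  moreover have "(Re t)\<^sup>2 \<le> (1/2)\<^sup>2" using Re abs_le_square_iff[of "Re t" "1/2"] by simp
  moreover have "(sqrt 3 / 2)\<^sup>2 = (3/4 :: real)" by (simp add: power_divide)
  moreover have "(1/2)\<^sup>2 = (1/4 :: real)" by (simp add: power2_eq_square)
  ultimately have "(sqrt 3 / 2)\<^sup>2 \<le> (Im t)\<^sup>2" by linarith
  then have "sqrt 3 / 2 \<le> Im t" by (rule power2_le_imp_le) (use t in \<open>simp add: uhp_def\<close>)
  with Re have "t \<in> fund_region" by (simp add: fund_region_def)
  then show ?thesis using that C t_def by auto
qed

lemma open_uhp: "open uhp" and connected_uhp: "connected uhp" and convex_uhp: "convex uhp"
proof -
  have "uhp = {\<tau>. Im \<tau> > 0}" by (simp add: uhp_def)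
  then show "open uhp" using open_halfspace_Im_gt by metis
  show "convex uhp" unfolding uhp_def using convex_halfspace_Im_gt by metis
  then show "connected uhp" by (rule convex_connected)
qed

section \<open>The exponential e(z) = exp(2 pi i z)\<close>

definition ee :: "complex \<Rightarrow> complex" where
  "ee z = exp (2 * of_real pi * \<i> * z)"

lemma ee_add: "ee (x + y) = ee x * ee y"
  by (simp add: ee_def ring_distribs exp_add)

lemma ee_diff: "ee (x - y) = ee x / ee y"
  by (simp add: ee_def ring_distribs exp_diff)

lemma ee_minus: "ee (- x) = inverse (ee x)"
  by (simp add: ee_def exp_minus)

lemma ee_nonzero [simp]: "ee x \<noteq> 0"
  by (simp add: ee_def)

lemma ee_0 [simp]: "ee 0 = 1"
  by (simp add: ee_def)

lemma ee_power: "ee x ^ n = ee (of_nat n * x)"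
  by (simp add: ee_def flip: exp_of_nat_mult) (simp add: mult_ac)

lemma ee_eq_1_iff: "ee x = 1 \<longleftrightarrow> x \<in> \<int>"
proof -
  have "ee x = 1 \<longleftrightarrow> (\<exists>n::int. Re x = of_int n) \<and> Im x = 0"
    unfolding ee_def exp_eq_1 by (auto simp: mult_ac)
  also have "\<dots> \<longleftrightarrow> x \<in> \<int>"
    by (auto simp: complex_eq_iff Ints_def)
  finally show ?thesis .
qed

lemma ee_of_int [simp]: "ee (of_int n) = 1" and ee_of_nat [simp]: "ee (of_nat m) = 1"
  and ee_1 [simp]: "ee 1 = 1"
  by (simp_all add: ee_eq_1_iff)

lemma ee_half: "ee (1/2) = -1"
  by (simp add: ee_def)

lemma ee_minus_half: "ee (-(1/2)) = -1"
  by (simp add: ee_minus ee_half)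

lemma norm_ee: "norm (ee z) = exp (- 2 * pi * Im z)"
  by (simp add: ee_def)

lemma norm_ee_less_1: "z \<in> uhp \<Longrightarrow> norm (ee z) < 1"
  by (simp add: norm_ee uhp_def)

lemma ee_holomorphic [holomorphic_intros]:
  "f holomorphic_on A \<Longrightarrow> (\<lambda>z. ee (f z)) holomorphic_on A"
  unfolding ee_def by (intro holomorphic_intros)

lemma ee_has_field_derivative:
  "(ee has_field_derivative 2 * of_real pi * \<i> * ee z) (at z within A)"
  unfolding ee_def by (auto intro!: derivative_eq_intros)

section \<open>Infinite products\<close>

lemma abs_summable_convergent_prod:
  fixes f :: "nat \<Rightarrow> complex"
  assumes "summable (\<lambda>n. norm (f n - 1))"
  shows "convergent_prod f"
  using assms abs_convergent_prod_conv_summable abs_convergent_prod_imp_convergent_prod by blast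

lemma prodinf_LIMSEQ:
  fixes f :: "nat \<Rightarrow> complex"
  assumes "convergent_prod f"
  shows "(\<lambda>n. \<Prod>k<n. f k) \<longlonglongrightarrow> prodinf f"
  using assms convergent_prod_has_prod has_prod_imp_tendsto' by blast

lemma prodinf_head:
  fixes f :: "nat \<Rightarrow> complex"
  assumes "convergent_prod f"
  shows "prodinf f = f 0 * (\<Prod>n. f (Suc n))"
proof -
  have "(\<lambda>n. \<Prod>k<Suc n. f k) \<longlonglongrightarrow> prodinf f"
    using prodinf_LIMSEQ[OF assms] LIMSEQ_Suc by blast
  moreover have "(\<lambda>n. f 0 * (\<Prod>k<n. f (Suc k))) \<longlonglongrightarrow> f 0 * (\<Prod>n. f (Suc n))"
    using assms by (intro tendsto_mult tendsto_const prodinf_LIMSEQ) simp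
  ultimately show ?thesis
    unfolding prod.lessThan_Suc_shift by (metis LIMSEQ_unique comp_apply)
qed

lemma prodinf_even_odd:
  fixes f :: "nat \<Rightarrow> complex"
  assumes "summable (\<lambda>n. norm (f n - 1))"
  shows "prodinf f = (\<Prod>n. f (2 * n)) * (\<Prod>n. f (2 * n + 1))"
proof -
  have *: "summable (\<lambda>n. norm (f (2 * n) - 1))" "summable (\<lambda>n. norm (f (2 * n + 1) - 1))"
    using summable_reindex[OF assms, of "\<lambda>n. 2 * n"] summable_reindex[OF assms, of "\<lambda>n. 2 * n + 1"]
    by (auto simp: o_def inj_on_def)
  have "(\<lambda>n. (\<Prod>k<n. f (2*k)) * (\<Prod>k<n. f (2*k+1))) \<longlonglongrightarrow> (\<Prod>n. f (2 * n)) * (\<Prod>n. f (2 * n + 1))"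
    by (intro tendsto_mult prodinf_LIMSEQ abs_summable_convergent_prod *)
  moreover have "(\<Prod>k<n. f (2*k)) * (\<Prod>k<n. f (2*k+1)) = (\<Prod>k<2*n. f k)" for n
    by (induction n) (auto simp: mult_ac)
  moreover have "(\<lambda>n. \<Prod>k<2*n. f k) \<longlonglongrightarrow> prodinf f"
    using LIMSEQ_subseq_LIMSEQ[OF prodinf_LIMSEQ[OF abs_summable_convergent_prod[OF assms]], of "\<lambda>n. 2 * n"]
    by (simp add: strict_mono_def o_def)
  ultimately show ?thesis by (simp add: LIMSEQ_unique)
qed

lemma uniform_limit_prodinf_complex:
  fixes f :: "nat \<Rightarrow> complex \<Rightarrow> complex"
  assumes "\<And>n. continuous_on K (f n)" "compact K" "summable M"
    "\<And>n x. x \<in> K \<Longrightarrow> norm (f n x - 1) \<le> M n"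
  shows "uniform_limit K (\<lambda>n x. \<Prod>k<n. f k x) (\<lambda>x. \<Prod>k. f k x) sequentially"
proof -
  have "uniformly_convergent_on K (\<lambda>N x. \<Sum>n<N. norm (f n x - 1))"
    by (rule Weierstrass_m_test'[OF _ assms(3)]) (use assms(4) in auto)
  then have "uniformly_convergent_on K (\<lambda>N x. \<Prod>n<N. f n x)"
    by (intro uniformly_convergent_on_prod' assms)
  then have ul: "uniform_limit K (\<lambda>n x. \<Prod>k<n. f k x) (\<lambda>x. lim (\<lambda>n. \<Prod>k<n. f k x)) sequentially"
    using uniformly_convergent_uniform_limit_iff by blast
  moreover have "lim (\<lambda>n. \<Prod>k<n. f k x) = (\<Prod>k. f k x)" if "x \<in> K" for x
  proof (rule limI, rule prodinf_LIMSEQ, rule abs_summable_convergent_prod)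
    show "summable (\<lambda>n. norm (f n x - 1))"
      by (rule summable_comparison_test[OF _ assms(3)]) (use assms(4) that in auto)
  qed
  ultimately show ?thesis by (metis (mono_tags, lifting) uniform_limit_cong')
qed

lemma holomorphic_prodinf:
  fixes f :: "nat \<Rightarrow> complex \<Rightarrow> complex"
  assumes "open A" "\<And>n. f n holomorphic_on A"
    "\<And>K. compact K \<Longrightarrow> K \<subseteq> A \<Longrightarrow> \<exists>M. summable M \<and> (\<forall>n. \<forall>x\<in>K. norm (f n x - 1) \<le> M n)"
  shows "(\<lambda>x. \<Prod>n. f n x) holomorphic_on A"
proof (rule holomorphic_uniform_sequence[OF assms(1), of "\<lambda>n x. \<Prod>k<n. f k x"])
  show "(\<lambda>x. \<Prod>k<n. f k x) holomorphic_on A" for n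
    by (intro holomorphic_intros assms)
  fix x assume "x \<in> A"
  then obtain d where d: "d > 0" "cball x d \<subseteq> A" using assms(1) open_contains_cball by blast
  obtain M where "summable M" "\<forall>n. \<forall>y\<in>cball x d. norm (f n y - 1) \<le> M n"
    using assms(3)[OF compact_cball d(2)] by blast
  then have "uniform_limit (cball x d) (\<lambda>n x. \<Prod>k<n. f k x) (\<lambda>x. \<Prod>k. f k x) sequentially"
    using d holomorphic_on_imp_continuous_on[OF holomorphic_on_subset[OF assms(2) d(2)]]
    by (intro uniform_limit_prodinf_complex[of _ _ M]) auto
  with d show "\<exists>d>0. cball x d \<subseteq> A \<and> uniform_limit (cball x d) (\<lambda>n x. \<Prod>k<n. f k x) (\<lambda>x. \<Prod>k. f k x) sequentially"
    by blast
qed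

text \<open>The q-Pochhammer symbol (w; q)_infinity.\<close>

definition PP :: "complex \<Rightarrow> complex \<Rightarrow> complex" where
  "PP q w = (\<Prod>n. 1 - w * q ^ n)"

lemma PP_summable:
  fixes q w :: complex
  assumes "norm q < 1"
  shows "summable (\<lambda>n. norm ((1 - w * q ^ n) - 1))"
proof -
  have "(\<lambda>n. norm ((1 - w * q ^ n) - 1)) = (\<lambda>n. norm w * norm q ^ n)"
    by (simp add: fun_eq_iff norm_mult norm_power)
  then show ?thesis using assms by (simp add: summable_mult)
qed

lemma PP_convergent: "norm (q :: complex) < 1 \<Longrightarrow> convergent_prod (\<lambda>n. 1 - w * q ^ n)"
  by (rule abs_summable_convergent_prod, rule PP_summable)

lemma PP_rec: "norm q < 1 \<Longrightarrow> PP q w = (1 - w) * PP q (w * q)"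
  unfolding PP_def by (subst prodinf_head[OF PP_convergent]) (simp_all add: mult_ac)

lemma PP_nonzero: "norm q < 1 \<Longrightarrow> (\<And>n. w * q ^ n \<noteq> 1) \<Longrightarrow> PP q w \<noteq> 0"
  unfolding PP_def by (rule prodinf_nonzero[OF PP_convergent]) auto

lemma PP_nonzero': "norm q < 1 \<Longrightarrow> norm w < 1 \<Longrightarrow> PP q w \<noteq> 0"
proof (rule PP_nonzero)
  fix n assume "norm q < 1" "norm w < 1"
  then have "norm w * norm q ^ n \<le> norm w * 1" by (intro mult_left_mono power_le_one) auto
  with \<open>norm w < 1\<close> have "norm (w * q ^ n) < 1" by (simp add: norm_mult norm_power)
  then show "w * q ^ n \<noteq> 1" by auto
qed

lemma PP_holomorphic:
  assumes "norm q < 1"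
  shows "PP q holomorphic_on UNIV"
  unfolding PP_def
proof (rule holomorphic_prodinf)
  fix K :: "complex set" assume "compact K"
  then obtain B where B: "\<And>x. x \<in> K \<Longrightarrow> norm x \<le> B" using compact_imp_bounded bounded_iff by metis
  show "\<exists>M. summable M \<and> (\<forall>n. \<forall>x\<in>K. norm (1 - x * q ^ n - 1) \<le> M n)"
    using assms B by (intro exI[of _ "\<lambda>n. B * norm q ^ n"])
      (auto simp: norm_mult norm_power intro!: summable_mult mult_right_mono)
qed (auto intro!: holomorphic_intros)

lemma PP_holomorphic' [holomorphic_intros]:
  assumes "norm q < 1" "f holomorphic_on A"
  shows "(\<lambda>z. PP q (f z)) holomorphic_on A"
proof -
  have "(PP q \<circ> f) holomorphic_on A"
    by (rule holomorphic_on_compose[OF assms(2)]) (rule holomorphic_on_subset[OF PP_holomorphic[OF assms(1)]], simp)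
  then show ?thesis by (simp add: o_def)
qed

lemma PP_even_odd: "norm q < 1 \<Longrightarrow> PP q w = PP (q\<^sup>2) w * PP (q\<^sup>2) (w * q)"
  unfolding PP_def by (subst prodinf_even_odd[OF PP_summable])
    (auto simp: power_mult[symmetric] mult_ac)

lemma PP_plus_minus:
  assumes "norm q < 1"
  shows "PP q w * PP q (- w) = PP (q\<^sup>2) (w\<^sup>2)"
  unfolding PP_def
  by (subst prodinf_mult) (use assms PP_convergent[of q w] PP_convergent[of q "-w"] in
    \<open>auto simp: algebra_simps power_mult_distrib simp flip: power_mult power2_eq_square power_add intro!: prodinf_cong\<close>)

text \<open>Euler's identity between partitions into distinct parts and into odd parts. Splitting
  (q; q) into odd and even factors and using (q; q)(-q; q) = (q^2; q^2) gives the claim after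
  cancelling (q^2; q^2).\<close>

lemma PP_Euler:
  assumes "norm q < 1"
  shows "PP q (- q) * PP (q\<^sup>2) q = 1"
proof -
  have q2: "norm (q\<^sup>2) < 1" using assms by (simp add: norm_power power_less_one_iff)
  have "PP q q = PP (q\<^sup>2) q * PP (q\<^sup>2) (q\<^sup>2)"
    using PP_even_odd[OF assms, of q] by (simp add: power2_eq_square)
  with PP_plus_minus[OF assms, of q]
  have "PP (q\<^sup>2) (q\<^sup>2) * (PP q (- q) * PP (q\<^sup>2) q) = PP (q\<^sup>2) (q\<^sup>2)" by (simp add: mult_ac)
  moreover have "PP (q\<^sup>2) (q\<^sup>2) \<noteq> 0" by (rule PP_nonzero'[OF q2 q2])
  ultimately show ?thesis by simp
qed

section \<open>The theta function\<close>

text \<open>Up to a constant this is Jacobi's theta_1(z) divided by Dedekind's eta, written through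
  the triple product. The division makes the weight 0, so that S contributes only a constant and a
  quadratic exponential.\<close>

definition theta :: "complex \<Rightarrow> complex \<Rightarrow> complex" where
  "theta z \<tau> = ee (\<tau> / 12 - z / 2) * PP (ee \<tau>) (ee z) * PP (ee \<tau>) (ee (\<tau> - z))"

lemma theta_plus_1: "theta (z + 1) \<tau> = - theta z \<tau>"
proof -
  have "ee (\<tau> / 12 - (z + 1) / 2) = - ee (\<tau> / 12 - z / 2)"
  proof -
    have "\<tau> / 12 - (z + 1) / 2 = (\<tau> / 12 - z / 2) - 1 / 2" by (simp add: field_simps)
    then show ?thesis by (simp only: ee_diff ee_half) simp
  qed
  moreover have "ee (\<tau> - (z + 1)) = ee (\<tau> - z)" "ee (z + 1) = ee z"
    by (simp_all add: ee_diff ee_add)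
  ultimately show ?thesis by (simp add: theta_def)
qed

text \<open>With w = e(z), passing from w to w q removes the first factor of one product and puts a
  new one in front of the other; the change is (1 - 1/w)/(1 - w) = -1/w.\<close>

lemma theta_plus_tau:
  assumes "\<tau> \<in> uhp"
  shows "theta (z + \<tau>) \<tau> = - ee (- z - \<tau> / 2) * theta z \<tau>"
proof -
  define q w where "q = ee \<tau>" and "w = ee z"
  have q: "norm q < 1" "w \<noteq> 0" using norm_ee_less_1[OF assms] by (simp_all add: q_def w_def)
  have 1: "PP q (1 / w) = (1 - 1 / w) * PP q (q / w)" using PP_rec[OF q(1), of "1 / w"] by simp
  have 2: "PP q w = (1 - w) * PP q (w * q)" by (rule PP_rec[OF q(1)])
  have "ee (z + \<tau>) = w * q" "ee (\<tau> - (z + \<tau>)) = 1 / w"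
    by (simp_all add: ee_add ee_diff ee_minus q_def w_def field_simps)
  then have "theta (z + \<tau>) \<tau> = ee (\<tau> / 12 - (z + \<tau>) / 2) * (PP q (w * q) * PP q (1 / w))"
    by (simp add: theta_def q_def)
  also have "PP q (w * q) * PP q (1 / w) = - (1 / w) * (PP q w * PP q (q / w))"
    unfolding 1 2 using q(2) by (simp add: field_simps)
  also have "ee (\<tau> / 12 - (z + \<tau>) / 2) = ee (- z - \<tau> / 2) * w * ee (\<tau> / 12 - z / 2)"
  proof -
    have "\<tau> / 12 - (z + \<tau>) / 2 = (- z - \<tau> / 2) + z + (\<tau> / 12 - z / 2)" by (simp add: field_simps)
    then show ?thesis by (simp only: ee_add w_def)
  qed
  also have "ee (- z - \<tau> / 2) * w * ee (\<tau> / 12 - z / 2) * (- (1 / w) * (PP q w * PP q (q / w)))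
      = - ee (- z - \<tau> / 2) * theta z \<tau>"
    using q(2) by (simp add: theta_def ee_diff flip: q_def w_def)
  finally show ?thesis .
qed

lemma theta_minus: 
  assumes "\<tau> \<in> uhp"
  shows "theta (- z) \<tau> = - theta z \<tau>"
proof -
  define q w where "q = ee \<tau>" and "w = ee z"
  have q: "norm q < 1" "w \<noteq> 0" using norm_ee_less_1[OF assms] by (simp_all add: q_def w_def)
  have 1: "PP q (1 / w) = (1 - 1 / w) * PP q (q / w)" using PP_rec[OF q(1), of "1 / w"] by simp
  have 2: "PP q w = (1 - w) * PP q (w * q)" by (rule PP_rec[OF q(1)])
  have "ee (\<tau> / 12 - z / 2) * w = ee (\<tau> / 12 + z / 2)"
  proof -
    have "\<tau> / 12 + z / 2 = (\<tau> / 12 - z / 2) + z" by (simp add: field_simps)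
    then show ?thesis by (simp only: ee_add w_def)
  qed
  then have *: "ee (\<tau> / 12 - z / 2) = ee (\<tau> / 12 + z / 2) / w" using q(2) by (simp add: eq_divide_eq)
  have e: "ee (\<tau> - z) = q / w" "ee (\<tau> - (- z)) = w * q" "ee (- z) = 1 / w"
    using ee_diff[of \<tau> z] ee_add[of \<tau> z] ee_diff[of 0 z] by (simp_all add: q_def w_def mult.commute)
  have 3: "theta z \<tau> = ee (\<tau> / 12 + z / 2) / w * (PP q w * PP q (q / w))"
    unfolding theta_def * e by (simp flip: q_def w_def)
  have "theta (- z) \<tau> = ee (\<tau> / 12 + z / 2) * (PP q (1 / w) * PP q (w * q))"
    unfolding theta_def e by (simp flip: q_def)
  also have "PP q (1 / w) * PP q (w * q) = - (1 / w) * (PP q w * PP q (q / w))"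
    unfolding 1 2 using q(2) by (simp add: field_simps)
  finally show ?thesis unfolding 3 by simp
qed

lemma theta_holomorphic: "\<tau> \<in> uhp \<Longrightarrow> (\<lambda>z. theta z \<tau>) holomorphic_on UNIV"
  unfolding theta_def
  by (intro holomorphic_intros norm_ee_less_1) auto

section \<open>Zeros of theta and quasi-periodic functions\<close>

definition lattice :: "complex \<Rightarrow> complex set" where
  "lattice \<tau> = {of_int m + of_int n * \<tau> |m n. True}"

lemma theta_zero_imp:
  assumes "\<tau> \<in> uhp" "theta z \<tau> = 0"
  shows "z \<in> lattice \<tau>"
proof -
  have q: "norm (ee \<tau>) < 1" by (rule norm_ee_less_1) fact
  from assms(2) have "PP (ee \<tau>) (ee z) = 0 \<or> PP (ee \<tau>) (ee (\<tau> - z)) = 0"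
    by (simp add: theta_def)
  then have "(\<exists>n. ee z * ee \<tau> ^ n = 1) \<or> (\<exists>n. ee (\<tau> - z) * ee \<tau> ^ n = 1)"
    using PP_nonzero[OF q] by blast
  then obtain n where "z + of_nat n * \<tau> \<in> \<int> \<or> \<tau> - z + of_nat n * \<tau> \<in> \<int>"
    by (auto simp: ee_power ee_eq_1_iff simp flip: ee_add)
  then show ?thesis
  proof
    assume "z + of_nat n * \<tau> \<in> \<int>"
    then obtain m where "z + of_nat n * \<tau> = of_int m" by (auto elim: Ints_cases)
    then have "z = of_int m + of_int (- int n) * \<tau>" by (simp add: algebra_simps eq_diff_eq)
    then show ?thesis unfolding lattice_def by blast
  next
    assume "\<tau> - z + of_nat n * \<tau> \<in> \<int>"
    then obtain m where "\<tau> - z + of_nat n * \<tau> = of_int m" by (auto elim: Ints_cases)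
    then have "z = of_int (- m) + of_int (int n + 1) * \<tau>" by (simp add: algebra_simps)
    then show ?thesis unfolding lattice_def by blast
  qed
qed

text \<open>The square of Dedekind's eta function.\<close>

definition eta_sq :: "complex \<Rightarrow> complex" where
  "eta_sq \<tau> = ee (\<tau> / 12) * (PP (ee \<tau>) (ee \<tau>))\<^sup>2"

text \<open>Only the factor 1 - e(z) vanishes at z = 0, and the remaining product takes the value
  eta^2 there.\<close>

lemma theta_deriv_0:
  assumes "\<tau> \<in> uhp"
  shows "((\<lambda>z. theta z \<tau>) has_field_derivative (- 2 * of_real pi * \<i> * eta_sq \<tau>)) (at 0)"
proof -
  have q: "norm (ee \<tau>) < 1" by (rule norm_ee_less_1) fact
  define G where "G = (\<lambda>z. ee (\<tau> / 12 - z / 2) * PP (ee \<tau>) (ee z * ee \<tau>) * PP (ee \<tau>) (ee (\<tau> - z)))"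
  have eq: "theta z \<tau> = (1 - ee z) * G z" for z
    unfolding theta_def G_def by (subst PP_rec[OF q]) simp
  have "G holomorphic_on UNIV" unfolding G_def
    by (intro holomorphic_intros q) auto
  then obtain G' where G': "(G has_field_derivative G') (at 0)"
    by (meson UNIV_I field_differentiable_def holomorphic_on_imp_differentiable_at open_UNIV)
  have "G 0 = eta_sq \<tau>" by (simp add: G_def eta_sq_def power2_eq_square)
  then show ?thesis unfolding eq
    by (auto intro!: derivative_eq_intros G' ee_has_field_derivative)
qed

lemma eta_sq_nonzero: "\<tau> \<in> uhp \<Longrightarrow> eta_sq \<tau> \<noteq> 0"
  by (simp add: eta_sq_def PP_nonzero' norm_ee_less_1)

lemma theta_0: "\<tau> \<in> uhp \<Longrightarrow> theta 0 \<tau> = 0"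
  using PP_rec[of "ee \<tau>" 1] norm_ee_less_1[of \<tau>] by (simp add: theta_def)

lemma lattice_plus_1: "z + 1 \<in> lattice \<tau> \<longleftrightarrow> z \<in> lattice \<tau>"
  and lattice_plus_tau: "z + \<tau> \<in> lattice \<tau> \<longleftrightarrow> z \<in> lattice \<tau>"
proof -
  have *: "of_int m + of_int n * \<tau> \<in> lattice \<tau>" for m n by (auto simp: lattice_def)
  have "z \<in> lattice \<tau> \<longleftrightarrow> (\<exists>m n. z = of_int m + of_int n * \<tau>)" for z by (auto simp: lattice_def)
  note ** = this
  show "z + 1 \<in> lattice \<tau> \<longleftrightarrow> z \<in> lattice \<tau>"
  proof
    assume "z + 1 \<in> lattice \<tau>"
    then obtain m n where "z + 1 = of_int m + of_int n * \<tau>" using ** by blast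
    then have "z = of_int (m - 1) + of_int n * \<tau>" by (simp add: algebra_simps eq_diff_eq)
    then show "z \<in> lattice \<tau>" using ** by blast
  next
    assume "z \<in> lattice \<tau>"
    then obtain m n where "z = of_int m + of_int n * \<tau>" using ** by blast
    then have "z + 1 = of_int (m + 1) + of_int n * \<tau>" by simp
    then show "z + 1 \<in> lattice \<tau>" using ** by blast
  qed
  show "z + \<tau> \<in> lattice \<tau> \<longleftrightarrow> z \<in> lattice \<tau>"
  proof
    assume "z + \<tau> \<in> lattice \<tau>"
    then obtain m n where "z + \<tau> = of_int m + of_int n * \<tau>" using ** by blast
    then have "z = of_int m + of_int (n - 1) * \<tau>" by (simp add: algebra_simps eq_diff_eq)
    then show "z \<in> lattice \<tau>" using ** by blast
  next
    assume "z \<in> lattice \<tau>"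
    then obtain m n where "z = of_int m + of_int n * \<tau>" using ** by blast
    then have "z + \<tau> = of_int m + of_int (n + 1) * \<tau>" by (simp add: algebra_simps)
    then show "z + \<tau> \<in> lattice \<tau>" using ** by blast
  qed
qed

lemma periodic_add_lattice:
  fixes R :: "complex \<Rightarrow> 'b"
  assumes 1: "\<And>z. R (z + 1) = R z" and 2: "\<And>z. R (z + \<tau>) = R z"
  shows "R (z + (of_int m + of_int n * \<tau>)) = R z"
proof -
  have a: "R (z + of_nat k) = R z" for k z
  proof (induction k)
    case (Suc k)
    have "z + of_nat (Suc k) = (z + of_nat k) + 1" by simp
    then show ?case using Suc by (simp only: 1)
  qed simp
  have a': "R (z + of_nat k * \<tau>) = R z" for k z
  proof (induction k)
    case (Suc k)
    have "z + of_nat (Suc k) * \<tau> = (z + of_nat k * \<tau>) + \<tau>" by (simp add: algebra_simps)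
    then show ?case using Suc by (simp only: 2)
  qed simp
  have b: "R (z + of_int m) = R z" for m z
  proof (cases m rule: int_cases2)
    case (nonpos k)
    then show ?thesis using a[of "z - of_nat k" k] by simp
  qed (simp add: a)
  have c: "R (z + of_int n * \<tau>) = R z" for n z
  proof (cases n rule: int_cases2)
    case (nonpos k)
    then show ?thesis using a'[of "z - of_nat k * \<tau>" k] by simp
  qed (simp add: a')
  show ?thesis using b[of "z + of_int n * \<tau>" m] c[of z n] by (simp add: add_ac)
qed

lemma doubly_periodic_entire_constant:
  assumes "\<tau> \<in> uhp" and hol: "R holomorphic_on UNIV"
    and per: "\<And>z. R (z + 1) = R z" "\<And>z. R (z + \<tau>) = R z"
  obtains c where "\<And>z. R z = c"
proof -
  have y: "Im \<tau> > 0" using assms(1) by (simp add: uhp_def)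
  define K where "K = (\<lambda>(s :: real, t :: real). of_real s + of_real t * \<tau>) ` ({0..1} \<times> {0..1})"
  have "compact K" unfolding K_def
    by (intro compact_continuous_image compact_Times compact_Icc) (auto simp: case_prod_unfold intro!: continuous_intros)
  then have "compact (R ` K)"
    by (intro compact_continuous_image holomorphic_on_imp_continuous_on holomorphic_on_subset[OF hol]) auto
  moreover have "range R \<subseteq> R ` K"
  proof clarify
    fix z
    define t where "t = Im z / Im \<tau>"
    define s where "s = Re z - t * Re \<tau>"
    have z: "z = of_real s + of_real t * \<tau>" using y by (simp add: complex_eq_iff s_def t_def)
    define w where "w = z + (of_int (- \<lfloor>s\<rfloor>) + of_int (- \<lfloor>t\<rfloor>) * \<tau>)"
    have "R w = R z" unfolding w_def by (rule periodic_add_lattice) (rule per)+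
    moreover have "w = of_real (frac s) + of_real (frac t) * \<tau>"
      by (simp add: w_def z frac_def algebra_simps)
    then have "w \<in> K" unfolding K_def
      by (intro image_eqI[of _ _ "(frac s, frac t)"]) (auto simp: frac_ge_0 frac_lt_1 less_imp_le)
    ultimately show "R z \<in> R ` K" by (metis imageI)
  qed
  ultimately have "bounded (range R)" using compact_imp_bounded bounded_subset by blast
  from Liouville_theorem[OF hol this] show ?thesis using that by (auto simp: constant_on_def)
qed

text \<open>The quotient f/g is doubly periodic. The zeros of g are simple and lie on the lattice,
  where f vanishes as well, so the quotient extends to an entire function and is constant by
  Liouville.\<close>

lemma quasi_periodic_unique:
  assumes "\<tau> \<in> uhp" and hol: "f holomorphic_on UNIV" "g holomorphic_on UNIV"
    and f: "\<And>z. f (z + 1) = a * f z" "\<And>z. f (z + \<tau>) = b z * f z"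
    and g: "\<And>z. g (z + 1) = a * g z" "\<And>z. g (z + \<tau>) = b z * g z"
    and nz: "a \<noteq> 0" "\<And>z. b z \<noteq> 0"
    and zero: "f 0 = 0" "g 0 = 0" and g': "deriv g 0 \<noteq> 0"
    and g_zero: "\<And>z. g z = 0 \<Longrightarrow> z \<in> lattice \<tau>"
  obtains c where "\<And>z. f z = c * g z"
proof -
  have lat: "z \<in> lattice \<tau> \<longleftrightarrow> (\<exists>m n. z = of_int m + of_int n * \<tau>)" for z by (auto simp: lattice_def)
  have fz: "f z = 0" and gz: "g z = 0" if z: "z \<in> lattice \<tau>" for z
  proof -
    obtain m n where mn: "z = of_int m + of_int n * \<tau>" using z lat by blast
    have "(f (0 + (of_int m + of_int n * \<tau>)) = 0) = (f 0 = 0)"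
      by (rule periodic_add_lattice[where R = "\<lambda>z. f z = 0"]) (simp_all add: f nz)
    then show "f z = 0" by (simp add: zero mn)
    have "(g (0 + (of_int m + of_int n * \<tau>)) = 0) = (g 0 = 0)"
      by (rule periodic_add_lattice[where R = "\<lambda>z. g z = 0"]) (simp_all add: g nz)
    then show "g z = 0" by (simp add: zero mn)
  qed
  define L where "L = deriv f 0 / deriv g 0"
  define R where "R = (\<lambda>z. if z \<in> lattice \<tau> then L else f z / g z)"
  have per: "R (z + 1) = R z" "R (z + \<tau>) = R z" for z
    by (simp_all add: R_def lattice_plus_1 lattice_plus_tau f g nz)
  \<comment> \<open>The functions f(z)/z and g(z)/z with the gap at 0 filled by the derivative. As g
    has a simple zero there, their quotient extends f/g across 0; periodicity carries this to all
    other lattice points.\<close>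
  define fh where "fh = (\<lambda>z. if z = 0 then deriv f 0 else (f z - f 0) / (z - 0))"
  define gh where "gh = (\<lambda>z. if z = 0 then deriv g 0 else (g z - g 0) / (z - 0))"
  have holh: "fh holomorphic_on UNIV" "gh holomorphic_on UNIV"
    unfolding fh_def gh_def by (intro pole_lemma_open hol open_UNIV)+
  define V where "V = {z. gh z \<noteq> 0}"
  have openV: "open V" unfolding V_def
    by (rule open_Collect_neq[OF holomorphic_on_imp_continuous_on[OF holh(2)] continuous_on_const])
  have "0 \<in> V" using g' by (simp add: V_def gh_def)
  have 0: "R analytic_on {0}"
  proof -
    have "(\<lambda>z. fh z / gh z) holomorphic_on V"
      by (intro holomorphic_intros holomorphic_on_subset[OF holh(1)] holomorphic_on_subset[OF holh(2)]) (auto simp: V_def)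
    moreover have "fh z / gh z = R z" if "z \<in> V" for z
    proof (cases "z = 0")
      case True
      have "(0 :: complex) \<in> lattice \<tau>" using lat by (auto intro!: exI[of _ 0])
      then show ?thesis using True by (simp add: fh_def gh_def R_def L_def)
    next
      case False
      then have "g z \<noteq> 0" using that zero by (auto simp: V_def gh_def)
      then have "z \<notin> lattice \<tau>" using gz by auto
      then show ?thesis using False by (simp add: fh_def gh_def R_def zero)
    qed
    ultimately have "R holomorphic_on V" by (simp cong: holomorphic_cong)
    then show ?thesis using openV \<open>0 \<in> V\<close> analytic_at by blast
  qed
  have "R analytic_on {z}" for z
  proof (cases "z \<in> lattice \<tau>")
    case True
    then obtain m n where mn: "z = of_int m + of_int n * \<tau>" using lat by blast
    have eq: "R = R \<circ> (\<lambda>w. w - z)"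
    proof
      fix w show "R w = (R \<circ> (\<lambda>w. w - z)) w"
        using periodic_add_lattice[of R \<tau> "w - z" m n, OF per] by (simp add: mn)
    qed
    have "R \<circ> (\<lambda>w. w - z) analytic_on {z}"
      by (rule analytic_on_compose) (use 0 in \<open>auto intro!: analytic_intros\<close>)
    then show ?thesis using eq by simp
  next
    case False
    define W where "W = {z. g z \<noteq> 0}"
    have W: "W = - lattice \<tau>" using g_zero gz by (auto simp: W_def)
    have "open W" unfolding W_def
      by (rule open_Collect_neq[OF holomorphic_on_imp_continuous_on[OF hol(2)] continuous_on_const])
    moreover have "(\<lambda>z. f z / g z) holomorphic_on W"
      by (intro holomorphic_intros holomorphic_on_subset[OF hol(1)] holomorphic_on_subset[OF hol(2)]) (auto simp: W_def)
    then have "R holomorphic_on W" by (rule holomorphic_transform) (auto simp: R_def W)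
    ultimately show ?thesis using False W analytic_at by blast
  qed
  then have "R holomorphic_on UNIV"
    by (metis analytic_imp_holomorphic analytic_on_analytic_at)
  from doubly_periodic_entire_constant[OF assms(1) this per] obtain c where c: "\<And>z. R z = c" by blast
  show ?thesis
  proof (rule that[of c])
    fix z show "f z = c * g z"
    proof (cases "z \<in> lattice \<tau>")
      case False
      then have "g z \<noteq> 0" using g_zero by blast
      moreover have "f z / g z = c" using c[of z] False by (simp add: R_def)
      ultimately show ?thesis by (simp add: field_simps)
    qed (simp add: fz gz)
  qed
qed

lemma uhp_S: "\<tau> \<in> uhp \<Longrightarrow> -1 / \<tau> \<in> uhp"
  using mob_in_uhp[OF Smat_SL2Z, of \<tau>] by (simp add: mob_Smat)

lemma uhp_nonzero: "\<tau> \<in> uhp \<Longrightarrow> \<tau> \<noteq> 0"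
  by (auto simp: uhp_def)

lemma ee_cong_add: "x = y + z \<Longrightarrow> ee x = ee y * ee z"
  by (simp add: ee_add)

text \<open>Division by \<tau> exchanges the roles of the periods 1 and \<tau>, and the Gaussian
  factor corrects the multipliers: the left side has exactly the quasi-periods of theta(z, \<tau>)
  and also vanishes at 0, so the two are proportional.\<close>

lemma theta_S_exists:
  assumes "\<tau> \<in> uhp"
  obtains c where "\<And>z. theta (z / \<tau>) (-1 / \<tau>) * ee (- (z\<^sup>2 / (2 * \<tau>))) = c * theta z \<tau>"
proof -
  define t where "t = -1 / \<tau>"
  have t: "t \<in> uhp" and nz: "\<tau> \<noteq> 0" using assms uhp_S uhp_nonzero by (auto simp: t_def)
  define f where "f = (\<lambda>z. theta (z / \<tau>) t * ee (- (z\<^sup>2 / (2 * \<tau>))))"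
  have fhol: "f holomorphic_on UNIV"
  proof -
    have "((\<lambda>z. theta z t) \<circ> (\<lambda>z. z / \<tau>)) holomorphic_on UNIV"
      by (rule holomorphic_on_compose) (use nz t in \<open>auto intro!: holomorphic_intros holomorphic_on_subset[OF theta_holomorphic]\<close>)
    then show ?thesis unfolding f_def o_def by (intro holomorphic_intros) (use nz in auto)
  qed
  have f1: "f (z + 1) = (-1) * f z" for z
  proof -
    have "theta (z / \<tau>) t = theta ((z + 1) / \<tau> + t) t"
      by (simp add: t_def add_divide_distrib)
    also have "\<dots> = - ee (- ((z + 1) / \<tau>) - t / 2) * theta ((z + 1) / \<tau>) t"
      by (rule theta_plus_tau[OF t])
    finally have *: "theta (z / \<tau>) t = - ee (- ((z + 1) / \<tau>) - t / 2) * theta ((z + 1) / \<tau>) t" .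
    have "ee (- ((z + 1)\<^sup>2 / (2 * \<tau>))) = ee (- (z\<^sup>2 / (2 * \<tau>))) * ee (- ((z + 1) / \<tau>) - t / 2)"
      by (rule ee_cong_add) (use nz in \<open>simp add: t_def field_simps power2_eq_square\<close>)
    then show ?thesis unfolding f_def * by simp
  qed
  have f2: "f (z + \<tau>) = - ee (- z - \<tau> / 2) * f z" for z
  proof -
    have "theta ((z + \<tau>) / \<tau>) t = - theta (z / \<tau>) t"
      using theta_plus_1[of "z / \<tau>" t] nz by (simp add: add_divide_distrib)
    moreover have "ee (- ((z + \<tau>)\<^sup>2 / (2 * \<tau>))) = ee (- z - \<tau> / 2) * ee (- (z\<^sup>2 / (2 * \<tau>)))"
      by (rule ee_cong_add) (use nz in \<open>simp add: field_simps power2_eq_square\<close>)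
    ultimately show ?thesis by (simp add: f_def)
  qed
  have d: "deriv (\<lambda>z. theta z \<tau>) 0 \<noteq> 0"
    using DERIV_imp_deriv[OF theta_deriv_0[OF assms]] eta_sq_nonzero[OF assms] by simp
  obtain c where "\<And>z. f z = c * theta z \<tau>"
  proof (rule quasi_periodic_unique[OF assms fhol theta_holomorphic[OF assms] f1 f2])
    show "theta (z + 1) \<tau> = -1 * theta z \<tau>" for z by (simp add: theta_plus_1)
    show "theta (z + \<tau>) \<tau> = - ee (- z - \<tau> / 2) * theta z \<tau>" for z by (rule theta_plus_tau) fact
    show "f 0 = 0" using theta_0[OF t] by (simp add: f_def)
  qed (use theta_0[OF assms] d theta_zero_imp[OF assms] in auto)
  then show ?thesis using that[of c] by (simp add: f_def t_def)
qed

text \<open>The prefactors multiply to e(-1/2) = -1 and the infinite products collapse by Euler's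
  identity. Being independent of \<tau>, this product over the three nonzero 2-torsion points pins
  down the unknown constant of the S-law.\<close>

lemma theta_two_torsion:
  assumes "\<tau> \<in> uhp"
  shows "theta (1/2) \<tau> * (ee (\<tau> / 8) * theta (\<tau> / 2) \<tau>) * (ee (\<tau> / 8) * theta ((1 + \<tau>) / 2) \<tau>) = -2"
proof -
  define q s where "q = ee \<tau>" and "s = ee (\<tau> / 2)"
  have q: "norm q < 1" using norm_ee_less_1[OF assms] by (simp add: q_def)
  have s2: "s\<^sup>2 = q" by (simp add: s_def q_def ee_power)
  have s1: "norm s < 1" using q s2 by (metis norm_power norm_ge_zero power_less_one_iff zero_less_numeral linorder_not_less one_le_power)
  have e: "ee (\<tau> - 1/2) = - q" "ee (\<tau> - \<tau> / 2) = s" "ee ((1 + \<tau>) / 2) = - s" "ee (\<tau> - (1 + \<tau>) / 2) = - s"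
  proof -
    have "\<tau> - \<tau> / 2 = \<tau> / 2" "(1 + \<tau>) / 2 = 1/2 + \<tau> / 2" "\<tau> - (1 + \<tau>) / 2 = \<tau> / 2 - 1 / 2"
      by (simp_all add: field_simps)
    then show "ee (\<tau> - 1/2) = - q" "ee (\<tau> - \<tau> / 2) = s" "ee ((1 + \<tau>) / 2) = - s" "ee (\<tau> - (1 + \<tau>) / 2) = - s"
      by (simp_all only: ee_diff ee_add ee_half q_def s_def) simp_all
  qed
  have A: "theta (1/2) \<tau> = ee (\<tau> / 12 - 1 / 4) * (2 * PP q (- q) * PP q (- q))"
    using PP_rec[OF q, of "-1"] unfolding theta_def e by (simp add: ee_half flip: q_def)
  have B: "ee (\<tau> / 8) * theta (\<tau> / 2) \<tau> = ee (\<tau> / 8) * ee (\<tau> / 12 - \<tau> / 4) * (PP q s * PP q s)"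
    unfolding theta_def e by (simp flip: q_def s_def)
  have C: "ee (\<tau> / 8) * theta ((1 + \<tau>) / 2) \<tau> = ee (\<tau> / 8) * ee (\<tau> / 12 - (1 + \<tau>) / 4) * (PP q (-s) * PP q (-s))"
    unfolding theta_def e by (simp flip: q_def s_def)
  have "ee (\<tau> / 12 - 1 / 4) * (ee (\<tau> / 8) * ee (\<tau> / 12 - \<tau> / 4)) * (ee (\<tau> / 8) * ee (\<tau> / 12 - (1 + \<tau>) / 4))
     = ee ((\<tau> / 12 - 1 / 4) + (\<tau> / 8 + (\<tau> / 12 - \<tau> / 4)) + (\<tau> / 8 + (\<tau> / 12 - (1 + \<tau>) / 4)))"
    by (simp only: ee_add)
  also have "(\<tau> / 12 - 1 / 4) + (\<tau> / 8 + (\<tau> / 12 - \<tau> / 4)) + (\<tau> / 8 + (\<tau> / 12 - (1 + \<tau>) / 4)) = -(1/2)"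
    by (simp add: field_simps)
  finally have exps: "ee (\<tau> / 12 - 1 / 4) * (ee (\<tau> / 8) * ee (\<tau> / 12 - \<tau> / 4)) * (ee (\<tau> / 8) * ee (\<tau> / 12 - (1 + \<tau>) / 4)) = -1"
    by (simp only: ee_minus_half)
  have "PP q s * PP q (- s) = PP (q\<^sup>2) q" using PP_plus_minus[OF q, of s] s2 by simp
  then have one: "PP q (- q) * (PP q s * PP q (- s)) = 1" using PP_Euler[OF q] by simp
  have "theta (1/2) \<tau> * (ee (\<tau> / 8) * theta (\<tau> / 2) \<tau>) * (ee (\<tau> / 8) * theta ((1 + \<tau>) / 2) \<tau>)
    = (ee (\<tau> / 12 - 1 / 4) * (ee (\<tau> / 8) * ee (\<tau> / 12 - \<tau> / 4)) * (ee (\<tau> / 8) * ee (\<tau> / 12 - (1 + \<tau>) / 4)))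
      * 2 * (PP q (- q) * (PP q s * PP q (- s)))\<^sup>2"
    unfolding A B C by (simp only: power2_eq_square mult_ac)
  then show ?thesis unfolding exps one by simp
qed

text \<open>S exchanges two of the three 2-torsion values and fixes the third, each up to the factor
  c and a root of unity. Since their product is -2 at both \<tau> and -1/\<tau>, it follows that c^3
  e(-1/4) = 1.\<close>

lemma theta_S:
  assumes "\<tau> \<in> uhp"
  obtains c where "c ^ 12 = 1" "\<And>z. theta (z / \<tau>) (-1 / \<tau>) = c * ee (z\<^sup>2 / (2 * \<tau>)) * theta z \<tau>"
proof -
  obtain c where c: "\<And>z. theta (z / \<tau>) (-1 / \<tau>) * ee (- (z\<^sup>2 / (2 * \<tau>))) = c * theta z \<tau>"
    using theta_S_exists[OF assms] by blast
  define t where "t = -1 / \<tau>"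
  have t: "t \<in> uhp" and nz: "\<tau> \<noteq> 0" using assms uhp_S uhp_nonzero by (auto simp: t_def)
  have S: "theta (z / \<tau>) t = c * ee (z\<^sup>2 / (2 * \<tau>)) * theta z \<tau>" for z
  proof -
    have "theta (z / \<tau>) t * (ee (- (z\<^sup>2 / (2 * \<tau>))) * ee (z\<^sup>2 / (2 * \<tau>))) = c * ee (z\<^sup>2 / (2 * \<tau>)) * theta z \<tau>"
      using c[of z] by (simp add: t_def mult_ac)
    then show ?thesis by (simp flip: ee_add)
  qed
  define A where "A = (\<lambda>\<tau>. theta (1/2) \<tau>)"
  define B where "B = (\<lambda>\<tau>. ee (\<tau> / 8) * theta (\<tau> / 2) \<tau>)"
  define C where "C = (\<lambda>\<tau>. ee (\<tau> / 8) * theta ((1 + \<tau>) / 2) \<tau>)"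
  have A: "A t = c * B \<tau>"
  proof -
    have "theta (\<tau> / 2 / \<tau>) t = c * ee ((\<tau> / 2)\<^sup>2 / (2 * \<tau>)) * theta (\<tau> / 2) \<tau>" by (rule S)
    moreover have "(\<tau> / 2)\<^sup>2 / (2 * \<tau>) = \<tau> / 8" "\<tau> / 2 / \<tau> = 1 / 2"
      using nz by (simp_all add: field_simps power2_eq_square)
    ultimately show ?thesis by (simp only: A_def B_def mult.assoc)
  qed
  have B: "B t = - c * A \<tau>"
  proof -
    have *: "t / 2 = (-(1/2)) / \<tau>" by (simp add: t_def)
    have "B t = ee (t / 8) * (c * ee ((-(1/2))\<^sup>2 / (2 * \<tau>)) * theta (-(1/2)) \<tau>)"
      unfolding B_def * by (simp only: S)
    also have "\<dots> = (ee (t / 8) * ee ((-(1/2))\<^sup>2 / (2 * \<tau>))) * (- c * A \<tau>)"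
      by (simp add: theta_minus[OF assms] A_def)
    also have "ee (t / 8) * ee ((-(1/2))\<^sup>2 / (2 * \<tau>)) = ee (t / 8 + (-(1/2))\<^sup>2 / (2 * \<tau>))" by (simp only: ee_add)
    also have "t / 8 + (-(1/2))\<^sup>2 / (2 * \<tau>) = 0" using nz by (simp add: t_def field_simps power2_eq_square)
    finally show ?thesis by simp
  qed
  have C: "C t = - c * ee (-(1/4)) * C \<tau>"
  proof -
    have *: "(1 + t) / 2 = ((\<tau> - 1) / 2) / \<tau>" using nz by (simp add: t_def field_simps)
    have **: "theta ((\<tau> - 1) / 2) \<tau> = - theta ((1 + \<tau>) / 2) \<tau>"
      using theta_plus_1[of "(\<tau> - 1) / 2" \<tau>] by (simp add: field_simps)
    have "C t = ee (t / 8) * (c * ee (((\<tau> - 1) / 2)\<^sup>2 / (2 * \<tau>)) * theta ((\<tau> - 1) / 2) \<tau>)"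
      unfolding C_def * by (simp only: S)
    also have "\<dots> = (ee (t / 8) * ee (((\<tau> - 1) / 2)\<^sup>2 / (2 * \<tau>))) * (- c * theta ((1 + \<tau>) / 2) \<tau>)"
      by (simp add: **)
    also have "ee (t / 8) * ee (((\<tau> - 1) / 2)\<^sup>2 / (2 * \<tau>)) = ee (t / 8 + ((\<tau> - 1) / 2)\<^sup>2 / (2 * \<tau>))" by (simp only: ee_add)
    also have "t / 8 + ((\<tau> - 1) / 2)\<^sup>2 / (2 * \<tau>) = \<tau> / 8 + (-(1/4))" using nz by (simp add: t_def field_simps power2_eq_square)
    also have "ee (\<tau> / 8 + (-(1/4))) = ee (\<tau> / 8) * ee (-(1/4))" by (rule ee_add)
    finally show ?thesis by (simp add: C_def)
  qed
  have "-2 = A t * B t * C t" using theta_two_torsion[OF t] by (simp add: A_def B_def C_def)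
  also have "\<dots> = c ^ 3 * ee (-(1/4)) * (A \<tau> * B \<tau> * C \<tau>)"
    unfolding A B C by (simp add: power3_eq_cube)
  also have "A \<tau> * B \<tau> * C \<tau> = -2" using theta_two_torsion[OF assms] by (simp add: A_def B_def C_def)
  finally have "c ^ 3 * ee (-(1/4)) = 1" by simp
  then have "(c ^ 3 * ee (-(1/4))) ^ 4 = 1" by simp
  moreover have "ee (-(1/4)) ^ 4 = 1" unfolding ee_power using ee_of_int[of "-1"] by simp
  ultimately have "c ^ 12 = 1" by (simp add: power_mult_distrib flip: power_mult)
  then show ?thesis using that[of c] S by (simp add: t_def)
qed

text \<open>The Siegel function with characteristic (a, b), up to sign. The exponential factor turns
  the leading exponent of q into B_2(a)/2 and absorbs the Gaussian of the S-law.\<close>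

definition kap :: "complex \<Rightarrow> complex \<Rightarrow> complex \<Rightarrow> complex" where
  "kap a b \<tau> = ee (a * (a * \<tau> + b) / 2) * theta (a * \<tau> + b) \<tau>"

text \<open>The exponential in \<open>kap\<close> and the Gaussian of the S-law add up to precisely
  the exponential belonging to the characteristic (b, -a); what remains is the constant c with c^12
  = 1.\<close>

lemma kap_S:
  assumes "\<tau> \<in> uhp"
  shows "kap a b (-1 / \<tau>) ^ 12 = kap b (- a) \<tau> ^ 12"
proof -
  have nz: "\<tau> \<noteq> 0" using assms uhp_nonzero by auto
  obtain c where c: "c ^ 12 = 1" "\<And>z. theta (z / \<tau>) (-1 / \<tau>) = c * ee (z\<^sup>2 / (2 * \<tau>)) * theta z \<tau>"
    using theta_S[OF assms] by blast
  have "a * (-1 / \<tau>) + b = (b * \<tau> + - a) / \<tau>" using nz by (simp add: field_simps)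
  then have "kap a b (-1 / \<tau>) = ee (a * ((b * \<tau> + - a) / \<tau>) / 2) * (c * ee ((b * \<tau> + - a)\<^sup>2 / (2 * \<tau>)) * theta (b * \<tau> + - a) \<tau>)"
    by (simp only: kap_def c)
  also have "\<dots> = c * (ee (a * ((b * \<tau> + - a) / \<tau>) / 2) * ee ((b * \<tau> + - a)\<^sup>2 / (2 * \<tau>))) * theta (b * \<tau> + - a) \<tau>"
    by (simp only: mult_ac)
  also have "ee (a * ((b * \<tau> + - a) / \<tau>) / 2) * ee ((b * \<tau> + - a)\<^sup>2 / (2 * \<tau>)) = ee (a * ((b * \<tau> + - a) / \<tau>) / 2 + (b * \<tau> + - a)\<^sup>2 / (2 * \<tau>))"
    by (simp only: ee_add)
  also have "a * ((b * \<tau> + - a) / \<tau>) / 2 + (b * \<tau> + - a)\<^sup>2 / (2 * \<tau>) = b * (b * \<tau> + - a) / 2"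
    using nz by (simp add: field_simps power2_eq_square)
  finally have "kap a b (-1 / \<tau>) = c * kap b (- a) \<tau>" by (simp add: kap_def)
  then show ?thesis by (simp add: power_mult_distrib c)
qed

lemma theta_T: "theta z (\<tau> + of_int k) = ee (of_int k / 12) * theta z \<tau>"
proof -
  have 1: "(\<tau> + of_int k) / 12 - z / 2 = of_int k / 12 + (\<tau> / 12 - z / 2)" by (simp add: field_simps)
  have 2: "\<tau> + of_int k - z = (\<tau> - z) + of_int k" by simp
  show ?thesis unfolding theta_def 1 2 ee_add by simp
qed

lemma kap_T: "kap a b (\<tau> + of_int k) ^ 12 = kap a (b + a * of_int k) \<tau> ^ 12"
proof -
  have 1: "a * (\<tau> + of_int k) + b = a * \<tau> + (b + a * of_int k)" by (simp add: algebra_simps)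
  have "kap a b (\<tau> + of_int k) = ee (of_int k / 12) * kap a (b + a * of_int k) \<tau>"
    unfolding kap_def 1 theta_T by simp
  moreover have "ee (of_int k / 12) ^ 12 = 1" unfolding ee_power by simp
  ultimately show ?thesis by (simp add: power_mult_distrib)
qed

lemma kap_minus: "\<tau> \<in> uhp \<Longrightarrow> kap (- a) (- b) \<tau> = - kap a b \<tau>"
proof -
  assume t: "\<tau> \<in> uhp"
  have 1: "- a * \<tau> + - b = - (a * \<tau> + b)" "- a * - (a * \<tau> + b) = a * (a * \<tau> + b)"
    by (simp_all add: algebra_simps)
  show ?thesis unfolding kap_def 1 theta_minus[OF t] by simp
qed

lemma kap_shift_b: "kap a (b + 1) \<tau> = - ee (a / 2) * kap a b \<tau>"
proof -
  have 1: "a * \<tau> + (b + 1) = (a * \<tau> + b) + 1" by simp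
  have 2: "a * (a * \<tau> + b + 1) / 2 = a / 2 + a * (a * \<tau> + b) / 2" by (simp add: field_simps)
  show ?thesis unfolding kap_def 1 theta_plus_1 2 ee_add by simp
qed

lemma kap_shift_a: "\<tau> \<in> uhp \<Longrightarrow> kap (a + 1) b \<tau> = - ee (- b / 2) * kap a b \<tau>"
proof -
  assume t: "\<tau> \<in> uhp"
  have 1: "(a + 1) * \<tau> + b = (a * \<tau> + b) + \<tau>" by (simp add: algebra_simps)
  have "ee ((a + 1) * ((a * \<tau> + b) + \<tau>) / 2) * ee (- (a * \<tau> + b) - \<tau> / 2)
     = ee ((a + 1) * ((a * \<tau> + b) + \<tau>) / 2 + (- (a * \<tau> + b) - \<tau> / 2))"
    by (simp only: ee_add)
  also have "(a + 1) * ((a * \<tau> + b) + \<tau>) / 2 + (- (a * \<tau> + b) - \<tau> / 2) = - b / 2 + a * (a * \<tau> + b) / 2"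
    by (simp add: field_simps)
  finally have 2: "ee ((a + 1) * ((a * \<tau> + b) + \<tau>) / 2) * ee (- (a * \<tau> + b) - \<tau> / 2) = ee (- b / 2) * ee (a * (a * \<tau> + b) / 2)"
    by (simp only: ee_add)
  have "kap (a + 1) b \<tau> = - (ee ((a + 1) * ((a * \<tau> + b) + \<tau>) / 2) * ee (- (a * \<tau> + b) - \<tau> / 2)) * theta (a * \<tau> + b) \<tau>"
    unfolding kap_def 1 theta_plus_tau[OF t] by simp
  then show ?thesis unfolding 2 by (simp add: kap_def)
qed

text \<open>The discriminant form eta^24, normalised to begin with q.\<close>

definition eta24 :: "complex \<Rightarrow> complex" where
  "eta24 \<tau> = eta_sq \<tau> ^ 12"

text \<open>Differentiate the S-law of theta at z = 0, where the derivative is a constant times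
  eta^2. The inner derivative 1/\<tau> becomes the weight of eta^2, and the twelfth power removes
  c.\<close>

lemma eta24_S:
  assumes "\<tau> \<in> uhp"
  shows "eta24 (-1 / \<tau>) = \<tau> ^ 12 * eta24 \<tau>"
proof -
  define t where "t = -1 / \<tau>"
  have t: "t \<in> uhp" and nz: "\<tau> \<noteq> 0" using assms uhp_S uhp_nonzero by (auto simp: t_def)
  obtain c where c: "c ^ 12 = 1" "\<And>z. theta (z / \<tau>) t = c * ee (z\<^sup>2 / (2 * \<tau>)) * theta z \<tau>"
    using theta_S[OF assms] unfolding t_def by blast
  have "((\<lambda>z. theta (z / \<tau>) t) has_field_derivative (- 2 * of_real pi * \<i> * eta_sq t) * (1 / \<tau>)) (at 0)"
    by (rule DERIV_chain2[of "\<lambda>z. theta z t"]) (use theta_deriv_0[OF t] nz in \<open>auto intro!: derivative_eq_intros\<close>)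
  moreover have "((\<lambda>z. c * ee (z\<^sup>2 / (2 * \<tau>)) * theta z \<tau>) has_field_derivative c * (- 2 * of_real pi * \<i> * eta_sq \<tau>)) (at 0)"
    unfolding ee_def using nz
    by (auto intro!: derivative_eq_intros theta_deriv_0[OF assms] simp: theta_0[OF assms])
  ultimately have "(- 2 * of_real pi * \<i> * eta_sq t) * (1 / \<tau>) = c * (- 2 * of_real pi * \<i> * eta_sq \<tau>)"
    unfolding c(2) by (rule DERIV_unique)
  then have "eta_sq t = c * \<tau> * eta_sq \<tau>" using nz by (simp add: field_simps)
  then show ?thesis by (simp add: eta24_def t_def power_mult_distrib c(1))
qed

lemma eta24_T: "eta24 (\<tau> + 1) = eta24 \<tau>"
proof -
  have "eta_sq (\<tau> + 1) = ee (1 / 12) * eta_sq \<tau>"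
    unfolding eta_sq_def add_divide_distrib ee_add by simp
  then show ?thesis by (simp add: eta24_def power_mult_distrib ee_power)
qed

lemma eta24_nonzero: "\<tau> \<in> uhp \<Longrightarrow> eta24 \<tau> \<noteq> 0"
  by (simp add: eta24_def eta_sq_nonzero)

lemma eta24_eq: "eta24 \<tau> = ee \<tau> * PP (ee \<tau>) (ee \<tau>) ^ 24"
  by (simp add: eta24_def eta_sq_def power_mult_distrib ee_power flip: power_mult)

section \<open>Subrings of the complex numbers\<close>

definition is_subring :: "complex set \<Rightarrow> bool" where
  "is_subring R \<longleftrightarrow> 1 \<in> R \<and> (\<forall>x\<in>R. \<forall>y\<in>R. x + y \<in> R \<and> x * y \<in> R \<and> - x \<in> R)"

lemma subring_1: "is_subring R \<Longrightarrow> 1 \<in> R"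
  and subring_add: "is_subring R \<Longrightarrow> x \<in> R \<Longrightarrow> y \<in> R \<Longrightarrow> x + y \<in> R"
  and subring_mult: "is_subring R \<Longrightarrow> x \<in> R \<Longrightarrow> y \<in> R \<Longrightarrow> x * y \<in> R"
  and subring_uminus: "is_subring R \<Longrightarrow> x \<in> R \<Longrightarrow> - x \<in> R"
  by (auto simp: is_subring_def)

lemma subring_diff: "is_subring R \<Longrightarrow> x \<in> R \<Longrightarrow> y \<in> R \<Longrightarrow> x - y \<in> R"
  using subring_add[of R x "- y"] subring_uminus by simp

lemma subring_0: "is_subring R \<Longrightarrow> 0 \<in> R"
  using subring_diff[of R 1 1] subring_1 by simp

lemma subring_sum: "is_subring R \<Longrightarrow> (\<And>i. i \<in> I \<Longrightarrow> f i \<in> R) \<Longrightarrow> sum f I \<in> R"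
  by (induction I rule: infinite_finite_induct) (auto intro: subring_0 subring_add)

lemma subring_power: "is_subring R \<Longrightarrow> x \<in> R \<Longrightarrow> x ^ n \<in> R"
  by (induction n) (auto intro: subring_1 subring_mult)

lemma subring_of_nat: "is_subring R \<Longrightarrow> of_nat n \<in> R"
  by (induction n) (auto intro: subring_1 subring_add subring_0)

lemma subring_of_int: "is_subring R \<Longrightarrow> of_int n \<in> R"
  by (cases n rule: int_cases2) (auto intro: subring_of_nat subring_uminus)

lemma subring_UNIV [simp]: "is_subring UNIV" and subring_Ints [simp]: "is_subring \<int>"
  by (auto simp: is_subring_def)

lemma Ints_subset_subring: "is_subring R \<Longrightarrow> \<int> \<subseteq> R"
  by (auto elim!: Ints_cases intro: subring_of_int)

section \<open>Cyclotomic integers and the cyclotomic field\<close>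

definition Zz :: "nat \<Rightarrow> complex set" where
  "Zz N = range (\<lambda>p :: int poly. poly (map_poly of_int p) (zeta N))"

lemma zeta_ee: "zeta N = ee (1 / of_nat N)"
  by (simp add: zeta_def ee_def)

lemma zeta_power_N: "N > 0 \<Longrightarrow> zeta N ^ N = 1"
  by (simp add: zeta_ee ee_power)

lemma zeta_nonzero [simp]: "zeta N \<noteq> 0"
  by (simp add: zeta_ee)

lemma zeta_powi: "zeta N powi k = ee (of_int k / of_nat N)"
  by (cases k rule: int_cases2)
     (auto simp: zeta_ee ee_power ee_minus power_int_minus simp flip: ee_minus)

lemma zeta_powi_mod: "N > 0 \<Longrightarrow> zeta N powi (k mod int N) = zeta N powi k"
proof -
  assume N: "N > 0"
  have "(of_int k :: complex) = of_int (int N * (k div int N) + k mod int N)" by simp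
  then have "of_int k / of_nat N = (of_int (k div int N) + of_int (k mod int N) / of_nat N :: complex)"
    unfolding of_int_add of_int_mult using N by (simp add: field_simps)
  then show ?thesis by (simp only: zeta_powi ee_add) simp
qed

lemma zeta_powi_eq_1_iff: "N > 0 \<Longrightarrow> zeta N powi k = 1 \<longleftrightarrow> int N dvd k"
proof -
  assume N: "N > 0"
  have "of_int k / of_nat N \<in> (\<int> :: complex set) \<longleftrightarrow> int N dvd k"
  proof
    assume "of_int k / of_nat N \<in> (\<int> :: complex set)"
    then obtain m where "of_int k / of_nat N = (of_int m :: complex)" by (auto elim: Ints_cases)
    then have "(of_int k :: complex) = of_int (m * int N)" using N by (simp add: field_simps)
    then have "k = m * int N" by (simp only: of_int_eq_iff)
    then show "int N dvd k" by simp
  qed (use N in \<open>auto elim!: dvdE\<close>)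
  then show ?thesis by (simp add: zeta_powi ee_eq_1_iff)
qed

lemma hom_poly_range_subring:
  fixes f :: "'a :: comm_ring_1 \<Rightarrow> complex"
  assumes f: "f 0 = 0" "f 1 = 1" "\<And>x y. f (x + y) = f x + f y" "\<And>x y. f (x * y) = f x * f y" "\<And>x. f (- x) = - f x"
  shows "is_subring (range (\<lambda>p. poly (map_poly f p) z))"
proof -
  define E where "E = (\<lambda>p. poly (map_poly f p) z)"
  have coeff: "coeff (map_poly f p) n = f (coeff p n)" for p n by (simp add: coeff_map_poly f)
  have fsum: "f (sum g A) = sum (\<lambda>i. f (g i)) A" for g and A :: "nat set"
    by (induction A rule: infinite_finite_induct) (auto simp: f)
  have "E 1 = 1" unfolding E_def by (simp add: f(2) one_pCons map_poly_pCons f)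
  moreover have "E (p + q) = E p + E q" for p q
  proof -
    have "map_poly f (p + q) = map_poly f p + map_poly f q" by (rule poly_eqI) (simp add: coeff f)
    then show ?thesis by (simp add: E_def)
  qed
  moreover have "E (p * q) = E p * E q" for p q
  proof -
    have "map_poly f (p * q) = map_poly f p * map_poly f q" by (rule poly_eqI) (simp add: coeff f coeff_mult fsum)
    then show ?thesis by (simp add: E_def)
  qed
  moreover have "E (- p) = - E p" for p
  proof -
    have "map_poly f (- p) = - map_poly f p" by (rule poly_eqI) (simp add: coeff f)
    then show ?thesis by (simp add: E_def)
  qed
  ultimately have "is_subring (range E)" unfolding is_subring_def
    by (smt (verit, ccfv_threshold) rangeE rangeI)
  then show ?thesis by (simp add: E_def)
qed

lemma subring_Zz [simp]: "is_subring (Zz N)"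
  unfolding Zz_def by (rule hom_poly_range_subring) simp_all

lemma subring_Q_zeta [simp]: "is_subring (Q_zeta N)"
  unfolding Q_zeta_def by (rule hom_poly_range_subring) (simp_all add: of_rat_add of_rat_mult of_rat_minus)

lemma zeta_in_Zz: "zeta N \<in> Zz N"
  unfolding Zz_def by (rule image_eqI[of _ _ "[:0, 1:]"]) (simp_all add: map_poly_pCons)

lemma Zz_subset_Q_zeta: "Zz N \<subseteq> Q_zeta N"
proof
  fix x assume "x \<in> Zz N"
  then obtain p :: "int poly" where p: "x = poly (map_poly of_int p) (zeta N)" by (auto simp: Zz_def)
  have "map_poly of_int p = map_poly of_rat (map_poly of_int p :: rat poly)"
    by (rule poly_eqI) (simp add: coeff_map_poly)
  then show "x \<in> Q_zeta N" unfolding Q_zeta_def p by (metis rangeI)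
qed

lemma of_rat_in_Q_zeta: "of_rat r \<in> Q_zeta N"
  unfolding Q_zeta_def by (rule image_eqI[of _ _ "[:r:]"]) (simp_all add: map_poly_pCons)

lemma zeta_powi_in_Zz: "N > 0 \<Longrightarrow> zeta N powi k \<in> Zz N"
  by (subst zeta_powi_mod[symmetric]) (auto simp: power_int_def intro!: subring_power zeta_in_Zz)

interpretation Q_vs: vector_space "\<lambda>(r :: rat) (x :: complex). of_rat r * x"
  by unfold_locales (simp_all add: algebra_simps of_rat_add of_rat_mult)

lemma Q_zeta_subset_span: "N > 0 \<Longrightarrow> Q_zeta N \<subseteq> Q_vs.span ((\<lambda>i. zeta N ^ i) ` {..<N})"
proof
  fix x assume "x \<in> Q_zeta N" and N: "N > 0"
  then obtain p :: "rat poly" where p: "x = poly (map_poly of_rat p) (zeta N)" by (auto simp: Q_zeta_def)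
  have *: "zeta N ^ i \<in> Q_vs.span ((\<lambda>i. zeta N ^ i) ` {..<N})" for i
  proof -
    have "zeta N ^ i = zeta N ^ (N * (i div N) + i mod N)" by simp
    also have "\<dots> = (zeta N ^ N) ^ (i div N) * zeta N ^ (i mod N)" by (simp only: power_add power_mult)
    finally have "zeta N ^ i = zeta N ^ (i mod N)" using N by (simp add: zeta_power_N)
    then show ?thesis using N by (auto intro!: Q_vs.span_base)
  qed
  show "x \<in> Q_vs.span ((\<lambda>i. zeta N ^ i) ` {..<N})"
    unfolding p poly_altdef by (auto intro!: Q_vs.span_sum Q_vs.span_scale * simp: coeff_map_poly)
qed

text \<open>The N + 1 powers 1, y, ..., y^N lie in the rational span of N elements: either two of
  them coincide or they are linearly dependent, and both cases give an annihilating
  polynomial.\<close>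

lemma Q_zeta_algebraic:
  assumes N: "N > 0" and y: "y \<in> Q_zeta N"
  shows "algebraic y"
proof -
  let ?B = "(\<lambda>i. zeta N ^ i) ` {..<N}"
  have pow: "y ^ k \<in> Q_vs.span ?B" for k
    using Q_zeta_subset_span[OF N] subring_power[OF subring_Q_zeta y] by blast
  show ?thesis
  proof (cases "inj_on (\<lambda>k. y ^ k) {..N}")
    case False
    then obtain i j where ij: "i < j" "y ^ i = y ^ j" unfolding inj_on_def by (metis linorder_neqE_nat)
    define p :: "complex poly" where "p = monom 1 j - monom 1 i"
    have "coeff p j = 1" using ij by (simp add: p_def)
    then have "p \<noteq> 0" by auto
    moreover have "poly p y = 0" using ij by (simp add: p_def poly_monom)
    ultimately show ?thesis by (intro algebraicI[of p]) (auto simp: p_def)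
  next
    case True
    have "card ((\<lambda>k. y ^ k) ` {..N}) = Suc N" using True by (simp add: card_image)
    moreover have "card ?B \<le> N" using card_image_le[of "{..<N}" "\<lambda>i. zeta N ^ i"] by simp
    ultimately have "Q_vs.dependent ((\<lambda>k. y ^ k) ` {..N})"
      using Q_vs.independent_span_bound[of ?B "(\<lambda>k. y ^ k) ` {..N}"] pow by fastforce
    then obtain u where u: "\<exists>v\<in>(\<lambda>k. y ^ k) ` {..N}. u v \<noteq> 0" "(\<Sum>v\<in>(\<lambda>k. y ^ k) ` {..N}. of_rat (u v) * v) = 0"
      by (subst (asm) Q_vs.dependent_finite) auto
    define p :: "complex poly" where "p = (\<Sum>k\<le>N. monom (of_rat (u (y ^ k))) k)"
    have c: "coeff p k = (if k \<le> N then of_rat (u (y ^ k)) else 0)" for k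
      by (simp add: p_def coeff_sum)
    have "p \<noteq> 0" using u(1) c by (auto simp: poly_eq_iff)
    moreover have "poly p y = 0" using u(2) True
      by (simp add: p_def poly_sum poly_monom sum.reindex)
    ultimately show ?thesis by (intro algebraicI'[of p]) (auto simp: c)
  qed
qed

lemma Q_zeta_subset_Qbar: "N > 0 \<Longrightarrow> Q_zeta N \<subseteq> Qbar"
  using Q_zeta_algebraic by (auto simp: Qbar_def)

text \<open>A relation a + y q(y) = 0 with a nonzero integer a exhibits 1/y as -q(y)/a.\<close>

lemma Q_zeta_inverse:
  assumes N: "N > 0" and y: "y \<in> Q_zeta N"
  shows "inverse y \<in> Q_zeta N"
proof (cases "y = 0")
  case False
  obtain p :: "int poly" where p: "p \<noteq> 0" "poly (map_poly of_int p) y = 0" "coeff p 0 \<noteq> 0"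
    by (rule algebraicE'_nonzero[OF Q_zeta_algebraic[OF N y] False])
  obtain a q where q: "p = pCons a q" by (cases p)
  have "a \<noteq> 0" using p(3) by (simp add: q)
  have qy: "poly (map_poly of_int q) y \<in> Q_zeta N"
    unfolding poly_altdef
    by (auto intro!: subring_sum subring_mult subring_power y simp: coeff_map_poly intro: subring_of_int)
  have "of_int a + y * poly (map_poly of_int q) y = 0" using p(2) by (simp add: q map_poly_pCons)
  then have "inverse y = - of_rat (1 / of_int a) * poly (map_poly of_int q) y"
    using False \<open>a \<noteq> 0\<close> by (simp add: field_simps of_rat_divide eq_neg_iff_add_eq_0)
  then show ?thesis using qy subring_mult[OF subring_Q_zeta subring_uminus[OF subring_Q_zeta of_rat_in_Q_zeta] qy]
    by simp
qed (use y in simp)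

text \<open>Relative to a subring, so that the same notion covers an automorphism restricted to
  Q(zeta_N) or Z[zeta_N] and the identity on an arbitrary coefficient ring.\<close>

definition ring_emb :: "complex set \<Rightarrow> (complex \<Rightarrow> complex) \<Rightarrow> bool" where
  "ring_emb R \<sigma> \<longleftrightarrow> is_subring R \<and> \<sigma> 1 = 1 \<and> inj_on \<sigma> R \<and>
     (\<forall>x\<in>R. \<forall>y\<in>R. \<sigma> (x + y) = \<sigma> x + \<sigma> y \<and> \<sigma> (x * y) = \<sigma> x * \<sigma> y)"

lemma ring_embD:
  assumes "ring_emb R \<sigma>"
  shows "is_subring R" "\<sigma> 1 = 1" "x \<in> R \<Longrightarrow> y \<in> R \<Longrightarrow> \<sigma> (x + y) = \<sigma> x + \<sigma> y"
    "x \<in> R \<Longrightarrow> y \<in> R \<Longrightarrow> \<sigma> (x * y) = \<sigma> x * \<sigma> y" "\<sigma> 0 = 0" "x \<in> R \<Longrightarrow> \<sigma> x = 0 \<longleftrightarrow> x = 0"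
    "x \<in> R \<Longrightarrow> \<sigma> (- x) = - \<sigma> x"
proof -
  show R: "is_subring R" and "\<sigma> 1 = 1" and add: "\<And>x y. x \<in> R \<Longrightarrow> y \<in> R \<Longrightarrow> \<sigma> (x + y) = \<sigma> x + \<sigma> y"
    and "x \<in> R \<Longrightarrow> y \<in> R \<Longrightarrow> \<sigma> (x * y) = \<sigma> x * \<sigma> y" using assms by (auto simp: ring_emb_def)
  show 0: "\<sigma> 0 = 0" using add[of 0 0] subring_0[OF R] by simp
  then show "x \<in> R \<Longrightarrow> \<sigma> x = 0 \<longleftrightarrow> x = 0" using assms subring_0[OF R] by (auto simp: ring_emb_def inj_on_def)
  show "\<sigma> (- x) = - \<sigma> x" if "x \<in> R"
    using add[OF that subring_uminus[OF R that]] 0 by (simp add: eq_neg_iff_add_eq_0 add.commute)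
qed

lemma ring_emb_id: "is_subring R \<Longrightarrow> ring_emb R (\<lambda>x. x)"
  by (auto simp: ring_emb_def)

lemma ring_emb_subset: "ring_emb R \<sigma> \<Longrightarrow> is_subring R' \<Longrightarrow> R' \<subseteq> R \<Longrightarrow> ring_emb R' \<sigma>"
  by (auto simp: ring_emb_def intro: inj_on_subset)

lemma ring_emb_sum:
  assumes "ring_emb R \<sigma>" "\<And>i. i \<in> I \<Longrightarrow> f i \<in> R"
  shows "\<sigma> (sum f I) = (\<Sum>i\<in>I. \<sigma> (f i))"
  using assms(2)
proof (induction I rule: infinite_finite_induct)
  case (insert i I)
  then have "\<sigma> (f i + sum f I) = \<sigma> (f i) + \<sigma> (sum f I)"
    by (intro ring_embD(3)[OF assms(1)] subring_sum ring_embD(1)[OF assms(1)]) auto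
  then show ?case using insert by simp
qed (simp_all add: ring_embD(5)[OF assms(1)])

lemma ring_emb_power:
  assumes "ring_emb R \<sigma>" "x \<in> R"
  shows "\<sigma> (x ^ n) = \<sigma> x ^ n"
  by (induction n)
    (simp_all add: ring_embD(2)[OF assms(1)] ring_embD(4)[OF assms(1) assms(2)] subring_power[OF ring_embD(1)[OF assms(1)] assms(2)])

lemma ring_emb_of_int:
  assumes "ring_emb R \<sigma>"
  shows "\<sigma> (of_int n) = of_int n"
proof -
  note R = ring_embD[OF assms]
  have nat: "\<sigma> (of_nat n) = of_nat n" for n
    by (induction n) (auto simp: R subring_of_nat subring_1)
  show ?thesis by (cases n rule: int_cases2) (auto simp: nat R subring_of_nat)
qed

lemma Gal_Q_ring_emb:
  assumes "\<sigma> \<in> Gal_Q" "N > 0"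
  shows "ring_emb (Q_zeta N) \<sigma>"
proof -
  note sub = Q_zeta_subset_Qbar[OF assms(2)]
  have inj: "inj_on \<sigma> Qbar" and hom: "\<And>x y. x \<in> Qbar \<Longrightarrow> y \<in> Qbar \<Longrightarrow> \<sigma> (x + y) = \<sigma> x + \<sigma> y \<and> \<sigma> (x * y) = \<sigma> x * \<sigma> y"
    using assms(1) by (auto simp: Gal_Q_def bij_betw_def)
  have mem: "0 \<in> Qbar" "1 \<in> Qbar"
    using sub subring_0[OF subring_Q_zeta] subring_1[OF subring_Q_zeta] by blast+
  have "\<sigma> 0 = 0" using hom[OF mem(1) mem(1)] by simp
  \<comment> \<open>\<open>Gal_Q\<close> does not mention 1; its image is a nonzero
    idempotent.\<close>
  then have "\<sigma> 1 \<noteq> 0" using inj mem by (metis inj_onD zero_neq_one)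
  moreover have "\<sigma> 1 * \<sigma> 1 = \<sigma> 1" using hom[OF mem(2) mem(2)] by simp
  ultimately have "\<sigma> 1 = 1" by simp
  then show ?thesis unfolding ring_emb_def using hom sub inj by (auto intro: inj_on_subset)
qed

lemma Gal_Q_eq_on_Q_zeta:
  assumes "\<sigma> \<in> Gal_Q" "\<sigma>' \<in> Gal_Q" "N > 0" "\<sigma> (zeta N) = \<sigma>' (zeta N)" "x \<in> Q_zeta N"
  shows "\<sigma> x = \<sigma>' x"
proof -
  obtain p :: "rat poly" where p: "x = poly (map_poly of_rat p) (zeta N)" using assms(5) by (auto simp: Q_zeta_def)
  have rat: "s (of_rat r) = of_rat r" if "s \<in> Gal_Q" for s r
  proof -
    note e = Gal_Q_ring_emb[OF that assms(3)]
    obtain a b where r: "r = Fract a b" "b > 0" by (cases r)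
    have "of_int b * s (of_rat r) = s (of_int b * of_rat r)"
      using ring_embD(4)[OF e subring_of_int[OF subring_Q_zeta] of_rat_in_Q_zeta] by (simp add: ring_emb_of_int[OF e])
    also have "of_int b * of_rat r = (of_int a :: complex)" using r by (simp add: of_rat_rat)
    finally have "of_int b * s (of_rat r) = of_int a" by (simp add: ring_emb_of_int[OF e])
    then show ?thesis using r by (simp add: of_rat_rat field_simps)
  qed
  have zQ: "zeta N \<in> Q_zeta N" using zeta_in_Zz Zz_subset_Q_zeta by blast
  have *: "s x = (\<Sum>i\<le>degree (map_poly of_rat p :: complex poly). of_rat (coeff p i) * s (zeta N) ^ i)" if "s \<in> Gal_Q" for s
  proof -
    note e = Gal_Q_ring_emb[OF that assms(3)]
    have "s x = (\<Sum>i\<le>degree (map_poly of_rat p :: complex poly). s (of_rat (coeff p i) * zeta N ^ i))"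
      unfolding p poly_altdef
      by (subst ring_emb_sum[OF e]) (auto simp: coeff_map_poly intro!: subring_mult subring_power zQ of_rat_in_Q_zeta)
    then show ?thesis
      by (simp add: ring_embD(4)[OF e] of_rat_in_Q_zeta subring_power zQ rat[OF that] ring_emb_power[OF e zQ])
  qed
  show ?thesis by (simp add: *[OF assms(1)] *[OF assms(2)] assms(4))
qed

section \<open>Laurent series with coefficients in a subring\<close>

text \<open>For the identity map this just says that all coefficients lie in R
  (\<open>fls_rel_id_iff\<close>). One set of closure lemmas thus yields both integrality of
  coefficients and compatibility with the Galois action.\<close>

definition fls_rel :: "complex set \<Rightarrow> (complex \<Rightarrow> complex) \<Rightarrow> complex fls \<Rightarrow> complex fls \<Rightarrow> bool" where
  "fls_rel R \<sigma> F G \<longleftrightarrow> (\<forall>n. fls_nth F n \<in> R \<and> fls_nth G n = \<sigma> (fls_nth F n))"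

lemma fls_relD: "fls_rel R \<sigma> F G \<Longrightarrow> fls_nth F n \<in> R" "fls_rel R \<sigma> F G \<Longrightarrow> fls_nth G n = \<sigma> (fls_nth F n)"
  by (auto simp: fls_rel_def)

lemma fls_rel_id_iff: "fls_rel R (\<lambda>x. x) F F \<longleftrightarrow> (\<forall>n. fls_nth F n \<in> R)"
  by (auto simp: fls_rel_def)

lemma fls_rel_subdegree:
  assumes "ring_emb R \<sigma>" "fls_rel R \<sigma> F G"
  shows "fls_subdegree G = fls_subdegree F" "F = 0 \<longleftrightarrow> G = 0"
proof -
  have z: "fls_nth G n = 0 \<longleftrightarrow> fls_nth F n = 0" for n
    using assms ring_embD(6)[OF assms(1)] by (auto simp: fls_rel_def)
  then show "F = 0 \<longleftrightarrow> G = 0" by (auto simp: fls_eq_iff)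
  show "fls_subdegree G = fls_subdegree F"
  proof (cases "F = 0")
    case True
    then have "G = 0" using z by (auto simp: fls_eq_iff)
    then show ?thesis using True by simp
  next
    case False
    then show ?thesis by (intro fls_subdegree_eqI) (auto simp: z)
  qed
qed

context
  fixes R \<sigma> assumes emb: "ring_emb R \<sigma>"
begin

lemma fls_rel_add: "fls_rel R \<sigma> F F' \<Longrightarrow> fls_rel R \<sigma> G G' \<Longrightarrow> fls_rel R \<sigma> (F + G) (F' + G')"
  by (auto simp: fls_rel_def ring_embD[OF emb] intro!: subring_add)

lemma fls_rel_uminus: "fls_rel R \<sigma> F F' \<Longrightarrow> fls_rel R \<sigma> (- F) (- F')"
  by (auto simp: fls_rel_def ring_embD[OF emb] intro!: subring_uminus)

lemma fls_rel_mult: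
  assumes "fls_rel R \<sigma> F F'" "fls_rel R \<sigma> G G'"
  shows "fls_rel R \<sigma> (F * G) (F' * G')"
  unfolding fls_rel_def
proof
  fix n
  note R = ring_embD[OF emb]
  have m: "fls_nth F i * fls_nth G j \<in> R" for i j
    using assms R(1) by (auto simp: fls_rel_def intro!: subring_mult)
  then have "fls_nth (F * G) n \<in> R" unfolding fls_times_nth(2) by (intro subring_sum R)
  moreover have "fls_nth (F' * G') n = \<sigma> (fls_nth (F * G) n)"
    unfolding fls_times_nth(2) fls_rel_subdegree(1)[OF emb assms(1)] fls_rel_subdegree(1)[OF emb assms(2)]
      ring_emb_sum[OF emb m]
    using assms by (intro sum.cong) (auto simp: fls_rel_def R)
  ultimately show "fls_nth (F * G) n \<in> R \<and> fls_nth (F' * G') n = \<sigma> (fls_nth (F * G) n)" by blast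
qed

lemma fls_rel_const: "c \<in> R \<Longrightarrow> fls_rel R \<sigma> (fls_const c) (fls_const (\<sigma> c))"
  using ring_embD(1,5)[OF emb] by (auto simp: fls_rel_def fls_const_nth intro: subring_0)

lemma fls_rel_1: "fls_rel R \<sigma> 1 1"
  using fls_rel_const[of 1] ring_embD(1,2)[OF emb] subring_1 by simp

lemma fls_rel_0: "fls_rel R \<sigma> 0 0"
  using ring_embD(1,5)[OF emb] by (auto simp: fls_rel_def intro: subring_0)

lemma fls_rel_X_intpow: "fls_rel R \<sigma> (fls_X_intpow k) (fls_X_intpow k)"
  using ring_embD(1,2,5)[OF emb] by (auto simp: fls_rel_def intro: subring_0 subring_1)

lemma fls_rel_power: "fls_rel R \<sigma> F F' \<Longrightarrow> fls_rel R \<sigma> (F ^ n) (F' ^ n)"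
  by (induction n) (auto intro: fls_rel_1 fls_rel_mult)

lemma fls_rel_sum: "(\<And>i. i \<in> I \<Longrightarrow> fls_rel R \<sigma> (F i) (F' i)) \<Longrightarrow> fls_rel R \<sigma> (sum F I) (sum F' I)"
  by (induction I rule: infinite_finite_induct) (auto intro: fls_rel_0 fls_rel_add)

lemma fls_rel_prod: "(\<And>i. i \<in> I \<Longrightarrow> fls_rel R \<sigma> (F i) (F' i)) \<Longrightarrow> fls_rel R \<sigma> (prod F I) (prod F' I)"
  by (induction I rule: infinite_finite_induct) (auto intro: fls_rel_1 fls_rel_mult)

end

section \<open>Expansions at the cusp\<close>

lemma qx_eq: "exp (2 * of_real pi * \<i> * \<tau> / of_nat N) = ee (\<tau> / of_nat N)"
  by (simp add: ee_def)

lemma has_q_expansion_ee: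
  "has_q_expansion N f F \<longleftrightarrow> fls_conv_radius F > 0 \<and> (\<forall>\<^sub>F \<tau> in at_i_inf. f \<tau> = eval_fls F (ee (\<tau> / of_nat N)))"
  unfolding has_q_expansion_def qx_eq ..

lemma eventually_at_i_inf: "eventually P at_i_inf \<longleftrightarrow> (\<exists>Y. \<forall>\<tau>. Im \<tau> \<ge> Y \<longrightarrow> P \<tau>)"
  unfolding eventually_filtercomap eventually_at_top_linorder
proof
  assume "\<exists>Q. (\<exists>Y. \<forall>n\<ge>Y. Q n) \<and> (\<forall>x. Q (Im x) \<longrightarrow> P x)"
  then show "\<exists>Y. \<forall>\<tau>. Im \<tau> \<ge> Y \<longrightarrow> P \<tau>" by blast
next
  assume "\<exists>Y. \<forall>\<tau>. Im \<tau> \<ge> Y \<longrightarrow> P \<tau>"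
  then obtain Y where "\<forall>\<tau>. Im \<tau> \<ge> Y \<longrightarrow> P \<tau>" by blast
  then show "\<exists>Q. (\<exists>Y. \<forall>n\<ge>Y. Q n) \<and> (\<forall>x. Q (Im x) \<longrightarrow> P x)"
    by (intro exI[of _ "\<lambda>y. y \<ge> Y"]) auto
qed

lemma eventually_in_uhp: "\<forall>\<^sub>F \<tau> in at_i_inf. \<tau> \<in> uhp"
  unfolding eventually_at_i_inf by (intro exI[of _ 1]) (auto simp: uhp_def)

text \<open>Every small nonzero x is reached through the logarithm, so q^(1/N) sweeps out full
  punctured neighbourhoods of 0. Equality of the filters, not just one inclusion, is what makes
  expansions unique.\<close>

lemma filtermap_qx:
  assumes N: "N > 0"
  shows "filtermap (\<lambda>\<tau>. ee (\<tau> / of_nat N)) at_i_inf = at 0"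
proof (rule filter_eqI)
  fix P
  show "eventually P (filtermap (\<lambda>\<tau>. ee (\<tau> / of_nat N)) at_i_inf) \<longleftrightarrow> eventually P (at 0)"
  proof
    assume "eventually P (filtermap (\<lambda>\<tau>. ee (\<tau> / of_nat N)) at_i_inf)"
    then obtain Y where Y: "\<And>\<tau>. Im \<tau> \<ge> Y \<Longrightarrow> P (ee (\<tau> / of_nat N))"
      unfolding eventually_filtermap eventually_at_i_inf by blast
    define d where "d = exp (- 2 * pi * Y / N)"
    have "P x" if "x \<noteq> 0" "norm x < d" for x
    proof -
      define \<tau> where "\<tau> = of_nat N * Ln x / (2 * of_real pi * \<i>)"
      have x: "ee (\<tau> / of_nat N) = x" using N that(1) by (simp add: \<tau>_def ee_def)
      have "norm x = exp (- 2 * pi * Im \<tau> / N)" unfolding x[symmetric] norm_ee by simp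
      then have "- 2 * pi * Im \<tau> / N < - 2 * pi * Y / N" using that(2) by (simp add: d_def)
      then have "Im \<tau> \<ge> Y" using N by (simp add: divide_strict_right_mono_neg field_simps)
      then show ?thesis using Y x by metis
    qed
    then show "eventually P (at 0)" unfolding eventually_at
      by (intro exI[of _ d]) (auto simp: d_def dist_norm)
  next
    assume "eventually P (at 0)"
    then obtain d where d: "d > 0" "\<And>x. x \<noteq> 0 \<Longrightarrow> norm x < d \<Longrightarrow> P x"
      unfolding eventually_at by (auto simp: dist_norm)
    define Y where "Y = (1 - ln d) * N / (2 * pi)"
    have "P (ee (\<tau> / of_nat N))" if "Im \<tau> \<ge> Y" for \<tau>
    proof (rule d(2))
      have "2 * pi * Im \<tau> / N \<ge> 1 - ln d" using that N unfolding Y_def by (simp add: field_simps)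
      then have "exp (- (2 * pi * Im \<tau> / N)) < exp (ln d)" by (subst exp_less_cancel_iff) linarith
      then show "norm (ee (\<tau> / of_nat N)) < d" using d(1) by (simp add: norm_ee)
    qed simp
    then show "eventually P (filtermap (\<lambda>\<tau>. ee (\<tau> / of_nat N)) at_i_inf)"
      unfolding eventually_filtermap eventually_at_i_inf by blast
  qed
qed

lemma eventually_qx: "N > 0 \<Longrightarrow> (\<forall>\<^sub>F \<tau> in at_i_inf. P (ee (\<tau> / of_nat N))) \<longleftrightarrow> eventually P (at 0)"
  unfolding filtermap_qx[of N, symmetric] eventually_filtermap ..

lemma tendsto_qx: "N > 0 \<Longrightarrow> filterlim (\<lambda>\<tau>. g (ee (\<tau> / of_nat N))) F at_i_inf \<longleftrightarrow> filterlim g F (at 0)"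
  unfolding filtermap_qx[of N, symmetric] filterlim_filtermap ..

lemma qexpI:
  assumes "N > 0" "g has_laurent_expansion F" "\<forall>\<^sub>F \<tau> in at_i_inf. f \<tau> = g (ee (\<tau> / of_nat N))"
  shows "has_q_expansion N f F"
proof -
  have "\<forall>\<^sub>F \<tau> in at_i_inf. eval_fls F (ee (\<tau> / of_nat N)) = g (ee (\<tau> / of_nat N))"
    using eventually_qx[OF assms(1), of "\<lambda>x. eval_fls F x = g x"] assms(2) unfolding has_laurent_expansion_def by blast
  with assms(3) have "\<forall>\<^sub>F \<tau> in at_i_inf. f \<tau> = eval_fls F (ee (\<tau> / of_nat N))"
    by eventually_elim simp
  then show ?thesis using assms(2) by (simp add: has_q_expansion_ee has_laurent_expansion_def)
qed

lemma qexpD: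
  assumes "has_q_expansion N f F"
  shows "eval_fls F has_laurent_expansion F" "\<forall>\<^sub>F \<tau> in at_i_inf. f \<tau> = eval_fls F (ee (\<tau> / of_nat N))"
  using assms by (auto simp: has_q_expansion_ee intro: eval_fls_has_laurent_expansion)

lemma qexp_cong:
  assumes "has_q_expansion N f F" "\<forall>\<^sub>F \<tau> in at_i_inf. f \<tau> = g \<tau>"
  shows "has_q_expansion N g F"
proof -
  have "\<forall>\<^sub>F \<tau> in at_i_inf. g \<tau> = eval_fls F (ee (\<tau> / of_nat N))"
    using assms(2) qexpD(2)[OF assms(1)] by eventually_elim simp
  then show ?thesis using assms(1) by (auto simp: has_q_expansion_ee)
qed

lemma qexp_cong_uhp:
  assumes "has_q_expansion N f F" "\<And>\<tau>. \<tau> \<in> uhp \<Longrightarrow> f \<tau> = g \<tau>"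
  shows "has_q_expansion N g F"
  using assms(1) by (rule qexp_cong) (use eventually_in_uhp assms(2) in \<open>auto elim: eventually_mono\<close>)

context
  fixes N :: nat assumes N: "N > 0"
begin

lemma qexp_unique:
  assumes "has_q_expansion N f F" "has_q_expansion N f G"
  shows "F = G"
proof -
  have "\<forall>\<^sub>F \<tau> in at_i_inf. eval_fls F (ee (\<tau> / of_nat N)) = eval_fls G (ee (\<tau> / of_nat N))"
    using qexpD(2)[OF assms(1)] qexpD(2)[OF assms(2)] by eventually_elim simp
  then have "\<forall>\<^sub>F x in at 0. eval_fls F x = eval_fls G x" using eventually_qx[OF N, of "\<lambda>x. eval_fls F x = eval_fls G x"] by blast
  then have "eval_fls F has_laurent_expansion G"
    using assms(2) by (auto simp: has_laurent_expansion_def has_q_expansion_ee elim!: eventually_mono)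
  then show ?thesis using has_laurent_expansion_unique qexpD(1)[OF assms(1)] by blast
qed

lemma qexp_add:
  assumes "has_q_expansion N f F" "has_q_expansion N g G"
  shows "has_q_expansion N (\<lambda>\<tau>. f \<tau> + g \<tau>) (F + G)"
  by (rule qexpI[OF N has_laurent_expansion_add[OF qexpD(1)[OF assms(1)] qexpD(1)[OF assms(2)]]])
     (use qexpD(2)[OF assms(1)] qexpD(2)[OF assms(2)] in \<open>eventually_elim, simp\<close>)

lemma qexp_mult:
  assumes "has_q_expansion N f F" "has_q_expansion N g G"
  shows "has_q_expansion N (\<lambda>\<tau>. f \<tau> * g \<tau>) (F * G)"
  by (rule qexpI[OF N has_laurent_expansion_mult[OF qexpD(1)[OF assms(1)] qexpD(1)[OF assms(2)]]])
     (use qexpD(2)[OF assms(1)] qexpD(2)[OF assms(2)] in \<open>eventually_elim, simp\<close>)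

lemma qexp_inverse:
  assumes "has_q_expansion N f F"
  shows "has_q_expansion N (\<lambda>\<tau>. inverse (f \<tau>)) (inverse F)"
  by (rule qexpI[OF N has_laurent_expansion_inverse[OF qexpD(1)[OF assms]]])
     (use qexpD(2)[OF assms] in \<open>eventually_elim, simp\<close>)

lemma qexp_const: "has_q_expansion N (\<lambda>\<tau>. c) (fls_const c)"
  by (rule qexpI[OF N has_laurent_expansion_const]) simp

lemma qexp_uminus: "has_q_expansion N f F \<Longrightarrow> has_q_expansion N (\<lambda>\<tau>. - f \<tau>) (- F)"
proof -
  assume "has_q_expansion N f F"
  then have "has_q_expansion N (\<lambda>\<tau>. - 1 * f \<tau>) (fls_const (- 1) * F)" by (intro qexp_mult qexp_const)
  moreover have "fls_const (- 1) * F = - F" by (rule fls_eqI) simp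
  ultimately show ?thesis by simp
qed

lemma qexp_sum:
  "(\<And>i. i \<in> I \<Longrightarrow> has_q_expansion N (f i) (F i)) \<Longrightarrow> has_q_expansion N (\<lambda>\<tau>. \<Sum>i\<in>I. f i \<tau>) (\<Sum>i\<in>I. F i)"
  using qexp_const[of 0] by (induction I rule: infinite_finite_induct) (auto intro: qexp_add)

lemma qexp_prod:
  "(\<And>i. i \<in> I \<Longrightarrow> has_q_expansion N (f i) (F i)) \<Longrightarrow> has_q_expansion N (\<lambda>\<tau>. \<Prod>i\<in>I. f i \<tau>) (\<Prod>i\<in>I. F i)"
  using qexp_const[of 1] by (induction I rule: infinite_finite_induct) (auto intro: qexp_mult)

lemma qexp_power: "has_q_expansion N f F \<Longrightarrow> has_q_expansion N (\<lambda>\<tau>. f \<tau> ^ k) (F ^ k)"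
  using qexp_const[of 1] by (induction k) (auto intro: qexp_mult)

lemma qexp_powi: "has_q_expansion N (\<lambda>\<tau>. ee (\<tau> / of_nat N) powi k) (fls_X_intpow k)"
  by (rule qexpI[OF N has_laurent_expansion_fps_X_power_int]) simp

lemma qexp_tendsto:
  assumes "has_q_expansion N f F" "\<And>n. n < 0 \<Longrightarrow> fls_nth F n = 0"
  shows "(f \<longlongrightarrow> fls_nth F 0) at_i_inf"
proof -
  have "fls_subdegree F \<ge> 0"
    using assms(2) by (metis fls_subdegree_geI fls_zero_nth fls_eq_iff fls_zero_subdegree order_refl)
  then have "(eval_fls F \<longlongrightarrow> fls_nth F 0) (at 0)"
    using has_laurent_expansion_imp_tendsto_0[OF qexpD(1)[OF assms(1)]] by blast
  then have "((\<lambda>\<tau>. eval_fls F (ee (\<tau> / of_nat N))) \<longlongrightarrow> fls_nth F 0) at_i_inf" by (simp add: tendsto_qx[OF N])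
  then show ?thesis using qexpD(2)[OF assms(1)]
    by (elim Lim_transform_eventually) (auto elim: eventually_mono)
qed

lemma qexp_tendsto_imp:
  assumes "has_q_expansion N f F" "(f \<longlongrightarrow> v) at_i_inf"
  shows "\<And>n. n < 0 \<Longrightarrow> fls_nth F n = 0" "v = fls_nth F 0"
proof -
  have nb: "at_i_inf \<noteq> bot"
    using filtermap_qx[OF N] by (metis filtermap_bot trivial_limit_at)
  have "((\<lambda>\<tau>. eval_fls F (ee (\<tau> / of_nat N))) \<longlongrightarrow> v) at_i_inf"
    using Lim_transform_eventually[OF assms(2) qexpD(2)[OF assms(1)]] .
  then have lim: "(eval_fls F \<longlongrightarrow> v) (at 0)" by (simp add: tendsto_qx[OF N])
  have sd: "fls_subdegree F \<ge> 0"
  proof (rule ccontr)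
    assume "\<not> fls_subdegree F \<ge> 0"
    then have "filterlim (eval_fls F) at_infinity (at 0)"
      using has_laurent_expansion_imp_filterlim_infinity_0[OF qexpD(1)[OF assms(1)]] by simp
    with lim show False using not_tendsto_and_filterlim_at_infinity[of "at (0::complex)"] by auto
  qed
  then show "\<And>n. n < 0 \<Longrightarrow> fls_nth F n = 0" by simp
  have "(eval_fls F \<longlongrightarrow> fls_nth F 0) (at 0)"
    using has_laurent_expansion_imp_tendsto_0[OF qexpD(1)[OF assms(1)] sd] .
  then show "v = fls_nth F 0" using lim tendsto_unique trivial_limit_at by blast
qed

end

section \<open>Expansions of infinite products\<close>

definition Pf :: "complex \<Rightarrow> (nat \<Rightarrow> nat) \<Rightarrow> complex \<Rightarrow> complex" where
  "Pf c k x = (\<Prod>n. 1 - c * x ^ k n)"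

text \<open>Used for n < k n only: then the factors of index above m begin beyond x^m, so the m-th
  coefficient can be read off from the first m + 1 factors.\<close>

definition Pfps :: "complex \<Rightarrow> (nat \<Rightarrow> nat) \<Rightarrow> complex fps" where
  "Pfps c k = Abs_fps (\<lambda>m. fps_nth (\<Prod>n<Suc m. 1 - fps_const c * fps_X ^ k n) m)"

lemma Pf_bound:
  fixes c x :: complex
  assumes "norm c \<le> 1" "n < k n" "norm x \<le> r" "r < 1"
  shows "norm ((1 - c * x ^ k n) - 1) \<le> r ^ n"
proof -
  have r: "0 \<le> r" using assms(3) norm_ge_zero order_trans by blast
  have "norm ((1 - c * x ^ k n) - 1) = norm c * norm x ^ k n" by (simp add: norm_mult norm_power)
  also have "\<dots> \<le> 1 * r ^ k n" using assms r by (intro mult_mono power_mono) auto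
  also have "\<dots> \<le> r ^ n" using assms r by (simp add: power_decreasing)
  finally show ?thesis .
qed

context
  fixes c :: complex and k :: "nat \<Rightarrow> nat"
  assumes c: "norm c \<le> 1" and k: "\<And>n. n < k n"
begin

lemma Pf_bound': "norm x \<le> r \<Longrightarrow> r < 1 \<Longrightarrow> norm ((1 - c * x ^ k n) - 1) \<le> r ^ n"
  using Pf_bound[OF c k] .

lemma Pf_summable: "norm x < 1 \<Longrightarrow> summable (\<lambda>n. norm ((1 - c * x ^ k n) - 1))"
  by (rule summable_comparison_test'[of "\<lambda>n. norm x ^ n" 0]) (use Pf_bound'[OF order_refl] in auto)

lemma Pf_uniform_limit:
  assumes "compact K" "K \<subseteq> cball 0 r" "r < 1" "0 \<le> r"
  shows "uniform_limit K (\<lambda>M x. \<Prod>n<M. 1 - c * x ^ k n) (Pf c k) sequentially"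
proof -
  have "uniform_limit K (\<lambda>M x. \<Prod>n<M. 1 - c * x ^ k n) (\<lambda>x. \<Prod>n. 1 - c * x ^ k n) sequentially"
    by (rule uniform_limit_prodinf_complex[where M = "\<lambda>n. r ^ n"])
       (use assms Pf_bound' in \<open>auto intro!: continuous_intros\<close>)
  then show ?thesis unfolding Pf_def .
qed

lemma Pf_holomorphic: "Pf c k holomorphic_on ball 0 1"
  unfolding Pf_def
proof (rule holomorphic_prodinf)
  fix K :: "complex set" assume K: "compact K" "K \<subseteq> ball 0 1"
  show "\<exists>M. summable M \<and> (\<forall>n. \<forall>x\<in>K. norm (1 - c * x ^ k n - 1) \<le> M n)"
  proof (cases "K = {}")
    case False
    then obtain x0 where x0: "x0 \<in> K" "\<And>x. x \<in> K \<Longrightarrow> norm x \<le> norm x0"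
      using continuous_attains_sup[OF K(1) False continuous_on_norm_id] by auto
    then have "norm x0 < 1" using K by auto
    then show ?thesis using x0 Pf_bound' by (intro exI[of _ "\<lambda>n. norm x0 ^ n"]) auto
  qed auto
qed (auto intro!: holomorphic_intros)

lemma Pf_nonzero:
  assumes "norm x < 1"
  shows "Pf c k x \<noteq> 0"
  unfolding Pf_def
proof (rule prodinf_nonzero[OF abs_summable_convergent_prod[OF Pf_summable[OF assms]]])
  fix n
  have "norm (c * x ^ k n) \<le> norm x ^ k n"
    using c by (simp add: norm_mult norm_power mult_left_le_one_le)
  also have "\<dots> < 1" using assms k[of n] by (simp add: power_less_one_iff)
  finally show "1 - c * x ^ k n \<noteq> 0" by auto
qed

lemma Pfps_stable:
  assumes "m < M"
  shows "fps_nth (\<Prod>n<M. 1 - fps_const c * fps_X ^ k n) m = fps_nth (Pfps c k) m"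
  using assms
proof (induction M)
  case (Suc M)
  show ?case
  proof (cases "m < M")
    case True
    have "fps_nth ((\<Prod>n<M. 1 - fps_const c * fps_X ^ k n) * (1 - fps_const c * fps_X ^ k M)) m
      = fps_nth (\<Prod>n<M. 1 - fps_const c * fps_X ^ k n) m
        - c * fps_nth ((\<Prod>n<M. 1 - fps_const c * fps_X ^ k n) * fps_X ^ k M) m"
      by (simp add: algebra_simps flip: fps_mult_left_const_nth)
    also have "\<dots> = fps_nth (\<Prod>n<M. 1 - fps_const c * fps_X ^ k n) m"
      using k[of M] True by (simp add: fps_X_power_mult_right_nth)
    finally show ?thesis using Suc True by simp
  next
    case False
    then have "m = M" using Suc.prems by simp
    then show ?thesis by (simp add: Pfps_def)
  qed
qed simp

text \<open>Partial products converge uniformly near 0, so each derivative at 0 is the limit of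
  theirs; by \<open>Pfps_stable\<close> that sequence is eventually constant.\<close>

lemma Pf_has_fps_expansion: "Pf c k has_fps_expansion Pfps c k"
proof -
  have ul: "uniform_limit (ball 0 (1/2)) (\<lambda>M x. \<Prod>n<M. 1 - c * x ^ k n) (Pf c k) sequentially"
    by (rule uniform_limit_on_subset[OF Pf_uniform_limit[of "cball 0 (1/2)" "1/2"]]) auto
  have "(deriv ^^ m) (Pf c k) 0 = fact m * fps_nth (Pfps c k) m" for m
  proof -
    have lim: "(\<lambda>M. (deriv ^^ m) (\<lambda>x. \<Prod>n<M. 1 - c * x ^ k n) 0) \<longlonglongrightarrow> (deriv ^^ m) (Pf c k) 0"
      by (rule higher_deriv_complex_uniform_limit[OF ul])
         (auto intro!: always_eventually holomorphic_intros)
    have "(deriv ^^ m) (\<lambda>x. \<Prod>n<M. 1 - c * x ^ k n) 0 = fact m * fps_nth (Pfps c k) m" if "m < M" for M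
    proof -
      have "(\<lambda>x. \<Prod>n<M. 1 - c * x ^ k n) has_fps_expansion (\<Prod>n<M. 1 - fps_const c * fps_X ^ k n)"
        by (intro fps_expansion_intros)
      from fps_nth_fps_expansion[OF this, of m] show ?thesis
        unfolding Pfps_stable[OF that] by (simp add: field_simps)
    qed
    then have "\<forall>\<^sub>F M in sequentially. (deriv ^^ m) (\<lambda>x. \<Prod>n<M. 1 - c * x ^ k n) 0 = fact m * fps_nth (Pfps c k) m"
      by (intro eventually_sequentiallyI[of "Suc m"]) auto
    then have "(\<lambda>M. (deriv ^^ m) (\<lambda>x. \<Prod>n<M. 1 - c * x ^ k n) 0) \<longlonglongrightarrow> fact m * fps_nth (Pfps c k) m"
      by (rule tendsto_eventually)
    with lim show ?thesis using LIMSEQ_unique by blast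
  qed
  then have "fps_expansion (Pf c k) 0 = Pfps c k" by (simp add: fps_expansion_def fps_eq_iff)
  moreover have "Pf c k has_fps_expansion fps_expansion (Pf c k) 0"
    by (rule has_fps_expansion_fps_expansion[OF _ _ Pf_holomorphic]) auto
  ultimately show ?thesis by simp
qed

lemma Pfps_nth_0: "fps_nth (Pfps c k) 0 = 1"
  using k[of 0] by (simp add: Pfps_def)

end

definition fps_rel :: "complex set \<Rightarrow> (complex \<Rightarrow> complex) \<Rightarrow> complex fps \<Rightarrow> complex fps \<Rightarrow> bool" where
  "fps_rel R \<sigma> F G \<longleftrightarrow> (\<forall>n. fps_nth F n \<in> R \<and> fps_nth G n = \<sigma> (fps_nth F n))"

context
  fixes R \<sigma> assumes emb: "ring_emb R \<sigma>"
begin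

lemma fps_rel_mult:
  assumes "fps_rel R \<sigma> F F'" "fps_rel R \<sigma> G G'"
  shows "fps_rel R \<sigma> (F * G) (F' * G')"
  unfolding fps_rel_def
proof
  fix n
  note R = ring_embD[OF emb]
  have m: "fps_nth F i * fps_nth G j \<in> R" for i j
    using assms R(1) by (auto simp: fps_rel_def intro!: subring_mult)
  then have "fps_nth (F * G) n \<in> R" unfolding fps_mult_nth by (intro subring_sum R)
  moreover have "fps_nth (F' * G') n = \<sigma> (fps_nth (F * G) n)"
    unfolding fps_mult_nth ring_emb_sum[OF emb m]
    using assms by (intro sum.cong) (auto simp: fps_rel_def R)
  ultimately show "fps_nth (F * G) n \<in> R \<and> fps_nth (F' * G') n = \<sigma> (fps_nth (F * G) n)" by blast
qed

lemma fps_rel_1: "fps_rel R \<sigma> 1 1"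
  using ring_embD(1,2,5)[OF emb] by (auto simp: fps_rel_def intro: subring_0 subring_1)

lemma fps_rel_prod: "(\<And>i. i \<in> I \<Longrightarrow> fps_rel R \<sigma> (F i) (F' i)) \<Longrightarrow> fps_rel R \<sigma> (prod F I) (prod F' I)"
  by (induction I rule: infinite_finite_induct) (auto intro: fps_rel_1 fps_rel_mult)

lemma fps_rel_power: "fps_rel R \<sigma> F F' \<Longrightarrow> fps_rel R \<sigma> (F ^ n) (F' ^ n)"
  by (induction n) (auto intro: fps_rel_1 fps_rel_mult)

lemma fps_rel_const: "c \<in> R \<Longrightarrow> fps_rel R \<sigma> (fps_const c) (fps_const (\<sigma> c))"
  using ring_embD(1,5)[OF emb] by (auto simp: fps_rel_def intro: subring_0)

lemma fps_rel_Pfps: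
  assumes "c \<in> R"
  shows "fps_rel R \<sigma> (Pfps c k) (Pfps (\<sigma> c) k)"
proof -
  note R = ring_embD[OF emb]
  have f: "fps_rel R \<sigma> (1 - fps_const c * fps_X ^ m) (1 - fps_const (\<sigma> c) * fps_X ^ m)" for m
    unfolding fps_rel_def using assms subring_diff[OF R(1) subring_1[OF R(1)] assms] subring_uminus[OF R(1) assms]
      R(3)[OF subring_1[OF R(1)] subring_uminus[OF R(1) assms]] R(1,2,5,7)
    by (auto simp: fps_X_power_nth subring_0 subring_1)
  have "fps_rel R \<sigma> (\<Prod>n<M. 1 - fps_const c * fps_X ^ k n) (\<Prod>n<M. 1 - fps_const (\<sigma> c) * fps_X ^ k n)" for M
    by (intro fps_rel_prod f)
  then show ?thesis unfolding fps_rel_def Pfps_def by (simp del: prod.lessThan_Suc)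
qed

lemma fls_rel_fps_to_fls: "fps_rel R \<sigma> F G \<Longrightarrow> fls_rel R \<sigma> (fps_to_fls F) (fps_to_fls G)"
  using ring_embD(1,5)[OF emb] by (auto simp: fps_rel_def fls_rel_def intro: subring_0)

end

text \<open>With constant term 1 the recursion for the coefficients of the inverse involves no
  division.\<close>

lemma fps_inverse_in:
  assumes "is_subring R" "\<And>n. fps_nth F n \<in> R" "fps_nth F 0 = 1"
  shows "fps_nth (inverse F) n \<in> R"
proof (induction n rule: less_induct)
  case (less n)
  show ?case
  proof (cases "n = 0")
    case False
    have "F * inverse F = 1" using assms(3) by (intro inverse_mult_eq_1') simp
    then have "fps_nth (F * inverse F) n = 0" using False by simp
    then have "fps_nth (inverse F) n = - (\<Sum>i=1..n. fps_nth F i * fps_nth (inverse F) (n - i))"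
      unfolding fps_mult_nth using assms(3) by (simp add: sum.atLeast_Suc_atMost eq_neg_iff_add_eq_0)
    also have "\<dots> \<in> R" using less by (intro subring_uminus subring_sum subring_mult assms) auto
    finally show ?thesis .
  qed (use assms subring_1 in simp)
qed

section \<open>Siegel functions\<close>

text \<open>The $12N$-th power of the Siegel function $g_a$, $a = (r/N, s/N)$.\<close>

definition hh :: "nat \<Rightarrow> int \<Rightarrow> int \<Rightarrow> complex \<Rightarrow> complex" where
  "hh N r s \<tau> = kap (of_int r / of_nat N) (of_int s / of_nat N) \<tau> ^ (12 * N)"

lemma hh_S: "\<tau> \<in> uhp \<Longrightarrow> hh N r s (-1 / \<tau>) = hh N s (- r) \<tau>"
  unfolding hh_def power_mult kap_S by simp

lemma hh_T:
  assumes "N > 0"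
  shows "hh N r s (\<tau> + of_int k) = hh N r (s + r * k) \<tau>"
proof -
  have "of_int s / of_nat N + of_int r / of_nat N * of_int k = (of_int (s + r * k) / of_nat N :: complex)"
    using assms by (simp add: field_simps)
  then show ?thesis unfolding hh_def power_mult kap_T by simp
qed

text \<open>Induction along a word in S and T. Both act on the row vector (r, s) by right
  multiplication, and the twelfth power has removed all constants, so the laws compose without a
  cocycle.\<close>

lemma hh_mob:
  assumes "N > 0" "A \<in> SL2Z" "\<tau> \<in> uhp"
  shows "hh N r s (mob A \<tau>) = hh N (r * A$1$1 + s * A$2$1) (r * A$1$2 + s * A$2$2) \<tau>"
  using assms(2,3)
proof (induction A arbitrary: \<tau> rule: SL2Z_induct)
  case one
  then show ?case by simp
next
  case (S A)
  have "hh N r s (mob (A ** Smat) \<tau>) = hh N r s (mob A (-1 / \<tau>))"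
    using mob_mult[OF Smat_SL2Z S.prems] by (simp add: mob_Smat)
  also have "\<dots> = hh N (r * A$1$1 + s * A$2$1) (r * A$1$2 + s * A$2$2) (-1 / \<tau>)"
    by (rule S.IH[OF uhp_S[OF S.prems]])
  also have "\<dots> = hh N (r * A$1$2 + s * A$2$2) (- (r * A$1$1 + s * A$2$1)) \<tau>"
    by (rule hh_S[OF S.prems])
  finally show ?case by (simp add: mult_nth2 Smat_def)
next
  case (T A k)
  have "hh N r s (mob (A ** Tmat k) \<tau>) = hh N r s (mob A (\<tau> + of_int k))"
    using mob_mult[OF Tmat_SL2Z T.prems] by (simp add: mob_Tmat)
  moreover have "\<tau> + of_int k \<in> uhp" using T.prems by (simp add: uhp_def)
  ultimately show ?case using T by (simp add: hh_T[OF assms(1)] mult_nth2 Tmat_def algebra_simps)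
qed

lemma hh_minus: "\<tau> \<in> uhp \<Longrightarrow> hh N (- r) (- s) \<tau> = hh N r s \<tau>"
  using kap_minus[of \<tau> "of_int r / of_nat N" "of_int s / of_nat N"] by (simp add: hh_def)

text \<open>An integer shift of a characteristic multiplies \<open>kap\<close> by minus a 2N-th root
  of unity, which the exponent 12 N kills.\<close>

lemma hh_shift:
  assumes "N > 0" "\<tau> \<in> uhp"
  shows "hh N (r + int N) s \<tau> = hh N r s \<tau>" "hh N r (s + int N) \<tau> = hh N r s \<tau>"
proof -
  have 1: "(of_int (r + int N) / of_nat N :: complex) = of_int r / of_nat N + 1" for r
    using assms by (simp add: field_simps)
  have 2: "(- ee (of_int k / of_nat N / 2)) ^ (12 * N) = 1" for k
  proof -
    have "of_nat (12 * N) * (of_int k / of_nat N / 2) = (of_int (6 * k) :: complex)" using assms by (simp add: field_simps)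
    then have "ee (of_int k / of_nat N / 2) ^ (12 * N) = 1" unfolding ee_power by (simp only: ee_of_int)
    then show ?thesis by simp
  qed
  show "hh N r (s + int N) \<tau> = hh N r s \<tau>"
    unfolding hh_def 1 kap_shift_b by (simp only: power_mult_distrib 2 mult_1)
  have 3: "- (of_int s / of_nat N) / 2 = (of_int (- s) / of_nat N / 2 :: complex)" by simp
  show "hh N (r + int N) s \<tau> = hh N r s \<tau>"
    unfolding hh_def 1 kap_shift_a[OF assms(2)] 3 by (simp only: power_mult_distrib 2 mult_1)
qed

lemma hh_mod:
  assumes "N > 0" "\<tau> \<in> uhp"
  shows "hh N (r mod int N) (s mod int N) \<tau> = hh N r s \<tau>"
proof -
  have 1: "hh N (r + int N * of_nat k) s \<tau> = hh N r s \<tau>" for r s k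
    by (induction k) (use hh_shift(1)[OF assms, of "r + int N * of_nat _" s] in \<open>auto simp: algebra_simps\<close>)
  have 2: "hh N r (s + int N * of_nat k) \<tau> = hh N r s \<tau>" for r s k
    by (induction k) (use hh_shift(2)[OF assms, of r "s + int N * of_nat _"] in \<open>auto simp: algebra_simps\<close>)
  have e1: "hh N (r + int N * k) s \<tau> = hh N r s \<tau>" for r s k
  proof (cases k rule: int_cases2)
    case (nonpos n) then show ?thesis using 1[of "r - int N * int n" n s] by simp
  qed (simp add: 1)
  have e2: "hh N r (s + int N * k) \<tau> = hh N r s \<tau>" for r s k
  proof (cases k rule: int_cases2)
    case (nonpos n) then show ?thesis using 2[of r "s - int N * int n" n] by simp
  qed (simp add: 2)
  have "hh N r s \<tau> = hh N (r mod int N + int N * (r div int N)) (s mod int N + int N * (s div int N)) \<tau>" by simp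
  then show ?thesis unfolding e1 e2 by simp
qed

lemma hh_cong:
  assumes "N > 0" "\<tau> \<in> uhp" "r mod int N = r' mod int N" "s mod int N = s' mod int N"
  shows "hh N r s \<tau> = hh N r' s' \<tau>"
  using hh_mod[OF assms(1,2), of r s] hh_mod[OF assms(1,2), of r' s'] assms(3,4) by simp

lemma hh_zero:
  assumes "N > 0" "\<tau> \<in> uhp" "int N dvd r" "int N dvd s"
  shows "hh N r s \<tau> = 0"
proof -
  have "hh N r s \<tau> = hh N 0 0 \<tau>" using assms by (intro hh_cong) auto
  also have "\<dots> = 0" using assms by (simp add: hh_def kap_def theta_0)
  finally show ?thesis .
qed

lemma hh_nonzero:
  assumes "N > 0" "\<tau> \<in> uhp" "\<not> (int N dvd r \<and> int N dvd s)"
  shows "hh N r s \<tau> \<noteq> 0"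
proof
  assume "hh N r s \<tau> = 0"
  then have "theta (of_int r / of_nat N * \<tau> + of_int s / of_nat N) \<tau> = 0" by (simp add: hh_def kap_def)
  from theta_zero_imp[OF assms(2) this] obtain m n where
    mn: "of_int r / of_nat N * \<tau> + of_int s / of_nat N = of_int m + of_int n * \<tau>" by (auto simp: lattice_def)
  have "Im (of_int r / of_nat N * \<tau> + of_int s / of_nat N) = of_int r / of_nat N * Im \<tau>"
  proof -
    have "(of_int r / of_nat N :: complex) = of_real (of_int r / of_nat N)" "(of_int s / of_nat N :: complex) = of_real (of_int s / of_nat N)"
      by simp_all
    then show ?thesis by (simp only: plus_complex.sel times_complex.sel Im_complex_of_real Re_complex_of_real mult_zero_left add_0_right)
  qed
  moreover have "Im (of_int r / of_nat N * \<tau> + of_int s / of_nat N) = of_int n * Im \<tau>" unfolding mn by simp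
  ultimately have "real_of_int r / of_nat N * Im \<tau> = of_int n * Im \<tau>" by (simp only:)
  then have r: "real_of_int r = of_int (n * int N)" using assms(1,2) by (simp add: uhp_def field_simps)
  then have r': "r = n * int N" by (simp only: of_int_eq_iff)
  then have "of_int r / of_nat N = (of_int n :: complex)" using assms(1) by simp
  then have "of_int s / of_nat N = (of_int m :: complex)" using mn by simp
  then have "(of_int s :: complex) = of_int (m * int N)" using assms(1) by (simp add: field_simps)
  then have "s = m * int N" by (simp only: of_int_eq_iff)
  then show False using assms(3) r' by simp
qed

text \<open>\<open>bq N r\<close> is $6N^2 B_2(\{r/N\})$, the order of the Siegel function in $q^{1/N}$.\<close>

definition bq :: "nat \<Rightarrow> int \<Rightarrow> int" where
  "bq N r = 6 * (r mod int N)\<^sup>2 - 6 * (r mod int N) * int N + (int N)\<^sup>2"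

text \<open>With \<rho> = r mod N, \<open>ka\<close> and \<open>kb\<close> are the exponents of x =
  q^(1/N) in the two products of theta at the point (\<rho> \<tau> + s)/N. For \<rho> = 0 the first
  factor 1 - zeta^s contains no x; it is split off as \<open>hc\<close>, and the exponents then
  start at N.\<close>

definition ka :: "nat \<Rightarrow> int \<Rightarrow> nat \<Rightarrow> nat" where
  "ka N r n = (if r mod int N = 0 then N else nat (r mod int N)) + N * n"

definition kb :: "nat \<Rightarrow> int \<Rightarrow> nat \<Rightarrow> nat" where
  "kb N r n = nat (int N - r mod int N) + N * n"

lemma ka_gt: "N > 0 \<Longrightarrow> n < ka N r n"
proof -
  assume N: "N > 0"
  then have "0 \<le> r mod int N" by simp
  then have "0 < (if r mod int N = 0 then N else nat (r mod int N))" using N by (cases "r mod int N = 0"; simp; linarith)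
  moreover have "n \<le> N * n" using N by simp
  ultimately show ?thesis unfolding ka_def by linarith
qed

lemma kb_gt: "N > 0 \<Longrightarrow> n < kb N r n"
proof -
  assume N: "N > 0"
  then have "0 < nat (int N - r mod int N)" using pos_mod_bound[of "int N" r] by auto
  moreover have "n \<le> N * n" using N by simp
  ultimately show ?thesis unfolding kb_def by linarith
qed

definition hc :: "nat \<Rightarrow> int \<Rightarrow> int \<Rightarrow> complex" where
  "hc N r s = (if r mod int N = 0 then 1 - zeta N powi s else 1)"

definition hprod :: "nat \<Rightarrow> int \<Rightarrow> int \<Rightarrow> complex \<Rightarrow> complex" where
  "hprod N r s x = (hc N r s * Pf (zeta N powi s) (ka N r) x * Pf (zeta N powi (- s)) (kb N r) x) ^ (12 * N)"

definition hfps :: "nat \<Rightarrow> int \<Rightarrow> int \<Rightarrow> complex fps" where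
  "hfps N r s = (fps_const (hc N r s) * Pfps (zeta N powi s) (ka N r) * Pfps (zeta N powi (- s)) (kb N r)) ^ (12 * N)"

definition hfls :: "nat \<Rightarrow> int \<Rightarrow> int \<Rightarrow> complex fls" where
  "hfls N r s = fls_X_intpow (bq N r) * (fls_const (zeta N powi (6 * (r mod int N) * s)) * fps_to_fls (hfps N r s))"

lemma norm_zeta_powi [simp]: "norm (zeta N powi k) = 1"
  by (simp add: zeta_powi norm_ee)

lemma norm_qx: "N > 0 \<Longrightarrow> \<tau> \<in> uhp \<Longrightarrow> norm (ee (\<tau> / of_nat N)) < 1"
  by (intro norm_ee_less_1) (simp add: uhp_def)

lemma PP_eq_Pf: "PP (x ^ N) (c * x ^ m) = Pf c (\<lambda>n. m + N * n) x"
  unfolding PP_def Pf_def by (simp add: power_add mult.assoc flip: power_mult)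

lemma hh_product:
  assumes N: "N > 0" and \<tau>: "\<tau> \<in> uhp"
  defines "x \<equiv> ee (\<tau> / of_nat N)"
  shows "hh N r s \<tau> = x powi (bq N r) * (zeta N powi (6 * (r mod int N) * s) * hprod N r s x)"
proof -
  define \<rho> where "\<rho> = r mod int N"
  have \<rho>: "0 \<le> \<rho>" "\<rho> < int N" using N by (auto simp: \<rho>_def)
  have "hh N r s \<tau> = hh N \<rho> s \<tau>" using N \<tau> by (intro hh_cong) (auto simp: \<rho>_def)
  define a b where "a = (of_int \<rho> / of_nat N :: complex)" and "b = (of_int s / of_nat N :: complex)"
  have x: "norm x < 1" unfolding x_def by (rule norm_qx[OF N \<tau>])
  have q: "ee \<tau> = x ^ N" using N by (simp add: x_def ee_power)
  have x\<rho>: "ee (a * \<tau>) = x ^ nat \<rho>" using N \<rho> by (simp add: x_def ee_power a_def mult_ac)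
  have w: "ee (a * \<tau> + b) = zeta N powi s * x ^ nat \<rho>"
    by (simp add: ee_add x\<rho> b_def zeta_powi)
  have w': "ee (\<tau> - (a * \<tau> + b)) = zeta N powi (- s) * x ^ nat (int N - \<rho>)"
  proof -
    have "ee \<tau> = x ^ nat \<rho> * x ^ nat (int N - \<rho>)" using \<rho> by (simp add: q flip: power_add nat_add_distrib)
    moreover have "x \<noteq> 0" by (simp add: x_def)
    moreover have "ee (\<tau> - (a * \<tau> + b)) = ee \<tau> / (x ^ nat \<rho> * zeta N powi s)"
      unfolding ee_diff ee_add x\<rho> by (simp add: b_def zeta_powi)
    ultimately show ?thesis by (simp add: power_int_minus field_simps)
  qed
  have P1: "PP (ee \<tau>) (ee (a * \<tau> + b)) = hc N r s * Pf (zeta N powi s) (ka N r) x"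
  proof (cases "\<rho> = 0")
    case True
    have "PP (ee \<tau>) (zeta N powi s * 1) = (1 - zeta N powi s) * PP (ee \<tau>) (zeta N powi s * x ^ N)"
      using PP_rec[OF norm_ee_less_1[OF \<tau>], of "zeta N powi s"] by (simp add: q)
    also have "PP (ee \<tau>) (zeta N powi s * x ^ N) = Pf (zeta N powi s) (ka N r) x"
      unfolding q PP_eq_Pf using True by (intro arg_cong2[where f = "\<lambda>k. Pf _ k"] ext) (auto simp: ka_def \<rho>_def)
    finally show ?thesis unfolding w using True by (simp add: hc_def \<rho>_def)
  next
    case False
    then show ?thesis unfolding w q PP_eq_Pf
      by (simp add: hc_def \<rho>_def ka_def[abs_def])
  qed
  have P2: "PP (ee \<tau>) (ee (\<tau> - (a * \<tau> + b))) = Pf (zeta N powi (- s)) (kb N r) x"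
    unfolding w' q PP_eq_Pf by (simp add: kb_def[abs_def] \<rho>_def)
  have "kap a b \<tau> = ee (a * (a * \<tau> + b) / 2) * ee (\<tau> / 12 - (a * \<tau> + b) / 2)
      * (hc N r s * Pf (zeta N powi s) (ka N r) x * Pf (zeta N powi (- s)) (kb N r) x)"
    unfolding kap_def theta_def P1 P2 by simp
  then have "kap a b \<tau> ^ (12 * N) = (ee (a * (a * \<tau> + b) / 2) * ee (\<tau> / 12 - (a * \<tau> + b) / 2)) ^ (12 * N) * hprod N r s x"
    by (simp add: power_mult_distrib hprod_def)
  also have "(ee (a * (a * \<tau> + b) / 2) * ee (\<tau> / 12 - (a * \<tau> + b) / 2)) ^ (12 * N)
      = ee (of_nat (12 * N) * (a * (a * \<tau> + b) / 2 + (\<tau> / 12 - (a * \<tau> + b) / 2)))"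
    by (simp only: ee_add[symmetric] ee_power)
  \<comment> \<open>With a = \<rho>/N the coefficient of \<tau> is 12 N (a^2 - a + 1/6)/2, which in
    units of 1/N equals 6 \<rho>^2 - 6 \<rho> N + N^2. The last summand is an integer and disappears
    under e.\<close>
  also have "of_nat (12 * N) * (a * (a * \<tau> + b) / 2 + (\<tau> / 12 - (a * \<tau> + b) / 2))
      = of_int (bq N r) * (\<tau> / of_nat N) + of_int (6 * \<rho> * s) / of_nat N + of_int (- 6 * s)"
    using N unfolding a_def b_def bq_def \<rho>_def[symmetric]
    by (simp add: field_simps power2_eq_square)
  also have "ee (of_int (bq N r) * (\<tau> / of_nat N) + of_int (6 * \<rho> * s) / of_nat N + of_int (- 6 * s))
      = x powi (bq N r) * zeta N powi (6 * \<rho> * s)"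
  proof -
    have "ee (of_int k * y) = ee y powi k" for k y
      by (cases k rule: int_cases2) (auto simp: ee_power ee_minus power_int_minus)
    then show ?thesis unfolding ee_add ee_of_int zeta_powi x_def by (simp only: mult_1_right)
  qed
  finally show ?thesis unfolding \<open>hh N r s \<tau> = hh N \<rho> s \<tau>\<close> by (simp add: hh_def a_def b_def \<rho>_def)
qed

lemma hprod_holomorphic: "N > 0 \<Longrightarrow> hprod N r s holomorphic_on ball 0 1"
  unfolding hprod_def by (intro holomorphic_intros Pf_holomorphic) (auto simp: ka_gt kb_gt)

lemma hh_holomorphic:
  assumes N: "N > 0"
  shows "hh N r s holomorphic_on uhp"
proof -
  have "(hprod N r s \<circ> (\<lambda>\<tau>. ee (\<tau> / of_nat N))) holomorphic_on uhp"
    by (rule holomorphic_on_compose) (auto intro!: holomorphic_intros holomorphic_on_subset[OF hprod_holomorphic[OF N]] simp: norm_qx N)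
  then have "(\<lambda>\<tau>. ee (\<tau> / of_nat N) powi (bq N r) * (zeta N powi (6 * (r mod int N) * s) * hprod N r s (ee (\<tau> / of_nat N)))) holomorphic_on uhp"
    unfolding o_def by (intro holomorphic_intros) auto
  then show ?thesis by (rule holomorphic_transform) (simp add: hh_product[OF N])
qed

lemma hprod_has_fps_expansion: "N > 0 \<Longrightarrow> hprod N r s has_fps_expansion hfps N r s"
  unfolding hprod_def hfps_def
  by (intro fps_expansion_intros Pf_has_fps_expansion) (auto simp: ka_gt kb_gt)

lemma hh_qexp:
  assumes N: "N > 0"
  shows "has_q_expansion N (hh N r s) (hfls N r s)"
proof (rule qexpI[OF N])
  show "(\<lambda>x. x powi (bq N r) * (zeta N powi (6 * (r mod int N) * s) * hprod N r s x)) has_laurent_expansion hfls N r s"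
    unfolding hfls_def by (intro laurent_expansion_intros has_laurent_expansion_fps hprod_has_fps_expansion N)
  show "\<forall>\<^sub>F \<tau> in at_i_inf. hh N r s \<tau> = ee (\<tau> / of_nat N) powi bq N r *
      (zeta N powi (6 * (r mod int N) * s) * hprod N r s (ee (\<tau> / of_nat N)))"
    using eventually_in_uhp by eventually_elim (rule hh_product[OF N])
qed

lemma ring_emb_zeta_powi:
  assumes "N > 0" "ring_emb R \<sigma>" "zeta N \<in> R" "\<sigma> (zeta N) = zeta N powi d"
  shows "\<sigma> (zeta N powi k) = zeta N powi (d * k)" "zeta N powi k \<in> R"
proof -
  note R = ring_embD[OF assms(2)]
  define m where "m = nat (k mod int N)"
  have m: "zeta N powi k = zeta N ^ m"
    using zeta_powi_mod[OF assms(1), of k] assms(1) by (simp add: m_def power_int_def)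
  show "zeta N powi k \<in> R" unfolding m by (intro subring_power R assms)
  have "\<sigma> (zeta N powi k) = (zeta N powi d) ^ m" unfolding m by (simp add: ring_emb_power[OF assms(2,3)] assms(4))
  also have "\<dots> = zeta N powi (d * int m)" by (simp add: power_int_mult)
  also have "\<dots> = zeta N powi (d * k)"
  proof -
    have "(d * int m) mod int N = (d * k) mod int N" using assms(1) by (simp add: m_def mod_mult_right_eq)
    then show ?thesis using zeta_powi_mod[OF assms(1)] by metis
  qed
  finally show "\<sigma> (zeta N powi k) = zeta N powi (d * k)" .
qed

text \<open>The second coordinate s enters the expansion only through powers of zeta^s, the first
  one only through exponents of x. Hence conjugating the coefficients by zeta -> zeta^d is the
  action of diag(1, d) on (r, s).\<close>

lemma hfls_rel:
  assumes "N > 0" "ring_emb R \<sigma>" "zeta N \<in> R" "\<sigma> (zeta N) = zeta N powi d"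
  shows "fls_rel R \<sigma> (hfls N r s) (hfls N r (d * s))"
proof -
  note R = ring_embD[OF assms(2)] and z = ring_emb_zeta_powi[OF assms]
  have hc: "hc N r s \<in> R" "hc N r (d * s) = \<sigma> (hc N r s)"
  proof -
    show "hc N r s \<in> R" by (auto simp: hc_def intro!: subring_diff subring_1 R z)
    have "\<sigma> (1 + (- (zeta N powi s))) = 1 - zeta N powi (d * s)"
      by (subst R(3)) (auto simp: R z intro!: subring_1 subring_uminus R z)
    then show "hc N r (d * s) = \<sigma> (hc N r s)" by (auto simp: hc_def R)
  qed
  have 1: "fps_rel R \<sigma> (Pfps (zeta N powi s) (ka N r)) (Pfps (zeta N powi (d * s)) (ka N r))"
    using fps_rel_Pfps[OF assms(2) z(2)[of s]] by (simp add: z)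
  have 2: "fps_rel R \<sigma> (Pfps (zeta N powi (- s)) (kb N r)) (Pfps (zeta N powi (- (d * s))) (kb N r))"
    using fps_rel_Pfps[OF assms(2) z(2)[of "- s"]] by (simp add: z)
  have 3: "fls_rel R \<sigma> (fls_const (zeta N powi (6 * (r mod int N) * s))) (fls_const (zeta N powi (6 * (r mod int N) * (d * s))))"
    using fls_rel_const[OF assms(2) z(2)[of "6 * (r mod int N) * s"]] by (simp add: z mult_ac)
  have "fps_rel R \<sigma> (hfps N r s) (hfps N r (d * s))"
    unfolding hfps_def hc(2) by (intro fps_rel_power fps_rel_mult fps_rel_const assms(2) hc 1 2)
  then show ?thesis unfolding hfls_def
    by (intro fls_rel_mult fls_rel_X_intpow fls_rel_fps_to_fls assms(2) 3)
qed

section \<open>Lattice sums\<close>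

lemma summable_on_int_inverse_square: "(\<lambda>m::int. 1 / (1 + (real_of_int m)\<^sup>2)) summable_on UNIV"
proof -
  have "summable (\<lambda>n::nat. 1 / (1 + (real n)\<^sup>2))"
  proof (rule summable_comparison_test_ev)
    show "summable (\<lambda>n. inverse (real n ^ 2))" by (rule inverse_power_summable) simp
    show "\<forall>\<^sub>F n in sequentially. norm (1 / (1 + (real n)\<^sup>2)) \<le> inverse (real n ^ 2)"
      by (intro eventually_sequentiallyI[of 1]) (auto simp: inverse_eq_divide intro!: divide_left_mono mult_pos_pos add_pos_nonneg)
  qed
  then have nat: "(\<lambda>n::nat. 1 / (1 + (real n)\<^sup>2)) summable_on UNIV"
    by (intro summable_nonneg_imp_summable_on) auto
  have 1: "(\<lambda>m::int. 1 / (1 + (real_of_int m)\<^sup>2)) summable_on (range int)"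
    using nat by (subst summable_on_reindex) (auto simp: o_def)
  have 2: "(\<lambda>m::int. 1 / (1 + (real_of_int m)\<^sup>2)) summable_on ((\<lambda>n. - int n) ` UNIV)"
    using nat by (subst summable_on_reindex) (auto simp: o_def inj_on_def)
  have 3: "(\<lambda>m::int. 1 / (1 + (real_of_int m)\<^sup>2)) summable_on ((\<lambda>n. - int n) ` UNIV - range int)"
    by (rule summable_on_subset_banach[OF 2]) auto
  have "(\<lambda>m::int. 1 / (1 + (real_of_int m)\<^sup>2)) summable_on (range int \<union> ((\<lambda>n. - int n) ` UNIV - range int))"
    by (rule summable_on_Un_disjoint[OF 1 3]) auto
  also have "range int \<union> ((\<lambda>n. - int n) ` UNIV - range int) = UNIV"
    by (auto simp: image_iff) (metis int_cases2)
  finally show ?thesis .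
qed

lemma lattice_norm_bound:
  assumes "\<tau> \<in> uhp"
  obtains c :: real where "c > 0" "\<And>m n :: int. of_int m ^ 2 + of_int n ^ 2 \<le> c * (cmod (of_int m * \<tau> + of_int n))\<^sup>2"
proof -
  define x y where "x = Re \<tau>" and "y = Im \<tau>"
  have y: "y > 0" using assms by (simp add: uhp_def y_def)
  \<comment> \<open>From n^2 <= 2 (m x + n)^2 + 2 m^2 x^2 and m^2 y^2 <= |m \<tau> + n|^2.\<close>
  define c where "c = (1 + 2 * x\<^sup>2) / y\<^sup>2 + 2"
  have c: "c > 0" unfolding c_def by (intro add_nonneg_pos) auto
  show ?thesis
  proof (rule that[OF c])
    fix m n :: int
    define M K where "M = real_of_int m" and "K = real_of_int n"
    have "(cmod (of_int m * \<tau> + of_int n))\<^sup>2 = (M * x + K)\<^sup>2 + M\<^sup>2 * y\<^sup>2"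
      by (simp add: cmod_power2 x_def y_def M_def K_def power_mult_distrib)
    then have "c * (cmod (of_int m * \<tau> + of_int n))\<^sup>2 = c * ((M * x + K)\<^sup>2 + M\<^sup>2 * y\<^sup>2)" by simp
    moreover have "c * ((M * x + K)\<^sup>2 + M\<^sup>2 * y\<^sup>2) = (1 + 2 * x\<^sup>2) / y\<^sup>2 * (M * x + K)\<^sup>2 + 2 * (M * x + K)\<^sup>2
        + (1 + 2 * x\<^sup>2) * M\<^sup>2 + 2 * (M\<^sup>2 * y\<^sup>2)"
      using y by (simp add: c_def field_simps)
    moreover have "(1 + 2 * x\<^sup>2) / y\<^sup>2 * (M * x + K)\<^sup>2 \<ge> 0" "2 * (M\<^sup>2 * y\<^sup>2) \<ge> 0" by auto
    moreover have "2 * (M * x + K)\<^sup>2 + (1 + 2 * x\<^sup>2) * M\<^sup>2 = M\<^sup>2 + K\<^sup>2 + (2 * M * x + K)\<^sup>2"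
      by (simp add: power2_eq_square algebra_simps)
    moreover have "(2 * M * x + K)\<^sup>2 \<ge> 0" by auto
    ultimately show "of_int m ^ 2 + of_int n ^ 2 \<le> c * (cmod (of_int m * \<tau> + of_int n))\<^sup>2"
      unfolding M_def K_def by linarith
  qed
qed

text \<open>Comparison with a product of two one-dimensional series: (1 + m^2)(1 + n^2) is at most 4
  c^2 |m \<tau> + n|^4. The surplus k - 4 powers are handled by the lower bound s for the length of
  a nonzero lattice vector.\<close>

lemma lattice_summable:
  assumes "\<tau> \<in> uhp" "k \<ge> 4"
  shows "(\<lambda>(m, n). 1 / (of_int m * \<tau> + of_int n) ^ k) summable_on (UNIV - {(0::int, 0::int)})"
proof -
  obtain c where c: "c > 0" "\<And>m n :: int. of_int m ^ 2 + of_int n ^ 2 \<le> c * (cmod (of_int m * \<tau> + of_int n))\<^sup>2"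
    using lattice_norm_bound[OF assms(1)] by blast
  define s where "s = 1 / sqrt c"
  have s: "s > 0" using c by (simp add: s_def)
  define C where "C = 4 * c\<^sup>2 / s ^ (k - 4)"
  define g where "g = (\<lambda>p :: int \<times> int. C * (1 / (1 + (real_of_int (fst p))\<^sup>2) * (1 / (1 + (real_of_int (snd p))\<^sup>2))))"
  have "(\<lambda>p :: int \<times> int. 1 / (1 + (real_of_int (fst p))\<^sup>2) * (1 / (1 + (real_of_int (snd p))\<^sup>2))) summable_on (UNIV \<times> UNIV)"
  proof (rule summable_on_SigmaI)
    fix m :: int
    show "((\<lambda>n. 1 / (1 + (real_of_int (fst (m, n)))\<^sup>2) * (1 / (1 + (real_of_int (snd (m, n)))\<^sup>2))) has_sum
      (1 / (1 + (real_of_int m)\<^sup>2) * infsum (\<lambda>n::int. 1 / (1 + (real_of_int n)\<^sup>2)) UNIV)) UNIV"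
      unfolding fst_conv snd_conv
      by (rule has_sum_cmult_right[OF has_sum_infsum[OF summable_on_int_inverse_square]])
    show "(\<lambda>m. 1 / (1 + (real_of_int m)\<^sup>2) * infsum (\<lambda>n::int. 1 / (1 + (real_of_int n)\<^sup>2)) UNIV) summable_on UNIV"
      by (rule summable_on_cmult_left[OF summable_on_int_inverse_square])
  qed auto
  then have "g summable_on (UNIV \<times> UNIV)" unfolding g_def by (intro summable_on_cmult_right)
  then have "g summable_on (UNIV - {(0, 0)})" by (rule summable_on_subset_banach) auto
  then have "(\<lambda>p. norm (g p)) summable_on (UNIV - {(0, 0)})" using summable_on_iff_abs_summable_on_real by blast
  then have "(\<lambda>p. norm (case p of (m, n) \<Rightarrow> 1 / (of_int m * \<tau> + of_int n) ^ k)) summable_on (UNIV - {(0::int, 0::int)})"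
  proof (rule Infinite_Sum.abs_summable_on_comparison_test)
    fix p :: "int \<times> int" assume "p \<in> UNIV - {(0, 0)}"
    then obtain m n where p: "p = (m, n)" "m \<noteq> 0 \<or> n \<noteq> 0" by (cases p) auto
    define a where "a = cmod (of_int m * \<tau> + of_int n)"
    define t where "t = real_of_int m ^ 2 + real_of_int n ^ 2"
    have "m ^ 2 + n ^ 2 \<ge> 1"
    proof -
      have "m ^ 2 + n ^ 2 > 0" using p(2) by (simp add: sum_power2_gt_zero_iff)
      then show ?thesis by linarith
    qed
    then have t: "t \<ge> 1" unfolding t_def by (metis of_int_1_le_iff of_int_add of_int_power)
    have ta: "t \<le> c * a\<^sup>2" using c(2) by (simp add: t_def a_def)
    have a0: "a \<ge> 0" by (simp add: a_def)
    have "s\<^sup>2 \<le> a\<^sup>2" using t ta c(1) by (simp add: s_def power_divide field_simps)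
    then have as: "s \<le> a" using a0 by (rule power2_le_imp_le)
    then have a: "a > 0" using s by linarith
    have "(1 + (real_of_int m)\<^sup>2) * (1 + (real_of_int n)\<^sup>2) \<le> (2 * t) * (2 * t)"
    proof (intro mult_mono)
      have aux: "1 + a \<le> 2 * (a + b)" "1 + b \<le> 2 * (a + b)" if "1 \<le> a + b" "0 \<le> a" "0 \<le> b" for a b :: real
        using that by simp_all
      show "1 + (real_of_int m)\<^sup>2 \<le> 2 * t" "1 + (real_of_int n)\<^sup>2 \<le> 2 * t"
        unfolding t_def by (rule aux[OF t[unfolded t_def] zero_le_power2 zero_le_power2])+
    qed (use t in auto)
    also have "\<dots> \<le> (2 * (c * a\<^sup>2)) * (2 * (c * a\<^sup>2))" using t ta by (intro mult_mono) auto
    also have "\<dots> = 4 * c\<^sup>2 * a ^ 4" by (simp add: power2_eq_square power4_eq_xxxx)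
    finally have b: "(1 + (real_of_int m)\<^sup>2) * (1 + (real_of_int n)\<^sup>2) \<le> 4 * c\<^sup>2 * a ^ 4" .
    define B where "B = (1 + (real_of_int m)\<^sup>2) * (1 + (real_of_int n)\<^sup>2)"
    have B: "B > 0" unfolding B_def by (intro mult_pos_pos add_pos_nonneg) auto
    have "a ^ k = a ^ 4 * a ^ (k - 4)" using assms(2) by (simp flip: power_add)
    moreover have "a ^ (k - 4) \<ge> s ^ (k - 4)" using as s by (intro power_mono) auto
    ultimately have "a ^ k \<ge> a ^ 4 * s ^ (k - 4)" using a by (simp add: mult_left_mono)
    moreover have "B / (4 * c\<^sup>2) \<le> a ^ 4" using b c(1) by (simp add: B_def field_simps)
    then have "B / (4 * c\<^sup>2) * s ^ (k - 4) \<le> a ^ 4 * s ^ (k - 4)" using s by (intro mult_right_mono) auto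
    ultimately have le: "B / (4 * c\<^sup>2) * s ^ (k - 4) \<le> a ^ k" by linarith
    have pos: "B / (4 * c\<^sup>2) * s ^ (k - 4) > 0" using B c s by simp
    have "norm (case p of (m, n) \<Rightarrow> 1 / (of_int m * \<tau> + of_int n) ^ k) = 1 / a ^ k"
      by (simp add: p a_def norm_divide norm_power)
    also have "\<dots> \<le> 1 / (B / (4 * c\<^sup>2) * s ^ (k - 4))" by (rule frac_le[OF _ order_refl pos le]) simp
    also have "\<dots> = g p" using B by (simp add: g_def p C_def B_def)
    also have "\<dots> \<le> norm (g p)" by simp
    finally show "norm (case p of (m, n) \<Rightarrow> 1 / (of_int m * \<tau> + of_int n) ^ k) \<le> norm (g p)" .
  qed
  then show ?thesis using summable_on_iff_abs_summable_on_complex by blast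
qed

lemma Eisenstein_S:
  assumes "\<tau> \<in> uhp"
  shows "Eisenstein_G k (-1 / \<tau>) = \<tau> ^ k * Eisenstein_G k \<tau>"
proof -
  have nz: "\<tau> \<noteq> 0" using assms uhp_nonzero by auto
  have "Eisenstein_G k (-1 / \<tau>) = (\<Sum>\<^sub>\<infinity>p \<in> UNIV - {(0::int, 0::int)}. \<tau> ^ k * (1 / (of_int (fst p) * \<tau> + of_int (snd p)) ^ k))"
    unfolding Eisenstein_G_def case_prod_unfold
  proof (rule infsum_reindex_bij_witness[of _ "\<lambda>p. (- snd p, fst p)" "\<lambda>p. (snd p, - fst p)"])
    fix p :: "int \<times> int"
    have "of_int (fst p) * (- 1 / \<tau>) + of_int (snd p) = (of_int (snd p) * \<tau> + of_int (- fst p)) / \<tau>" using nz by (simp add: field_simps)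
    then show "\<tau> ^ k * (1 / (of_int (fst (snd p, - fst p)) * \<tau> + of_int (snd (snd p, - fst p))) ^ k)
      = 1 / (of_int (fst p) * (- 1 / \<tau>) + of_int (snd p)) ^ k"
      by (simp add: power_divide)
  qed (auto simp: prod_eq_iff)
  also have "\<dots> = \<tau> ^ k * Eisenstein_G k \<tau>"
    unfolding Eisenstein_G_def case_prod_unfold by (rule infsum_cmult_right')
  finally show ?thesis .
qed

section \<open>The Lipschitz formula\<close>

text \<open>The polylogarithm series of order -k. For k = 0 the convention 0^0 = 1 includes the
  constant term, so that the sum is 1/(1 - x).\<close>

definition Lf :: "nat \<Rightarrow> complex fps" where
  "Lf k = Abs_fps (\<lambda>d. of_nat d ^ k)"

lemma Lf_Suc: "Lf (Suc k) = fps_X * fps_deriv (Lf k)"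
  by (rule fps_ext) (simp add: Lf_def fps_X_mult_nth split: nat.split) 

lemma Lf_conv_radius: "fps_conv_radius (Lf k) \<ge> 1"
proof (induction k)
  case 0
  have "summable (\<lambda>n. fps_nth (Lf 0) n * of_real r ^ n)" if "0 < r" "ereal r < 1" for r
    using that by (simp add: Lf_def)
  then show ?case unfolding fps_conv_radius_def by (intro conv_radius_geI_ex') auto
next
  case (Suc k)
  have "fps_conv_radius (fps_deriv (Lf k)) \<ge> 1" using Suc fps_conv_radius_deriv[of "Lf k"] by (rule order_trans)
  then show ?case unfolding Lf_Suc by (intro fps_conv_radius_mult_ge) simp_all
qed

lemma Lf_less_radius: "norm x < 1 \<Longrightarrow> ereal (norm x) < fps_conv_radius (Lf k)"
  using Lf_conv_radius[of k] by (metis ereal_less(3) less_le_trans)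

lemma eval_Lf_0: "norm x < 1 \<Longrightarrow> eval_fps (Lf 0) x = 1 / (1 - x)"
  by (simp add: eval_fps_def Lf_def suminf_geometric)

lemma eval_Lf_has_derivative:
  assumes "norm x < 1"
  shows "(eval_fps (Lf k) has_field_derivative eval_fps (fps_deriv (Lf k)) x) (at x)"
    "eval_fps (Lf (Suc k)) x = x * eval_fps (fps_deriv (Lf k)) x"
proof -
  show "(eval_fps (Lf k) has_field_derivative eval_fps (fps_deriv (Lf k)) x) (at x)"
    by (rule has_field_derivative_eval_fps) (rule Lf_less_radius[OF assms])
  have "ereal (norm x) < fps_conv_radius (fps_deriv (Lf k))"
    using Lf_less_radius[OF assms, of k] fps_conv_radius_deriv[of "Lf k"] by (rule less_le_trans)
  then show "eval_fps (Lf (Suc k)) x = x * eval_fps (fps_deriv (Lf k)) x"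
    unfolding Lf_Suc by (subst eval_fps_mult) auto
qed

lemma eval_Lf_Suc:
  assumes "norm x < 1" "\<And>y. norm y < 1 \<Longrightarrow> eval_fps (Lf k) y = f y" "(f has_field_derivative D) (at x)"
  shows "eval_fps (Lf (Suc k)) x = x * D"
proof -
  have "(f has_field_derivative eval_fps (fps_deriv (Lf k)) x) (at x)"
    by (rule has_field_derivative_transform_within_open[OF eval_Lf_has_derivative(1)[OF assms(1)], of "ball 0 1"])
       (use assms in auto)
  then have "D = eval_fps (fps_deriv (Lf k)) x" using DERIV_unique assms(3) by blast
  then show ?thesis using eval_Lf_has_derivative(2)[OF assms(1)] by simp
qed

lemma norm_less_1_nz: "norm (x :: complex) < 1 \<Longrightarrow> 1 - x \<noteq> 0"
  by auto

text \<open>One application of x d/dx to p(x)/(1 - x)^m. Iterated from 1/(1 - x) it produces the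
  Eulerian polynomials; exponents 3 and 5 belong to the Eisenstein series of weights 4 and
  6.\<close>

lemma eval_Lf_step:
  assumes x: "norm x < 1" and k: "k' = Suc k" and m: "m' = Suc m"
    and f: "\<And>y. norm y < 1 \<Longrightarrow> eval_fps (Lf k) y = p y / (1 - y) ^ m"
    and p: "(p has_field_derivative p') (at x)" and r: "x * (p' * (1 - x) + of_nat m * p x) = r"
  shows "eval_fps (Lf k') x = r / (1 - x) ^ m'"
proof -
  have nz: "1 - x \<noteq> 0" using norm_less_1_nz[OF x] .
  have "((\<lambda>x. p x / (1 - x) ^ m) has_field_derivative (p' * (1 - x) + of_nat m * p x) / (1 - x) ^ Suc m) (at x)"
  proof (cases m)
    case 0
    then show ?thesis using p nz by simp
  next
    case (Suc l)
    have "((\<lambda>x. p x / (1 - x) ^ m) has_field_derivative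
       (p' * (1 - x) ^ m - p x * (of_nat m * (1 - x) ^ l * (-1))) / ((1 - x) ^ m * (1 - x) ^ m)) (at x)"
      using nz Suc by (auto intro!: derivative_eq_intros p simp del: of_nat_Suc power_Suc)
    moreover have "(p' * (1 - x) ^ m - p x * (of_nat m * (1 - x) ^ l * (-1))) / ((1 - x) ^ m * (1 - x) ^ m)
       = (p' * (1 - x) + of_nat m * p x) / (1 - x) ^ Suc m"
    proof -
      have "p' * (1 - x) ^ m - p x * (of_nat m * (1 - x) ^ l * (-1)) = (1 - x) ^ l * (p' * (1 - x) + of_nat m * p x)"
        unfolding Suc power_Suc by (simp add: algebra_simps)
      moreover have "(1 - x) ^ m * (1 - x) ^ m = (1 - x) ^ l * (1 - x) ^ Suc m"
        unfolding Suc power_Suc by (simp add: algebra_simps)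
      ultimately show ?thesis using nz by simp
    qed
    ultimately show ?thesis by simp
  qed
  from eval_Lf_Suc[OF x f this] show ?thesis unfolding k m r[symmetric] by simp
qed

lemma eval_Lf_1: "norm x < 1 \<Longrightarrow> eval_fps (Lf 1) x = x / (1 - x) ^ 2"
  by (rule eval_Lf_step[where p = "\<lambda>_. 1" and k = 0 and m = 1])
     (auto simp: eval_Lf_0)

lemma eval_Lf_2: "norm x < 1 \<Longrightarrow> eval_fps (Lf 2) x = (x + x ^ 2) / (1 - x) ^ 3"
  by (rule eval_Lf_step[where p = "\<lambda>x. x" and k = 1 and m = 2 and p' = 1])
     (simp_all add: eval_Lf_1 algebra_simps power2_eq_square del: One_nat_def)

lemma eval_Lf_3: "norm x < 1 \<Longrightarrow> eval_fps (Lf 3) x = (x + 4 * x ^ 2 + x ^ 3) / (1 - x) ^ 4"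
  by (rule eval_Lf_step[where p = "\<lambda>x. x + x ^ 2" and k = 2 and m = 3 and p' = "1 + 2 * x"])
     (simp_all add: eval_Lf_2, auto simp: eval_nat_numeral algebra_simps intro!: derivative_eq_intros)

lemma eval_Lf_4: "norm x < 1 \<Longrightarrow> eval_fps (Lf 4) x = (x + 11 * x ^ 2 + 11 * x ^ 3 + x ^ 4) / (1 - x) ^ 5"
  by (rule eval_Lf_step[where p = "\<lambda>x. x + 4 * x ^ 2 + x ^ 3" and k = 3 and m = 4 and p' = "1 + 8 * x + 3 * x ^ 2"])
     (simp_all add: eval_Lf_3, auto simp: eval_nat_numeral algebra_simps intro!: derivative_eq_intros)

lemma eval_Lf_5: "norm x < 1 \<Longrightarrow> eval_fps (Lf 5) x = (x + 26 * x ^ 2 + 66 * x ^ 3 + 26 * x ^ 4 + x ^ 5) / (1 - x) ^ 6"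
  by (rule eval_Lf_step[where p = "\<lambda>x. x + 11 * x ^ 2 + 11 * x ^ 3 + x ^ 4" and k = 4 and m = 5 and p' = "1 + 22 * x + 33 * x ^ 2 + 4 * x ^ 3"])
     (simp_all add: eval_Lf_4, auto simp: eval_nat_numeral algebra_simps intro!: derivative_eq_intros)

lemma uhp_not_Ints: "z \<in> uhp \<Longrightarrow> z \<notin> \<int>"
  by (auto simp: uhp_def elim!: Ints_cases)

lemma uhp_not_nonpos: "z \<in> uhp \<Longrightarrow> z \<notin> \<int>\<^sub>\<le>\<^sub>0" "z \<in> uhp \<Longrightarrow> 1 - z \<notin> \<int>\<^sub>\<le>\<^sub>0"
proof -
  assume z: "z \<in> uhp"
  show "z \<notin> \<int>\<^sub>\<le>\<^sub>0" using uhp_not_Ints[OF z] nonpos_Ints_subset_Ints by blast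
  have "1 - z \<notin> \<int>" using z by (auto simp: uhp_def elim!: Ints_cases simp: complex_eq_iff)
  then show "1 - z \<notin> \<int>\<^sub>\<le>\<^sub>0" using nonpos_Ints_subset_Ints by blast
qed

text \<open>Differentiating rGamma(z) rGamma(1 - z) = sin(pi z)/pi gives pi cot(pi z), rewritten
  here in terms of e(z).\<close>

lemma Digamma_reflection_uhp:
  assumes z: "z \<in> uhp"
  shows "Digamma (1 - z) - Digamma z = of_real pi * \<i> - 2 * of_real pi * \<i> * (1 / (1 - ee z))"
proof -
  note np = uhp_not_nonpos[OF z]
  have "((\<lambda>z. rGamma z * rGamma (1 - z)) has_field_derivative
      (- rGamma z * Digamma z) * rGamma (1 - z) + (- rGamma (1 - z) * Digamma (1 - z)) * (-1) * rGamma z) (at z)"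
    using np by (auto intro!: derivative_eq_intros)
  moreover have "((\<lambda>z. sin (of_real pi * z) / of_real pi) has_field_derivative cos (of_real pi * z)) (at z)"
    by (auto intro!: derivative_eq_intros)
  ultimately have "(- rGamma z * Digamma z) * rGamma (1 - z) + (- rGamma (1 - z) * Digamma (1 - z)) * (-1) * rGamma z = cos (of_real pi * z)"
    unfolding rGamma_reflection_complex by (rule DERIV_unique)
  then have "(rGamma z * rGamma (1 - z)) * (Digamma (1 - z) - Digamma z) = cos (of_real pi * z)"
    by (simp add: algebra_simps)
  then have eq: "sin (of_real pi * z) * (Digamma (1 - z) - Digamma z) = of_real pi * cos (of_real pi * z)"
    unfolding rGamma_reflection_complex by (simp add: field_simps)
  define w where "w = exp (\<i> * (of_real pi * z))"
  have w: "w \<noteq> 0" "w * w = ee z" by (simp_all add: w_def ee_def mult_ac flip: exp_add)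
  have q1: "1 - ee z \<noteq> 0" using norm_less_1_nz[OF norm_ee_less_1[OF z]] .
  have sin: "sin (of_real pi * z) = (w - 1 / w) / (2 * \<i>)" and cos: "cos (of_real pi * z) = (w + 1 / w) / 2"
    by (simp_all add: sin_exp_eq cos_exp_eq w_def exp_minus inverse_eq_divide)
  define D where "D = Digamma (1 - z) - Digamma z"
  have "(w * w - 1) * D = 2 * \<i> * w * ((w - 1 / w) / (2 * \<i>) * D)" using w(1) by (simp add: field_simps)
  also have "(w - 1 / w) / (2 * \<i>) * D = of_real pi * ((w + 1 / w) / 2)" using eq unfolding sin cos D_def .
  also have "2 * \<i> * w * (of_real pi * ((w + 1 / w) / 2)) = of_real pi * \<i> * (w * w + 1)"
    using w(1) by (simp add: field_simps)
  finally have "(w * w - 1) * (Digamma (1 - z) - Digamma z) = of_real pi * \<i> * (w * w + 1)" unfolding D_def .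
  then show ?thesis using q1 unfolding w(2) by (simp add: field_simps)
qed

text \<open>Repeated differentiation of the digamma case: d/dz acts on functions of e(z) as 2 pi i
  times x d/dx, which turns \<open>Lf n\<close> into \<open>Lf (Suc n)\<close> and kills the
  constant pi i after the first step.\<close>

lemma Polygamma_reflection_uhp:
  assumes "z \<in> uhp"
  shows "(-1) ^ n * Polygamma n (1 - z) - Polygamma n z
     = (if n = 0 then of_real pi * \<i> else 0) - (2 * of_real pi * \<i>) ^ Suc n * eval_fps (Lf n) (ee z)"
  using assms
proof (induction n arbitrary: z)
  case 0
  then show ?case using Digamma_reflection_uhp[OF 0] eval_Lf_0[OF norm_ee_less_1[OF 0]] by simp
next
  case (Suc n)
  note np = uhp_not_nonpos[OF Suc.prems] and q = norm_ee_less_1[OF Suc.prems]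
  define D where "D = eval_fps (fps_deriv (Lf n)) (ee z) * (2 * of_real pi * \<i> * ee z)"
  have d1: "((\<lambda>z. (-1) ^ n * Polygamma n (1 - z) - Polygamma n z) has_field_derivative
     ((-1) ^ n * (Polygamma (Suc n) (1 - z) * (-1)) - Polygamma (Suc n) z)) (at z)"
    using np by (auto intro!: derivative_eq_intros)
  have "((\<lambda>z. eval_fps (Lf n) (ee z)) has_field_derivative D) (at z)"
    unfolding D_def by (rule DERIV_chain2[OF eval_Lf_has_derivative(1)[OF q] ee_has_field_derivative])
  from DERIV_diff[OF DERIV_const[of "if n = 0 then of_real pi * \<i> else 0"] DERIV_cmult[OF this, of "(2 * of_real pi * \<i>) ^ Suc n"]]
  have d2: "((\<lambda>z. (if n = 0 then of_real pi * \<i> else 0) - (2 * of_real pi * \<i>) ^ Suc n * eval_fps (Lf n) (ee z))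
      has_field_derivative (- ((2 * of_real pi * \<i>) ^ Suc n * D))) (at z)"
    by (simp del: power_Suc)
  have "((\<lambda>z. (-1) ^ n * Polygamma n (1 - z) - Polygamma n z) has_field_derivative (- ((2 * of_real pi * \<i>) ^ Suc n * D))) (at z)"
    by (rule has_field_derivative_transform_within_open[OF d2 open_uhp Suc.prems]) (use Suc.IH in auto)
  from DERIV_unique[OF d1 this] show ?case
    unfolding eval_Lf_has_derivative(2)[OF q] D_def by (simp add: mult_ac)
qed

lemma Polygamma_nat_sum:
  fixes z :: complex
  assumes "odd n" "(\<lambda>j::nat. 1 / (z + of_nat j) ^ Suc n) summable_on UNIV"
  shows "((\<lambda>j::nat. 1 / (z + of_nat j) ^ Suc n) has_sum (Polygamma n z / fact n)) UNIV"
proof -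
  have n: "n \<noteq> 0" "even (Suc n)" using assms(1) by (auto elim: oddE)
  obtain S where S: "((\<lambda>j::nat. 1 / (z + of_nat j) ^ Suc n) has_sum S) UNIV" using assms(2) by (auto simp: summable_on_def)
  have "S = (\<Sum>j. 1 / (z + of_nat j) ^ Suc n)" using has_sum_imp_sums[OF S] sums_unique by blast
  also have "\<dots> = Polygamma n z / fact n"
    unfolding Polygamma_def using n by (simp add: inverse_eq_divide del: power_Suc)
  finally show ?thesis using S by simp
qed

lemma int_sum_split:
  fixes f :: "int \<Rightarrow> complex"
  assumes "((\<lambda>j::nat. f (int j)) has_sum a) UNIV" "((\<lambda>j::nat. f (- 1 - int j)) has_sum b) UNIV"
  shows "(f has_sum (a + b)) UNIV"
proof -
  have "(f has_sum a) (range int)"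
    using assms(1) has_sum_reindex[of int UNIV f a] by (simp add: o_def)
  moreover have "(f has_sum b) (range (\<lambda>j. - 1 - int j))"
    using assms(2) has_sum_reindex[of "\<lambda>j. - 1 - int j" UNIV f b] by (simp add: o_def inj_on_def)
  ultimately have "(f has_sum (a + b)) (range int \<union> range (\<lambda>j. - 1 - int j))"
    by (rule has_sum_Un_disjoint) auto
  also have "range int \<union> range (\<lambda>j. - 1 - int j) = UNIV"
  proof -
    have "x \<in> range int \<union> range (\<lambda>j. - 1 - int j)" for x
    proof (cases "x \<ge> 0")
      case False
      then have "x = - 1 - int (nat (- 1 - x))" by simp
      then show ?thesis by blast
    qed (auto intro: image_eqI[of _ _ "nat x"])
    then show ?thesis by auto
  qed
  finally show ?thesis .
qed

text \<open>The terms with j >= 0 form a polygamma series at z and those with j < 0 one at 1 - z,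
  the exponent n + 1 being even; the reflection formula adds the two.\<close>

lemma Lipschitz_formula:
  assumes z: "z \<in> uhp" and n: "odd n" "n \<ge> 3"
  shows "((\<lambda>j::int. 1 / (z + of_int j) ^ Suc n) has_sum ((2 * of_real pi * \<i>) ^ Suc n / fact n * eval_fps (Lf n) (ee z))) UNIV"
proof -
  have "(\<lambda>(m, n'). 1 / (of_int m * z + of_int n') ^ Suc n) summable_on (Sigma {1} (\<lambda>_. UNIV))"
    by (rule summable_on_subset_banach[OF lattice_summable[OF z, of "Suc n"]]) (use n in auto)
  from summable_on_SigmaD1[OF this, of 1] have s: "(\<lambda>j::int. 1 / (z + of_int j) ^ Suc n) summable_on UNIV" by simp
  have 1: "(\<lambda>j::nat. 1 / (z + of_nat j) ^ Suc n) summable_on UNIV"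
    using summable_on_reindex[of int UNIV "\<lambda>j::int. 1 / (z + of_int j) ^ Suc n"] summable_on_subset_banach[OF s, of "range int"]
    by (simp add: o_def)
  have e: "1 / (z + of_int (- 1 - int j)) ^ Suc n = 1 / (1 - z + of_nat j) ^ Suc n" for j
  proof -
    have "(1 - z + of_nat j) ^ Suc n = (- (z + of_int (- 1 - int j))) ^ Suc n" by (simp add: algebra_simps)
    also have "\<dots> = (z + of_int (- 1 - int j)) ^ Suc n" using n by (intro power_minus_even) simp
    finally show ?thesis by (simp only:)
  qed
  have 2: "(\<lambda>j::nat. 1 / (1 - z + of_nat j) ^ Suc n) summable_on UNIV"
    using summable_on_reindex[of "\<lambda>j. - 1 - int j" UNIV "\<lambda>j::int. 1 / (z + of_int j) ^ Suc n"] summable_on_subset_banach[OF s, of "range (\<lambda>j. - 1 - int j)"]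
    unfolding o_def e by (simp add: inj_on_def del: power_Suc)
  have "((\<lambda>j::int. 1 / (z + of_int j) ^ Suc n) has_sum (Polygamma n z / fact n + Polygamma n (1 - z) / fact n)) UNIV"
    by (rule int_sum_split)
       (use Polygamma_nat_sum[OF n(1) 1] Polygamma_nat_sum[OF n(1) 2] in \<open>simp_all only: e of_int_of_nat_eq\<close>)
  moreover have "Polygamma n z + Polygamma n (1 - z) = (2 * of_real pi * \<i>) ^ Suc n * eval_fps (Lf n) (ee z)"
    using Polygamma_reflection_uhp[OF z, of n] n by (auto simp: algebra_simps elim!: oddE)
  ultimately show ?thesis by (simp add: add_divide_distrib[symmetric] del: power_Suc)
qed

section \<open>Eisenstein series and their expansions\<close>

text \<open>For odd n the value at 1 is n! times zeta(n + 1). By the recurrence and the reflection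
  formula, the sum of the values at 1 + z and 1 - z is an explicit function of e(z) minus its pole.
  Letting z = i t/(2 pi) tend to 0 leaves the limit of a real elementary function.\<close>

lemma Polygamma_1_limit:
  fixes h :: "real \<Rightarrow> real"
  assumes n: "odd n" "n \<ge> 3"
    and h: "\<And>t. t > 0 \<Longrightarrow> (2 * of_real pi * \<i>) ^ Suc n * eval_fps (Lf n) (of_real (exp (- t))) - fact n / (\<i> * of_real (t / (2 * pi))) ^ Suc n = of_real (h t)"
    and lim: "(h \<longlongrightarrow> l) (at_right 0)"
  shows "2 * Polygamma n (1::complex) = of_real l"
proof -
  define z where "z = (\<lambda>t. \<i> * of_real (t / (2 * pi)))"
  have z0: "(z \<longlongrightarrow> 0) (at_right 0)" unfolding z_def by (auto intro!: tendsto_eq_intros)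
  have one: "(1::complex) \<notin> \<int>\<^sub>\<le>\<^sub>0" by (auto elim!: nonpos_Ints_cases' simp: complex_eq_iff)
  have c: "isCont (\<lambda>w::complex. Polygamma n (1 + w) + Polygamma n (1 - w)) 0"
    using one by (intro continuous_intros) auto
  have "((\<lambda>t. Polygamma n (1 + z t) + Polygamma n (1 - z t)) \<longlongrightarrow> Polygamma n (1 + 0) + Polygamma n (1 - 0)) (at_right 0)"
    by (rule isCont_tendsto_compose[OF c z0])
  moreover have "\<forall>\<^sub>F t in at_right 0. Polygamma n (1 + z t) + Polygamma n (1 - z t) = of_real (h t)"
  proof -
    have "Polygamma n (1 + z t) + Polygamma n (1 - z t) = of_real (h t)" if t: "t > 0" for t
    proof -
      have zu: "z t \<in> uhp" using t by (simp add: z_def uhp_def)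
      have "Polygamma n (z t + 1) = Polygamma n (z t) + (-1) ^ n * fact n / (z t ^ Suc n)"
        by (rule Polygamma_plus1) (use uhp_nonzero[OF zu] in auto)
      then have a: "Polygamma n (1 + z t) = Polygamma n (z t) - fact n / (z t ^ Suc n)"
        using n(1) by (simp add: add.commute del: power_Suc)
      have b: "Polygamma n (z t) + Polygamma n (1 - z t) = (2 * of_real pi * \<i>) ^ Suc n * eval_fps (Lf n) (ee (z t))"
        using Polygamma_reflection_uhp[OF zu, of n] n by (auto simp: algebra_simps elim!: oddE)
      have e: "ee (z t) = of_real (exp (- t))" by (simp add: ee_def z_def mult_ac flip: exp_of_real)
      have "Polygamma n (1 + z t) + Polygamma n (1 - z t) = (Polygamma n (z t) + Polygamma n (1 - z t)) - fact n / (z t ^ Suc n)"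
        unfolding a by (simp only: diff_add_eq)
      then show ?thesis unfolding b e using h[OF t] by (simp only: z_def)
    qed
    then show ?thesis by (auto simp: eventually_at_filter)
  qed
  ultimately have "((\<lambda>t. of_real (h t)) \<longlongrightarrow> 2 * Polygamma n (1::complex)) (at_right 0)"
    by (auto elim!: Lim_transform_eventually)
  moreover have "((\<lambda>t. of_real (h t)) \<longlongrightarrow> (of_real l :: complex)) (at_right 0)" by (intro tendsto_intros lim)
  ultimately show ?thesis by (rule tendsto_unique[rotated]) simp
qed

lemma Polygamma_3_1: "Polygamma 3 (1::complex) = of_real pi ^ 4 / 15"
proof -
  define c where "c = (\<lambda>t::real. (exp (-t) + 4 * exp (-t)^2 + exp (-t)^3) / (1 - exp (-t))^4 - 6 / t ^ 4)"
  \<comment> \<open>The limit is zeta(-3): the constant term of the sum of d^3 exp(-d t) once the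
    pole 6/t^4 is removed.\<close>
  have "(c \<longlongrightarrow> 1/120) (at_right 0)" unfolding c_def by real_asymp
  then have lim: "((\<lambda>t. 16 * pi ^ 4 * c t) \<longlongrightarrow> 16 * pi ^ 4 * (1/120)) (at_right 0)" by (intro tendsto_intros)
  have "2 * Polygamma 3 (1::complex) = of_real (16 * pi ^ 4 * (1/120))"
  proof (rule Polygamma_1_limit[OF _ _ _ lim])
    have i: "\<i> ^ 4 = 1" "\<i> ^ 6 = -1" by (simp_all add: eval_nat_numeral)
    fix t :: real assume t: "t > 0"
    then have "norm (of_real (exp (- t)) :: complex) < 1" by simp
    note e = eval_Lf_3[OF this]
    have i4: "(2 * of_real pi * \<i>) ^ Suc 3 = of_real (16 * pi ^ 4)" "(\<i> * of_real (t / (2 * pi))) ^ Suc 3 = of_real (t ^ 4 / (16 * pi ^ 4))"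
      by (simp_all add: power_mult_distrib power_divide i)
    have "16 * pi ^ 4 * c t = 16 * pi ^ 4 * ((exp (-t) + 4 * exp (-t)^2 + exp (-t)^3) / (1 - exp (-t))^4) - 6 / (t ^ 4 / (16 * pi ^ 4))"
      unfolding c_def by (simp add: right_diff_distrib)
    then show "(2 * of_real pi * \<i>) ^ Suc 3 * eval_fps (Lf 3) (of_real (exp (- t))) - fact 3 / (\<i> * of_real (t / (2 * pi))) ^ Suc 3 = of_real (16 * pi ^ 4 * c t)"
      unfolding e i4 by (simp add: fact_numeral)
  qed auto
  then show ?thesis by (simp add: field_simps)
qed

lemma Polygamma_5_1: "Polygamma 5 (1::complex) = 8 * of_real pi ^ 6 / 63"
proof -
  define c where "c = (\<lambda>t::real. (exp (-t) + 26 * exp (-t)^2 + 66 * exp (-t)^3 + 26 * exp (-t)^4 + exp (-t)^5) / (1 - exp (-t))^6 - 120 / t ^ 6)"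
  \<comment> \<open>Likewise zeta(-5), after the pole 120/t^6.\<close>
  have "(c \<longlongrightarrow> -1/252) (at_right 0)" unfolding c_def by real_asymp
  then have lim: "((\<lambda>t. - 64 * pi ^ 6 * c t) \<longlongrightarrow> - 64 * pi ^ 6 * (-1/252)) (at_right 0)" by (intro tendsto_intros)
  have "2 * Polygamma 5 (1::complex) = of_real (- 64 * pi ^ 6 * (-1/252))"
  proof (rule Polygamma_1_limit[OF _ _ _ lim])
    have i: "\<i> ^ 4 = 1" "\<i> ^ 6 = -1" by (simp_all add: eval_nat_numeral)
    fix t :: real assume t: "t > 0"
    then have "norm (of_real (exp (- t)) :: complex) < 1" by simp
    note e = eval_Lf_5[OF this]
    have i6: "(2 * of_real pi * \<i>) ^ Suc 5 = of_real (- 64 * pi ^ 6)" "(\<i> * of_real (t / (2 * pi))) ^ Suc 5 = of_real (- (t ^ 6 / (64 * pi ^ 6)))"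
      by (simp_all add: power_mult_distrib power_divide i)
    have "- 64 * pi ^ 6 * c t = - 64 * pi ^ 6 * ((exp (-t) + 26 * exp (-t)^2 + 66 * exp (-t)^3 + 26 * exp (-t)^4 + exp (-t)^5) / (1 - exp (-t))^6) - 120 / (- (t ^ 6 / (64 * pi ^ 6)))"
      unfolding c_def by (simp add: right_diff_distrib)
    then show "(2 * of_real pi * \<i>) ^ Suc 5 * eval_fps (Lf 5) (of_real (exp (- t))) - fact 5 / (\<i> * of_real (t / (2 * pi))) ^ Suc 5 = of_real (- 64 * pi ^ 6 * c t)"
      unfolding e i6 by (simp add: fact_numeral)
  qed auto
  then show ?thesis by (simp add: field_simps)
qed

text \<open>The generating series of the divisor sums sigma_n. Its constant term is 0 because the
  sum over the infinite set of divisors of 0 has that default value.\<close>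

definition Sf :: "nat \<Rightarrow> complex fps" where
  "Sf n = Abs_fps (\<lambda>k. of_nat (\<Sum>d | d dvd k. d ^ n))"

lemma Lf_row_has_sum:
  assumes "norm y < 1" "n > 0"
  shows "((\<lambda>d. of_nat (Suc d) ^ n * y ^ Suc d) has_sum eval_fps (Lf n) y) UNIV"
proof (rule norm_summable_imp_has_sum)
  have s: "summable (\<lambda>d. norm (fps_nth (Lf n) d * y ^ d))"
    by (rule norm_summable_fps) (rule Lf_less_radius[OF assms(1)])
  then show "summable (\<lambda>d. norm (of_nat (Suc d) ^ n * y ^ Suc d))"
    by (subst (asm) summable_Suc_iff[symmetric]) (simp only: Lf_def fps_nth_Abs_fps)
  have "(\<lambda>d. fps_nth (Lf n) d * y ^ d) sums eval_fps (Lf n) y"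
    unfolding eval_fps_def by (rule summable_sums) (rule summable_norm_cancel[OF s])
  then show "(\<lambda>d. of_nat (Suc d) ^ n * y ^ Suc d) sums eval_fps (Lf n) y"
    using sums_Suc_iff[of "\<lambda>d. fps_nth (Lf n) d * y ^ d" "eval_fps (Lf n) y"] assms(2)
    by (simp add: Lf_def zero_power del: power_Suc of_nat_Suc)
qed

text \<open>Summed by rows, the double series of d^n q^(m d) over m, d >= 1 is the Lambert series;
  grouped by k = m d it becomes the series of divisor sums. Absolute summability comes from (m +
  1)(d + 1) >= m + d + 1.\<close>

lemma Lambert_has_sum:
  assumes q: "norm q < 1" and n: "n > 0"
  shows "((\<lambda>m. eval_fps (Lf n) (q ^ Suc m)) has_sum eval_fps (Sf n) q) UNIV"
    and "(\<lambda>k. fps_nth (Sf n) k * q ^ k) sums eval_fps (Sf n) q"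
proof -
  define f where "f = (\<lambda>(m, d). of_nat (Suc d) ^ n * (q ^ Suc m) ^ Suc d)"
  define r where "r = norm q"
  have r: "0 \<le> r" "r < 1" using q by (auto simp: r_def)
  obtain L where L: "((\<lambda>d. real (Suc d) ^ n * r ^ Suc d) has_sum L) UNIV"
  proof -
    have "summable (\<lambda>d. norm (fps_nth (Lf n) d * (of_real r) ^ d))"
      by (rule norm_summable_fps) (rule Lf_less_radius, use r in simp)
    then have "summable (\<lambda>d. real (Suc d) ^ n * r ^ Suc d)"
      by (subst (asm) summable_Suc_iff[symmetric]) (use r in \<open>simp add: Lf_def norm_mult norm_power del: power_Suc of_nat_Suc\<close>)
    then have "(\<lambda>d. real (Suc d) ^ n * r ^ Suc d) summable_on UNIV"
      using r by (intro summable_nonneg_imp_summable_on) auto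
    then show ?thesis using that by (auto simp: summable_on_def)
  qed
  have geo: "(\<lambda>m. r ^ m) summable_on UNIV"
    using r by (intro summable_nonneg_imp_summable_on) (auto intro: summable_geometric)
  have "(\<lambda>p. r ^ fst p * (real (Suc (snd p)) ^ n * r ^ Suc (snd p))) summable_on Sigma UNIV (\<lambda>_. UNIV)"
  proof (rule summable_on_SigmaI)
    show "((\<lambda>d. r ^ fst (m, d) * (real (Suc (snd (m, d))) ^ n * r ^ Suc (snd (m, d)))) has_sum (r ^ m * L)) UNIV" for m :: nat
      unfolding fst_conv snd_conv by (rule has_sum_cmult_right[OF L])
    show "(\<lambda>m. r ^ m * L) summable_on UNIV" by (rule summable_on_cmult_left[OF geo])
  qed (use r in auto)
  then have "(\<lambda>p. norm (r ^ fst p * (real (Suc (snd p)) ^ n * r ^ Suc (snd p)))) summable_on UNIV"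
    using r by simp
  then have "(\<lambda>p. norm (f p)) summable_on UNIV"
  proof (rule Infinite_Sum.abs_summable_on_comparison_test)
    fix p :: "nat \<times> nat"
    obtain m d where p: "p = (m, d)" by (cases p)
    have "norm (f p) = real (Suc d) ^ n * r ^ (Suc m * Suc d)"
      unfolding f_def p r_def by (simp only: prod.case norm_mult norm_power power_mult[symmetric] norm_of_nat)
    also have "r ^ (Suc m * Suc d) \<le> r ^ (m + Suc d)" using r by (intro power_decreasing) auto
    finally have "norm (f p) \<le> real (Suc d) ^ n * r ^ (m + Suc d)" by (simp add: mult_left_mono)
    also have "\<dots> = norm (r ^ fst p * (real (Suc (snd p)) ^ n * r ^ Suc (snd p)))"
      using r by (simp add: p power_add mult_ac abs_mult)
    finally show "norm (f p) \<le> norm (r ^ fst p * (real (Suc (snd p)) ^ n * r ^ Suc (snd p)))" .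
  qed
  then have "f summable_on UNIV" using summable_on_iff_abs_summable_on_complex by blast
  then obtain V where V: "(f has_sum V) UNIV" by (auto simp: summable_on_def)
  have qm: "norm (q ^ Suc m) < 1" for m
    unfolding norm_power using q power_less_one_iff by (metis norm_ge_zero zero_less_Suc power_less_one_iff)
  have lam: "((\<lambda>m. eval_fps (Lf n) (q ^ Suc m)) has_sum V) UNIV"
  proof (rule has_sum_SigmaD)
    show "(f has_sum V) (Sigma UNIV (\<lambda>_. UNIV))" using V by simp
    show "((\<lambda>d. f (m, d)) has_sum eval_fps (Lf n) (q ^ Suc m)) UNIV" for m
      unfolding f_def prod.case by (rule Lf_row_has_sum[OF qm n])
  qed
  define g where "g = (\<lambda>(k::nat, d::nat). of_nat d ^ n * q ^ k :: complex)"
  have "(g has_sum V) (Sigma {1..} (\<lambda>k. {d. d dvd k}))"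
  proof -
    have "(f has_sum V) UNIV \<longleftrightarrow> (g has_sum V) (Sigma {1..} (\<lambda>k. {d. d dvd k}))"
      by (rule has_sum_reindex_bij_witness[of _ "\<lambda>(k, d). (k div d - 1, d - 1)" "\<lambda>(m, d). (Suc m * Suc d, Suc d)"])
         (auto simp: f_def g_def elim!: dvdE simp flip: power_mult simp del: mult_Suc mult_Suc_right of_nat_Suc power_Suc)
    then show ?thesis using V by simp
  qed
  then have "((\<lambda>k. fps_nth (Sf n) k * q ^ k) has_sum V) {1..}"
  proof (rule has_sum_SigmaD)
    fix k :: nat assume k: "k \<in> {1..}"
    then have "finite {d. d dvd k}" by auto
    then have "((\<lambda>d. g (k, d)) has_sum (\<Sum>d | d dvd k. g (k, d))) {d. d dvd k}" by (rule has_sum_finite)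
    also have "(\<Sum>d | d dvd k. g (k, d)) = fps_nth (Sf n) k * q ^ k"
      by (simp add: g_def Sf_def sum_distrib_right)
    finally show "((\<lambda>d. g (k, d)) has_sum (fps_nth (Sf n) k * q ^ k)) {d. d dvd k}" .
  qed
  then have "((\<lambda>k. fps_nth (Sf n) k * q ^ k) has_sum (fps_nth (Sf n) 0 * q ^ 0 + V)) (insert 0 {1..})"
    by (intro has_sum_insert) auto
  moreover have "insert 0 {1..} = (UNIV :: nat set)" by auto
  moreover have "fps_nth (Sf n) 0 = 0" by (simp add: Sf_def)
  ultimately have "(\<lambda>k. fps_nth (Sf n) k * q ^ k) sums V" using has_sum_imp_sums by auto
  moreover from this have "eval_fps (Sf n) q = V" unfolding eval_fps_def using sums_unique by blast
  ultimately show "((\<lambda>m. eval_fps (Lf n) (q ^ Suc m)) has_sum eval_fps (Sf n) q) UNIV"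
    "(\<lambda>k. fps_nth (Sf n) k * q ^ k) sums eval_fps (Sf n) q"
    using lam by simp_all
qed

lemma Sf_conv_radius: "n > 0 \<Longrightarrow> fps_conv_radius (Sf n) \<ge> 1"
  unfolding fps_conv_radius_def
proof (rule conv_radius_geI_ex')
  fix r :: real assume "n > 0" "0 < r" "ereal r < 1"
  then show "summable (\<lambda>k. fps_nth (Sf n) k * of_real r ^ k)"
    using Lambert_has_sum(2)[of "of_real r" n] by (auto simp: sums_iff)
qed

text \<open>Sum over the lattice row by row. The row of m \<noteq> 0 is given by the Lipschitz
  formula at |m| \<tau>, rows m and -m agreeing since the weight is even; the row m = 0 is twice a
  zeta value. The rows together form a Lambert series.\<close>

lemma Eisenstein_expansion:
  assumes \<tau>: "\<tau> \<in> uhp" and n: "odd n" "n \<ge> 3"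
  shows "Eisenstein_G (Suc n) \<tau> = 2 * Polygamma n 1 / fact n
    + 2 * ((2 * of_real pi * \<i>) ^ Suc n / fact n) * eval_fps (Sf n) (ee \<tau>)"
proof -
  define R where "R = (2 * of_real pi * \<i>) ^ Suc n / fact n"
  define b0 where "b0 = 2 * Polygamma n (1::complex) / fact n"
  define b where "b = (\<lambda>m::int. if m = 0 then b0 else R * eval_fps (Lf n) (ee \<tau> ^ nat \<bar>m\<bar>))"
  \<comment> \<open>Only the row through the origin has a point removed.\<close>
  define B where "B = (\<lambda>m::int. if m = 0 then UNIV - {0::int} else UNIV)"
  have Sig: "UNIV - {(0::int, 0::int)} = Sigma UNIV B" by (auto simp: B_def split: if_splits)
  define f where "f = (\<lambda>(m, k). 1 / (of_int m * \<tau> + of_int k) ^ Suc n)"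
  have fs: "f summable_on Sigma UNIV B" unfolding f_def Sig[symmetric] by (rule lattice_summable[OF \<tau>]) (use n in auto)
  then have G: "(f has_sum Eisenstein_G (Suc n) \<tau>) (Sigma UNIV B)"
    unfolding Eisenstein_G_def Sig f_def by (rule has_sum_infsum)
  have pos: "((\<lambda>k. f (m, k)) has_sum (R * eval_fps (Lf n) (ee \<tau> ^ nat m))) UNIV" if "m > 0" for m
  proof -
    have "of_int m * \<tau> \<in> uhp" using \<tau> that by (simp add: uhp_def)
    from Lipschitz_formula[OF this n] have "((\<lambda>j::int. 1 / (of_int m * \<tau> + of_int j) ^ Suc n) has_sum (R * eval_fps (Lf n) (ee (of_int m * \<tau>)))) UNIV"
      by (simp add: R_def)
    moreover have "ee (of_int m * \<tau>) = ee \<tau> ^ nat m" using that by (simp add: ee_power)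
    ultimately show ?thesis by (simp add: f_def)
  qed
  have minus: "f (- m, - k) = f (m, k)" for m k
  proof -
    have "(of_int (- m) * \<tau> + of_int (- k)) ^ Suc n = (- (of_int m * \<tau> + of_int k)) ^ Suc n" by simp
    also have "\<dots> = (of_int m * \<tau> + of_int k) ^ Suc n" using n by (intro power_minus_even) simp
    finally show ?thesis by (simp only: f_def prod.case)
  qed
  have zero: "((\<lambda>k. f (0, k)) has_sum b0) (UNIV - {0})"
  proof -
    have s: "(\<lambda>k. f (0, k)) summable_on (UNIV - {0})"
      using summable_on_SigmaD1[of "\<lambda>m k. f (m, k)" UNIV B 0] fs by (simp add: B_def)
    have "(\<lambda>k. f (0, k)) summable_on (range (\<lambda>j. 1 + int j))"
      by (rule summable_on_subset_banach[OF s]) auto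
    then have "(\<lambda>j::nat. 1 / (1 + of_nat j) ^ Suc n :: complex) summable_on UNIV"
      by (subst (asm) summable_on_reindex) (auto simp: inj_on_def o_def f_def simp del: power_Suc)
    note P = Polygamma_nat_sum[OF n(1) this]
    have p1: "((\<lambda>k. f (0, k)) has_sum (Polygamma n 1 / fact n)) (range (\<lambda>j. 1 + int j))"
      using P by (subst has_sum_reindex) (auto simp: inj_on_def o_def f_def simp del: power_Suc)
    have m1: "((\<lambda>k. f (0, k)) has_sum (Polygamma n 1 / fact n)) (range (\<lambda>j. - (1 + int j)))"
      using P minus[of 0] by (subst has_sum_reindex) (auto simp: inj_on_def o_def f_def simp del: power_Suc minus_add_distrib of_int_minus)
    have "((\<lambda>k. f (0, k)) has_sum (Polygamma n 1 / fact n + Polygamma n 1 / fact n)) (range (\<lambda>j. 1 + int j) \<union> range (\<lambda>j. - (1 + int j)))"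
      by (rule has_sum_Un_disjoint[OF p1 m1]) auto
    also have "range (\<lambda>j. 1 + int j) \<union> range (\<lambda>j. - (1 + int j)) = UNIV - {0}"
    proof -
      have "x \<in> range (\<lambda>j. 1 + int j) \<union> range (\<lambda>j. - (1 + int j))" if "x \<noteq> 0" for x
      proof (cases "x > 0")
        case True then show ?thesis by (auto intro: image_eqI[of _ _ "nat (x - 1)"])
      next
        case False then have "x = - (1 + int (nat (- x - 1)))" using that by simp
        then show ?thesis by blast
      qed
      then show ?thesis by auto
    qed
    finally show ?thesis by (simp add: b0_def)
  qed
  have "(b has_sum Eisenstein_G (Suc n) \<tau>) UNIV"
  proof (rule has_sum_SigmaD[OF G])
    fix m :: int
    consider "m = 0" | "m > 0" | "m < 0" by linarith
    then show "((\<lambda>k. f (m, k)) has_sum b m) (B m)"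
    proof cases
      case 1 then show ?thesis using zero by (simp add: b_def B_def)
    next
      case 2 then show ?thesis using pos by (simp add: b_def B_def)
    next
      case 3
      have "((\<lambda>k. f (- m, k)) has_sum b m) UNIV" using 3 pos[of "- m"] by (simp add: b_def)
      then have "((\<lambda>k. f (m, k)) has_sum b m) UNIV"
        by (subst (asm) has_sum_reindex_bij_witness[of _ uminus uminus UNIV "\<lambda>k. f (m, k)" _ "b m"])
           (use minus[of "- m"] in auto)
      then show ?thesis using 3 by (simp add: B_def)
    qed
  qed
  moreover have "(b has_sum ((b0 + R * eval_fps (Sf n) (ee \<tau>)) + R * eval_fps (Sf n) (ee \<tau>))) UNIV"
  proof (rule int_sum_split)
    have L: "((\<lambda>m. R * eval_fps (Lf n) (ee \<tau> ^ Suc m)) has_sum (R * eval_fps (Sf n) (ee \<tau>))) UNIV"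
      by (rule has_sum_cmult_right[OF Lambert_has_sum(1)]) (use n norm_ee_less_1[OF \<tau>] in auto)
    have "nat \<bar>- 1 - int j\<bar> = Suc j" "- 1 - int j \<noteq> 0" for j by auto
    then show "((\<lambda>j. b (- 1 - int j)) has_sum (R * eval_fps (Sf n) (ee \<tau>))) UNIV"
      using L by (simp only: b_def if_False)
    have "((\<lambda>j. b (int j)) has_sum (R * eval_fps (Sf n) (ee \<tau>))) (range Suc)"
      using L by (subst has_sum_reindex) (auto simp: o_def b_def simp del: power_Suc of_nat_Suc)
    then have "((\<lambda>j. b (int j)) has_sum (b (int 0) + R * eval_fps (Sf n) (ee \<tau>))) (insert 0 (range Suc))"
      by (intro has_sum_insert) auto
    moreover have "insert 0 (range Suc) = UNIV" by (auto simp: image_iff) (metis not0_implies_Suc)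
    ultimately show "((\<lambda>j. b (int j)) has_sum (b0 + R * eval_fps (Sf n) (ee \<tau>))) UNIV" by (simp add: b_def)
  qed
  ultimately have "Eisenstein_G (Suc n) \<tau> = (b0 + R * eval_fps (Sf n) (ee \<tau>)) + R * eval_fps (Sf n) (ee \<tau>)"
    by (rule has_sum_unique)
  then show ?thesis by (simp add: b0_def R_def algebra_simps)
qed

definition E4fps :: "complex fps" where "E4fps = 1 + 240 * Sf 3"
definition E6fps :: "complex fps" where "E6fps = 1 - 504 * Sf 5"
definition E4 :: "complex \<Rightarrow> complex" where "E4 \<tau> = eval_fps E4fps (ee \<tau>)"
definition E6 :: "complex \<Rightarrow> complex" where "E6 \<tau> = eval_fps E6fps (ee \<tau>)"

lemma E46_conv_radius: "fps_conv_radius E4fps \<ge> 1" "fps_conv_radius E6fps \<ge> 1"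
proof -
  have 240: "(240 :: complex fps) = fps_const 240" and 504: "(504 :: complex fps) = fps_const 504"
    by (simp_all add: numeral_fps_const)
  show "fps_conv_radius E4fps \<ge> 1" unfolding E4fps_def 240
    by (intro fps_conv_radius_add_ge fps_conv_radius_mult_ge Sf_conv_radius) simp_all
  show "fps_conv_radius E6fps \<ge> 1" unfolding E6fps_def 504
    by (intro fps_conv_radius_diff_ge fps_conv_radius_mult_ge Sf_conv_radius) simp_all
qed

lemma eval_E46:
  assumes "norm x < 1"
  shows "eval_fps E4fps x = 1 + 240 * eval_fps (Sf 3) x" "eval_fps E6fps x = 1 - 504 * eval_fps (Sf 5) x"
proof -
  have 240: "(240 :: complex fps) = fps_const 240" and 504: "(504 :: complex fps) = fps_const 504"
    by (simp_all add: numeral_fps_const)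
  have less: "ereal (norm x) < fps_conv_radius F" if "fps_conv_radius F \<ge> 1" for F :: "complex fps"
    using assms that by (metis ereal_less(3) less_le_trans)
  have m: "fps_conv_radius (fps_const c * Sf k) \<ge> 1" if "k > 0" for c k
    using that by (intro fps_conv_radius_mult_ge Sf_conv_radius) simp_all
  show "eval_fps E4fps x = 1 + 240 * eval_fps (Sf 3) x"
    unfolding E4fps_def 240 using less[OF m[of 3]] less[OF Sf_conv_radius[of 3]]
    by (subst eval_fps_add; simp; subst eval_fps_mult; simp)
  show "eval_fps E6fps x = 1 - 504 * eval_fps (Sf 5) x"
    unfolding E6fps_def 504 using less[OF m[of 5]] less[OF Sf_conv_radius[of 5]]
    by (subst eval_fps_diff; simp; subst eval_fps_mult; simp)
qed

lemma Eisenstein_E4: "\<tau> \<in> uhp \<Longrightarrow> Eisenstein_G 4 \<tau> = of_real pi ^ 4 / 45 * E4 \<tau>"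
  using Eisenstein_expansion[of \<tau> 3] eval_E46(1)[OF norm_ee_less_1[of \<tau>]] unfolding E4_def
  by (simp add: Polygamma_3_1 fact_numeral power_mult_distrib field_simps)

lemma Eisenstein_E6: "\<tau> \<in> uhp \<Longrightarrow> Eisenstein_G 6 \<tau> = 2 * of_real pi ^ 6 / 945 * E6 \<tau>"
proof -
  assume \<tau>: "\<tau> \<in> uhp"
  have i: "\<i> ^ 6 = -1" by (simp add: eval_nat_numeral)
  show ?thesis using Eisenstein_expansion[OF \<tau>, of 5] unfolding E6_def eval_E46(2)[OF norm_ee_less_1[OF \<tau>]]
    by (simp add: Polygamma_5_1 fact_numeral power_mult_distrib field_simps i)
qed

lemma E4_S: "\<tau> \<in> uhp \<Longrightarrow> E4 (-1 / \<tau>) = \<tau> ^ 4 * E4 \<tau>"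
  using Eisenstein_S[of \<tau> 4] Eisenstein_E4[of \<tau>] Eisenstein_E4[OF uhp_S, of \<tau>] by simp

lemma E6_S: "\<tau> \<in> uhp \<Longrightarrow> E6 (-1 / \<tau>) = \<tau> ^ 6 * E6 \<tau>"
  using Eisenstein_S[of \<tau> 6] Eisenstein_E6[of \<tau>] Eisenstein_E6[OF uhp_S, of \<tau>] by simp

lemma E46_T: "E4 (\<tau> + 1) = E4 \<tau>" "E6 (\<tau> + 1) = E6 \<tau>"
  by (simp_all add: E4_def E6_def ee_add)

lemma E46_holomorphic: "E4 holomorphic_on uhp" "E6 holomorphic_on uhp"
proof -
  have sub: "ball 0 1 \<subseteq> eball 0 (fps_conv_radius F)" if "fps_conv_radius F \<ge> 1" for F :: "complex fps"
    using that by (auto simp: in_eball_iff dist_norm) (metis ereal_less(3) less_le_trans)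
  have "(eval_fps E4fps \<circ> ee) holomorphic_on uhp" "(eval_fps E6fps \<circ> ee) holomorphic_on uhp"
    by (rule holomorphic_on_compose_gen[of _ _ _ "ball 0 1"];
        auto intro!: holomorphic_intros holomorphic_on_eval_fps sub E46_conv_radius norm_ee_less_1 ee_holomorphic[of "\<lambda>x. x", simplified])+
  then show "E4 holomorphic_on uhp" "E6 holomorphic_on uhp" by (simp_all add: E4_def[abs_def] E6_def[abs_def] o_def)
qed

section \<open>Invariant functions\<close>

lemma at_i_inf_neq_bot: "at_i_inf \<noteq> bot"
  using filtermap_qx[of 1] by (metis filtermap_bot trivial_limit_at zero_less_one)

lemma ST_invariant:
  fixes f :: "complex \<Rightarrow> 'b"
  assumes S: "\<And>\<tau>. \<tau> \<in> uhp \<Longrightarrow> f (-1 / \<tau>) = f \<tau>" and T: "\<And>\<tau>. \<tau> \<in> uhp \<Longrightarrow> f (\<tau> + 1) = f \<tau>"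
    and A: "A \<in> SL2Z" and \<tau>: "\<tau> \<in> uhp"
  shows "f (mob A \<tau>) = f \<tau>"
proof -
  have n: "f (\<tau> + of_nat k) = f \<tau>" if "\<tau> \<in> uhp" for \<tau> k
  proof (induction k)
    case (Suc k)
    have "\<tau> + of_nat k \<in> uhp" using that by (simp add: uhp_def)
    from T[OF this] show ?case using Suc by (simp add: add_ac)
  qed simp
  have z: "f (\<tau> + of_int k) = f \<tau>" if "\<tau> \<in> uhp" for \<tau> k
  proof (cases k rule: int_cases2)
    case (nonpos m)
    have "\<tau> - of_nat m \<in> uhp" using that by (simp add: uhp_def)
    from n[OF this, of m] show ?thesis using nonpos by simp
  qed (simp add: n that)
  show ?thesis using A \<tau>
  proof (induction A arbitrary: \<tau> rule: SL2Z_induct)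
    case (S A)
    then show ?case using mob_mult[OF Smat_SL2Z S.prems] assms(1)[OF S.prems] uhp_S[OF S.prems] by (simp add: mob_Smat)
  next
    case (T A k)
    have "\<tau> + of_int k \<in> uhp" using T.prems by (simp add: uhp_def)
    then show ?case using T mob_mult[OF Tmat_SL2Z T.prems] z by (simp add: mob_Tmat)
  qed simp
qed

lemma compact_fund_region_strip: "compact (fund_region \<inter> {\<tau>. Im \<tau> \<le> Y})"
proof -
  have "closed (fund_region \<inter> {\<tau>. Im \<tau> \<le> Y})"
    unfolding fund_region_def by (intro closed_Int closed_Collect_conj closed_Collect_le continuous_intros)
  moreover have "bounded (fund_region \<inter> {\<tau>. Im \<tau> \<le> Y})"
  proof (rule boundedI)
    fix \<tau> assume *: "\<tau> \<in> fund_region \<inter> {\<tau>. Im \<tau> \<le> Y}"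
    have "0 \<le> sqrt 3 / 2" by simp
    with * have "0 \<le> Im \<tau>" unfolding fund_region_def by (smt (verit) IntD1 mem_Collect_eq)
    with * show "norm \<tau> \<le> 1/2 + \<bar>Y\<bar>" using cmod_le[of \<tau>] by (auto simp: fund_region_def)
  qed
  ultimately show ?thesis using compact_eq_bounded_closed by blast
qed

text \<open>If f took a nonzero value w, then all values of modulus at least |w| would be attained
  in a compact part of the half-strip, because f is small high up. So |f| has a maximum, f is
  constant, and the limit 0 gives a contradiction.\<close>

lemma invariant_vanishing:
  assumes hol: "f holomorphic_on uhp" and inv: "\<And>A \<tau>. A \<in> SL2Z \<Longrightarrow> \<tau> \<in> uhp \<Longrightarrow> f (mob A \<tau>) = f \<tau>"
    and lim: "(f \<longlongrightarrow> 0) at_i_inf" and \<tau>: "\<tau> \<in> uhp"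
  shows "f \<tau> = 0"
proof (rule ccontr)
  assume nz: "f \<tau> \<noteq> 0"
  then have "\<forall>\<^sub>F t in at_i_inf. norm (f t) < norm (f \<tau>)"
    using tendstoD[OF lim, of "norm (f \<tau>)"] by (auto elim: eventually_mono)
  then obtain Y where Y: "\<And>t. Im t \<ge> Y \<Longrightarrow> norm (f t) < norm (f \<tau>)" unfolding eventually_at_i_inf by blast
  define K where "K = fund_region \<inter> {\<tau>. Im \<tau> \<le> Y}"
  have K: "compact K" "K \<subseteq> uhp" using compact_fund_region_strip fund_region_subset by (auto simp: K_def)
  have red: "\<exists>t'\<in>K. f t' = f t" if "t \<in> uhp" "norm (f \<tau>) \<le> norm (f t)" for t
  proof -
    obtain A where A: "A \<in> SL2Z" "mob A t \<in> fund_region" using ex_fund_region[OF \<open>t \<in> uhp\<close>] by blast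
    have e: "f (mob A t) = f t" using inv A that by blast
    moreover have "Im (mob A t) < Y" using Y[of "mob A t"] that e by force
    ultimately show ?thesis using A by (intro bexI[of _ "mob A t"]) (auto simp: K_def)
  qed
  have "K \<noteq> {}" using red[OF \<tau>] by auto
  moreover have "continuous_on K (\<lambda>t. norm (f t))"
    by (intro continuous_intros holomorphic_on_imp_continuous_on holomorphic_on_subset[OF hol] K)
  ultimately obtain t0 where t0: "t0 \<in> K" "\<And>t. t \<in> K \<Longrightarrow> norm (f t) \<le> norm (f t0)"
    using continuous_attains_sup[OF K(1)] by metis
  have max: "norm (f t) \<le> norm (f t0)" if "t \<in> uhp" for t
  proof (cases "norm (f \<tau>) \<le> norm (f t)")
    case True then show ?thesis using red[OF that True] t0(2) by metis
  next
    case False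
    obtain t' where "t' \<in> K" "f t' = f \<tau>" using red[OF \<tau>] by auto
    then show ?thesis using t0(2)[of t'] False by simp
  qed
  have "f constant_on uhp"
    by (rule maximum_modulus_principle[OF hol open_uhp connected_uhp open_uhp _ _ max]) (use t0 K in auto)
  then obtain c where c: "\<And>t. t \<in> uhp \<Longrightarrow> f t = c" by (auto simp: constant_on_def)
  then have "\<forall>\<^sub>F t in at_i_inf. f t = c" using eventually_in_uhp by (auto elim: eventually_mono)
  then have "(f \<longlongrightarrow> c) at_i_inf" by (rule tendsto_eventually)
  then have "c = 0" using lim tendsto_unique at_i_inf_neq_bot by blast
  then show False using c[OF \<tau>] nz by simp
qed

section \<open>The modular invariant\<close>

definition etaP :: "complex \<Rightarrow> complex" where "etaP x = Pf 1 Suc x ^ 24"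

lemma etaP_facts:
  shows "etaP holomorphic_on ball 0 1" "norm x < 1 \<Longrightarrow> etaP x \<noteq> 0" "etaP has_fps_expansion Pfps 1 Suc ^ 24"
  unfolding etaP_def
  by (auto intro!: holomorphic_intros Pf_holomorphic fps_expansion_intros Pf_has_fps_expansion simp: Pf_nonzero)

lemma eta24_etaP: "eta24 \<tau> = ee \<tau> * etaP (ee \<tau>)"
proof -
  have "PP x x = Pf 1 Suc x" for x using PP_eq_Pf[of x 1 1 1] by simp
  then show ?thesis by (simp add: eta24_eq etaP_def)
qed

lemma ee_holomorphic': "ee holomorphic_on A"
  using ee_holomorphic[of "\<lambda>x. x" A] by simp

lemma compose_ee_holomorphic: "g holomorphic_on ball 0 1 \<Longrightarrow> (\<lambda>\<tau>. g (ee \<tau>)) holomorphic_on uhp"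
  using holomorphic_on_compose_gen[OF ee_holomorphic', of g "ball 0 1" uhp] by (auto simp: o_def norm_ee_less_1 image_subset_iff)

lemma eta24_holomorphic: "eta24 holomorphic_on uhp"
  unfolding eta24_etaP[abs_def] by (intro holomorphic_intros compose_ee_holomorphic etaP_facts ee_holomorphic')

lemma tendsto_ee_0: "filterlim ee (at 0) at_i_inf"
  using filtermap_qx[of 1] by (simp add: filterlim_def)

text \<open>As eta^24 has no zeros, the quotient is holomorphic of weight 0. It tends to 1728 at
  infinity, because the numerator starts with (3 * 240 + 2 * 504) q and the denominator with q; so
  it differs from 1728 by an invariant function vanishing at infinity.\<close>

lemma E4_E6_eta24:
  assumes "\<tau> \<in> uhp"
  shows "E4 \<tau> ^ 3 - E6 \<tau> ^ 2 = 1728 * eta24 \<tau>"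
proof -
  define f where "f = (\<lambda>\<tau>. (E4 \<tau> ^ 3 - E6 \<tau> ^ 2) / eta24 \<tau> - 1728)"
  have "f holomorphic_on uhp" unfolding f_def
    by (intro holomorphic_intros E46_holomorphic eta24_holomorphic) (auto simp: eta24_nonzero)
  moreover have "f (mob A \<tau>) = f \<tau>" if "A \<in> SL2Z" "\<tau> \<in> uhp" for A \<tau>
  proof (rule ST_invariant[OF _ _ that])
    fix \<tau> assume \<tau>: "\<tau> \<in> uhp"
    show "f (\<tau> + 1) = f \<tau>" by (simp add: f_def E46_T eta24_T)
    have "E4 (-1 / \<tau>) ^ 3 - E6 (-1 / \<tau>) ^ 2 = \<tau> ^ 12 * (E4 \<tau> ^ 3 - E6 \<tau> ^ 2)"
      unfolding E4_S[OF \<tau>] E6_S[OF \<tau>] by (simp add: power_mult_distrib algebra_simps flip: power_mult)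
    then show "f (-1 / \<tau>) = f \<tau>" using uhp_nonzero[OF \<tau>] unfolding f_def eta24_S[OF \<tau>] by simp
  qed
  moreover have "(f \<longlongrightarrow> 0) at_i_inf"
  proof -
    define g where "g = eval_fps (E4fps ^ 3 - E6fps ^ 2)"
    have r: "fps_conv_radius (E4fps ^ 3 - E6fps ^ 2) \<ge> 1"
      using E46_conv_radius by (intro fps_conv_radius_diff_ge order_trans[OF _ fps_conv_radius_power])
    have less: "ereal (norm x) < fps_conv_radius F" if "norm x < 1" "fps_conv_radius F \<ge> 1" for F :: "complex fps" and x :: complex
      using that by (metis ereal_less(3) less_le_trans)
    have g: "g x = eval_fps E4fps x ^ 3 - eval_fps E6fps x ^ 2" if "norm x < 1" for x
      unfolding g_def using E46_conv_radius less[OF that]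
      by (subst eval_fps_diff) (auto simp: eval_fps_power intro: order_trans[OF _ fps_conv_radius_power])
    have n: "fps_nth E4fps 0 = 1" "fps_nth E4fps 1 = 240" "fps_nth E6fps 0 = 1" "fps_nth E6fps 1 = - 504"
      by (simp_all add: E4fps_def E6fps_def Sf_def numeral_fps_const)
    have c: "fps_nth (E4fps ^ 3 - E6fps ^ 2) 0 = 0" "fps_nth (E4fps ^ 3 - E6fps ^ 2) 1 = 1728"
      using n by (simp_all add: power3_eq_cube power2_eq_square fps_mult_nth)
    have "(g has_field_derivative eval_fps (fps_deriv (E4fps ^ 3 - E6fps ^ 2)) 0) (at 0)"
      unfolding g_def by (rule has_field_derivative_eval_fps) (rule less[OF _ r], simp)
    then have "(g has_field_derivative 1728) (at 0)" using c(2) by (simp add: eval_fps_at_0)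
    moreover have "g 0 = 0" using c(1) by (simp add: g_def eval_fps_at_0)
    ultimately have "((\<lambda>x. g x / x) \<longlongrightarrow> 1728) (at 0)" by (simp add: has_field_derivative_iff)
    moreover have "(etaP \<longlongrightarrow> etaP 0) (at 0)"
      using holomorphic_on_imp_continuous_on[OF etaP_facts(1)] continuous_on_interior[of "ball 0 1" etaP 0] isContD by (simp add: isCont_def)
    moreover have e0: "etaP 0 = 1" unfolding etaP_def Pf_def by simp
    ultimately have "((\<lambda>x. g x / x / etaP x - 1728) \<longlongrightarrow> 1728 / 1 - 1728) (at 0)"
      by (intro tendsto_intros) auto
    then have "((\<lambda>x. g x / x / etaP x - 1728) \<longlongrightarrow> 0) (at 0)" by simp
    from filterlim_compose[OF this tendsto_ee_0]
    have "((\<lambda>\<tau>. g (ee \<tau>) / ee \<tau> / etaP (ee \<tau>) - 1728) \<longlongrightarrow> 0) at_i_inf" .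
    then show ?thesis
      by (rule Lim_transform_eventually)
         (use eventually_in_uhp in eventually_elim, simp add: f_def g norm_ee_less_1 E4_def E6_def eta24_etaP)
  qed
  ultimately have "f \<tau> = 0" using assms by (rule invariant_vanishing)
  then show ?thesis using eta24_nonzero[OF assms] by (simp add: f_def field_simps)
qed

text \<open>The powers of pi cancel, and so does 1728. What is left is a quotient of series with
  integer coefficients, which is the source of the integrality of the expansion of j.\<close>

lemma j_inv_eq:
  assumes "\<tau> \<in> uhp"
  shows "j_inv \<tau> = E4 \<tau> ^ 3 / eta24 \<tau>"
proof -
  define p where "p = (of_real pi :: complex)"
  have p: "p \<noteq> 0" by (simp add: p_def)
  have g2: "60 * Eisenstein_G 4 \<tau> = 4 / 3 * p ^ 4 * E4 \<tau>" and g3: "140 * Eisenstein_G 6 \<tau> = 8 / 27 * p ^ 6 * E6 \<tau>"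
    by (simp_all add: Eisenstein_E4 Eisenstein_E6 assms p_def)
  have "(4 / 3 * p ^ 4 * E4 \<tau>) ^ 3 - 27 * (8 / 27 * p ^ 6 * E6 \<tau>) ^ 2 = 64 / 27 * p ^ 12 * (E4 \<tau> ^ 3 - E6 \<tau> ^ 2)"
    by (simp add: power_mult_distrib power_divide field_simps flip: power_mult)
  then have "j_inv \<tau> = 1728 * (64 / 27 * p ^ 12 * E4 \<tau> ^ 3) / (64 / 27 * p ^ 12 * (1728 * eta24 \<tau>))"
    unfolding j_inv_def Let_def g2 g3 E4_E6_eta24[OF assms]
    by (simp add: power_mult_distrib power_divide field_simps flip: power_mult)
  then show ?thesis using p by simp
qed

lemma j_invariant:
  assumes "A \<in> SL2Z" "\<tau> \<in> uhp"
  shows "j_inv (mob A \<tau>) = j_inv \<tau>"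
proof (rule ST_invariant[OF _ _ assms])
  fix \<tau> assume \<tau>: "\<tau> \<in> uhp"
  have \<tau>': "\<tau> + 1 \<in> uhp" using \<tau> by (simp add: uhp_def)
  show "j_inv (\<tau> + 1) = j_inv \<tau>" by (simp add: j_inv_eq \<tau> \<tau>' E46_T eta24_T)
  show "j_inv (-1 / \<tau>) = j_inv \<tau>"
    using uhp_nonzero[OF \<tau>] unfolding j_inv_eq[OF \<tau>] j_inv_eq[OF uhp_S[OF \<tau>]] E4_S[OF \<tau>] eta24_S[OF \<tau>]
    by (simp add: power_mult_distrib flip: power_mult)
qed

lemma j_holomorphic: "j_inv holomorphic_on uhp"
proof -
  have "(\<lambda>\<tau>. E4 \<tau> ^ 3 / eta24 \<tau>) holomorphic_on uhp"
    by (intro holomorphic_intros E46_holomorphic eta24_holomorphic) (simp add: eta24_nonzero)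
  then show ?thesis by (rule holomorphic_transform) (simp add: j_inv_eq)
qed

text \<open>The expansion of q j in powers of q; in \<open>jfls\<close> it is rewritten in x =
  q^(1/N) and divided by q.\<close>

definition Jfps :: "complex fps" where
  "Jfps = E4fps ^ 3 * inverse (Pfps 1 Suc ^ 24)"

definition jfls :: "nat \<Rightarrow> complex fls" where
  "jfls N = fls_X_intpow (- int N) * fps_to_fls (fps_compose Jfps (fps_X ^ N))"

lemma Jfps_expansion: "(\<lambda>x. eval_fps E4fps x ^ 3 * inverse (etaP x)) has_fps_expansion Jfps"
  unfolding Jfps_def
proof (intro fps_expansion_intros etaP_facts)
  show "eval_fps E4fps has_fps_expansion E4fps"
    using E46_conv_radius(1) by (intro eval_fps_has_fps_expansion) (auto intro: less_le_trans[of _ 1])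
  show "fps_nth (Pfps 1 Suc ^ 24) 0 \<noteq> 0" by (simp add: fps_nth_power_0 Pfps_nth_0)
qed

lemma Jfps_int: "fps_nth Jfps n \<in> \<int>" and Jfps_0: "fps_nth Jfps 0 = 1"
proof -
  note e = ring_emb_id[OF subring_Ints]
  have E: "fps_rel \<int> (\<lambda>x. x) E4fps E4fps"
    unfolding fps_rel_def E4fps_def by (auto simp: Sf_def numeral_fps_const intro!: Ints_add Ints_mult)
  have P: "fps_rel \<int> (\<lambda>x. x) (Pfps 1 Suc ^ 24) (Pfps 1 Suc ^ 24)"
    using fps_rel_power[OF e fps_rel_Pfps[OF e, of 1 Suc], of 24] by simp
  have P0: "fps_nth (Pfps 1 Suc ^ 24) 0 = 1" by (simp add: fps_nth_power_0 Pfps_nth_0)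
  have I: "fps_rel \<int> (\<lambda>x. x) (inverse (Pfps 1 Suc ^ 24)) (inverse (Pfps 1 Suc ^ 24))"
    using fps_inverse_in[OF subring_Ints _ P0] P by (auto simp: fps_rel_def)
  show "fps_nth Jfps n \<in> \<int>"
    using fps_rel_mult[OF e fps_rel_power[OF e E, of 3] I] by (auto simp: fps_rel_def Jfps_def)
  show "fps_nth Jfps 0 = 1"
    unfolding Jfps_def by (simp add: fps_nth_power_0 Pfps_nth_0 E4fps_def Sf_def)
qed

lemma j_qexp:
  assumes N: "N > 0"
  shows "has_q_expansion N j_inv (jfls N)"
proof (rule qexpI[OF N])
  define u where "u = (\<lambda>x. eval_fps E4fps x ^ 3 * inverse (etaP x))"
  have "(u \<circ> (\<lambda>x. x ^ N)) has_fps_expansion fps_compose Jfps (fps_X ^ N)"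
    unfolding u_def by (rule has_fps_expansion_compose[OF Jfps_expansion]) (use N in \<open>auto intro!: fps_expansion_intros\<close>)
  then show "(\<lambda>x. x powi (- int N) * u (x ^ N)) has_laurent_expansion jfls N"
    unfolding jfls_def o_def by (intro laurent_expansion_intros has_laurent_expansion_fps)
  show "\<forall>\<^sub>F \<tau> in at_i_inf. j_inv \<tau> = ee (\<tau> / of_nat N) powi (- int N) * u (ee (\<tau> / of_nat N) ^ N)"
    using eventually_in_uhp
  proof eventually_elim
    case (elim \<tau>)
    have "ee (\<tau> / of_nat N) ^ N = ee \<tau>" using N by (simp add: ee_power)
    then show ?case using elim
      by (simp add: j_inv_eq eta24_etaP u_def E4_def power_int_minus field_simps)
  qed
qed

lemma fls_X_intpow_mult_nth: "fls_nth (fls_X_intpow k * F) n = fls_nth (F :: complex fls) (n - k)"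
  by (simp add: fls_X_intpow_times_conv_shift)

lemma jfls_coeffs:
  assumes N: "N > 0"
  shows "fls_nth (jfls N) n \<in> \<int>" "n < - int N \<Longrightarrow> fls_nth (jfls N) n = 0" "fls_nth (jfls N) (- int N) = 1"
proof -
  have "fps_nth (fps_compose Jfps (fps_X ^ N)) k \<in> \<int>" for k
    unfolding fps_compose_nth
    by (intro subring_sum subring_mult subring_Ints Jfps_int) (simp add: fps_X_power_nth flip: power_mult)
  then show "fls_nth (jfls N) n \<in> \<int>" unfolding jfls_def fls_X_intpow_mult_nth by simp
  show "n < - int N \<Longrightarrow> fls_nth (jfls N) n = 0" unfolding jfls_def fls_X_intpow_mult_nth by simp
  show "fls_nth (jfls N) (- int N) = 1" unfolding jfls_def fls_X_intpow_mult_nth by (simp add: fps_compose_nth Jfps_0)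
qed

text \<open>Translation by 1 multiplies x = q^(1/N) by zeta_N. After multiplication by x^k the
  leading coefficient becomes a nonzero limit at infinity, which must therefore be fixed under
  multiplication by zeta_N^k.\<close>

lemma invariant_pole_order:
  assumes N: "N > 0" and T: "\<And>\<tau>. \<tau> \<in> uhp \<Longrightarrow> f (\<tau> + 1) = f \<tau>"
    and F: "has_q_expansion N f F" and low: "\<And>m. m < - int k \<Longrightarrow> fls_nth F m = 0" and c: "fls_nth F (- int k) \<noteq> 0"
  shows "N dvd k"
proof -
  define c where "c = fls_nth F (- int k)"
  define g where "g = (\<lambda>\<tau>. ee (\<tau> / of_nat N) powi int k * f \<tau>)"
  have "has_q_expansion N g (fls_X_intpow (int k) * F)"
    unfolding g_def by (rule qexp_mult[OF N qexp_powi[OF N] F])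
  from qexp_tendsto[OF N this] low have lim: "(g \<longlongrightarrow> c) at_i_inf"
    by (simp add: fls_X_intpow_mult_nth c_def)
  have "filterlim (\<lambda>\<tau>. \<tau> + 1) at_i_inf at_i_inf"
    unfolding filterlim_iff eventually_at_i_inf by (metis Im_complex_of_real add.right_neutral of_real_1 plus_complex.sel(2))
  from filterlim_compose[OF lim this] have "((\<lambda>\<tau>. g (\<tau> + 1)) \<longlongrightarrow> c) at_i_inf" .
  moreover have "\<forall>\<^sub>F \<tau> in at_i_inf. g (\<tau> + 1) = zeta N powi int k * g \<tau>"
    using eventually_in_uhp
  proof eventually_elim
    case (elim \<tau>)
    have "ee ((\<tau> + 1) / of_nat N) = zeta N * ee (\<tau> / of_nat N)" by (simp add: add_divide_distrib ee_add zeta_ee)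
    then show ?case using T[OF elim] by (simp add: g_def power_mult_distrib mult_ac)
  qed
  ultimately have "((\<lambda>\<tau>. zeta N powi int k * g \<tau>) \<longlongrightarrow> c) at_i_inf" by (rule Lim_transform_eventually)
  moreover have "((\<lambda>\<tau>. zeta N powi int k * g \<tau>) \<longlongrightarrow> zeta N powi int k * c) at_i_inf" by (intro tendsto_intros lim)
  ultimately have "zeta N powi int k * c = c" using tendsto_unique at_i_inf_neq_bot by blast
  then have "zeta N powi int k = 1" using c by (simp add: c_def)
  then show ?thesis using zeta_powi_eq_1_iff[OF N, of "int k"] by simp
qed

text \<open>The q-expansion principle. Subtracting c j^l, with c the leading coefficient and l =
  k/N, lowers the pole; since j has integer coefficients and leading coefficient 1, all coefficients
  stay in R. The induction ends when the constant term vanishes too and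
  \<open>invariant_vanishing\<close> applies.\<close>

lemma invariant_poly_j:
  assumes N: "N > 0" and R: "is_subring R"
    and hol: "f holomorphic_on uhp" and inv: "\<And>A \<tau>. A \<in> SL2Z \<Longrightarrow> \<tau> \<in> uhp \<Longrightarrow> f (mob A \<tau>) = f \<tau>"
    and F: "has_q_expansion N f F" "\<And>n. fls_nth F n \<in> R"
  obtains p where "\<And>i. coeff p i \<in> R" "\<And>\<tau>. \<tau> \<in> uhp \<Longrightarrow> f \<tau> = poly p (j_inv \<tau>)"
proof -
  have "\<exists>p. (\<forall>i. coeff p i \<in> R) \<and> (\<forall>\<tau>\<in>uhp. f \<tau> = poly p (j_inv \<tau>))"
    if "f holomorphic_on uhp" "\<And>A \<tau>. A \<in> SL2Z \<Longrightarrow> \<tau> \<in> uhp \<Longrightarrow> f (mob A \<tau>) = f \<tau>"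
       "has_q_expansion N f F" "\<And>n. fls_nth F n \<in> R" "\<And>m. m \<le> - int k \<Longrightarrow> fls_nth F m = 0" for f F k
    using that
  proof (induction k arbitrary: f F)
    case 0
    have "(f \<longlongrightarrow> 0) at_i_inf"
      using qexp_tendsto[OF N 0(3)] 0(5) by simp
    then have "f \<tau> = 0" if "\<tau> \<in> uhp" for \<tau> using invariant_vanishing[OF 0(1,2)] that by blast
    then show ?case using subring_0[OF R] by (intro exI[of _ 0]) auto
  next
    case (Suc k)
    show ?case
    proof (cases "fls_nth F (- int k) = 0")
      case True
      show ?thesis
      proof (rule Suc.IH[OF Suc.prems(1-4)])
        fix m assume "m \<le> - int k"
        then show "fls_nth F m = 0" using True Suc.prems(5)[of m] by (cases "m = - int k") auto
      qed
    next
      case False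
      define c where "c = fls_nth F (- int k)"
      have T: "f (\<tau> + 1) = f \<tau>" if "\<tau> \<in> uhp" for \<tau>
        using Suc.prems(2)[OF Tmat_SL2Z that, of 1] by (simp add: mob_Tmat)
      have low: "fls_nth F m = 0" if "m < - int k" for m using Suc.prems(5)[of m] that by simp
      have "N dvd k" by (rule invariant_pole_order[OF N T Suc.prems(3) low False])
      then obtain l where l: "k = N * l" by blast
      define g where "g = (\<lambda>\<tau>. f \<tau> - c * j_inv \<tau> ^ l)"
      define G where "G = F + - (fls_const c * jfls N ^ l)"
      have qG: "has_q_expansion N g G"
        using qexp_add[OF N Suc.prems(3) qexp_uminus[OF N qexp_mult[OF N qexp_const[OF N] qexp_power[OF N j_qexp[OF N], of l]]], of c]
        by (simp add: g_def G_def)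
      have jl: "fls_nth (jfls N ^ l) m \<in> R \<and> (m < - int (N * l) \<longrightarrow> fls_nth (jfls N ^ l) m = 0) \<and> fls_nth (jfls N ^ l) (- int (N * l)) = 1" for m
      proof -
        have J: "jfls N = fls_X_intpow (- int N) * fps_to_fls (fps_compose Jfps (fps_X ^ N))" by (rule jfls_def)
        have "jfls N ^ l = fls_X_intpow (- int (N * l)) * fps_to_fls (fps_compose Jfps (fps_X ^ N) ^ l)"
          unfolding J power_mult_distrib fls_X_intpow_power by (simp add: fps_to_fls_power mult_ac)
        then have n: "fls_nth (jfls N ^ l) m = (if m + int (N * l) < 0 then 0 else fps_nth (fps_compose Jfps (fps_X ^ N) ^ l) (nat (m + int (N * l))))" for m
          unfolding \<open>jfls N ^ l = _\<close> fls_X_intpow_mult_nth by simp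
        have "fls_rel \<int> (\<lambda>x. x) (jfls N ^ l) (jfls N ^ l)"
          by (intro fls_rel_power ring_emb_id subring_Ints) (use jfls_coeffs(1)[OF N] in \<open>simp add: fls_rel_id_iff\<close>)
        then have "fls_nth (jfls N ^ l) m \<in> R" using Ints_subset_subring[OF R] by (auto simp: fls_rel_id_iff)
        then show ?thesis using n[of m] n[of "- int (N * l)"]
          by (simp add: fps_nth_power_0 fps_compose_nth Jfps_0)
      qed
      have cR: "c \<in> R" by (simp add: c_def Suc.prems(4))
      have "\<exists>p. (\<forall>i. coeff p i \<in> R) \<and> (\<forall>\<tau>\<in>uhp. g \<tau> = poly p (j_inv \<tau>))"
      proof (rule Suc.IH[OF _ _ qG])
        show "g holomorphic_on uhp" unfolding g_def by (intro holomorphic_intros Suc.prems j_holomorphic)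
        show "g (mob A \<tau>) = g \<tau>" if "A \<in> SL2Z" "\<tau> \<in> uhp" for A \<tau>
          using Suc.prems(2)[OF that] j_invariant[OF that] by (simp add: g_def)
        show "fls_nth G m \<in> R" for m
          unfolding G_def using subring_diff[OF R Suc.prems(4) subring_mult[OF R cR conjunct1[OF jl]]] by simp
        show "fls_nth G m = 0" if "m \<le> - int k" for m
          using that jl[of m] jl[of 0] low[of m] by (cases "m = - int k") (auto simp: G_def c_def l)
      qed
      then obtain p where p: "\<And>i. coeff p i \<in> R" "\<And>\<tau>. \<tau> \<in> uhp \<Longrightarrow> g \<tau> = poly p (j_inv \<tau>)" by blast
      show ?thesis
      proof (intro exI[of _ "p + monom c l"] conjI allI ballI)
        show "coeff (p + monom c l) i \<in> R" for i
          using p(1)[of i] subring_add[OF R p(1) cR] by auto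
        show "f \<tau> = poly (p + monom c l) (j_inv \<tau>)" if "\<tau> \<in> uhp" for \<tau>
          using p(2)[OF that] by (simp add: g_def poly_monom algebra_simps)
      qed
    qed
  qed
  note main = this
  define k where "k = nat (1 - fls_subdegree F)"
  have "fls_nth F m = 0" if "m \<le> - int k" for m using that by (intro fls_eq0_below_subdegree) (auto simp: k_def split: if_splits)
  from main[OF hol inv F this] show ?thesis using that by blast
qed

lemma poly_in_subring:
  assumes "is_subring R" "\<And>i. coeff p i \<in> R" "x \<in> R"
  shows "poly p x \<in> R"
  unfolding poly_altdef by (intro subring_sum subring_mult subring_power assms)

section \<open>Finite groups of matrices\<close>

lemma finite_mat_mod: "N > 0 \<Longrightarrow> finite {A. mat_mod N A = A}"
proof -
  assume N: "N > 0"
  have "{A. mat_mod N A = A} \<subseteq> (\<lambda>(a, b, c, d). mat2 a b c d) ` ({0..<int N} \<times> {0..<int N} \<times> {0..<int N} \<times> {0..<int N})"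
  proof
    fix A assume "A \<in> {A. mat_mod N A = A}"
    then have A: "mat_mod N A = A" by simp
    have "A$i$j \<in> {0..<int N}" for i j
    proof -
      have "A$i$j = A$i$j mod int N" using mat_mod_nth[of N A i j] unfolding A .
      moreover have "A$i$j mod int N \<in> {0..<int N}" using N by simp
      ultimately show ?thesis by simp
    qed
    then show "A \<in> (\<lambda>(a, b, c, d). mat2 a b c d) ` ({0..<int N} \<times> {0..<int N} \<times> {0..<int N} \<times> {0..<int N})"
      by (intro image_eqI[of _ _ "(A$1$1, A$1$2, A$2$1, A$2$2)"]) (auto simp: mat2_collapse)
  qed
  then show ?thesis by (rule finite_subset) auto
qed

lemma mat_mod_cancel_right:
  assumes "coprime (det g) (int N)" "mat_mod N (A ** g) = mat_mod N (B ** g)"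
  shows "mat_mod N A = mat_mod N B"
proof -
  \<comment> \<open>The adjugate of g: multiplying by it leaves A times det g, and the determinant
    can be cancelled modulo N.\<close>
  define h where "h = mat2 (g$2$2) (-g$1$2) (-g$2$1) (g$1$1)"
  have h: "((A ** g) ** h) $ i $ j = A $ i $ j * det g" for A :: "int^2^2" and i j
    using exhaust_2[of j] by (auto simp: mult_nth2 h_def det_2 algebra_simps)
  have "mat_mod N ((A ** g) ** h) = mat_mod N ((B ** g) ** h)"
    by (rule mat_mod_mult_cong[OF assms(2) refl])
  then have "(A $ i $ j * det g) mod int N = (B $ i $ j * det g) mod int N" for i j
    unfolding vec_eq_iff mat_mod_nth h by blast
  then have "A $ i $ j mod int N = B $ i $ j mod int N" for i j
    using cong_mult_rcancel[OF assms(1)] unfolding cong_def by blast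
  then show ?thesis by (simp add: vec_eq_iff)
qed

lemma mult_right_bij:
  assumes "finite S" "\<And>B. B \<in> S \<Longrightarrow> mat_mod N B = B" "coprime (det g) (int N)"
    "\<And>B. B \<in> S \<Longrightarrow> mat_mod N (B ** g) \<in> S"
  shows "bij_betw (\<lambda>B. mat_mod N (B ** g)) S S"
proof -
  have "inj_on (\<lambda>B. mat_mod N (B ** g)) S"
  proof (rule inj_onI)
    fix A B assume A: "A \<in> S" and B: "B \<in> S" and "mat_mod N (A ** g) = mat_mod N (B ** g)"
    from mat_mod_cancel_right[OF assms(3) this(3)] show "A = B"
      unfolding assms(2)[OF A] assms(2)[OF B] .
  qed
  then show ?thesis unfolding bij_betw_def using assms(1,4) by (metis endo_inj_surj image_subsetI)
qed

text \<open>The reduced matrices that come from SL2(Z). Taken as an image, every element has a lift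
  by definition.\<close>

definition SB :: "nat \<Rightarrow> (int^2^2) set" where "SB N = mat_mod N ` SL2Z"

lemma finite_SB: "N > 0 \<Longrightarrow> finite (SB N)"
  by (rule finite_subset[OF _ finite_mat_mod]) (auto simp: SB_def)

lemma SB_bij:
  assumes "N > 0" "\<gamma> \<in> SL2Z"
  shows "bij_betw (\<lambda>B. mat_mod N (B ** \<gamma>)) (SB N) (SB N)"
  by (rule mult_right_bij[OF finite_SB[OF assms(1)]]) (use assms in \<open>auto simp: SB_def SL2Z_def det_mul\<close>)

lemma SB_one: "mat_mod N (mat 1) \<in> SB N"
  by (auto simp: SB_def)

section \<open>Families of modular functions\<close>

text \<open>A modular function of level \<open>N\<close> together with its images under matrices: \<open>\<Phi> A\<close> plays the
  role of $f^A$ and \<open>X A\<close> is its expansion.\<close>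

definition modfam :: "nat \<Rightarrow> complex set \<Rightarrow> (int^2^2 \<Rightarrow> complex \<Rightarrow> complex) \<Rightarrow> (int^2^2 \<Rightarrow> complex fls) \<Rightarrow> bool" where
  "modfam N R \<Phi> X \<longleftrightarrow>
     (\<forall>A B. mat_mod N A = mat_mod N B \<longrightarrow> (\<forall>\<tau>\<in>uhp. \<Phi> A \<tau> = \<Phi> B \<tau>)) \<and>
     (\<forall>A. \<forall>\<gamma>\<in>SL2Z. \<forall>\<tau>\<in>uhp. \<Phi> A (mob \<gamma> \<tau>) = \<Phi> (A ** \<gamma>) \<tau>) \<and>
     (\<forall>A. \<Phi> A holomorphic_on uhp) \<and> (\<forall>A. has_q_expansion N (\<Phi> A) (X A)) \<and> (\<forall>A n. fls_nth (X A) n \<in> R)"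

text \<open>In addition, conjugating an expansion at infinity amounts to multiplying the index by
  diag(1, d) on the right; together with the composition rule this is Shimura's action. Indices
  range over all integer matrices, so that products can be formed without reducing or
  lifting.\<close>

definition galfam :: "nat \<Rightarrow> (int^2^2 \<Rightarrow> complex \<Rightarrow> complex) \<Rightarrow> (int^2^2 \<Rightarrow> complex fls) \<Rightarrow> bool" where
  "galfam N \<Phi> X \<longleftrightarrow> modfam N (Zz N) \<Phi> X \<and>
     (\<forall>\<sigma>\<in>Gal_Q. \<forall>d A. \<sigma> (zeta N) = zeta N powi d \<longrightarrow> fls_rel (Zz N) \<sigma> (X A) (X (A ** diag1 d)))"

lemma modfamD:
  assumes "modfam N R \<Phi> X"
  shows "mat_mod N A = mat_mod N B \<Longrightarrow> \<tau> \<in> uhp \<Longrightarrow> \<Phi> A \<tau> = \<Phi> B \<tau>"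
    "\<gamma> \<in> SL2Z \<Longrightarrow> \<tau> \<in> uhp \<Longrightarrow> \<Phi> A (mob \<gamma> \<tau>) = \<Phi> (A ** \<gamma>) \<tau>"
    "\<Phi> A holomorphic_on uhp" "has_q_expansion N (\<Phi> A) (X A)" "fls_nth (X A) n \<in> R"
  using assms unfolding modfam_def by blast+

lemma galfamD:
  assumes "galfam N \<Phi> X"
  shows "modfam N (Zz N) \<Phi> X"
    "\<sigma> \<in> Gal_Q \<Longrightarrow> \<sigma> (zeta N) = zeta N powi d \<Longrightarrow> fls_rel (Zz N) \<sigma> (X A) (X (A ** diag1 d))"
  using assms unfolding galfam_def by blast+

lemma ring_emb_Zz: "\<sigma> \<in> Gal_Q \<Longrightarrow> N > 0 \<Longrightarrow> ring_emb (Zz N) \<sigma>"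
  using ring_emb_subset[OF Gal_Q_ring_emb subring_Zz Zz_subset_Q_zeta] .

lemma modfam_qexp_cong:
  assumes "N > 0" "modfam N R \<Phi> X" "mat_mod N A = mat_mod N B"
  shows "X A = X B"
proof (rule qexp_unique[OF assms(1) modfamD(4)[OF assms(2)]])
  show "has_q_expansion N (\<Phi> A) (X B)"
    by (rule qexp_cong_uhp[OF modfamD(4)[OF assms(2)]]) (rule modfamD(1)[OF assms(2) assms(3)[symmetric]])
qed

lemma modfam_mult_left:
  assumes "modfam N R \<Phi> X"
  shows "modfam N R (\<lambda>A. \<Phi> (B ** A)) (\<lambda>A. X (B ** A))"
proof -
  note F = modfamD[OF assms]
  show ?thesis unfolding modfam_def
  proof (intro conjI allI impI ballI)
    fix A A' \<tau> assume "mat_mod N A = mat_mod N A'" "\<tau> \<in> uhp"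
    then show "\<Phi> (B ** A) \<tau> = \<Phi> (B ** A') \<tau>" by (intro F(1) mat_mod_mult_cong refl)
  next
    fix A \<gamma> \<tau> assume "\<gamma> \<in> SL2Z" "\<tau> \<in> uhp"
    from F(2)[OF this] show "\<Phi> (B ** A) (mob \<gamma> \<tau>) = \<Phi> (B ** (A ** \<gamma>)) \<tau>" unfolding matrix_mul_assoc .
  qed (rule F(3) F(4) F(5))+
qed

lemma galfam_mult_left:
  assumes "galfam N \<Phi> X"
  shows "galfam N (\<lambda>A. \<Phi> (B ** A)) (\<lambda>A. X (B ** A))"
  unfolding galfam_def
proof (intro conjI ballI allI impI)
  show "modfam N (Zz N) (\<lambda>A. \<Phi> (B ** A)) (\<lambda>A. X (B ** A))" by (rule modfam_mult_left[OF galfamD(1)[OF assms]])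
  fix \<sigma> d A assume "\<sigma> \<in> Gal_Q" "\<sigma> (zeta N) = zeta N powi d"
  from galfamD(2)[OF assms this] show "fls_rel (Zz N) \<sigma> (X (B ** A)) (X (B ** (A ** diag1 d)))"
    unfolding matrix_mul_assoc .
qed

context
  fixes N :: nat assumes N: "N > 0"
begin

lemma modfam_prod:
  assumes "is_subring R" "\<And>i. i \<in> I \<Longrightarrow> modfam N R (\<Phi> i) (X i)"
  shows "modfam N R (\<lambda>A \<tau>. \<Prod>i\<in>I. \<Phi> i A \<tau>) (\<lambda>A. \<Prod>i\<in>I. X i A)"
proof -
  note F = modfamD[OF assms(2)]
  have coeffs: "fls_rel R (\<lambda>x. x) (\<Prod>i\<in>I. X i A) (\<Prod>i\<in>I. X i A)" for A
    by (rule fls_rel_prod[OF ring_emb_id[OF assms(1)]]) (simp add: fls_rel_id_iff F(5))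
  show ?thesis unfolding modfam_def
  proof (intro conjI allI impI ballI)
    fix A B :: "int^2^2" and \<tau> assume "mat_mod N A = mat_mod N B" "\<tau> \<in> uhp"
    then show "(\<Prod>i\<in>I. \<Phi> i A \<tau>) = (\<Prod>i\<in>I. \<Phi> i B \<tau>)" by (intro prod.cong refl F(1))
  next
    fix A \<gamma> \<tau> assume "\<gamma> \<in> SL2Z" "\<tau> \<in> uhp"
    then show "(\<Prod>i\<in>I. \<Phi> i A (mob \<gamma> \<tau>)) = (\<Prod>i\<in>I. \<Phi> i (A ** \<gamma>) \<tau>)" by (intro prod.cong refl F(2))
  next
    fix A show "(\<lambda>\<tau>. \<Prod>i\<in>I. \<Phi> i A \<tau>) holomorphic_on uhp" by (intro holomorphic_intros F(3))
    show "has_q_expansion N (\<lambda>\<tau>. \<Prod>i\<in>I. \<Phi> i A \<tau>) (\<Prod>i\<in>I. X i A)" by (intro qexp_prod[OF N] F(4))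
    show "fls_nth (\<Prod>i\<in>I. X i A) n \<in> R" for n by (rule fls_relD(1)[OF coeffs])
  qed
qed

lemma galfam_prod:
  assumes "\<And>i. i \<in> I \<Longrightarrow> galfam N (\<Phi> i) (X i)"
  shows "galfam N (\<lambda>A \<tau>. \<Prod>i\<in>I. \<Phi> i A \<tau>) (\<lambda>A. \<Prod>i\<in>I. X i A)"
  unfolding galfam_def
proof (intro conjI ballI allI impI)
  show "modfam N (Zz N) (\<lambda>A \<tau>. \<Prod>i\<in>I. \<Phi> i A \<tau>) (\<lambda>A. \<Prod>i\<in>I. X i A)"
    by (rule modfam_prod[OF subring_Zz galfamD(1)[OF assms]])
  fix \<sigma> d A assume s: "\<sigma> \<in> Gal_Q" "\<sigma> (zeta N) = zeta N powi d"
  show "fls_rel (Zz N) \<sigma> (\<Prod>i\<in>I. X i A) (\<Prod>i\<in>I. X i (A ** diag1 d))"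
    by (rule fls_rel_prod[OF ring_emb_Zz[OF s(1) N] galfamD(2)[OF assms s]])
qed

lemma galfam_mult:
  assumes "galfam N \<Phi> X" "galfam N \<Psi> Y"
  shows "galfam N (\<lambda>A \<tau>. \<Phi> A \<tau> * \<Psi> A \<tau>) (\<lambda>A. X A * Y A)"
proof -
  have "galfam N (\<lambda>A \<tau>. \<Prod>i\<in>{True, False}. (if i then \<Phi> else \<Psi>) A \<tau>) (\<lambda>A. \<Prod>i\<in>{True, False}. (if i then X else Y) A)"
    using assms by (intro galfam_prod) auto
  then show ?thesis by simp
qed

lemma galfam_uminus:
  assumes "galfam N \<Phi> X"
  shows "galfam N (\<lambda>A \<tau>. - \<Phi> A \<tau>) (\<lambda>A. - X A)"
proof -
  note F = modfamD[OF galfamD(1)[OF assms]]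
  have "modfam N (Zz N) (\<lambda>A \<tau>. - \<Phi> A \<tau>) (\<lambda>A. - X A)"
    unfolding modfam_def
  proof (intro conjI allI impI ballI)
    fix A B :: "int^2^2" and \<tau> assume "mat_mod N A = mat_mod N B" "\<tau> \<in> uhp"
    from F(1)[OF this] show "- \<Phi> A \<tau> = - \<Phi> B \<tau>" by simp
  qed (use F(2,3) F(4)[THEN qexp_uminus[OF N]] subring_uminus[OF subring_Zz F(5)] in \<open>auto intro!: holomorphic_intros\<close>)
  moreover have "fls_rel (Zz N) \<sigma> (- X A) (- X (A ** diag1 d))" if s: "\<sigma> \<in> Gal_Q" "\<sigma> (zeta N) = zeta N powi d" for \<sigma> d A
    by (rule fls_rel_uminus[OF ring_emb_Zz[OF s(1) N] galfamD(2)[OF assms s]])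
  ultimately show ?thesis unfolding galfam_def by blast
qed

lemma galfam_add:
  assumes "galfam N \<Phi> X" "galfam N \<Psi> Y"
  shows "galfam N (\<lambda>A \<tau>. \<Phi> A \<tau> + \<Psi> A \<tau>) (\<lambda>A. X A + Y A)"
proof -
  note F = modfamD[OF galfamD(1)[OF assms(1)]] and G = modfamD[OF galfamD(1)[OF assms(2)]]
  have "modfam N (Zz N) (\<lambda>A \<tau>. \<Phi> A \<tau> + \<Psi> A \<tau>) (\<lambda>A. X A + Y A)"
    unfolding modfam_def
  proof (intro conjI allI impI ballI)
    fix A B :: "int^2^2" and \<tau> assume "mat_mod N A = mat_mod N B" "\<tau> \<in> uhp"
    from F(1)[OF this] G(1)[OF this] show "\<Phi> A \<tau> + \<Psi> A \<tau> = \<Phi> B \<tau> + \<Psi> B \<tau>" by simp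
  qed (use F(2,3) G(2,3) qexp_add[OF N F(4) G(4)] subring_add[OF subring_Zz F(5) G(5)] in \<open>auto intro!: holomorphic_intros\<close>)
  moreover have "fls_rel (Zz N) \<sigma> (X A + Y A) (X (A ** diag1 d) + Y (A ** diag1 d))" if s: "\<sigma> \<in> Gal_Q" "\<sigma> (zeta N) = zeta N powi d" for \<sigma> d A
    by (rule fls_rel_add[OF ring_emb_Zz[OF s(1) N] galfamD(2)[OF assms(1) s] galfamD(2)[OF assms(2) s]])
  ultimately show ?thesis unfolding galfam_def by blast
qed

section \<open>The powers of Siegel functions as a Galois-compatible family\<close>

definition hfam :: "int \<Rightarrow> int \<Rightarrow> int^2^2 \<Rightarrow> complex \<Rightarrow> complex" where
  "hfam u v A = hh N (u * A$1$1 + v * A$2$1) (u * A$1$2 + v * A$2$2)"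

definition hfamX :: "int \<Rightarrow> int \<Rightarrow> int^2^2 \<Rightarrow> complex fls" where
  "hfamX u v A = hfls N (u * A$1$1 + v * A$2$1) (u * A$1$2 + v * A$2$2)"

lemma row_mod_cong:
  assumes "mat_mod N A = mat_mod N B"
  shows "(u * A$1$j + v * A$2$j) mod int N = (u * B$1$j + v * B$2$j) mod int N"
proof -
  have "A$i$j mod int N = B$i$j mod int N" for i using assms by (metis mat_mod_nth)
  then show ?thesis by (intro mod_add_cong mod_mult_cong refl)
qed

lemma hfls_in_Zz: "fls_nth (hfls N r s) n \<in> Zz N"
proof -
  have "fls_rel (Zz N) (\<lambda>x. x) (hfls N r s) (hfls N r (1 * s))"
    by (rule hfls_rel[OF N ring_emb_id[OF subring_Zz] zeta_in_Zz]) simp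
  then show ?thesis by (simp add: fls_rel_id_iff)
qed

lemma galfam_hfam: "galfam N (hfam u v) (hfamX u v)"
proof -
  have "modfam N (Zz N) (hfam u v) (hfamX u v)"
    unfolding modfam_def
  proof (intro conjI allI impI ballI)
    fix A B :: "int^2^2" and \<tau> assume "mat_mod N A = mat_mod N B" "\<tau> \<in> uhp"
    then show "hfam u v A \<tau> = hfam u v B \<tau>" unfolding hfam_def by (intro hh_cong N row_mod_cong) auto
  next
    fix A \<gamma> \<tau> assume "\<gamma> \<in> SL2Z" "\<tau> \<in> uhp"
    then show "hfam u v A (mob \<gamma> \<tau>) = hfam u v (A ** \<gamma>) \<tau>"
      unfolding hfam_def hh_mob[OF N \<open>\<gamma> \<in> SL2Z\<close> \<open>\<tau> \<in> uhp\<close>] by (simp add: mult_nth2 algebra_simps)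
  qed (auto simp: hfam_def hfamX_def hh_holomorphic[OF N] hh_qexp[OF N] hfls_in_Zz)
  moreover have "fls_rel (Zz N) \<sigma> (hfamX u v A) (hfamX u v (A ** diag1 d))"
    if "\<sigma> \<in> Gal_Q" "\<sigma> (zeta N) = zeta N powi d" for \<sigma> d A
  proof -
    have e: "u * (A ** diag1 d)$1$1 + v * (A ** diag1 d)$2$1 = u * A$1$1 + v * A$2$1"
      "u * (A ** diag1 d)$1$2 + v * (A ** diag1 d)$2$2 = d * (u * A$1$2 + v * A$2$2)"
      by (simp_all add: mult_nth2 algebra_simps)
    show ?thesis unfolding hfamX_def e by (rule hfls_rel[OF N ring_emb_Zz[OF that(1) N] zeta_in_Zz that(2)])
  qed
  ultimately show ?thesis unfolding galfam_def by blast
qed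

section \<open>Integrality\<close>

text \<open>Summation by parts of the geometric sum. It serves twice: N/(1 - zeta^s) lies in
  Z[zeta_N], and |1 - zeta^s| has a lower bound of order 1/N.\<close>

lemma sum_k_roots_of_unity:
  assumes s: "\<not> int N dvd s"
  shows "of_nat N / (1 - zeta N powi s) = - (\<Sum>k<N. of_nat k * (zeta N powi s) ^ k)"
proof -
  define w where "w = zeta N powi s"
  have w1: "w \<noteq> 1" using zeta_powi_eq_1_iff[OF N, of s] s by (simp add: w_def)
  have wN: "w ^ N = 1"
    unfolding w_def zeta_powi ee_power using N by simp
  have tel: "(1 - w) * (\<Sum>k<n. of_nat k * w ^ k) = (\<Sum>k<n. w ^ k) * w - of_nat n * w ^ n" for n
  proof (induction n)
    case (Suc n)
    have "(1 - w) * (\<Sum>k<Suc n. of_nat k * w ^ k) = (1 - w) * (\<Sum>k<n. of_nat k * w ^ k) + (1 - w) * (of_nat n * w ^ n)"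
      by (simp add: distrib_left)
    also have "\<dots> = ((\<Sum>k<n. w ^ k) * w - of_nat n * w ^ n) + (1 - w) * (of_nat n * w ^ n)"
      by (simp only: Suc.IH)
    also have "\<dots> = (\<Sum>k<Suc n. w ^ k) * w - of_nat (Suc n) * w ^ Suc n"
      by (simp add: algebra_simps)
    finally show ?case .
  qed simp
  have "(1 - w) * (\<Sum>k<N. w ^ k) = 1 - w ^ N" by (rule one_diff_power_eq[symmetric])
  then have "(\<Sum>k<N. w ^ k) = 0" using wN w1 by simp
  then have "(1 - w) * (\<Sum>k<N. of_nat k * w ^ k) = - of_nat N" using tel[of N] wN by simp
  then show ?thesis using w1 by (simp add: field_simps flip: w_def)
qed

lemma N_over_1_minus_root:
  assumes "\<not> int N dvd s"
  shows "of_nat N / (1 - zeta N powi s) \<in> Zz N"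
  unfolding sum_k_roots_of_unity[OF assms]
  by (intro subring_uminus subring_sum subring_mult subring_of_nat subring_power subring_Zz)
     (simp add: zeta_powi_in_Zz N)

text \<open>Apart from a power of x and a root of unity, the only leading factor is a power of
  \<open>hc\<close>, whose inverse becomes integral after multiplication by N; the infinite products
  have constant term 1. When \<open>hc\<close> is 0 the whole series is 0, and so is its inverse by
  convention.\<close>

lemma inverse_hfls_in_Zz: "fls_nth (fls_const (of_nat N ^ (12 * N)) * inverse (hfls N r s)) n \<in> Zz N"
proof (cases "hc N r s = 0")
  case True
  then have "hfls N r s = 0" using N by (simp add: hfls_def hfps_def)
  then show ?thesis by (simp add: subring_0)
next
  case False
  define P where "P = Pfps (zeta N powi s) (ka N r) * Pfps (zeta N powi (- s)) (kb N r)"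
  note e = ring_emb_id[OF subring_Zz[of N]]
  have P0: "fps_nth P 0 = 1" unfolding P_def using N by (simp add: Pfps_nth_0 ka_gt kb_gt)
  have P: "fps_rel (Zz N) (\<lambda>x. x) P P" unfolding P_def
    by (intro fps_rel_mult[OF e] fps_rel_Pfps[OF e] zeta_powi_in_Zz N)
  have IP: "fps_rel (Zz N) (\<lambda>x. x) (inverse P) (inverse P)"
    using fps_inverse_in[OF subring_Zz _ P0] P by (auto simp: fps_rel_def)
  have c: "of_nat N / hc N r s \<in> Zz N"
  proof (cases "r mod int N = 0")
    case True
    then have "\<not> int N dvd s" using False zeta_powi_eq_1_iff[OF N, of s] by (auto simp: hc_def)
    then show ?thesis using True N_over_1_minus_root by (simp add: hc_def)
  qed (simp add: hc_def subring_of_nat)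
  define z where "z = zeta N powi (6 * (r mod int N) * s)"
  have z: "z \<noteq> 0" by (simp add: z_def)
  define H where "H = fls_X_intpow (bq N r) * (fls_const z * (fls_const (hc N r s ^ (12 * N)) * fps_to_fls P ^ (12 * N)))"
  have H: "hfls N r s = H"
    unfolding hfls_def hfps_def H_def P_def z_def
    by (simp add: power_mult_distrib fps_to_fls_power fls_times_fps_to_fls mult.assoc flip: fls_const_power)
  define K where "K = fls_X_intpow (- bq N r) * (fls_const (inverse z) * (fls_const ((of_nat N / hc N r s) ^ (12 * N)) * fps_to_fls (inverse P) ^ (12 * N)))"
  have "fps_to_fls P * fps_to_fls (inverse P) = 1"
    using P0 by (simp add: inverse_mult_eq_1' flip: fls_times_fps_to_fls)
  then have PI: "fps_to_fls P ^ (12 * N) * fps_to_fls (inverse P) ^ (12 * N) = 1" by (simp flip: power_mult_distrib)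
  have cc: "fls_const a * fls_const b = fls_const (a * b)" for a b :: complex by (simp add: fls_const_mult_const)
  have xx: "fls_X_intpow (bq N r) * fls_X_intpow (- bq N r) = (1 :: complex fls)"
    using fls_X_intpow_times_fls_X_intpow[of "bq N r" "- bq N r"] by simp
  have "H * K = (fls_X_intpow (bq N r) * fls_X_intpow (- bq N r)) * ((fls_const z * fls_const (inverse z))
      * ((fls_const (hc N r s ^ (12 * N)) * fls_const ((of_nat N / hc N r s) ^ (12 * N))) * (fps_to_fls P ^ (12 * N) * fps_to_fls (inverse P) ^ (12 * N))))"
    unfolding H_def K_def by (simp only: mult_ac)
  also have "\<dots> = fls_const (of_nat N ^ (12 * N))"
    unfolding xx PI cc using z False by (simp add: power_divide)
  finally have HK: "H * K = fls_const (of_nat N ^ (12 * N))" .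
  have "fls_const (of_nat N ^ (12 * N)) \<noteq> (0 :: complex fls)" using N by simp
  then have "H \<noteq> 0" using HK by auto
  then have "fls_const (of_nat N ^ (12 * N)) * inverse (hfls N r s) = K"
    unfolding H HK[symmetric] by (simp add: mult_ac)
  moreover have "fls_rel (Zz N) (\<lambda>x. x) K K" unfolding K_def
    by (intro fls_rel_mult[OF e] fls_rel_X_intpow[OF e] fls_rel_const[OF e] fls_rel_power[OF e] fls_rel_fps_to_fls[OF e] IP
        subring_power[OF subring_Zz] c)
       (simp add: z_def zeta_powi_in_Zz N flip: power_int_minus)
  ultimately show ?thesis by (simp add: fls_rel_id_iff)
qed

lemma modfam_inverse_hfam:
  "modfam N (Zz N) (\<lambda>A \<tau>. of_nat N ^ (12 * N) * inverse (hfam u v A \<tau>)) (\<lambda>A. fls_const (of_nat N ^ (12 * N)) * inverse (hfamX u v A))"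
proof -
  note F = modfamD[OF galfamD(1)[OF galfam_hfam]]
  have "(\<lambda>\<tau>. inverse (hfam u v A \<tau>)) holomorphic_on uhp" for A
  proof (cases "int N dvd (u * A$1$1 + v * A$2$1) \<and> int N dvd (u * A$1$2 + v * A$2$2)")
    \<comment> \<open>At an index that sends (u, v) to 0 modulo N the function is identically 0, and
      \<open>inverse 0 = 0\<close> keeps the family holomorphic.\<close>
    case True
    then have "hfam u v A \<tau> = 0" if "\<tau> \<in> uhp" for \<tau> using hh_zero[OF N that] by (simp add: hfam_def)
    then show ?thesis by (intro holomorphic_transform[OF holomorphic_on_const[of 0]]) simp
  next
    case False
    then have "hfam u v A \<tau> \<noteq> 0" if "\<tau> \<in> uhp" for \<tau> using hh_nonzero[OF N that False] by (simp add: hfam_def)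
    then show ?thesis by (intro holomorphic_intros F(3))
  qed
  note hol = this
  show ?thesis unfolding modfam_def
  proof (intro conjI allI impI ballI)
    fix A B :: "int^2^2" and \<tau> assume "mat_mod N A = mat_mod N B" "\<tau> \<in> uhp"
    from F(1)[OF this] show "of_nat N ^ (12 * N) * inverse (hfam u v A \<tau>) = of_nat N ^ (12 * N) * inverse (hfam u v B \<tau>)" by simp
  next
    fix A \<gamma> \<tau> assume "\<gamma> \<in> SL2Z" "\<tau> \<in> uhp"
    from F(2)[OF this] show "of_nat N ^ (12 * N) * inverse (hfam u v A (mob \<gamma> \<tau>)) = of_nat N ^ (12 * N) * inverse (hfam u v (A ** \<gamma>) \<tau>)" by simp
  next
    fix A show "(\<lambda>\<tau>. of_nat N ^ (12 * N) * inverse (hfam u v A \<tau>)) holomorphic_on uhp" by (intro holomorphic_intros hol)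
  next
    fix A show "has_q_expansion N (\<lambda>\<tau>. of_nat N ^ (12 * N) * inverse (hfam u v A \<tau>)) (fls_const (of_nat N ^ (12 * N)) * inverse (hfamX u v A))"
      by (rule qexp_mult[OF N qexp_const[OF N] qexp_inverse[OF N F(4)]])
  next
    fix A n show "fls_nth (fls_const (of_nat N ^ (12 * N)) * inverse (hfamX u v A)) n \<in> Zz N"
      unfolding hfamX_def by (rule inverse_hfls_in_Zz)
  qed
qed

text \<open>There is no condition at other cusps and no invariance here, so the notion is closed
  under ring operations even for functions permuted by SL2(Z); invariance is supplied separately for
  \<open>good_invariant_poly_j\<close>.\<close>

definition good :: "complex set \<Rightarrow> (complex \<Rightarrow> complex) \<Rightarrow> bool" where
  "good R f \<longleftrightarrow> f holomorphic_on uhp \<and> (\<exists>F. has_q_expansion N f F \<and> (\<forall>n. fls_nth F n \<in> R))"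

lemma goodI: "f holomorphic_on uhp \<Longrightarrow> has_q_expansion N f F \<Longrightarrow> fls_rel R (\<lambda>x. x) F F \<Longrightarrow> good R f"
  unfolding good_def fls_rel_id_iff by blast

lemma goodE:
  assumes "good R f"
  obtains F where "f holomorphic_on uhp" "has_q_expansion N f F" "fls_rel R (\<lambda>x. x) F F"
  using assms unfolding good_def by (auto simp: fls_rel_id_iff)

lemma good_const: "is_subring R \<Longrightarrow> c \<in> R \<Longrightarrow> good R (\<lambda>\<tau>. c)"
  by (rule goodI[OF holomorphic_on_const qexp_const[OF N] fls_rel_const[OF ring_emb_id]])

lemma good_add:
  assumes "is_subring R" "good R f" "good R g"
  shows "good R (\<lambda>\<tau>. f \<tau> + g \<tau>)"
  by (rule goodE[OF assms(2)], rule goodE[OF assms(3)],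
      rule goodI[OF holomorphic_on_add qexp_add[OF N] fls_rel_add[OF ring_emb_id[OF assms(1)]]])

lemma good_mult:
  assumes "is_subring R" "good R f" "good R g"
  shows "good R (\<lambda>\<tau>. f \<tau> * g \<tau>)"
  by (rule goodE[OF assms(2)], rule goodE[OF assms(3)],
      rule goodI[OF holomorphic_on_mult qexp_mult[OF N] fls_rel_mult[OF ring_emb_id[OF assms(1)]]])

lemma good_uminus:
  assumes "is_subring R" "good R f"
  shows "good R (\<lambda>\<tau>. - f \<tau>)"
  by (rule goodE[OF assms(2)],
      rule goodI[OF holomorphic_on_minus qexp_uminus[OF N] fls_rel_uminus[OF ring_emb_id[OF assms(1)]]])

lemma good_invariant_poly_j:
  assumes "is_subring R" "good R f" "\<And>A \<tau>. A \<in> SL2Z \<Longrightarrow> \<tau> \<in> uhp \<Longrightarrow> f (mob A \<tau>) = f \<tau>"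
  obtains p where "\<And>i. coeff p i \<in> R" "\<And>\<tau>. \<tau> \<in> uhp \<Longrightarrow> f \<tau> = poly p (j_inv \<tau>)"
  using assms invariant_poly_j[OF N assms(1)] unfolding good_def by metis

lemma good_sum:
  assumes "is_subring R" "\<And>i. i \<in> I \<Longrightarrow> good R (f i)"
  shows "good R (\<lambda>\<tau>. \<Sum>i\<in>I. f i \<tau>)"
  using assms(2)
proof (induction I rule: infinite_finite_induct)
  case (insert i I)
  have "good R (\<lambda>\<tau>. f i \<tau> + (\<Sum>i\<in>I. f i \<tau>))"
    by (rule good_add[OF assms(1)]) (use insert in auto)
  then show ?case using insert.hyps by simp
qed (simp_all add: good_const[OF assms(1) subring_0[OF assms(1)]])

lemma good_coeff_prod:
  assumes R: "is_subring R" and p: "\<And>C i. C \<in> T \<Longrightarrow> good R (\<lambda>\<tau>. coeff (p C \<tau>) i)"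
  shows "good R (\<lambda>\<tau>. coeff (\<Prod>C\<in>T. p C \<tau>) i)"
  using p
proof (induction T arbitrary: i rule: infinite_finite_induct)
  case (insert C T)
  have "good R (\<lambda>\<tau>. \<Sum>k\<le>i. coeff (p C \<tau>) k * coeff (\<Prod>C\<in>T. p C \<tau>) (i - k))"
    by (intro good_sum[OF R] good_mult[OF R]) (use insert in auto)
  then show ?case using insert.hyps by (simp add: coeff_mult)
qed (simp_all add: coeff_1 good_const[OF R] subring_0[OF R] subring_1[OF R])

text \<open>The polynomial with roots \<Phi> B \<tau>, B running through SL2(Z/N), is monic, and
  SL2(Z) merely permutes its roots. Hence its coefficients are polynomials in j over Z[zeta_N], and
  they lie in Z[zeta_N] where j is an integer.\<close>

lemma modfam_integral:
  assumes \<Phi>: "modfam N (Zz N) \<Phi> X" and \<tau>: "\<tau> \<in> uhp" and j: "j_inv \<tau> \<in> \<int>"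
  obtains p where "\<And>i. coeff p i \<in> Zz N" "lead_coeff p = 1" "poly p (\<Phi> (mat 1) \<tau>) = 0"
proof -
  note F = modfamD[OF \<Phi>]
  define Q where "Q = (\<lambda>S \<tau>. \<Prod>B\<in>S. [:- \<Phi> B \<tau>, 1:])"
  have lin: "good (Zz N) (\<lambda>\<tau>. coeff [:- \<Phi> B \<tau>, 1:] i)" for B i
  proof (cases i)
    case 0
    have "good (Zz N) (\<Phi> B)" unfolding good_def using F(3-5) by blast
    then show ?thesis using 0 good_uminus[OF subring_Zz] by simp
  next
    case (Suc k)
    have "coeff [:1:] k \<in> Zz N" by (cases k) (simp_all add: subring_0 subring_1)
    from good_const[OF subring_Zz this] show ?thesis using Suc by simp
  qed
  have good: "good (Zz N) (\<lambda>\<tau>. coeff (Q (SB N) \<tau>) i)" for i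
    unfolding Q_def by (intro good_coeff_prod subring_Zz lin)
  have inv: "Q (SB N) (mob A \<tau>) = Q (SB N) \<tau>" if "A \<in> SL2Z" "\<tau> \<in> uhp" for A \<tau>
  proof -
    have "\<Phi> B (mob A \<tau>) = \<Phi> (mat_mod N (B ** A)) \<tau>" for B
      unfolding F(2)[OF that] by (rule F(1)[OF _ that(2)]) simp
    then have "Q (SB N) (mob A \<tau>) = (\<Prod>B\<in>SB N. [:- \<Phi> (mat_mod N (B ** A)) \<tau>, 1:])"
      unfolding Q_def by (simp only:)
    also have "\<dots> = Q (SB N) \<tau>"
      unfolding Q_def by (rule prod.reindex_bij_betw[OF SB_bij[OF N that(1)], of "\<lambda>B. [:- \<Phi> B \<tau>, 1:]"])
    finally show ?thesis .
  qed
  show ?thesis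
  proof (rule that[of "Q (SB N) \<tau>"])
    fix i
    obtain p where p: "\<And>k. coeff p k \<in> Zz N" "\<And>\<tau>. \<tau> \<in> uhp \<Longrightarrow> coeff (Q (SB N) \<tau>) i = poly p (j_inv \<tau>)"
      using good_invariant_poly_j[OF subring_Zz good[of i]] inv by metis
    show "coeff (Q (SB N) \<tau>) i \<in> Zz N"
      unfolding p(2)[OF \<tau>] using j Ints_subset_subring[OF subring_Zz] by (intro poly_in_subring[OF subring_Zz] p(1)) auto
    show "lead_coeff (Q (SB N) \<tau>) = 1" by (simp add: Q_def lead_coeff_prod)
    have "poly (Q (SB N) \<tau>) (\<Phi> (mat 1) \<tau>) = (\<Prod>B\<in>SB N. \<Phi> (mat 1) \<tau> - \<Phi> B \<tau>)"
      by (simp add: Q_def poly_prod)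
    also have "\<dots> = 0"
    proof -
      have "\<Phi> (mat 1) \<tau> = \<Phi> (mat_mod N (mat 1)) \<tau>" by (rule F(1)[OF _ \<tau>]) simp
      then have "\<exists>B\<in>SB N. \<Phi> (mat 1) \<tau> - \<Phi> B \<tau> = 0" by (intro bexI[OF _ SB_one]) simp
      then show ?thesis by (simp add: prod_zero_iff[OF finite_SB[OF N]])
    qed
    finally show "poly (Q (SB N) \<tau>) (\<Phi> (mat 1) \<tau>) = 0" .
  qed
qed

end

section \<open>Rational integral elements\<close>

text \<open>If b is the denominator of r, every power of b divides E, which forces b = 1.\<close>

lemma rat_bounded_denominators:
  assumes "E \<noteq> 0" "\<And>k. of_int E * r ^ k \<in> (\<int> :: rat set)"
  shows "r \<in> \<int>"
proof -
  obtain a b where r: "r = Fract a b" "b > 0" "coprime a b" by (cases r)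
  have dvd: "b ^ k dvd E" for k
  proof -
    obtain m where "of_int E * r ^ k = of_int m" using assms(2)[of k] by (auto elim: Ints_cases)
    then have "of_int E * of_int a ^ k = (of_int m * of_int b ^ k :: rat)"
      using r(2) by (simp add: r(1) Fract_of_int_quotient power_divide field_simps)
    then have "(of_int (E * a ^ k) :: rat) = of_int (m * b ^ k)" by simp
    then have "E * a ^ k = m * b ^ k" by (simp only: of_int_eq_iff)
    then have "b ^ k dvd E * a ^ k" by simp
    moreover have "coprime (b ^ k) (a ^ k)" using r(3) by (simp add: coprime_commute)
    ultimately show ?thesis by (simp add: coprime_dvd_mult_left_iff)
  qed
  have "b = 1"
  proof (rule ccontr)
    assume "b \<noteq> 1"
    then have b2: "b \<ge> 2" using r(2) by simp
    define k where "k = nat \<bar>E\<bar>"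
    have "int k < 2 ^ k" using less_exp[of k] by (metis of_nat_less_iff of_nat_numeral of_nat_power)
    also have "2 ^ k \<le> b ^ k" using b2 by (intro power_mono) auto
    also have "b ^ k \<le> \<bar>E\<bar>" using dvd[of k] assms(1) dvd_imp_le_int by (metis abs_ge_self order_trans)
    finally show False by (simp add: k_def)
  qed
  then show ?thesis by (simp add: r(1) Fract_of_int_eq flip: rat_number_collapse) 
qed

interpretation Q_pair: vector_space_pair "\<lambda>(r :: rat) (x :: complex). of_rat r * x" "times :: rat \<Rightarrow> rat \<Rightarrow> rat"
  by unfold_locales (simp_all add: algebra_simps)

text \<open>A Q-linear projection of the complex numbers onto Q, by extending {1} to a
  basis.\<close>

lemma rat_functional:
  obtains g :: "complex \<Rightarrow> rat" where "g 1 = 1" "\<And>x y. g (x + y) = g x + g y" "\<And>r x. g (of_rat r * x) = r * g x"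
proof -
  have "Q_vs.independent {1}" by simp
  then obtain g where "Vector_Spaces.linear (\<lambda>(r :: rat) (x :: complex). of_rat r * x) (times :: rat \<Rightarrow> rat \<Rightarrow> rat) g" "\<forall>x\<in>{1}. g x = 1"
    using Q_pair.linear_independent_extend[of "{1}" "\<lambda>_. 1"] by blast
  then show ?thesis using that by (auto simp: Vector_Spaces.linear_iff)
qed

lemma common_denominator:
  assumes "finite S"
  obtains D :: int where "D \<noteq> 0" "\<And>r :: rat. r \<in> S \<Longrightarrow> of_int D * r \<in> \<int>"
proof -
  have "\<exists>D :: int. D \<noteq> 0 \<and> (\<forall>r\<in>S. of_int D * r \<in> \<int>)"
    using assms
  proof (induction S rule: finite_induct)
    case (insert r S)
    then obtain D where D: "D \<noteq> 0" "\<forall>r\<in>S. of_int D * r \<in> \<int>" by blast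
    obtain a b where r: "r = Fract a b" "b > 0" by (cases r)
    have br: "of_int b * r = of_int a" using r by (simp add: Fract_of_int_quotient)
    have "of_int (D * b) * s = of_int b * (of_int D * s)" for s :: rat by simp
    then have "of_int (D * b) * s \<in> \<int>" if "s \<in> S" for s using D(2) that by (metis Ints_mult Ints_of_int)
    moreover have "of_int (D * b) * r = of_int (D * a)" by (simp add: mult.assoc br)
    then have "of_int (D * b) * r \<in> \<int>" by (simp only: Ints_of_int)
    ultimately show ?case using D(1) r(2) by (intro exI[of _ "D * b"]) auto
  qed (auto intro: exI[of _ 1])
  then show ?thesis using that by blast
qed

text \<open>All powers of x are combinations of 1, ..., x^(n-1) over Z[zeta_N]. A Q-linear
  projection onto Q maps Z[zeta_N] into (1/D) Z, as N powers of zeta_N generate that ring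
  additively; so all powers of the rational number x have denominators dividing one fixed
  integer.\<close>

lemma rational_integral:
  assumes N: "N > 0" and p: "\<And>i. coeff p i \<in> Zz N" "lead_coeff p = 1" "poly p x = 0" and x: "x \<in> \<rat>"
  shows "x \<in> \<int>"
proof -
  define n where "n = degree p"
  obtain r where r: "x = of_rat r" using x by (auto elim: Rats_cases)
  have n0: "n > 0"
  proof (rule ccontr)
    assume "\<not> n > 0"
    then obtain c where "p = [:c:]" unfolding n_def by (metis degree_eq_zeroE gr0I)
    then show False using p(2,3) by simp
  qed
  have xn: "x ^ n = - (\<Sum>i<n. coeff p i * x ^ i)"
  proof -
    have "0 = (\<Sum>i\<le>n. coeff p i * x ^ i)" using p(3) by (simp add: poly_altdef n_def)
    also have "\<dots> = (\<Sum>i<n. coeff p i * x ^ i) + x ^ n" using p(2) by (simp add: n_def flip: lessThan_Suc_atMost)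
    finally show ?thesis by (simp add: eq_neg_iff_add_eq_0 add.commute)
  qed
  have pow: "\<exists>d. (\<forall>i. d i \<in> Zz N) \<and> x ^ k = (\<Sum>i<n. d i * x ^ i)" for k
  proof (induction k)
    case 0
    have "(\<Sum>i<n. (if i = 0 then 1 else 0) * x ^ i) = 1" using n0 by (simp add: if_distrib[of "\<lambda>c. c * _"] cong: if_cong)
    then show ?case by (intro exI[of _ "\<lambda>i. if i = 0 then 1 else 0"]) (auto simp: subring_0 subring_1)
  next
    case (Suc k)
    then obtain d where d: "\<And>i. d i \<in> Zz N" "x ^ k = (\<Sum>i<n. d i * x ^ i)" by blast
    obtain m where m: "n = Suc m" using n0 by (cases n) auto
    define e where "e = (\<lambda>i. (if i = 0 then 0 else d (i - 1)) - d m * coeff p i)"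
    have "x ^ Suc k = (\<Sum>i<n. d i * x ^ Suc i)" using d(2) by (simp add: sum_distrib_left mult_ac)
    also have "\<dots> = (\<Sum>i<m. d i * x ^ Suc i) + d m * x ^ n" by (simp add: m)
    also have "(\<Sum>i<m. d i * x ^ Suc i) = (\<Sum>i<n. (if i = 0 then 0 else d (i - 1)) * x ^ i)"
      unfolding m by (subst sum.lessThan_Suc_shift) simp
    also have "d m * x ^ n = - (\<Sum>i<n. d m * coeff p i * x ^ i)" unfolding xn by (simp add: sum_distrib_left mult_ac)
    also have "(\<Sum>i<n. (if i = 0 then 0 else d (i - 1)) * x ^ i) + - (\<Sum>i<n. d m * coeff p i * x ^ i) = (\<Sum>i<n. e i * x ^ i)"
      unfolding e_def left_diff_distrib sum_subtractf by simp
    finally have "x ^ Suc k = (\<Sum>i<n. e i * x ^ i)" .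
    moreover have "e i \<in> Zz N" for i unfolding e_def
      by (intro subring_diff subring_mult subring_Zz p) (auto simp: subring_0 d)
    ultimately show ?case by blast
  qed
  obtain g :: "complex \<Rightarrow> rat" where g: "g 1 = 1" "\<And>x y. g (x + y) = g x + g y" "\<And>r x. g (of_rat r * x) = r * g x"
    using rat_functional by blast
  have g0: "g 0 = 0" using g(3)[of 0 0] by simp
  have gsum: "g (sum f I) = (\<Sum>i\<in>I. g (f i))" for f and I :: "nat set"
  proof (induction I rule: infinite_finite_induct)
    case (insert i I)
    then show ?case by (simp only: sum.insert[OF insert(1,2)] g(2) insert(3))
  qed (simp_all only: sum.infinite sum.empty g0 not_False_eq_True)
  obtain D :: int where D: "D \<noteq> 0" "\<And>j. j < N \<Longrightarrow> of_int D * g (zeta N ^ j) \<in> \<int>"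
  proof (rule common_denominator[of "(\<lambda>j. g (zeta N ^ j)) ` {..<N}"])
    fix D :: int assume "D \<noteq> 0" "\<And>r. r \<in> (\<lambda>j. g (zeta N ^ j)) ` {..<N} \<Longrightarrow> of_int D * r \<in> \<int>"
    then show thesis by (intro that[of D]) blast+
  qed simp
  have DZ: "of_int D * g c \<in> \<int>" if c: "c \<in> Zz N" for c
  proof -
    obtain q :: "int poly" where q: "c = poly (map_poly of_int q) (zeta N)" using c by (auto simp: Zz_def)
    have z: "zeta N ^ i = zeta N ^ (i mod N)" for i
    proof -
      have "zeta N ^ i = (zeta N ^ N) ^ (i div N) * zeta N ^ (i mod N)" by (simp flip: power_mult power_add)
      then show ?thesis by (simp add: zeta_power_N[OF N])
    qed
    have "c = (\<Sum>i\<le>degree (map_poly of_int q :: complex poly). of_rat (of_int (coeff q i)) * zeta N ^ (i mod N))"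
      unfolding q poly_altdef by (simp add: coeff_map_poly flip: z)
    then have "of_int D * g c = (\<Sum>i\<le>degree (map_poly of_int q :: complex poly). of_int (coeff q i) * (of_int D * g (zeta N ^ (i mod N))))"
      by (simp add: gsum g(3) sum_distrib_left mult_ac del: of_rat_of_int_eq)
    also have "\<dots> \<in> \<int>" using N by (intro Ints_sum Ints_mult D(2)) auto
    finally show ?thesis .
  qed
  obtain a b where ab: "r = Fract a b" "b > 0" by (cases r)
  have br: "of_int b * r = of_int a" using ab by (simp add: Fract_of_int_quotient)
  have "of_int (b ^ n * D) * r ^ k \<in> \<int>" for k
  proof -
    obtain d where d: "\<And>i. d i \<in> Zz N" "x ^ k = (\<Sum>i<n. d i * x ^ i)" using pow[of k] by blast
    have "r ^ k = g (x ^ k)" using g(3)[of "r ^ k" 1] g(1) by (simp add: r of_rat_power)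
    also have "\<dots> = (\<Sum>i<n. g (of_rat (r ^ i) * d i))" unfolding d(2) gsum by (simp add: r of_rat_power mult.commute)
    also have "\<dots> = (\<Sum>i<n. r ^ i * g (d i))" unfolding g(3) ..
    finally have "of_int (b ^ n * D) * r ^ k = (\<Sum>i<n. of_int (b ^ n) * r ^ i * (of_int D * g (d i)))"
      by (simp add: sum_distrib_left mult_ac)
    also have "\<dots> \<in> \<int>"
    proof (rule Ints_sum, rule Ints_mult[OF _ DZ[OF d(1)]])
      fix i assume i: "i \<in> {..<n}"
      have "b ^ n = b ^ (n - i) * b ^ i" using i by (simp flip: power_add)
      then have "of_int (b ^ n) * r ^ i = of_int (b ^ (n - i)) * (of_int b * r) ^ i" by (simp add: power_mult_distrib)
      then show "of_int (b ^ n) * r ^ i \<in> \<int>" unfolding br by simp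
    qed
    finally show ?thesis .
  qed
  then have "r \<in> \<int>" using rat_bounded_denominators[of "b ^ n * D" r] D(1) ab(2) by auto
  then show ?thesis unfolding r by (auto elim!: Ints_cases)
qed

section \<open>Units in the function field\<close>

text \<open>The norm of h_(u,v) over G. G multiplies the index on the left, where it permutes the
  factors, which leaves the right side free for the action of SL2(Z).\<close>

definition Uf :: "nat \<Rightarrow> (int^2^2) set \<Rightarrow> int \<Rightarrow> int \<Rightarrow> int^2^2 \<Rightarrow> complex \<Rightarrow> complex" where
  "Uf N G u v A \<tau> = (\<Prod>g\<in>G. hfam N u v (g ** A) \<tau>)"

definition UX :: "nat \<Rightarrow> (int^2^2) set \<Rightarrow> int \<Rightarrow> int \<Rightarrow> int^2^2 \<Rightarrow> complex fls" where
  "UX N G u v A = (\<Prod>g\<in>G. hfamX N u v (g ** A))"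

lemma function_fieldD:
  assumes "f \<in> function_field N G" "g \<in> G"
  obtains \<gamma> \<sigma> where "\<gamma> \<in> SL2Z" "\<sigma> \<in> Gal_Q" "mat_mod N (diag1 (det g) ** \<gamma>) = mat_mod N g" "\<sigma> (zeta N) = zeta N powi det g"
  using assms unfolding function_field_def GL2_maps_def by blast

locale level_group =
  fixes N :: nat and G :: "(int^2^2) set"
  assumes N2: "N \<ge> 2" and sub: "subgroup G (GL2 N)"
begin

lemma N0: "N > 0" using N2 by simp

lemma G_mod: "g \<in> G \<Longrightarrow> mat_mod N g = g" and G_det: "g \<in> G \<Longrightarrow> coprime (det g) (int N)"
  using subgroup.subset[OF sub] by (auto simp: GL2_def)

lemma G_closed: "g \<in> G \<Longrightarrow> h \<in> G \<Longrightarrow> mat_mod N (g ** h) \<in> G"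
  using subgroup.m_closed[OF sub, of g h] by (simp add: GL2_def)

lemma G_one: "mat_mod N (mat 1) \<in> G"
  using subgroup.one_closed[OF sub] by (simp add: GL2_def)

lemma G_finite: "finite G"
  by (rule finite_subset[OF _ finite_mat_mod[OF N0]]) (use G_mod in auto)

lemma G_bij: "h \<in> G \<Longrightarrow> bij_betw (\<lambda>g. mat_mod N (g ** h)) G G"
  by (rule mult_right_bij[OF G_finite G_mod G_det G_closed])

lemma G_left_inverse:
  assumes "h \<in> G"
  obtains k where "k \<in> G" "mat_mod N (k ** h) = mat_mod N (mat 1)"
proof -
  have "mat_mod N (mat 1) \<in> (\<lambda>g. mat_mod N (g ** h)) ` G"
    unfolding bij_betw_imp_surj_on[OF G_bij[OF assms]] by (rule G_one)
  then show ?thesis by (rule imageE) (use that in simp)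
qed

lemma galfam_Uf: "galfam N (Uf N G u v) (UX N G u v)"
proof -
  have "galfam N (\<lambda>A \<tau>. \<Prod>g\<in>G. hfam N u v (g ** A) \<tau>) (\<lambda>A. \<Prod>g\<in>G. hfamX N u v (g ** A))"
    by (intro galfam_prod N0 galfam_mult_left galfam_hfam)
  then show ?thesis unfolding Uf_def[abs_def] UX_def[abs_def] .
qed

lemma Uf_left:
  assumes "h \<in> G" "\<tau> \<in> uhp"
  shows "Uf N G u v (h ** A) \<tau> = Uf N G u v A \<tau>"
proof -
  have "hfam N u v (g ** (h ** A)) \<tau> = hfam N u v (mat_mod N (g ** h) ** A) \<tau>" for g
    by (rule modfamD(1)[OF galfamD(1)[OF galfam_hfam[OF N0]] _ assms(2)]) (simp add: matrix_mul_assoc)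
  then have "Uf N G u v (h ** A) \<tau> = (\<Prod>g\<in>G. hfam N u v (mat_mod N (g ** h) ** A) \<tau>)" unfolding Uf_def by (simp only:)
  also have "\<dots> = Uf N G u v A \<tau>"
    unfolding Uf_def by (rule prod.reindex_bij_betw[OF G_bij[OF assms(1)], of "\<lambda>g. hfam N u v (g ** A) \<tau>"])
  finally show ?thesis .
qed

text \<open>The required lifts \<open>\<gamma>\<close> and automorphisms \<open>\<sigma>\<close> are taken from any element of the
  function field.\<close>

lemma galfam_in_function_field:
  assumes \<Phi>: "galfam N \<Phi> X" and inv: "\<And>g A \<tau>. g \<in> G \<Longrightarrow> \<tau> \<in> uhp \<Longrightarrow> \<Phi> (g ** A) \<tau> = \<Phi> A \<tau>"
    and f0: "f0 \<in> function_field N G"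
  shows "\<Phi> (mat 1) \<in> function_field N G"
proof -
  note F = modfamD[OF galfamD(1)[OF \<Phi>]]
  have FN: "\<Phi> A \<in> F_field N" for A
  proof -
    have "\<Phi> A analytic_on uhp" using F(3) analytic_on_open[OF open_uhp] by blast
    then have 1: "\<Phi> A nicely_meromorphic_on uhp" by (rule analytic_on_imp_nicely_meromorphic_on)
    have 2: "\<Phi> A (mob \<gamma> \<tau>) = \<Phi> A \<tau>" if "\<gamma> \<in> SL2Z" "mat_mod N \<gamma> = mat_mod N (mat 1)" "\<tau> \<in> uhp" for \<gamma> \<tau>
      unfolding F(2)[OF that(1,3)]
      by (rule F(1)[OF _ that(3)]) (use mat_mod_mult_cong[OF refl that(2), of A] in simp)
    have 3: "has_q_expansion N (\<lambda>\<tau>. \<Phi> A (mob \<gamma> \<tau>)) (X (A ** \<gamma>))" if "\<gamma> \<in> SL2Z" for \<gamma>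
      by (rule qexp_cong_uhp[OF F(4)]) (rule F(2)[OF that, symmetric])
    have "modular_fun N (\<Phi> A)" unfolding modular_fun_def using 1 2 3 by blast
    moreover have "\<forall>n. fls_nth (X A) n \<in> Q_zeta N" using F(5) Zz_subset_Q_zeta by blast
    ultimately show ?thesis unfolding F_field_def using F(4) by blast
  qed
  have "GL2_maps N g (\<Phi> (mat 1)) (\<Phi> (mat 1))" if g: "g \<in> G" for g
  proof -
    obtain \<gamma> \<sigma> where \<gamma>: "\<gamma> \<in> SL2Z" "mat_mod N (diag1 (det g) ** \<gamma>) = mat_mod N g"
      and \<sigma>: "\<sigma> \<in> Gal_Q" "\<sigma> (zeta N) = zeta N powi det g"
      using function_fieldD[OF f0 g] by metis
    have rel: "fls_nth (X (mat 1 ** diag1 (det g))) n = \<sigma> (fls_nth (X (mat 1)) n)" for n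
      by (rule fls_relD(2)[OF galfamD(2)[OF \<Phi> \<sigma>]])
    have h: "\<Phi> (mat 1) \<tau> = \<Phi> (mat 1 ** diag1 (det g)) (mob \<gamma> \<tau>)" if "\<tau> \<in> uhp" for \<tau>
    proof -
      have "\<Phi> (mat 1 ** diag1 (det g)) (mob \<gamma> \<tau>) = \<Phi> (mat 1 ** diag1 (det g) ** \<gamma>) \<tau>" by (rule F(2)[OF \<gamma>(1) that])
      also have "\<dots> = \<Phi> (g ** mat 1) \<tau>" by (rule F(1)[OF _ that]) (simp add: \<gamma>(2))
      also have "\<dots> = \<Phi> (mat 1) \<tau>" by (rule inv[OF g that])
      finally show ?thesis by simp
    qed
    show ?thesis unfolding GL2_maps_def
      by (rule bexI[OF _ \<gamma>(1)], rule bexI[OF _ \<sigma>(1)], rule bexI[OF _ FN[of "mat 1 ** diag1 (det g)"]],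
          rule exI[of _ "X (mat 1)"], rule exI[of _ "X (mat 1 ** diag1 (det g))"])
         (use \<gamma>(2) \<sigma>(2) F(4) rel h in blast)
  qed
  then show ?thesis unfolding function_field_def using FN by blast
qed

lemma mob_ext_one: "mob_ext (mat 1) p = p"
  by (cases p) auto

lemma Gamma_one: "mat 1 \<in> Gamma_of N G"
  by (simp add: Gamma_of_def G_one)

lemma Y_curve_point:
  assumes "P \<in> Y_curve N G"
  obtains \<tau> where "\<tau> \<in> uhp" "Pt \<tau> \<in> P" "j_at P = j_inv \<tau>"
proof -
  obtain p where p: "p \<in> uhp_bar" "P = orbit_rel N G `` {p}"
    using assms by (auto simp: Y_curve_def X_curve_def quotient_def)
  have "p \<notin> Pt ` \<rat> \<union> {I_inf}" using assms p by (auto simp: Y_curve_def cusps_def quotient_def)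
  then obtain \<tau> where \<tau>: "\<tau> \<in> uhp" "p = Pt \<tau>" using p(1) by (auto simp: uhp_bar_def)
  have mem: "Pt \<tau> \<in> P" using p \<tau> Gamma_one by (auto simp: orbit_rel_def mob_ext_one intro!: bexI[of _ "mat 1"])
  have jj: "j_inv \<tau>' = j_inv \<tau>" if "Pt \<tau>' \<in> P" for \<tau>'
  proof -
    have "(Pt \<tau>, Pt \<tau>') \<in> orbit_rel N G" using that p \<tau> by simp
    then have "\<exists>\<gamma>\<in>Gamma_of N G. mob_ext \<gamma> (Pt \<tau>) = Pt \<tau>'" unfolding orbit_rel_def by (simp only: mem_Collect_eq prod.case)
    then obtain \<gamma> where "\<gamma> \<in> Gamma_of N G" "mob_ext \<gamma> (Pt \<tau>) = Pt \<tau>'" by (rule bexE)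
    then have \<gamma>: "\<gamma> \<in> SL2Z" "mob_ext \<gamma> (Pt \<tau>) = Pt \<tau>'" by (simp_all add: Gamma_of_def)
    then have "\<tau>' = mob \<gamma> \<tau>" by (auto split: if_splits)
    then show ?thesis using j_invariant[OF \<gamma>(1) \<tau>(1)] by simp
  qed
  have "{j_inv \<tau> |\<tau>. Pt \<tau> \<in> P} = {j_inv \<tau>}"
  proof (intro equalityI subsetI)
    fix y assume "y \<in> {j_inv \<tau> |\<tau>. Pt \<tau> \<in> P}"
    then obtain \<tau>' where "y = j_inv \<tau>'" "Pt \<tau>' \<in> P" by blast
    then show "y \<in> {j_inv \<tau>}" using jj[of \<tau>'] by simp
  next
    fix y assume "y \<in> {j_inv \<tau>}"
    then show "y \<in> {j_inv \<tau> |\<tau>. Pt \<tau> \<in> P}" using mem by blast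
  qed
  then have "j_at P = j_inv \<tau>" unfolding j_at_def by simp
  then show ?thesis using that \<tau> mem by blast
qed

lemma rational_value:
  assumes "rational_point N G P" "f \<in> function_field N G" "\<tau> \<in> uhp" "Pt \<tau> \<in> P" "f holomorphic_on uhp"
  shows "f \<tau> \<in> \<rat>"
proof -
  have "isCont f \<tau>"
    using assms(3,5) open_uhp by (meson continuous_on_eq_continuous_at holomorphic_on_imp_continuous_on)
  then have "has_value f (Pt \<tau>) (f \<tau>)" unfolding has_value_def isCont_def using assms(3) by blast
  then show ?thesis using assms(1,2,4) unfolding rational_point_def has_value_at_def by blast
qed

lemma Uf_nonzero:
  assumes "\<tau> \<in> uhp" "A \<in> SL2Z" "\<not> (int N dvd u \<and> int N dvd v)"
  shows "Uf N G u v A \<tau> \<noteq> 0"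
proof -
  have "hfam N u v (g ** A) \<tau> \<noteq> 0" if g: "g \<in> G" for g
  proof -
    define B where "B = g ** A"
    have det: "coprime (det B) (int N)" using G_det[OF g] assms(2) by (simp add: B_def det_mul SL2Z_def)
    have "\<not> (int N dvd (u * B$1$1 + v * B$2$1) \<and> int N dvd (u * B$1$2 + v * B$2$2))"
    proof
      assume *: "int N dvd (u * B$1$1 + v * B$2$1) \<and> int N dvd (u * B$1$2 + v * B$2$2)"
      have "u * det B = B$2$2 * (u * B$1$1 + v * B$2$1) - B$2$1 * (u * B$1$2 + v * B$2$2)"
        by (simp add: det_2 algebra_simps)
      then have "int N dvd u * det B" using * by (simp add: dvd_diff dvd_mult)
      then have "int N dvd u" using det by (simp add: coprime_commute coprime_dvd_mult_left_iff)
      have "v * det B = B$1$1 * (u * B$1$2 + v * B$2$2) - B$1$2 * (u * B$1$1 + v * B$2$1)"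
        by (simp add: det_2 algebra_simps)
      then have "int N dvd v * det B" using * by (simp add: dvd_diff dvd_mult)
      then have "int N dvd v" using det by (simp add: coprime_commute coprime_dvd_mult_left_iff)
      with \<open>int N dvd u\<close> show False using assms(3) by blast
    qed
    then show ?thesis unfolding hfam_def[OF N0] B_def[symmetric] by (rule hh_nonzero[OF N0 assms(1)])
  qed
  then show ?thesis unfolding Uf_def using G_finite by simp
qed

lemma modfam_rational_integral:
  assumes \<Phi>: "modfam N (Zz N) \<Phi> X" and \<tau>: "\<tau> \<in> uhp" and j: "j_inv \<tau> \<in> \<int>" and rat: "\<Phi> (mat 1) \<tau> \<in> \<rat>"
  shows "\<Phi> (mat 1) \<tau> \<in> \<int>"
proof (rule modfam_integral[OF N0 \<Phi> \<tau> j])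
  fix p assume p: "\<And>i. coeff p i \<in> Zz N" "lead_coeff p = 1" "poly p (\<Phi> (mat 1) \<tau>) = 0"
  show "\<Phi> (mat 1) \<tau> \<in> \<int>" by (rule rational_integral[OF N0 p rat])
qed

text \<open>U is rational at a rational point because it lies in the function field, and it is
  integral over Z[zeta_N] where j is an integer; a rational number with that property is an integer.
  The same argument is applied to the complementary factor W.\<close>

lemma Uf_integer:
  assumes P: "rational_point N G P" and f0: "f0 \<in> function_field N G" and \<tau>: "\<tau> \<in> uhp" "Pt \<tau> \<in> P" and j: "j_inv \<tau> \<in> \<int>"
  shows "Uf N G u v (mat 1) \<tau> \<in> \<int>" "of_nat N ^ (12 * N * card G) * inverse (Uf N G u v (mat 1) \<tau>) \<in> \<int>"
proof -
  have ff: "Uf N G u v (mat 1) \<in> function_field N G"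
    by (rule galfam_in_function_field[where \<Phi> = "Uf N G u v", OF galfam_Uf _ f0]) (rule Uf_left)
  have hol: "Uf N G u v (mat 1) holomorphic_on uhp" by (rule modfamD(3)[OF galfamD(1)[OF galfam_Uf[of u v]]])
  have rat: "Uf N G u v (mat 1) \<tau> \<in> \<rat>" by (rule rational_value[OF P ff \<tau> hol])
  show "Uf N G u v (mat 1) \<tau> \<in> \<int>"
    by (rule modfam_rational_integral[where \<Phi> = "Uf N G u v", OF galfamD(1)[OF galfam_Uf] \<tau>(1) j rat])
  define W where "W = (\<lambda>A \<tau>. \<Prod>g\<in>G. of_nat N ^ (12 * N) * inverse (hfam N u v (g ** A) \<tau>))"
  define Y where "Y = (\<lambda>A. \<Prod>g\<in>G. fls_const (of_nat N ^ (12 * N)) * inverse (hfamX N u v (g ** A)))"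
  have mW: "modfam N (Zz N) W Y"
    unfolding W_def Y_def
    by (rule modfam_prod[OF N0 subring_Zz])
       (rule modfam_mult_left[OF modfam_inverse_hfam[OF N0]])
  have "W (mat 1) \<tau> = (of_nat N ^ (12 * N)) ^ card G * inverse (Uf N G u v (mat 1) \<tau>)"
    unfolding W_def Uf_def prod.distrib prod_constant prod_inversef[symmetric] comp_def ..
  then have W: "W (mat 1) \<tau> = of_nat N ^ (12 * N * card G) * inverse (Uf N G u v (mat 1) \<tau>)"
    unfolding power_mult .
  \<comment> \<open>The rationality of W is inherited from U, of which it is a constant times the
    inverse; only integrality uses that W is a family of its own.\<close>
  have "W (mat 1) \<tau> \<in> \<rat>" unfolding W by (rule Rats_mult[OF Rats_power[OF Rats_of_nat] Rats_inverse[OF rat]])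
  then show "of_nat N ^ (12 * N * card G) * inverse (Uf N G u v (mat 1) \<tau>) \<in> \<int>"
    using modfam_rational_integral[where \<Phi> = W, OF mW \<tau>(1) j] unfolding W by blast
qed

end

section \<open>Fourier analysis of the orders at the cusps\<close>

lemma zeta_add: "zeta N powi (s + t) = zeta N powi s * zeta N powi t"
  by (rule power_int_add) simp

lemma zeta_orthogonal:
  assumes N: "N > 0"
  shows "(\<Sum>a<N. zeta N powi (int a * t)) = (if int N dvd t then of_nat N else 0)"
proof -
  have p: "zeta N powi (int a * t) = (zeta N powi t) ^ a" for a
    by (simp add: power_int_power' mult.commute)
  show ?thesis
  proof (cases "int N dvd t")
    case True
    then have "zeta N powi t = 1" using zeta_powi_eq_1_iff[OF N] by blast
    then show ?thesis using True by (simp add: p)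
  next
    case False
    then have "zeta N powi t \<noteq> 1" using zeta_powi_eq_1_iff[OF N] by blast
    moreover have "(zeta N powi t) ^ N = 1" unfolding p[symmetric] using zeta_powi_eq_1_iff[OF N] by simp
    ultimately show ?thesis using False unfolding p by (simp add: geometric_sum)
  qed
qed

lemma bq_mod: "bq N (t mod int N) = bq N t" "bq N (t + int N) = bq N t"
  by (simp_all add: bq_def)

definition bhat :: "nat \<Rightarrow> nat \<Rightarrow> complex" where
  "bhat N k = (\<Sum>t<N. of_int (bq N (int t)) * zeta N powi (- (int t * int k))) / of_nat N"

lemma bhat_inversion:
  assumes N: "N > 0"
  shows "(\<Sum>k<N. bhat N k * zeta N powi (int k * t)) = of_int (bq N t)"
proof -
  define r where "r = nat (t mod int N)"
  have r: "int r = t mod int N" "r < N" using N by (simp_all add: r_def nat_less_iff)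
  have "(\<Sum>k<N. bhat N k * zeta N powi (int k * t)) =
      (\<Sum>k<N. \<Sum>s<N. of_int (bq N (int s)) / of_nat N * zeta N powi (int k * (t - int s)))"
    unfolding bhat_def sum_divide_distrib sum_distrib_right
    by (intro sum.cong refl) (simp add: right_diff_distrib mult_ac flip: zeta_add)
  also have "\<dots> = (\<Sum>s<N. of_int (bq N (int s)) / of_nat N * (\<Sum>k<N. zeta N powi (int k * (t - int s))))"
    unfolding sum_distrib_left by (rule sum.swap)
  also have "\<dots> = (\<Sum>s<N. if s = r then of_int (bq N (int s)) else 0)"
  proof (rule sum.cong[OF refl])
    fix s assume "s \<in> {..<N}"
    then have s: "int s mod int N = int s" by simp
    have "int N dvd t - int s \<longleftrightarrow> t mod int N = int s mod int N" by (simp add: mod_eq_dvd_iff)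
    also have "\<dots> \<longleftrightarrow> s = r" unfolding s r(1)[symmetric] by auto
    finally show "of_int (bq N (int s)) / of_nat N * (\<Sum>k<N. zeta N powi (int k * (t - int s))) =
        (if s = r then of_int (bq N (int s)) else 0)"
      unfolding zeta_orthogonal[OF N] using N by simp
  qed
  also have "\<dots> = of_int (bq N (int r))" using r(2) by simp
  finally show ?thesis unfolding r(1) bq_mod .
qed

lemma bhat_0: "N > 0 \<Longrightarrow> bhat N 0 = 1"
proof -
  assume N: "N > 0"
  \<comment> \<open>Separating the number n of summands from the modulus m makes the closed form
    accessible to induction; it is used with n = m = N.\<close>
  have s: "(\<Sum>t<n. 6 * (int t)\<^sup>2 - 6 * int t * m + m\<^sup>2) = int n * (int n - 1) * (2 * int n - 1) - 3 * m * int n * (int n - 1) + m\<^sup>2 * int n" for n m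
    by (induction n) (simp_all add: algebra_simps power2_eq_square)
  have "(\<Sum>t<N. bq N (int t)) = (\<Sum>t<N. 6 * (int t)\<^sup>2 - 6 * int t * int N + (int N)\<^sup>2)"
    by (intro sum.cong) (simp_all add: bq_def)
  also have "\<dots> = int N" unfolding s by (simp add: algebra_simps power2_eq_square)
  finally have "of_int (\<Sum>t<N. bq N (int t)) = (of_int (int N) :: complex)" by simp
  then show ?thesis using N by (simp add: bhat_def)
qed

lemma sum_shift_periodic:
  fixes F :: "int \<Rightarrow> complex"
  assumes "\<And>t. F (t + int N) = F t"
  shows "(\<Sum>t<N. F (int t + 1)) = (\<Sum>t<N. F (int t))" "(\<Sum>t<N. F (int t - 1)) = (\<Sum>t<N. F (int t))"
proof -
  have *: "(\<Sum>t<N. H (int t + 1)) = (\<Sum>t<N. H (int t))" if "\<And>t. H (t + int N) = H t" for H :: "int \<Rightarrow> complex"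
  proof -
    have "(\<Sum>t<N. H (int t + 1)) + H 0 = (\<Sum>t<Suc N. H (int t))" unfolding sum.lessThan_Suc_shift by (simp add: add_ac)
    also have "\<dots> = (\<Sum>t<N. H (int t)) + H 0" using that[of 0] by simp
    finally show ?thesis by simp
  qed
  show "(\<Sum>t<N. F (int t + 1)) = (\<Sum>t<N. F (int t))" by (rule *) (rule assms)
  have "(\<Sum>t<N. (\<lambda>t. F (t - 1)) (int t + 1)) = (\<Sum>t<N. (\<lambda>t. F (t - 1)) (int t))"
  proof (rule *)
    fix t show "F (t + int N - 1) = F (t - 1)" using assms[of "t - 1"] by (simp only: diff_add_eq)
  qed
  then show "(\<Sum>t<N. F (int t - 1)) = (\<Sum>t<N. F (int t))" by simp
qed

text \<open>On one period \<open>bq\<close> is a quadratic polynomial; the periodic continuation has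
  a corner at 0, and this corner is all that its nontrivial Fourier coefficients see.\<close>

lemma bq_second_difference:
  assumes N: "N \<ge> 2" and t: "t < N"
  shows "2 * bq N (int t) - bq N (int t + 1) - bq N (int t - 1) = (if t = 0 then 12 * int N else 0) - 12"
proof -
  have e: "bq N r = 6 * r\<^sup>2 - 6 * r * int N + (int N)\<^sup>2" if "0 \<le> r" "r \<le> int N" for r
    using that by (cases "r = int N") (auto simp: bq_def power2_eq_square)
  show ?thesis
  proof (cases "t = 0")
    case True
    have "bq N (-1) = bq N (int N - 1)" using bq_mod(2)[of N "-1"] by simp
    then show ?thesis using True N by (simp add: e power2_eq_square algebra_simps)
  next
    case False
    then show ?thesis using t by (simp add: e power2_eq_square algebra_simps)
  qed
qed

text \<open>With z = zeta_N^k, shifting the summation index shows that (2 - z - 1/z) times the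
  Fourier sum is the Fourier sum of the second difference. That equals 12 N from the corner, since
  the constant -12 contributes nothing for k \<noteq> 0. The value is 3/sin^2(pi k/N).\<close>

lemma bhat_eq:
  assumes N: "N \<ge> 2" and k: "0 < k" "k < N"
  shows "bhat N k = of_real (6 / (1 - cos (2 * pi * real k / real N)))" "cos (2 * pi * real k / real N) < 1"
proof -
  define z where "z = zeta N powi int k"
  define x where "x = 2 * pi * real k / real N"
  have N0: "N > 0" using N by simp
  have zc: "z = cis x"
    unfolding z_def zeta_powi x_def cis_conv_exp ee_def by (simp add: algebra_simps)
  have z0: "z \<noteq> 0" by (simp add: z_def)
  have iz: "inverse z = cis (- x)" by (simp add: zc)
  have z1: "z \<noteq> 1"
    unfolding z_def zeta_powi_eq_1_iff[OF N0] using k by (auto dest: zdvd_imp_le)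
  define c where "c = (\<lambda>t :: int. zeta N powi (- (t * int k)))"
  have c1: "c (t + 1) = c t * inverse z" "c (t - 1) = c t * z" for t
  proof -
    have "c (t + 1) = zeta N powi (- (t * int k) + (- int k))" by (simp add: c_def algebra_simps)
    also have "\<dots> = c t * inverse z" unfolding zeta_add c_def z_def power_int_minus ..
    finally show "c (t + 1) = c t * inverse z" .
    have "c (t - 1) = zeta N powi (- (t * int k) + int k)" by (simp add: c_def algebra_simps)
    also have "\<dots> = c t * z" unfolding zeta_add c_def z_def ..
    finally show "c (t - 1) = c t * z" .
  qed
  have cN: "c (t + int N) = c t" for t
  proof -
    have "c (t + int N) = zeta N powi (- (t * int k) + int N * (- int k))" by (simp add: c_def algebra_simps)
    also have "\<dots> = c t" unfolding zeta_add c_def using zeta_powi_eq_1_iff[OF N0, of "int N * - int k"] by simp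
    finally show ?thesis .
  qed
  define F where "F = (\<lambda>t. of_int (bq N t) * c t)"
  define S where "S = (\<Sum>t<N. F (int t))"
  have FN: "F (t + int N) = F t" for t by (simp add: F_def cN bq_mod)
  note sh = sum_shift_periodic[of F, OF FN]
  have "(\<Sum>t<N. of_int (bq N (int t + 1)) * c (int t)) = z * (\<Sum>t<N. F (int t + 1))"
    unfolding sum_distrib_left by (intro sum.cong) (simp_all add: F_def c1 z0)
  then have s1: "(\<Sum>t<N. of_int (bq N (int t + 1)) * c (int t)) = z * S" unfolding sh S_def .
  have "(\<Sum>t<N. of_int (bq N (int t - 1)) * c (int t)) = inverse z * (\<Sum>t<N. F (int t - 1))"
    unfolding sum_distrib_left by (intro sum.cong) (simp_all add: F_def c1 z0)
  then have s2: "(\<Sum>t<N. of_int (bq N (int t - 1)) * c (int t)) = inverse z * S" unfolding sh S_def .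
  have "(\<Sum>t<N. of_int (2 * bq N (int t) - bq N (int t + 1) - bq N (int t - 1)) * c (int t)) =
      2 * S - (\<Sum>t<N. of_int (bq N (int t + 1)) * c (int t)) - (\<Sum>t<N. of_int (bq N (int t - 1)) * c (int t))"
    unfolding S_def F_def sum_distrib_left sum_subtractf[symmetric]
    by (intro sum.cong) (simp_all add: algebra_simps)
  then have "2 * S - z * S - inverse z * S = (\<Sum>t<N. of_int (2 * bq N (int t) - bq N (int t + 1) - bq N (int t - 1)) * c (int t))"
    unfolding s1 s2 by (rule sym)
  also have "\<dots> = (\<Sum>t<N. (if t = 0 then 12 * of_nat N else 0) - 12 * c (int t))"
  proof (rule sum.cong[OF refl])
    fix t assume "t \<in> {..<N}"
    then have t: "t < N" by simp
    show "of_int (2 * bq N (int t) - bq N (int t + 1) - bq N (int t - 1)) * c (int t) = (if t = 0 then 12 * of_nat N else 0) - 12 * c (int t)"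
      unfolding bq_second_difference[OF N t] by (simp add: algebra_simps) (simp add: c_def)
  qed
  also have "\<dots> = 12 * of_nat N - 12 * (\<Sum>t<N. c (int t))"
    using N0 by (simp add: sum_subtractf sum_distrib_left)
  also have "(\<Sum>t<N. c (int t)) = (\<Sum>t<N. zeta N powi (int t * (- int k)))" by (simp add: c_def)
  also have "\<dots> = 0" unfolding zeta_orthogonal[OF N0] using k by (auto dest: zdvd_imp_le)
  finally have eq: "(2 - (z + inverse z)) * S = 12 * of_nat N" by (simp add: algebra_simps)
  have "z + inverse z = of_real (2 * cos x)" unfolding iz zc by (simp add: complex_eq_iff)
  then have eq2: "of_real (2 * (1 - cos x)) * S = 12 * of_nat N" using eq by (simp add: algebra_simps)
  have "cos x \<noteq> 1"
  proof
    assume "cos x = 1"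
    then have "of_nat N = (0 :: complex)" using eq2 by simp
    then show False using N0 by simp
  qed
  then show c: "cos (2 * pi * real k / real N) < 1" unfolding x_def using cos_le_one[of "2 * pi * real k / real N"] by linarith
  have "bhat N k = S / of_nat N" by (simp add: bhat_def S_def F_def c_def)
  also have "\<dots> = of_real (6 / (1 - cos x))"
  proof -
    have "(1 - cos x) \<noteq> 0" using c by (simp add: x_def)
    then have "complex_of_real (1 - cos x) \<noteq> 0" unfolding of_real_eq_0_iff .
    moreover have "of_real (1 - cos x) * S = 6 * of_nat N"
      using eq2 unfolding of_real_mult by (simp del: of_real_diff add: mult.commute)
    ultimately show ?thesis using N0 by (simp add: field_simps del: of_real_diff)
  qed
  finally show "bhat N k = of_real (6 / (1 - cos (2 * pi * real k / real N)))" by (simp add: x_def)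
qed

text \<open>By inversion at 0 all coefficients add up to \<open>bq N 0\<close>, which is N^2, so it
  is enough that the indices 1 and N - 1 carry more than half of it. For N > 2, 1 - cos x <= x^2/2
  and pi^2 < 10 give each of them more than 3/10 of N^2.\<close>

lemma bhat_dominant:
  assumes N: "N \<ge> 2"
  obtains \<beta> :: "nat \<Rightarrow> real" where "\<And>k. k < N \<Longrightarrow> bhat N k = of_real (\<beta> k)" "\<And>k. k < N \<Longrightarrow> \<beta> k > 0"
    "(\<Sum>k\<in>{k. 0 < k \<and> k < N} - {1, N - 1}. \<beta> k) < (\<Sum>k\<in>{1, N - 1}. \<beta> k)"
proof -
  define \<beta> where "\<beta> = (\<lambda>k :: nat. if k = 0 then 1 else 6 / (1 - cos (2 * pi * real k / real N)))"
  have N0: "N > 0" using N by simp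
  have b: "bhat N k = of_real (\<beta> k)" if "k < N" for k
    using that bhat_eq(1)[OF N, of k] bhat_0[OF N0] by (cases "k = 0") (simp_all add: \<beta>_def)
  have pos: "\<beta> k > 0" if "k < N" for k
    using that bhat_eq(2)[OF N, of k] by (cases "k = 0") (simp_all add: \<beta>_def)
  have "(\<Sum>k<N. bhat N k * zeta N powi (int k * 0)) = of_int (bq N 0)" by (rule bhat_inversion[OF N0])
  then have "(\<Sum>k<N. complex_of_real (\<beta> k)) = of_real ((real N)\<^sup>2)" by (simp add: b bq_def)
  then have tot: "(\<Sum>k<N. \<beta> k) = (real N)\<^sup>2" unfolding of_real_sum[symmetric] of_real_eq_iff .
  have "{..<N} = insert 0 {k. 0 < k \<and> k < N}" using N0 by auto
  then have tot': "(\<Sum>k<N. \<beta> k) = 1 + (\<Sum>k\<in>{k. 0 < k \<and> k < N}. \<beta> k)" by (simp add: \<beta>_def)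
  have "finite {k. 0 < k \<and> k < N}" by simp
  moreover have "{1, N - 1} \<subseteq> {k. 0 < k \<and> k < N}" using N by auto
  ultimately have split: "(\<Sum>k\<in>{k. 0 < k \<and> k < N}. \<beta> k) = (\<Sum>k\<in>{k. 0 < k \<and> k < N} - {1, N - 1}. \<beta> k) + (\<Sum>k\<in>{1, N - 1}. \<beta> k)"
    by (rule sum.subset_diff[rotated])
  have "(real N)\<^sup>2 < 2 * (\<Sum>k\<in>{1, N - 1}. \<beta> k)"
  \<comment> \<open>For N = 2 the indices 1 and N - 1 coincide, and the single coefficient 3 is
    compared with 4 directly.\<close>
  proof (cases "N = 2")
    case True
    then show ?thesis by (simp add: \<beta>_def)
  next
    case False
    define x where "x = 2 * pi / real N"
    have x: "x > 0" using N0 by (simp add: x_def)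
    have "cos (2 * pi * real (N - 1) / real N) = cos (2 * pi - x)"
      using N by (intro arg_cong[of _ _ cos]) (simp add: x_def field_simps)
    then have c: "cos (2 * pi * real (N - 1) / real N) = cos x" by (simp add: cos_diff)
    have "cos x < 1" using bhat_eq(2)[OF N, of 1] N by (simp add: x_def)
    have "1 - cos x \<le> x\<^sup>2 / 2"
    proof -
      have "cos x = 1 - 2 * (sin (x / 2))\<^sup>2" using cos_double_sin[of "x / 2"] by simp
      moreover have "(sin (x / 2))\<^sup>2 \<le> (x / 2)\<^sup>2" using abs_sin_x_le_abs_x[of "x / 2"] abs_le_square_iff by blast
      ultimately show ?thesis by (simp add: power_divide)
    qed
    also have "\<dots> = 2 * pi\<^sup>2 / (real N)\<^sup>2" by (simp add: x_def power_divide power_mult_distrib)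
    also have "\<dots> < 20 / (real N)\<^sup>2"
    proof -
      have "pi < 3.15" using pi_approx by simp
      then have "pi * pi < 3.15 * 3.15" using pi_gt_zero by (intro mult_strict_mono) simp_all
      then show ?thesis using N0 by (simp add: power2_eq_square divide_strict_right_mono)
    qed
    finally have le: "1 - cos x < 20 / (real N)\<^sup>2" .
    have "6 / (20 / (real N)\<^sup>2) < 6 / (1 - cos x)" using le \<open>cos x < 1\<close> N0
      by (intro divide_strict_left_mono) auto
    then have "0.3 * (real N)\<^sup>2 < 6 / (1 - cos x)" by simp
    moreover have "\<beta> 1 = 6 / (1 - cos x)" "\<beta> (N - 1) = 6 / (1 - cos x)" using N c by (simp_all add: \<beta>_def x_def)
    moreover have "(\<Sum>k\<in>{1, N - 1}. \<beta> k) = \<beta> 1 + \<beta> (N - 1)" using N False by (subst sum.insert) auto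
    moreover have "(real N)\<^sup>2 > 0" using N0 by simp
    ultimately show ?thesis by linarith
  qed
  then have "(\<Sum>k\<in>{k. 0 < k \<and> k < N} - {1, N - 1}. \<beta> k) < (\<Sum>k\<in>{1, N - 1}. \<beta> k)"
    using tot tot' split by linarith
  then show ?thesis using that[of \<beta>] b pos by blast
qed

text \<open>Fourier transform on (Z/N)^2 of the function (a, b) -> sum of bq(a x_g + b y_g). By
  hypothesis this function is supported at 0, with value |G| N^2, so its transform is constant.
  Expanding bq in its own Fourier series evaluates the transform at (s, t) as a weighted count of
  the solutions of k (x_g, y_g) = (s, t).\<close>

lemma count_identity:
  fixes x y :: "'g \<Rightarrow> int"
  assumes N: "N > 0" and fin: "finite G"
    and H: "\<And>a b. \<not> (int N dvd a \<and> int N dvd b) \<Longrightarrow> (\<Sum>g\<in>G. bq N (a * x g + b * y g)) = 0"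
  shows "(\<Sum>k<N. bhat N k * of_nat (card {g\<in>G. int N dvd int k * x g - s \<and> int N dvd int k * y g - t})) = of_nat (card G)"
proof -
  define T where "T = (\<Sum>a<N. \<Sum>b<N. (\<Sum>g\<in>G. complex_of_int (bq N (int a * x g + int b * y g))) * zeta N powi (- (int a * s + int b * t)))"
  have "T = (\<Sum>a<N. \<Sum>b<N. if a = 0 then if b = 0 then of_nat (card G) * of_nat N ^ 2 else 0 else 0)"
    unfolding T_def
  proof (intro sum.cong refl)
    fix a b assume ab: "a \<in> {..<N}" "b \<in> {..<N}"
    show "(\<Sum>g\<in>G. complex_of_int (bq N (int a * x g + int b * y g))) * zeta N powi (- (int a * s + int b * t)) =
      (if a = 0 then if b = 0 then of_nat (card G) * of_nat N ^ 2 else 0 else 0)"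
    proof (cases "a = 0 \<and> b = 0")
      case True
      then show ?thesis by (simp add: bq_def)
    next
      case False
      then have "\<not> (int N dvd int a \<and> int N dvd int b)" using ab by (auto dest!: zdvd_imp_le)
      then have "(\<Sum>g\<in>G. complex_of_int (bq N (int a * x g + int b * y g))) = 0"
        using H[of "int a" "int b"] unfolding of_int_sum[symmetric] by simp
      then show ?thesis using False by auto
    qed
  qed
  also have "\<dots> = (\<Sum>a<N. if a = 0 then of_nat (card G) * of_nat N ^ 2 else 0)"
  proof (rule sum.cong[OF refl])
    fix a show "(\<Sum>b<N. if a = 0 then if b = 0 then of_nat (card G) * of_nat N ^ 2 else 0 else 0) =
      (if a = 0 then of_nat (card G) * of_nat N ^ 2 else (0 :: complex))"
      using N by (cases "a = 0") simp_all
  qed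
  finally have T1: "T = of_nat (card G) * of_nat N ^ 2" using N by simp
  have "T = (\<Sum>a<N. \<Sum>b<N. \<Sum>g\<in>G. \<Sum>k<N. bhat N k * (zeta N powi (int a * (int k * x g - s)) * zeta N powi (int b * (int k * y g - t))))"
    unfolding T_def bhat_inversion[OF N, symmetric] sum_distrib_right
    by (intro sum.cong refl) (simp add: mult.assoc flip: zeta_add, simp add: algebra_simps)
  also have "\<dots> = (\<Sum>a<N. \<Sum>g\<in>G. \<Sum>b<N. \<Sum>k<N. bhat N k * (zeta N powi (int a * (int k * x g - s)) * zeta N powi (int b * (int k * y g - t))))"
    by (rule sum.cong[OF refl], rule sum.swap)
  also have "\<dots> = (\<Sum>g\<in>G. \<Sum>a<N. \<Sum>b<N. \<Sum>k<N. bhat N k * (zeta N powi (int a * (int k * x g - s)) * zeta N powi (int b * (int k * y g - t))))"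
    by (rule sum.swap)
  also have "\<dots> = (\<Sum>g\<in>G. \<Sum>a<N. \<Sum>k<N. \<Sum>b<N. bhat N k * (zeta N powi (int a * (int k * x g - s)) * zeta N powi (int b * (int k * y g - t))))"
    by (rule sum.cong[OF refl], rule sum.cong[OF refl], rule sum.swap)
  also have "\<dots> = (\<Sum>g\<in>G. \<Sum>k<N. \<Sum>a<N. \<Sum>b<N. bhat N k * (zeta N powi (int a * (int k * x g - s)) * zeta N powi (int b * (int k * y g - t))))"
    by (rule sum.cong[OF refl], rule sum.swap)
  also have "\<dots> = (\<Sum>k<N. \<Sum>g\<in>G. \<Sum>a<N. \<Sum>b<N. bhat N k * (zeta N powi (int a * (int k * x g - s)) * zeta N powi (int b * (int k * y g - t))))"
    by (rule sum.swap)
  also have "\<dots> = (\<Sum>k<N. \<Sum>g\<in>G. bhat N k * ((\<Sum>a<N. zeta N powi (int a * (int k * x g - s))) * (\<Sum>b<N. zeta N powi (int b * (int k * y g - t)))))"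
    unfolding sum_product unfolding sum_distrib_left ..
  also have "\<dots> = (\<Sum>k<N. \<Sum>g\<in>G. bhat N k * (if int N dvd int k * x g - s \<and> int N dvd int k * y g - t then of_nat N ^ 2 else 0))"
    unfolding zeta_orthogonal[OF N] by (intro sum.cong refl) (simp add: power2_eq_square)
  also have "\<dots> = (\<Sum>k<N. bhat N k * of_nat (card {g\<in>G. int N dvd int k * x g - s \<and> int N dvd int k * y g - t})) * of_nat N ^ 2"
    unfolding sum_distrib_left[symmetric] sum_distrib_right
    by (intro sum.cong refl) (simp add: fin sum.If_cases Int_def)
  finally show ?thesis using N unfolding T1 by simp
qed

text \<open>The coefficients \<open>bhat N (\<plusminus>1)\<close> outweigh all other nontrivial ones, so the identity
  above at a vector hit by no element and at one hit most often are incompatible.\<close>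

lemma fourier_transitive:
  fixes x y :: "'g \<Rightarrow> int"
  assumes N: "N \<ge> 2" and fin: "finite G" "G \<noteq> {}"
    and neg: "\<And>s t. card {g\<in>G. int N dvd - x g - s \<and> int N dvd - y g - t} = card {g\<in>G. int N dvd x g - s \<and> int N dvd y g - t}"
    and H: "\<And>a b. \<not> (int N dvd a \<and> int N dvd b) \<Longrightarrow> (\<Sum>g\<in>G. bq N (a * x g + b * y g)) = 0"
    and prim: "gcd (gcd s t) (int N) = 1"
  shows "\<exists>g\<in>G. int N dvd x g - s \<and> int N dvd y g - t"
proof (rule ccontr)
  assume no: "\<not> (\<exists>g\<in>G. int N dvd x g - s \<and> int N dvd y g - t)"
  have N0: "N > 0" using N by simp
  define d where "d = (\<lambda>(k :: int) s t. card {g\<in>G. int N dvd k * x g - s \<and> int N dvd k * y g - t})"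
  obtain \<beta> :: "nat \<Rightarrow> real" where \<beta>: "\<And>k. k < N \<Longrightarrow> bhat N k = of_real (\<beta> k)" "\<And>k. k < N \<Longrightarrow> \<beta> k > 0"
    "(\<Sum>k\<in>{k. 0 < k \<and> k < N} - {1, N - 1}. \<beta> k) < (\<Sum>k\<in>{1, N - 1}. \<beta> k)"
    using bhat_dominant[OF N] by metis
  have id: "(\<Sum>k<N. \<beta> k * real (d (int k) s t)) = real (card G)" for s t
  proof -
    have "(\<Sum>k<N. complex_of_real (\<beta> k) * of_nat (d (int k) s t)) = of_nat (card G)"
      using count_identity[OF N0 fin(1) H, of s t] by (simp add: \<beta>(1) d_def)
    then have "complex_of_real (\<Sum>k<N. \<beta> k * real (d (int k) s t)) = of_real (real (card G))" by simp
    then show ?thesis unfolding of_real_eq_iff .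
  qed
  have dle: "d k s t \<le> card G" for k s t unfolding d_def by (rule card_mono[OF fin(1)]) blast
  have "\<exists>p. True \<and> (\<forall>p'. True \<longrightarrow> (case p' of (s, t) \<Rightarrow> d 1 s t) \<le> (case p of (s, t) \<Rightarrow> d 1 s t))"
    by (rule ex_has_greatest_nat[of _ "(0, 0)" _ "Suc (card G)"]) (auto simp: dle less_Suc_eq_le)
  then obtain s1 t1 where max: "\<And>s t. d 1 s t \<le> d 1 s1 t1" by fastforce
  define M where "M = d 1 s1 t1"
  obtain g0 where g0: "g0 \<in> G" using fin(2) by blast
  have "card {g0} \<le> d 1 (x g0) (y g0)" unfolding d_def by (rule card_mono) (use fin g0 in auto)
  then have M1: "M \<ge> 1" using max[of "x g0" "y g0"] by (simp add: M_def)
  \<comment> \<open>Index N - 1 stands for -1, and by the symmetry \<open>neg\<close> it counts as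
    often as index 1.\<close>
  have N1: "int N dvd int (N - 1) * z - u \<longleftrightarrow> int N dvd - z - u" for z u
  proof -
    have "int (N - 1) * z - u = (- z - u) + int N * z" using N0 by (simp add: of_nat_diff algebra_simps)
    then show ?thesis by (simp only: dvd_add_left_iff[OF dvd_triv_left])
  qed
  have dN1: "d (int (N - 1)) s t = d 1 s t" for s t
    unfolding d_def N1 using neg[of s t] by simp
  have d10: "d 1 s t = 0" unfolding d_def using no by (simp add: fin)
  have d0: "d 0 s t = 0"
  proof -
    have "\<not> (int N dvd - s \<and> int N dvd - t)"
    proof
      assume "int N dvd - s \<and> int N dvd - t"
      then have "int N dvd gcd (gcd s t) (int N)" by simp
      then have "int N dvd 1" unfolding prim .
      then show False using N by simp
    qed
    then have "{g\<in>G. int N dvd 0 * x g - s \<and> int N dvd 0 * y g - t} = {}" by simp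
    then show ?thesis unfolding d_def by (simp only: card.empty)
  qed
  \<comment> \<open>As (s, t) is primitive, a multiple k (x_g, y_g) can hit it only for a unit k;
    dividing by k gives a count for the multiplier 1, which M bounds.\<close>
  have dM: "d k s t \<le> M" for k
  proof (cases "\<exists>g\<in>G. int N dvd k * x g - s \<and> int N dvd k * y g - t")
    case False
    then have "{g\<in>G. int N dvd k * x g - s \<and> int N dvd k * y g - t} = {}" by blast
    then have "d k s t = 0" unfolding d_def by (simp only: card.empty)
    then show ?thesis by simp
  next
    case True
    then obtain g where g: "int N dvd k * x g - s" "int N dvd k * y g - t" by blast
    have "coprime k (int N)"
    proof (rule coprimeI)
      fix c assume c: "c dvd k" "c dvd int N"
      have "c dvd s" using dvd_diff[OF dvd_mult2[OF c(1), of "x g"] dvd_trans[OF c(2) g(1)]] by simp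
      moreover have "c dvd t" using dvd_diff[OF dvd_mult2[OF c(1), of "y g"] dvd_trans[OF c(2) g(2)]] by simp
      ultimately have "c dvd gcd (gcd s t) (int N)" using c by simp
      then show "is_unit c" unfolding prim .
    qed
    then obtain k' where "[k * k' = 1] (mod int N)" using cong_solve_coprime_int by blast
    then have k': "int N dvd k * k' - 1" by (simp add: cong_iff_dvd_diff)
    have sub: "int N dvd z - k' * u" if "int N dvd k * z - u" for z u
    proof -
      have "z - k' * u = k' * (k * z - u) - z * (k * k' - 1)" by (simp add: algebra_simps)
      then show ?thesis using dvd_diff[OF dvd_mult[OF that] dvd_mult[OF k']] by (simp only:)
    qed
    have "d k s t \<le> d 1 (k' * s) (k' * t)" unfolding d_def
      by (rule card_mono) (use fin sub in simp, use sub in \<open>simp add: subset_iff\<close>)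
    also have "\<dots> \<le> M" unfolding M_def by (rule max)
    finally show ?thesis .
  qed
  define U where "U = {1, N - 1}"
  define V where "V = {k. 0 < k \<and> k < N} - {1, N - 1}"
  have UV: "{..<N} = insert 0 (U \<union> V)" "finite U" "finite V" "U \<inter> V = {}" "0 \<notin> U \<union> V" "U \<subseteq> {..<N}" "V \<subseteq> {..<N}"
    using N unfolding U_def V_def by auto
  have sp: "(\<Sum>k<N. f k) = f 0 + (sum f U + sum f V)" for f :: "nat \<Rightarrow> real"
    unfolding UV(1) using UV(2-5) by (simp add: sum.union_disjoint)
  have "(\<Sum>k<N. \<beta> k * real (d (int k) s t)) = (\<Sum>k\<in>V. \<beta> k * real (d (int k) s t))"
  proof -
    have "(\<Sum>k\<in>U. \<beta> k * real (d (int k) s t)) = 0"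
      by (rule sum.neutral) (use dN1[of s t] d10 in \<open>auto simp: U_def\<close>)
    then show ?thesis unfolding sp by (simp add: d0)
  qed
  also have "\<dots> \<le> (\<Sum>k\<in>V. \<beta> k * real M)"
  proof (rule sum_mono)
    fix k assume "k \<in> V"
    then have "\<beta> k > 0" using \<beta>(2) UV(7) by blast
    then show "\<beta> k * real (d (int k) s t) \<le> \<beta> k * real M" using dM[of "int k"] by simp
  qed
  also have "\<dots> = sum \<beta> V * real M" by (simp add: sum_distrib_right)
  also have "\<dots> < sum \<beta> U * real M" using \<beta>(3) M1 unfolding U_def V_def by simp
  also have "\<dots> = (\<Sum>k\<in>U. \<beta> k * real (d (int k) s1 t1))"
    unfolding sum_distrib_right by (rule sum.cong) (use dN1[of s1 t1] in \<open>auto simp: U_def M_def\<close>)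
  also have "\<dots> \<le> (\<Sum>k<N. \<beta> k * real (d (int k) s1 t1))"
  proof (rule sum_mono2)
    fix k assume "k \<in> {..<N} - U"
    then have "\<beta> k > 0" using \<beta>(2) by blast
    then show "0 \<le> \<beta> k * real (d (int k) s1 t1)" by simp
  qed (use UV(6) in simp_all)
  finally show False unfolding id by simp
qed

section \<open>Denominators of modular functions\<close>

lemma modular_funD:
  assumes "modular_fun N f"
  shows "f nicely_meromorphic_on uhp"
    "\<gamma> \<in> SL2Z \<Longrightarrow> mat_mod N \<gamma> = mat_mod N (mat 1) \<Longrightarrow> \<tau> \<in> uhp \<Longrightarrow> f (mob \<gamma> \<tau>) = f \<tau>"
    "\<gamma> \<in> SL2Z \<Longrightarrow> \<exists>F. has_q_expansion N (\<lambda>\<tau>. f (mob \<gamma> \<tau>)) F"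
  using assms unfolding modular_fun_def by blast+

lemma modular_fun_cong:
  assumes f: "modular_fun N f" and "\<gamma> \<in> SL2Z" "\<delta> \<in> SL2Z" "mat_mod N \<gamma> = mat_mod N \<delta>" "\<tau> \<in> uhp"
  shows "f (mob \<gamma> \<tau>) = f (mob \<delta> \<tau>)"
proof -
  obtain E where E: "E \<in> SL2Z" "\<delta> ** E = mat 1" "E ** \<delta> = mat 1" using SL2Z_inv[OF assms(3)] by blast
  have "mat_mod N (\<gamma> ** E) = mat_mod N (\<delta> ** E)" by (rule mat_mod_mult_cong[OF assms(4) refl])
  then have m: "mat_mod N (\<gamma> ** E) = mat_mod N (mat 1)" unfolding E(2) .
  have "\<gamma> = (\<gamma> ** E) ** \<delta>" by (simp add: E(3) flip: matrix_mul_assoc)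
  then have "mob \<gamma> \<tau> = mob (\<gamma> ** E) (mob \<delta> \<tau>)" using mob_mult[OF assms(3,5), of "\<gamma> ** E"] by simp
  then show ?thesis using modular_funD(2)[OF f SL2Z_mult[OF assms(2) E(1)] m mob_in_uhp[OF assms(3,5)]] by simp
qed

definition SL2Z_lift :: "nat \<Rightarrow> int^2^2 \<Rightarrow> int^2^2" where
  "SL2Z_lift N B = (SOME \<gamma>. \<gamma> \<in> SL2Z \<and> mat_mod N \<gamma> = B)"

lemma SL2Z_lift:
  assumes "B \<in> SB N"
  shows "SL2Z_lift N B \<in> SL2Z" "mat_mod N (SL2Z_lift N B) = B"
proof -
  have "\<exists>\<gamma>. \<gamma> \<in> SL2Z \<and> mat_mod N \<gamma> = B" using assms unfolding SB_def by blast
  from someI_ex[OF this] show "SL2Z_lift N B \<in> SL2Z" "mat_mod N (SL2Z_lift N B) = B"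
    unfolding SL2Z_lift_def by simp_all
qed

lemma mob_holomorphic: "\<gamma> \<in> SL2Z \<Longrightarrow> mob \<gamma> holomorphic_on uhp"
  unfolding mob_def[abs_def] by (intro holomorphic_intros) (rule mob_denom_nonzero)

lemma mob_analytic: "\<gamma> \<in> SL2Z \<Longrightarrow> mob \<gamma> analytic_on uhp"
  using mob_holomorphic analytic_on_open[OF open_uhp] by blast

lemma meromorphic_mob:
  assumes "modular_fun N f" "\<gamma> \<in> SL2Z"
  shows "(\<lambda>\<tau>. f (mob \<gamma> \<tau>)) meromorphic_on uhp"
  by (rule meromorphic_on_compose[where A = uhp])
     (use assms modular_funD(1)[OF assms(1)] mob_analytic in \<open>auto simp: nicely_meromorphic_on_def\<close>)

lemma j_analytic: "j_inv analytic_on uhp"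
  using j_holomorphic analytic_on_open[OF open_uhp] by blast

lemma analytic_at_uhp: "f analytic_on uhp \<Longrightarrow> p \<in> uhp \<Longrightarrow> f analytic_on {p}"
  by (rule analytic_on_subset) auto

lemma poly_j_holomorphic: "(\<lambda>\<tau>. poly D (j_inv \<tau>)) holomorphic_on uhp"
  by (induction D) (auto intro!: holomorphic_intros j_holomorphic)

lemma poly_j_analytic: "p \<in> uhp \<Longrightarrow> (\<lambda>\<tau>. poly D (j_inv \<tau>)) analytic_on {p}"
  by (rule analytic_at_uhp) (use poly_j_holomorphic analytic_on_open[OF open_uhp] in blast)

lemma analytic_at_transform:
  "f analytic_on {p} \<Longrightarrow> \<forall>\<^sub>F x in nhds p. f x = g x \<Longrightarrow> g analytic_on {p}"
  by (rule iffD1[OF analytic_at_cong[OF _ refl]])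

text \<open>The function j - j(p) vanishes at p, so a high enough power of it cancels any pole
  there.\<close>

lemma clear_denominator_local:
  assumes g: "g meromorphic_on uhp" and p: "p \<in> uhp"
  obtains e where "e > 0" "(\<lambda>\<tau>. (j_inv \<tau> - j_inv p) ^ e * g \<tau>) analytic_on {p}"
proof -
  obtain F where F: "(\<lambda>w. g (p + w)) has_laurent_expansion F" using g p unfolding meromorphic_on_def by blast
  have an: "(\<lambda>\<tau>. j_inv \<tau> - j_inv p) analytic_on {p}" by (intro analytic_intros analytic_at_uhp[OF j_analytic p])
  then obtain H where H: "(\<lambda>w. j_inv (p + w) - j_inv p) has_fps_expansion H"
    using analytic_at_imp_has_fps_expansion by blast
  then have H': "(\<lambda>w. j_inv (p + w) - j_inv p) has_laurent_expansion fps_to_fls H" by (rule has_laurent_expansion_fps)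
  have H0: "fps_nth H 0 = 0" using has_fps_expansion_imp_0_eq_fps_nth_0[OF H] by simp
  \<comment> \<open>Large enough to create a zero at p: then the limit 0 agrees with the value 0^e
    g(p), whatever g(p) is, and the product is analytic without redefinition.\<close>
  define e where "e = nat (1 - fls_subdegree F) + 1"
  define L where "L = fps_to_fls H ^ e * F"
  have L: "(\<lambda>w. (j_inv (p + w) - j_inv p) ^ e * g (p + w)) has_laurent_expansion L"
    unfolding L_def by (intro laurent_expansion_intros H' F)
  have sub: "L = 0 \<or> fls_subdegree L > 0"
  proof (cases "H = 0 \<or> F = 0")
    case True
    then show ?thesis by (auto simp: L_def e_def)
  next
    case False
    then have "subdegree H \<ge> 1" using H0 subdegree_eq_0_iff[of H] by linarith
    then have "int e * 1 \<le> int e * int (subdegree H)" by (intro mult_left_mono) auto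
    moreover have "fls_subdegree L = int e * int (subdegree H) + fls_subdegree F"
      unfolding L_def using False by (simp add: fls_subdegree_pow fls_subdegree_fls_to_fps)
    moreover have "int e \<ge> 1 - fls_subdegree F + 1 \<or> int e \<ge> 1" by (simp add: e_def)
    moreover have "int e + fls_subdegree F > 0" by (simp add: e_def)
    ultimately show ?thesis by linarith
  qed
  then have "fls_subdegree L \<ge> 0" "fls_nth L 0 = 0" by auto
  then have "(\<lambda>w. (j_inv (p + w) - j_inv p) ^ e * g (p + w)) \<midarrow>0\<rightarrow> 0"
    using has_laurent_expansion_imp_tendsto_0[OF L] by simp
  then have "(\<lambda>\<tau>. (j_inv \<tau> - j_inv p) ^ e * g \<tau>) \<midarrow>p\<rightarrow> 0" by (rule LIM_offset_zero_cancel)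
  then have "(\<lambda>\<tau>. (j_inv \<tau> - j_inv p) ^ e * g \<tau>) \<midarrow>p\<rightarrow> (j_inv p - j_inv p) ^ e * g p"
    by (simp add: e_def)
  then have "isCont (\<lambda>\<tau>. (j_inv \<tau> - j_inv p) ^ e * g \<tau>) p" unfolding isCont_def .
  moreover have "(\<lambda>\<tau>. (j_inv \<tau> - j_inv p) ^ e * g \<tau>) meromorphic_on {p}"
    by (intro meromorphic_intros analytic_on_imp_meromorphic_on[OF an] meromorphic_on_subset[OF g]) (use p in auto)
  ultimately show ?thesis using that[of e] meromorphic_at_isCont_imp_analytic by (simp add: e_def)
qed

text \<open>High up the function is given by its convergent expansion and has no singularity. The
  rest of the half-strip is compact, and the singularities of a meromorphic function are
  sparse.\<close>

lemma finite_singularities: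
  assumes N: "N > 0" and f: "modular_fun N f" and \<gamma>: "\<gamma> \<in> SL2Z"
  shows "finite {p \<in> fund_region. \<not> (\<lambda>\<tau>. f (mob \<gamma> \<tau>)) analytic_on {p}}"
proof -
  let ?f = "\<lambda>\<tau>. f (mob \<gamma> \<tau>)"
  obtain F where F: "has_q_expansion N ?f F" using modular_funD(3)[OF f \<gamma>] by blast
  have r: "fls_conv_radius F > 0" using F unfolding has_q_expansion_def by blast
  have "\<forall>\<^sub>F x in at 0. x \<in> eball 0 (fls_conv_radius F)" 
    using r by (intro eventually_at_in_open') (auto simp: zero_ereal_def)
  then have "\<forall>\<^sub>F \<tau> in at_i_inf. ee (\<tau> / of_nat N) \<in> eball 0 (fls_conv_radius F)"
    by (rule iffD2[OF eventually_qx[OF N, of "\<lambda>x. x \<in> eball 0 (fls_conv_radius F)"]])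
  then have "\<forall>\<^sub>F \<tau> in at_i_inf. ee (\<tau> / of_nat N) \<in> eball 0 (fls_conv_radius F) \<and> ?f \<tau> = eval_fls F (ee (\<tau> / of_nat N))"
    using qexpD(2)[OF F] by (rule eventually_conj)
  then obtain Y where Y: "\<And>\<tau>. Im \<tau> \<ge> Y \<Longrightarrow> ee (\<tau> / of_nat N) \<in> eball 0 (fls_conv_radius F)"
      "\<And>\<tau>. Im \<tau> \<ge> Y \<Longrightarrow> ?f \<tau> = eval_fls F (ee (\<tau> / of_nat N))"
    unfolding eventually_at_i_inf by blast
  have an: "?f analytic_on {p}" if "Im p > Y" for p
  proof -
    have "(\<lambda>\<tau>. ee (\<tau> / of_nat N)) analytic_on {p}"
      unfolding ee_def by (intro analytic_intros) (use N in auto)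
    then have "(\<lambda>\<tau>. eval_fls F (ee (\<tau> / of_nat N))) analytic_on {p}"
      by (rule analytic_on_eval_fls') (use Y(1)[of p] that in auto)
    moreover have "\<forall>\<^sub>F \<tau> in nhds p. eval_fls F (ee (\<tau> / of_nat N)) = ?f \<tau>"
    proof -
      have "\<forall>\<^sub>F \<tau> in nhds p. \<tau> \<in> {\<tau>. Y < Im \<tau>}" using that by (intro eventually_nhds_in_open open_halfspace_Im_gt) simp
      then show ?thesis by eventually_elim (simp add: Y(2))
    qed
    ultimately show ?thesis by (rule analytic_at_transform)
  qed
  define K where "K = fund_region \<inter> {\<tau>. Im \<tau> \<le> Y}"
  have K: "compact K" "K \<subseteq> uhp" using compact_fund_region_strip fund_region_subset by (auto simp: K_def)
  have "?f meromorphic_on K" using meromorphic_mob[OF f \<gamma>] K(2) by (rule meromorphic_on_subset)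
  then have "{p. \<not> ?f analytic_on {p}} sparse_in K" by (rule meromorphic_on_imp_sparse_singularities)
  then have "finite (K \<inter> {p. \<not> ?f analytic_on {p}})" by (rule sparse_in_compact_finite[OF _ K(1)])
  moreover have "{p \<in> fund_region. \<not> ?f analytic_on {p}} \<subseteq> K \<inter> {p. \<not> ?f analytic_on {p}}"
  proof
    fix p assume p: "p \<in> {p \<in> fund_region. \<not> ?f analytic_on {p}}"
    then have "\<not> Y < Im p" using an[of p] by blast
    then show "p \<in> K \<inter> {p. \<not> ?f analytic_on {p}}" using p by (simp add: K_def not_less)
  qed
  ultimately show ?thesis by (rule rev_finite_subset)
qed

text \<open>One polynomial serves for all \<gamma>: modulo N there are finitely many functions f o
  \<gamma>, each with finitely many singularities in the half-strip. At any other point p, move p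
  into the half-strip by A and replace \<gamma> by \<gamma> A^(-1), which leaves j
  unchanged.\<close>

lemma clear_denominators:
  assumes N: "N > 0" and f: "modular_fun N f"
  obtains D :: "complex poly" where "D \<noteq> 0" "\<And>\<gamma>. \<gamma> \<in> SL2Z \<Longrightarrow> (\<lambda>\<tau>. poly D (j_inv \<tau>) * f (mob \<gamma> \<tau>)) holomorphic_on uhp"
proof -
  define an where "an = (\<lambda>D \<gamma> p. (\<lambda>\<tau>. poly D (j_inv \<tau>) * f (mob \<gamma> \<tau>)) analytic_on {p})"
  have dvd: "an D' \<gamma> p" if "an D \<gamma> p" "D dvd D'" "p \<in> uhp" for D D' \<gamma> p
  proof -
    from that(2) obtain E where E: "D' = E * D" by (metis dvdE mult.commute)
    have "(\<lambda>\<tau>. poly E (j_inv \<tau>) * (poly D (j_inv \<tau>) * f (mob \<gamma> \<tau>))) analytic_on {p}"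
      by (rule analytic_on_mult[OF poly_j_analytic[OF that(3)]]) (use that(1) in \<open>simp only: an_def\<close>)
    then show ?thesis unfolding an_def E by (simp add: mult.assoc)
  qed
  have cong: "an D \<delta> p" if "an D \<gamma> p" "p \<in> uhp" "\<And>\<tau>. \<tau> \<in> uhp \<Longrightarrow> f (mob \<gamma> \<tau>) = f (mob \<delta> \<tau>)" for D \<gamma> \<delta> p
  proof -
    have "\<forall>\<^sub>F \<tau> in nhds p. \<tau> \<in> uhp" by (rule eventually_nhds_in_open[OF open_uhp that(2)])
    then have "\<forall>\<^sub>F \<tau> in nhds p. poly D (j_inv \<tau>) * f (mob \<gamma> \<tau>) = poly D (j_inv \<tau>) * f (mob \<delta> \<tau>)"
      by eventually_elim (simp add: that(3))
    from analytic_at_cong[OF this refl] show ?thesis using that(1) unfolding an_def by blast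
  qed
  have comp: "an D (\<gamma> ** B) p" if "an D \<gamma> (mob B p)" "p \<in> uhp" "B \<in> SL2Z" for D \<gamma> B p
  proof -
    have "(\<lambda>\<tau>. poly D (j_inv \<tau>) * f (mob \<gamma> \<tau>)) \<circ> mob B analytic_on {p}"
      by (rule analytic_on_compose[OF analytic_at_uhp[OF mob_analytic[OF that(3)] that(2)]]) (use that(1) in \<open>simp add: an_def\<close>)
    moreover have "\<forall>\<^sub>F \<tau> in nhds p. \<tau> \<in> uhp" by (rule eventually_nhds_in_open[OF open_uhp that(2)])
    then have "\<forall>\<^sub>F \<tau> in nhds p. ((\<lambda>\<tau>. poly D (j_inv \<tau>) * f (mob \<gamma> \<tau>)) \<circ> mob B) \<tau> = poly D (j_inv \<tau>) * f (mob (\<gamma> ** B) \<tau>)"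
      by eventually_elim (simp add: j_invariant[OF that(3)] mob_mult[OF that(3)])
    ultimately show ?thesis unfolding an_def by (rule analytic_at_transform)
  qed
  define L where "L = SL2Z_lift N"
  note L = SL2Z_lift[of _ N, folded L_def]
  define P where "P = (\<lambda>B. {p \<in> fund_region. \<not> (\<lambda>\<tau>. f (mob (L B) \<tau>)) analytic_on {p}})"
  have finP: "finite (P B)" if "B \<in> SB N" for B
    unfolding P_def by (rule finite_singularities[OF N f L(1)[OF that]])
  have "\<exists>e. an ([:- j_inv p, 1:] ^ e) (L B) p" if "B \<in> SB N" "p \<in> fund_region" for B p
    using clear_denominator_local[OF meromorphic_mob[OF f L(1)[OF that(1)]], of p] that(2) fund_region_subset
    unfolding an_def by (auto simp: add.commute)
  then obtain e where e: "\<And>B p. B \<in> SB N \<Longrightarrow> p \<in> fund_region \<Longrightarrow> an ([:- j_inv p, 1:] ^ e B p) (L B) p" by metis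
  define D where "D = (\<Prod>B\<in>SB N. \<Prod>p\<in>P B. [:- j_inv p, 1:] ^ e B p)"
  have fin: "finite (SB N)" by (rule finite_SB[OF N])
  have D0: "D \<noteq> 0" using fin finP unfolding D_def by (simp add: prod_zero_iff)
  have base: "an D (L B) p" if B: "B \<in> SB N" and p: "p \<in> fund_region" for B p
  proof (cases "p \<in> P B")
    case True
    have "[:- j_inv p, 1:] ^ e B p dvd (\<Prod>p\<in>P B. [:- j_inv p, 1:] ^ e B p)" by (rule dvd_prodI[OF finP[OF B] True])
    also have "\<dots> dvd D" unfolding D_def by (rule dvd_prodI[OF fin B])
    finally show ?thesis using dvd[OF e[OF B p]] p fund_region_subset by blast
  next
    case False
    then have "(\<lambda>\<tau>. f (mob (L B) \<tau>)) analytic_on {p}" using p by (simp add: P_def)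
    then show ?thesis unfolding an_def using p fund_region_subset by (intro analytic_on_mult poly_j_analytic) auto
  qed
  have "an D \<gamma> p" if \<gamma>: "\<gamma> \<in> SL2Z" and p: "p \<in> uhp" for \<gamma> p
  proof -
    obtain A where A: "A \<in> SL2Z" "mob A p \<in> fund_region" using ex_fund_region[OF p] by blast
    obtain A' where A': "A' \<in> SL2Z" "A' ** A = mat 1" using SL2Z_inv[OF A(1)] by blast
    define B where "B = mat_mod N (\<gamma> ** A')"
    have B: "B \<in> SB N" unfolding B_def SB_def using SL2Z_mult[OF \<gamma> A'(1)] by blast
    have "an D (\<gamma> ** A') (mob A p)"
    proof (rule cong[OF base[OF B A(2)] mob_in_uhp[OF A(1) p]])
      fix \<tau> assume \<tau>: "\<tau> \<in> uhp"
      show "f (mob (L B) \<tau>) = f (mob (\<gamma> ** A') \<tau>)"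
        by (rule modular_fun_cong[OF f L(1)[OF B] SL2Z_mult[OF \<gamma> A'(1)] _ \<tau>]) (simp only: L(2)[OF B], simp add: B_def)
    qed
    then have "an D ((\<gamma> ** A') ** A) p" by (rule comp[OF _ p A(1)])
    moreover have "(\<gamma> ** A') ** A = \<gamma>" by (simp add: A'(2) flip: matrix_mul_assoc)
    ultimately show ?thesis by simp
  qed
  then have "(\<lambda>\<tau>. poly D (j_inv \<tau>) * f (mob \<gamma> \<tau>)) holomorphic_on uhp" if "\<gamma> \<in> SL2Z" for \<gamma>
    unfolding analytic_on_open[OF open_uhp, symmetric] using that unfolding an_def by (subst analytic_on_analytic_at) blast
  then show ?thesis using that[of D] D0 by blast
qed

section \<open>Linear systems over a subfield\<close>

text \<open>A linear system over K that is solvable in the complex numbers is solvable in K. The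
  unknowns are finite in number, the equations, one for each coefficient of a series, need not be;
  hence elimination by induction on the unknowns.\<close>

lemma subfield_solution:
  fixes b :: "'n \<Rightarrow> complex" and a :: "'i \<Rightarrow> 'n \<Rightarrow> complex"
  assumes K: "is_subring K" "\<And>x. x \<in> K \<Longrightarrow> inverse x \<in> K" and fin: "finite I"
    and b: "\<And>n. b n \<in> K" and a: "\<And>i n. i \<in> I \<Longrightarrow> a i n \<in> K"
    and eq: "\<And>n. b n = (\<Sum>i\<in>I. c i * a i n)"
  shows "\<exists>c'. (\<forall>i\<in>I. c' i \<in> K) \<and> (\<forall>n. b n = (\<Sum>i\<in>I. c' i * a i n))"
  using fin b a eq
proof (induction I arbitrary: b a c rule: finite_induct)
  case empty
  then show ?case by simp
next
  case (insert k I)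
  show ?case
  proof (cases "\<exists>m. a k m \<noteq> 0")
    case False
    have "\<exists>c'. (\<forall>i\<in>I. c' i \<in> K) \<and> (\<forall>n. b n = (\<Sum>i\<in>I. c' i * a i n))"
      by (rule insert.IH[of b a c]) (use insert.prems insert.hyps False in \<open>simp_all\<close>)
    then obtain c' where c': "\<And>i. i \<in> I \<Longrightarrow> c' i \<in> K" "\<And>n. b n = (\<Sum>i\<in>I. c' i * a i n)" by blast
    have "\<forall>i\<in>insert k I. (c'(k := 0)) i \<in> K" using c'(1) subring_0[OF K(1)] by simp
    moreover have "b n = (\<Sum>i\<in>insert k I. (c'(k := 0)) i * a i n)" for n
    proof -
      have "(\<Sum>i\<in>I. (c'(k := 0)) i * a i n) = (\<Sum>i\<in>I. c' i * a i n)"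
        by (rule sum.cong) (use insert.hyps in auto)
      then show ?thesis using insert.hyps c'(2)[of n] by simp
    qed
    ultimately show ?thesis by blast
  next
    case True
    \<comment> \<open>Equation m is the pivot for the unknown k; a' and b' describe the remaining
      equations after substitution.\<close>
    then obtain m where m: "a k m \<noteq> 0" by blast
    define t where "t = inverse (a k m)"
    have tK: "t \<in> K" unfolding t_def by (rule K(2)) (use insert.prems(2) in simp)
    have ta: "t * a k m = 1" using m by (simp add: t_def)
    define a' where "a' = (\<lambda>i n. a i n - a i m * t * a k n)"
    define b' where "b' = (\<lambda>n. b n - b m * t * a k n)"
    have ck: "c k = (b m - (\<Sum>i\<in>I. c i * a i m)) * t"
    proof -
      have "b m = c k * a k m + (\<Sum>i\<in>I. c i * a i m)" using insert.prems(3)[of m] insert.hyps by simp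
      then have "(b m - (\<Sum>i\<in>I. c i * a i m)) * t = c k * (t * a k m)" by simp
      then show ?thesis by (simp add: ta)
    qed
    have exp: "(\<Sum>i\<in>I. d i * a' i n) = (\<Sum>i\<in>I. d i * a i n) - (\<Sum>i\<in>I. d i * a i m) * t * a k n" for d n
      unfolding a'_def by (simp add: right_diff_distrib sum_subtractf sum_distrib_right mult.assoc)
    have "\<exists>c'. (\<forall>i\<in>I. c' i \<in> K) \<and> (\<forall>n. b' n = (\<Sum>i\<in>I. c' i * a' i n))"
    proof (rule insert.IH)
      show "b' n \<in> K" for n unfolding b'_def
        by (intro subring_diff subring_mult K(1) tK) (use insert.prems in auto)
      show "a' i n \<in> K" if "i \<in> I" for i n unfolding a'_def
        by (intro subring_diff subring_mult K(1) tK) (use insert.prems that in auto)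
      show "b' n = (\<Sum>i\<in>I. c i * a' i n)" for n
      proof -
        have "b n = c k * a k n + (\<Sum>i\<in>I. c i * a i n)" using insert.prems(3)[of n] insert.hyps by simp
        then show ?thesis unfolding exp b'_def ck by (simp add: algebra_simps)
      qed
    qed
    then obtain c' where c': "\<And>i. i \<in> I \<Longrightarrow> c' i \<in> K" "\<And>n. b' n = (\<Sum>i\<in>I. c' i * a' i n)" by blast
    define s where "s = (b m - (\<Sum>i\<in>I. c' i * a i m)) * t"
    have "s \<in> K" unfolding s_def
      by (intro subring_diff subring_mult subring_sum K(1) tK) (use insert.prems c'(1) in auto)
    then have "\<forall>i\<in>insert k I. (c'(k := s)) i \<in> K" using c'(1) by simp
    moreover have "b n = (\<Sum>i\<in>insert k I. (c'(k := s)) i * a i n)" for n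
    proof -
      have "(\<Sum>i\<in>I. (c'(k := s)) i * a i n) = (\<Sum>i\<in>I. c' i * a i n)"
        by (rule sum.cong) (use insert.hyps in auto)
      moreover have "b n = b m * t * a k n + ((\<Sum>i\<in>I. c' i * a i n) - (\<Sum>i\<in>I. c' i * a i m) * t * a k n)"
        using c'(2)[of n] unfolding exp b'_def by (simp add: algebra_simps)
      ultimately show ?thesis using insert.hyps by (simp add: s_def algebra_simps)
    qed
    ultimately show ?thesis by blast
  qed
qed

lemma fls_rel_unique: "fls_rel R \<sigma> F G \<Longrightarrow> fls_rel R \<sigma> F H \<Longrightarrow> G = H"
  by (rule fls_eqI) (metis fls_relD(2))

text \<open>After the leading term is pulled out, a power series with constant term 1 remains, so
  the only division is by the leading coefficient.\<close>

lemma fls_inverse_in_subfield: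
  assumes K: "is_subring K" "\<And>x. x \<in> K \<Longrightarrow> inverse x \<in> K" and Q: "\<And>n. fls_nth Q n \<in> K" "Q \<noteq> 0"
  obtains R where "\<And>n. fls_nth R n \<in> K" "R * Q = 1"
proof -
  define a c where "a = fls_subdegree Q" and "c = fls_nth Q a"
  have c0: "c \<noteq> 0" using Q(2) by (simp add: c_def a_def)
  have cK: "inverse c \<in> K" unfolding c_def by (rule K(2)[OF Q(1)])
  define q where "q = Abs_fps (\<lambda>n. inverse c * fls_nth Q (a + int n))"
  have q: "fps_nth q n \<in> K" "fps_nth q 0 = 1" for n
    using c0 subring_mult[OF K(1) cK Q(1)] by (simp_all add: q_def) (simp add: c_def)
  have Qeq: "Q = fls_X_intpow a * (fls_const c * fps_to_fls q)"
  proof (rule fls_eqI)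
    fix n
    show "fls_nth Q n = fls_nth (fls_X_intpow a * (fls_const c * fps_to_fls q)) n"
      using c0 by (cases "n < a") (simp_all add: fls_X_intpow_mult_nth q_def a_def)
  qed
  define R where "R = fls_X_intpow (- a) * (fls_const (inverse c) * fps_to_fls (inverse q))"
  have "fls_nth R n \<in> K" for n
    unfolding R_def fls_X_intpow_mult_nth using fps_inverse_in[OF K(1) q] cK
    by (auto simp: subring_0[OF K(1)] intro: subring_mult[OF K(1)])
  moreover have "R * Q = 1"
  proof -
    have "fps_to_fls (inverse q) * fps_to_fls q = 1" using q(2) by (simp add: inverse_mult_eq_1 flip: fls_times_fps_to_fls)
    moreover have "fls_X_intpow (- a) * fls_X_intpow a = (1 :: complex fls)"
      using fls_X_intpow_times_fls_X_intpow[of "- a" a] by simp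
    moreover have "fls_const (inverse c) * fls_const c = 1" using c0 by (simp add: fls_const_mult_const)
    moreover have "R * Q = (fls_X_intpow (- a) * fls_X_intpow a) * ((fls_const (inverse c) * fls_const c) * (fps_to_fls (inverse q) * fps_to_fls q))"
      unfolding R_def by (subst (1) Qeq) (simp only: mult_ac)
    ultimately show ?thesis by simp
  qed
  ultimately show ?thesis using that by blast
qed

text \<open>F = P/Q has coefficients in the field K. Its conjugate G satisfies Q' G = P' = Q' F',
  and Q' is nonzero.\<close>

lemma fls_rel_quotient:
  assumes e: "ring_emb K \<sigma>" and inv: "\<And>x. x \<in> K \<Longrightarrow> inverse x \<in> K"
    and Q: "fls_rel K \<sigma> Q Q'" "Q \<noteq> 0" and P: "fls_rel K \<sigma> P P'" and F: "Q * F = P" "Q' * F' = P'"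
  shows "fls_rel K \<sigma> F F'"
proof -
  note K = ring_embD(1)[OF e]
  obtain R where R: "\<And>n. fls_nth R n \<in> K" "R * Q = 1"
    using fls_inverse_in_subfield[OF K inv fls_relD(1)[OF Q(1)] Q(2)] by metis
  have "fls_rel K (\<lambda>x. x) (R * P) (R * P)"
    by (rule fls_rel_mult[OF ring_emb_id[OF K]]) (auto simp: fls_rel_id_iff R(1) fls_relD(1)[OF P])
  moreover have "F = R * P" unfolding F(1)[symmetric] using R(2) by (simp flip: mult.assoc)
  ultimately have FK: "fls_nth F n \<in> K" for n by (simp add: fls_rel_id_iff)
  define G where "G = Abs_fls (\<lambda>n. \<sigma> (fls_nth F n))"
  have "fls_nth G n = \<sigma> (fls_nth F n)" for n
    unfolding G_def by (subst nth_Abs_fls_lower_bound[of "fls_subdegree F"]) (auto simp: ring_embD(5)[OF e])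
  then have G: "fls_rel K \<sigma> F G" unfolding fls_rel_def using FK by simp
  have "Q' * G = P'" using fls_rel_unique[OF fls_rel_mult[OF e Q(1) G]] P unfolding F(1) by blast
  then have "Q' * (G - F') = 0" using F(2) by (simp add: right_diff_distrib)
  moreover have "Q' \<noteq> 0" using fls_rel_subdegree(2)[OF e Q(1)] Q(2) by simp
  ultimately show ?thesis using G by simp
qed

section \<open>A separating family\<close>

lemma hfls_nth:
  assumes N: "N > 0"
  shows "n < bq N r \<Longrightarrow> fls_nth (hfls N r s) n = 0"
    "fls_nth (hfls N r s) (bq N r) = zeta N powi (6 * (r mod int N) * s) * hc N r s ^ (12 * N)"
proof -
  have "fps_nth (hfps N r s) 0 = hc N r s ^ (12 * N)"
    using N by (simp add: hfps_def fps_nth_power_0 Pfps_nth_0 ka_gt kb_gt)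
  then show "n < bq N r \<Longrightarrow> fls_nth (hfls N r s) n = 0"
    "fls_nth (hfls N r s) (bq N r) = zeta N powi (6 * (r mod int N) * s) * hc N r s ^ (12 * N)"
    by (simp_all add: hfls_def fls_X_intpow_mult_nth)
qed

text \<open>The expansion remembers the index up to sign. The order \<open>bq N r\<close> attains
  its maximum N^2 only for r = 0 modulo N. Then the leading coefficients give |1 - zeta^s| = |1 -
  zeta|, so zeta^s is zeta or its conjugate; absolute values are compared because the exponent 12 N
  blurs the argument.\<close>

lemma hh_eq_01:
  assumes N: "N \<ge> 2" and eq: "\<And>\<tau>. \<tau> \<in> uhp \<Longrightarrow> hh N r s \<tau> = hh N 0 1 \<tau>"
  shows "int N dvd r \<and> (int N dvd s - 1 \<or> int N dvd s + 1)"
proof -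
  have N0: "N > 0" using N by simp
  have fls: "hfls N r s = hfls N 0 1"
    by (rule qexp_unique[OF N0 hh_qexp[OF N0] qexp_cong_uhp[OF hh_qexp[OF N0]]]) (rule eq[symmetric])
  have z1: "zeta N powi 1 \<noteq> 1" unfolding zeta_powi_eq_1_iff[OF N0] using N by simp
  have b0: "bq N 0 = (int N)\<^sup>2" by (simp add: bq_def)
  have l0: "fls_nth (hfls N 0 1) (bq N 0) = (1 - zeta N powi 1) ^ (12 * N)"
    using hfls_nth(2)[OF N0, of 0 1] by (simp add: hc_def)
  have h: "hc N r s \<noteq> 0"
  proof
    assume "hc N r s = 0"
    then have "hfls N r s = 0" using N0 by (simp add: hfls_def hfps_def)
    then show False using l0 z1 unfolding fls by simp
  qed
  have le1: "bq N r \<le> bq N 0"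
    using hfls_nth(1)[OF N0, of "bq N 0" r s] l0 z1 unfolding fls by (cases "bq N r \<le> bq N 0") simp_all
  have l1: "fls_nth (hfls N 0 1) (bq N r) = zeta N powi (6 * (r mod int N) * s) * hc N r s ^ (12 * N)"
    using hfls_nth(2)[OF N0, of r s] unfolding fls .
  have "fls_nth (hfls N 0 1) (bq N r) \<noteq> 0" unfolding l1 using h by simp
  then have "\<not> bq N r < bq N 0" using hfls_nth(1)[OF N0, of "bq N r" 0 1] by blast
  then have bq: "bq N r = bq N 0" using le1 by simp
  then have "6 * (r mod int N) * (r mod int N - int N) = 0" unfolding b0 by (simp add: bq_def power2_eq_square algebra_simps)
  moreover have "r mod int N < int N" using N0 by simp
  ultimately have r0: "r mod int N = 0" by simp
  have "(1 - zeta N powi s) ^ (12 * N) = (1 - zeta N powi 1) ^ (12 * N)"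
    using l1 l0 unfolding bq by (simp add: r0 hc_def)
  then have "norm (1 - zeta N powi s) ^ (12 * N) = norm (1 - zeta N powi 1) ^ (12 * N)"
    by (simp only: norm_power[symmetric])
  then have nrm: "norm (1 - zeta N powi s) = norm (1 - zeta N powi 1)"
    by (rule power_eq_imp_eq_base) (use N0 in auto)
  define w z where "w = zeta N powi s" and "z = zeta N powi 1"
  have nz: "w \<noteq> 0" "z \<noteq> 0" by (simp_all add: w_def z_def)
  have nw: "norm w = 1" "norm z = 1" unfolding w_def z_def by (rule norm_zeta_powi)+
  have cn: "(1 - x) * (1 - inverse x) = of_real ((norm (1 - x))\<^sup>2)" if "norm x = 1" for x :: complex
  proof -
    have "inverse x = cnj x" using that by (simp add: inverse_complex_def complex_eq_iff cmod_def)
    then show ?thesis unfolding complex_norm_square by simp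
  qed
  have "(1 - w) * (1 - inverse w) = (1 - z) * (1 - inverse z)"
    unfolding cn[OF nw(1)] cn[OF nw(2)] using nrm by (simp only: w_def z_def)
  then have "z + w * (w * z) = w + w * (z * z)" using nz by (simp add: field_simps)
  moreover have "(w - z) * (w * z - 1) = (z + w * (w * z)) - (w + w * (z * z))" by (simp add: algebra_simps)
  ultimately have "(w - z) * (w * z - 1) = 0" by simp
  then have "w = z \<or> w * z = 1" unfolding mult_eq_0_iff by simp
  then have "w * inverse z = 1 \<or> w * z = 1" using nz by auto
  moreover have "w * inverse z = zeta N powi (s - 1)" by (simp add: w_def z_def power_int_diff field_simps)
  moreover have "w * z = zeta N powi (s + 1)" unfolding w_def z_def zeta_add ..
  ultimately show ?thesis using r0 by (simp add: zeta_powi_eq_1_iff[OF N0] dvd_eq_mod_eq_0)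
qed

lemma galfam_of_int:
  assumes N: "N > 0"
  shows "galfam N (\<lambda>A \<tau>. of_int c) (\<lambda>A. fls_const (of_int c))"
proof -
  have c: "of_int c \<in> Zz N" by (rule subring_of_int) simp
  have "modfam N (Zz N) (\<lambda>A \<tau>. of_int c) (\<lambda>A. fls_const (of_int c))"
    unfolding modfam_def using c qexp_const[OF N] by (auto simp: subring_0 fls_const_nth)
  moreover have "fls_rel (Zz N) \<sigma> (fls_const (of_int c)) (fls_const (of_int c))" if "\<sigma> \<in> Gal_Q" for \<sigma>
    using fls_rel_const[OF ring_emb_Zz[OF that N] c] unfolding ring_emb_of_int[OF ring_emb_Zz[OF that N]] .
  ultimately show ?thesis unfolding galfam_def by blast
qed

text \<open>h_(1,0) and h_(0,1) each detect one row up to sign. In the combination h_(1,0) + c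
  h_(0,1), every class of matrices that moves one of the two functions excludes at most one integer
  c, and there are finitely many classes. If both functions are fixed, determinant 1 forces the two
  signs to agree. An integral c keeps the family compatible with Galois.\<close>

lemma separating_family:
  assumes N: "N \<ge> 2"
  obtains \<Theta> X where "galfam N \<Theta> X"
    "\<And>B. B \<in> SL2Z \<Longrightarrow> (\<And>\<tau>. \<tau> \<in> uhp \<Longrightarrow> \<Theta> B \<tau> = \<Theta> (mat 1) \<tau>) \<Longrightarrow> mat_mod N B = mat_mod N (mat 1) \<or> mat_mod N B = mat_mod N (- mat 1)"
proof -
  have N0: "N > 0" using N by simp
  define a where "a = (\<lambda>B \<tau>. hfam N 1 0 B \<tau> - hfam N 1 0 (mat 1) \<tau>)"
  define b where "b = (\<lambda>B \<tau>. hfam N 0 1 B \<tau> - hfam N 0 1 (mat 1) \<tau>)"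
  define triv where "triv = (\<lambda>B. \<forall>\<tau>\<in>uhp. a B \<tau> = 0 \<and> b B \<tau> = 0)"
  define bad where "bad = (\<lambda>B. {c :: int. \<forall>\<tau>\<in>uhp. a B \<tau> + of_int c * b B \<tau> = 0})"
  have fin: "finite (bad B)" if "\<not> triv B" for B
  proof (rule finite_subset)
    have "c = c'" if c: "c \<in> bad B" "c' \<in> bad B" for c c'
    proof (rule ccontr)
      assume ne: "c \<noteq> c'"
      have "a B \<tau> = 0 \<and> b B \<tau> = 0" if \<tau>: "\<tau> \<in> uhp" for \<tau>
      proof -
        have e: "a B \<tau> + of_int c * b B \<tau> = 0" "a B \<tau> + of_int c' * b B \<tau> = 0" using c \<tau> unfolding bad_def by blast+
        have "of_int (c - c') * b B \<tau> = (a B \<tau> + of_int c * b B \<tau>) - (a B \<tau> + of_int c' * b B \<tau>)" by (simp add: algebra_simps)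
        then have "b B \<tau> = 0" unfolding e using ne by simp
        then show ?thesis using e(1) by simp
      qed
      then show False using \<open>\<not> triv B\<close> unfolding triv_def by blast
    qed
    then show "bad B \<subseteq> {SOME c. c \<in> bad B}" by (metis singletonI someI subsetI)
  qed simp
  have "finite (\<Union>B\<in>{B \<in> SB N. \<not> triv B}. bad B)" using finite_SB[OF N0] fin by auto
  then obtain c where c: "c \<notin> (\<Union>B\<in>{B \<in> SB N. \<not> triv B}. bad B)" using ex_new_if_finite[OF infinite_UNIV_int] by blast
  define \<Theta> where "\<Theta> = (\<lambda>A \<tau>. hfam N 1 0 A \<tau> + of_int c * hfam N 0 1 A \<tau>)"
  define X where "X = (\<lambda>A. hfamX N 1 0 A + fls_const (of_int c) * hfamX N 0 1 A)"
  have gal: "galfam N \<Theta> X" unfolding \<Theta>_def X_def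
    by (intro galfam_add[OF N0] galfam_mult[OF N0] galfam_hfam[OF N0] galfam_of_int[OF N0])
  have "mat_mod N B = mat_mod N (mat 1) \<or> mat_mod N B = mat_mod N (- mat 1)"
    if B: "B \<in> SL2Z" and eq: "\<And>\<tau>. \<tau> \<in> uhp \<Longrightarrow> \<Theta> B \<tau> = \<Theta> (mat 1) \<tau>" for B
  proof -
    have cong: "hfam N u v (mat_mod N B) \<tau> = hfam N u v B \<tau>" if "\<tau> \<in> uhp" for u v \<tau>
      by (rule modfamD(1)[OF galfamD(1)[OF galfam_hfam[OF N0]] _ that]) simp
    have "c \<in> bad (mat_mod N B)"
      unfolding bad_def a_def b_def using eq by (simp add: cong \<Theta>_def algebra_simps)
    moreover have "mat_mod N B \<in> SB N" using B unfolding SB_def by blast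
    ultimately have "triv (mat_mod N B)" using c by blast
    then have ab: "hfam N 1 0 B \<tau> = hfam N 1 0 (mat 1) \<tau>" "hfam N 0 1 B \<tau> = hfam N 0 1 (mat 1) \<tau>" if "\<tau> \<in> uhp" for \<tau>
      using that unfolding triv_def a_def b_def by (simp_all add: cong)
    have 2: "hh N (B$2$1) (B$2$2) \<tau> = hh N 0 1 \<tau>" if "\<tau> \<in> uhp" for \<tau>
      using ab(2)[OF that] by (simp add: hfam_def[OF N0])
    \<comment> \<open>S carries the index (1, 0) to (0, -1), so the criterion for (0, 1) covers the
      first row as well.\<close>
    have 1: "hh N (B$1$2) (- B$1$1) \<tau> = hh N 0 1 \<tau>" if \<tau>: "\<tau> \<in> uhp" for \<tau>
    proof -
      have S: "-1 / \<tau> \<in> uhp" by (rule uhp_S[OF \<tau>])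
      have "hh N (B$1$2) (- B$1$1) \<tau> = hh N (B$1$1) (B$1$2) (-1 / \<tau>)" by (rule hh_S[OF \<tau>, symmetric])
      also have "\<dots> = hh N 1 0 (-1 / \<tau>)" using ab(1)[OF S] by (simp add: hfam_def[OF N0])
      also have "\<dots> = hh N 0 (- 1) \<tau>" by (rule hh_S[OF \<tau>])
      also have "\<dots> = hh N 0 1 \<tau>" using hh_minus[OF \<tau>, of N 0 1] by simp
      finally show ?thesis .
    qed
    have d1: "int N dvd B$1$2" "int N dvd - B$1$1 - 1 \<or> int N dvd - B$1$1 + 1"
      using hh_eq_01[OF N 1] by blast+
    have d2: "int N dvd B$2$1" "int N dvd B$2$2 - 1 \<or> int N dvd B$2$2 + 1"
      using hh_eq_01[OF N 2] by blast+
    have det: "B$1$1 * B$2$2 - B$1$2 * B$2$1 = 1" using B unfolding SL2Z_iff .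
    have "int N dvd B$1$2 * B$2$1" using d1(1) by (rule dvd_mult2)
    moreover have "B$1$1 * B$2$2 - 1 = B$1$2 * B$2$1" using det by simp
    ultimately have ad: "int N dvd B$1$1 * B$2$2 - 1" by simp
    have t: "int N dvd x" if "int N dvd y" "int N dvd z" "x = k * y + l * z" for x y z k l
      unfolding that(3) by (rule dvd_add[OF dvd_mult[OF that(1)] dvd_mult[OF that(2)]])
    have mm: "mat_mod N B = mat_mod N (mat2 e 0 0 e)" if "int N dvd B$1$1 - e" "int N dvd B$2$2 - e" for e
      unfolding mat2_eq_iff[of "mat_mod N B"] mat_mod_nth mat2_nth mod_eq_dvd_iff using that d1(1) d2(1) by simp
    have m1: "mat2 1 0 0 1 = mat 1" "mat2 (-1) 0 0 (-1) = - mat 1" by (simp_all add: mat2_eq_iff)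
    from d1(2) show ?thesis
    proof
      assume h: "int N dvd - B$1$1 + 1"
      have "int N dvd B$1$1 - 1" by (rule t[OF h h, of _ "-1" 0]) simp
      moreover have "int N dvd B$2$2 - 1" by (rule t[OF h ad, of _ "B$2$2" 1]) (simp add: algebra_simps)
      ultimately show ?thesis using mm[of 1] unfolding m1 by blast
    next
      assume h: "int N dvd - B$1$1 - 1"
      have "int N dvd B$1$1 - (-1)" by (rule t[OF h h, of _ "-1" 0]) simp
      moreover have "int N dvd B$2$2 - (-1)" by (rule t[OF h ad, of _ "- B$2$2" "-1"]) (simp add: algebra_simps)
      ultimately show ?thesis using mm[of "-1"] unfolding m1 by blast
    qed
  qed
  then show ?thesis using that[of \<Theta> X] gal by blast
qed

section \<open>Polynomials in j\<close>

text \<open>Polynomials in j as a degree bound with a coefficient function, so that an automorphism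
  can be applied to the coefficients directly.\<close>

definition pj :: "nat \<Rightarrow> (nat \<Rightarrow> complex) \<Rightarrow> complex \<Rightarrow> complex" where
  "pj n d \<tau> = (\<Sum>k\<le>n. d k * j_inv \<tau> ^ k)"

definition PJ :: "nat \<Rightarrow> nat \<Rightarrow> (nat \<Rightarrow> complex) \<Rightarrow> complex fls" where
  "PJ N n d = (\<Sum>k\<le>n. fls_const (d k) * jfls N ^ k)"

lemma pj_holomorphic: "pj n d holomorphic_on uhp"
  unfolding pj_def[abs_def] by (intro holomorphic_intros j_holomorphic)

lemma pj_mob: "A \<in> SL2Z \<Longrightarrow> \<tau> \<in> uhp \<Longrightarrow> pj n d (mob A \<tau>) = pj n d \<tau>"
  by (simp add: pj_def j_invariant)

lemma poly_j_pj: "degree p \<le> n \<Longrightarrow> poly p (j_inv \<tau>) = pj n (coeff p) \<tau>"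
  unfolding pj_def poly_altdef by (rule sum.mono_neutral_left) (auto simp: coeff_eq_0)

lemma PJ_qexp: "N > 0 \<Longrightarrow> has_q_expansion N (pj n d) (PJ N n d)"
  unfolding pj_def[abs_def] PJ_def
  by (intro qexp_sum qexp_mult qexp_const qexp_power j_qexp)

lemma PJ_rel:
  assumes e: "ring_emb K \<sigma>" and d: "\<And>k. k \<le> n \<Longrightarrow> d k \<in> K" and N: "N > 0"
  shows "fls_rel K \<sigma> (PJ N n d) (PJ N n (\<lambda>k. \<sigma> (d k)))"
proof -
  have "fls_rel K \<sigma> (jfls N) (jfls N)"
    unfolding fls_rel_def
  proof
    fix n
    obtain c where "fls_nth (jfls N) n = of_int c" using jfls_coeffs(1)[OF N, of n] by (auto elim: Ints_cases)
    then show "fls_nth (jfls N) n \<in> K \<and> fls_nth (jfls N) n = \<sigma> (fls_nth (jfls N) n)"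
      using ring_emb_of_int[OF e] subring_of_int[OF ring_embD(1)[OF e]] by simp
  qed
  then show ?thesis unfolding PJ_def
    by (intro fls_rel_sum[OF e] fls_rel_mult[OF e] fls_rel_const[OF e] fls_rel_power[OF e] d) auto
qed

lemma jfls_power:
  assumes N: "N > 0"
  shows "fls_nth (jfls N ^ k) (- int (k * N)) = 1" "n < - int (k * N) \<Longrightarrow> fls_nth (jfls N ^ k) n = 0"
proof -
  have "fls_subdegree (jfls N) = - int N"
    using jfls_coeffs(2,3)[OF N] by (intro fls_subdegree_eqI) simp_all
  then have s: "fls_subdegree (jfls N ^ k) = - int (k * N)" by (simp add: fls_subdegree_pow)
  show "fls_nth (jfls N ^ k) (- int (k * N)) = 1"
  proof (induction k)
    case (Suc k)
    have sk: "fls_subdegree (jfls N ^ k) = - int (k * N)" using \<open>fls_subdegree (jfls N) = - int N\<close> by (simp add: fls_subdegree_pow)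
    have "fls_nth (jfls N * jfls N ^ k) (fls_subdegree (jfls N) + fls_subdegree (jfls N ^ k)) =
        fls_nth (jfls N) (fls_subdegree (jfls N)) * fls_nth (jfls N ^ k) (fls_subdegree (jfls N ^ k))"
      by (rule fls_times_base)
    then show ?case unfolding sk \<open>fls_subdegree (jfls N) = - int N\<close> using Suc.IH jfls_coeffs(3)[OF N] by (simp add: algebra_simps)
  qed simp
  show "n < - int (k * N) \<Longrightarrow> fls_nth (jfls N ^ k) n = 0" using s by simp
qed

lemma PJ_nonzero:
  assumes N: "N > 0" and d: "d n \<noteq> 0"
  shows "PJ N n d \<noteq> 0"
proof
  assume "PJ N n d = 0"
  then have "0 = fls_nth (PJ N n d) (- int (n * N))" by simp
  also have "\<dots> = (\<Sum>k\<le>n. d k * fls_nth (jfls N ^ k) (- int (n * N)))" by (simp add: PJ_def fls_nth_sum)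
  also have "\<dots> = (\<Sum>k\<le>n. if k = n then d n else 0)"
  proof (rule sum.cong[OF refl])
    fix k assume "k \<in> {..n}"
    then show "d k * fls_nth (jfls N ^ k) (- int (n * N)) = (if k = n then d n else 0)"
      using jfls_power[OF N, of k] jfls_power(2)[OF N, of "- int (n * N)" k] N
      by (cases "k = n") simp_all
  qed
  finally show False using d by simp
qed

lemma holomorphic_qexp_zero:
  assumes hol: "f holomorphic_on uhp" and q: "has_q_expansion N f 0" and \<tau>: "\<tau> \<in> uhp"
  shows "f \<tau> = 0"
proof -
  obtain Y where Y: "\<And>\<tau>. Im \<tau> \<ge> Y \<Longrightarrow> f \<tau> = 0" using qexpD(2)[OF q] unfolding eventually_at_i_inf by auto
  define S where "S = {\<tau>. Im \<tau> > max Y 0}"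
  have "open S" "S \<subseteq> uhp" unfolding S_def uhp_def by (rule open_halfspace_Im_gt) auto
  moreover have "S \<noteq> {}"
  proof -
    have "Complex 0 (max Y 0 + 1) \<in> S" by (auto simp: S_def max_def)
    then show ?thesis by blast
  qed
  moreover have "f z = 0" if "z \<in> S" for z using that Y by (simp add: S_def)
  ultimately show ?thesis
    using analytic_continuation_open[of S uhp f "\<lambda>_. 0" \<tau>] open_uhp connected_uhp hol \<tau> by simp
qed

text \<open>An identity of expansions at infinity between holomorphic functions is an identity on
  the whole upper half-plane, hence may be composed with \<gamma> and expanded again. The poles of g
  are first cleared by a polynomial in j, which is SL2(Z)-invariant and cancels in the end.\<close>

lemma transport_identity:
  assumes N: "N > 0" and g: "modular_fun N g" "has_q_expansion N g G" and \<gamma>: "\<gamma> \<in> SL2Z" "has_q_expansion N (\<lambda>\<tau>. g (mob \<gamma> \<tau>)) G\<gamma>"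
    and \<Phi>: "modfam N R \<Phi> X" and \<Psi>: "modfam N R \<Psi> Y"
    and eq: "PJ N n d * X A * G = (\<Sum>i\<le>m. PJ N k (e i) * Y A ^ i)"
  shows "PJ N n d * X (A ** \<gamma>) * G\<gamma> = (\<Sum>i\<le>m. PJ N k (e i) * Y (A ** \<gamma>) ^ i)"
proof -
  note F = modfamD[OF \<Phi>] and H = modfamD[OF \<Psi>]
  obtain D :: "complex poly" where D: "D \<noteq> 0" "\<And>\<gamma>. \<gamma> \<in> SL2Z \<Longrightarrow> (\<lambda>\<tau>. poly D (j_inv \<tau>) * g (mob \<gamma> \<tau>)) holomorphic_on uhp"
    using clear_denominators[OF N g(1)] by blast
  define l where "l = degree D"
  define c where "c = coeff D"
  have cl: "c l \<noteq> 0" using D(1) by (simp add: c_def l_def)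
  have Dg: "(\<lambda>\<tau>. pj l c \<tau> * g \<tau>) holomorphic_on uhp"
    using D(2)[of "mat 1"] by (simp add: poly_j_pj[of D l] l_def c_def)
  define E where "E = (\<lambda>\<tau>. pj n d \<tau> * \<Phi> A \<tau> * (pj l c \<tau> * g \<tau>) - pj l c \<tau> * (\<Sum>i\<le>m. pj k (e i) \<tau> * \<Psi> A \<tau> ^ i))"
  have hol: "E holomorphic_on uhp"
    unfolding E_def by (intro holomorphic_intros pj_holomorphic F(3) H(3) Dg)
  have "has_q_expansion N E (PJ N n d * X A * (PJ N l c * G) + - (PJ N l c * (\<Sum>i\<le>m. PJ N k (e i) * Y A ^ i)))"
    unfolding E_def diff_conv_add_uminus
    by (intro qexp_add[OF N] qexp_uminus[OF N] qexp_mult[OF N] qexp_sum[OF N] qexp_power[OF N] PJ_qexp[OF N] F(4) H(4) g(2))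
  moreover have "PJ N n d * X A * (PJ N l c * G) + - (PJ N l c * (\<Sum>i\<le>m. PJ N k (e i) * Y A ^ i)) = 0"
    unfolding eq[symmetric] by (simp add: mult_ac)
  ultimately have q0: "has_q_expansion N E 0" by (simp only:)
  have E0: "E (mob \<gamma> \<tau>) = 0" if "\<tau> \<in> uhp" for \<tau>
    by (rule holomorphic_qexp_zero[OF hol q0 mob_in_uhp[OF \<gamma>(1) that]])
  define E' where "E' = (\<lambda>\<tau>. pj n d \<tau> * \<Phi> (A ** \<gamma>) \<tau> * (pj l c \<tau> * g (mob \<gamma> \<tau>)) + - (pj l c \<tau> * (\<Sum>i\<le>m. pj k (e i) \<tau> * \<Psi> (A ** \<gamma>) \<tau> ^ i)))"
  have E'0: "E' \<tau> = 0" if "\<tau> \<in> uhp" for \<tau>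
    using E0[OF that] unfolding E_def E'_def by (simp add: pj_mob[OF \<gamma>(1) that] F(2)[OF \<gamma>(1) that] H(2)[OF \<gamma>(1) that])
  have "has_q_expansion N E' (PJ N n d * X (A ** \<gamma>) * (PJ N l c * G\<gamma>) + - (PJ N l c * (\<Sum>i\<le>m. PJ N k (e i) * Y (A ** \<gamma>) ^ i)))"
    unfolding E'_def
    by (intro qexp_add[OF N] qexp_uminus[OF N] qexp_mult[OF N] qexp_sum[OF N] qexp_power[OF N] PJ_qexp[OF N] F(4) H(4) \<gamma>(2))
  moreover have "has_q_expansion N E' (fls_const 0)"
    by (rule qexp_cong_uhp[OF qexp_const[OF N]]) (rule E'0[symmetric])
  ultimately have "PJ N n d * X (A ** \<gamma>) * (PJ N l c * G\<gamma>) + - (PJ N l c * (\<Sum>i\<le>m. PJ N k (e i) * Y (A ** \<gamma>) ^ i)) = fls_const 0"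
    by (rule qexp_unique[OF N])
  then have "PJ N l c * (PJ N n d * X (A ** \<gamma>) * G\<gamma> - (\<Sum>i\<le>m. PJ N k (e i) * Y (A ** \<gamma>) ^ i)) = 0"
    by (simp add: algebra_simps)
  then show ?thesis using PJ_nonzero[OF N, of c l, OF cl] by simp
qed

section \<open>Galois action on expansions at all cusps\<close>

locale galois_descent =
  fixes N :: nat and \<Theta> :: "int^2^2 \<Rightarrow> complex \<Rightarrow> complex" and X
  assumes N2: "N \<ge> 2" and gal: "galfam N \<Theta> X"
    and sep: "\<And>B. B \<in> SL2Z \<Longrightarrow> (\<And>\<tau>. \<tau> \<in> uhp \<Longrightarrow> \<Theta> B \<tau> = \<Theta> (mat 1) \<tau>) \<Longrightarrow>
      mat_mod N B = mat_mod N (mat 1) \<or> mat_mod N B = mat_mod N (- mat 1)"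
begin

lemma N0: "N > 0" using N2 by simp

lemmas F = modfamD[OF galfamD(1)[OF gal]]

definition same :: "int^2^2 \<Rightarrow> int^2^2 \<Rightarrow> bool" where
  "same C B \<longleftrightarrow> (\<forall>\<tau>\<in>uhp. \<Theta> C \<tau> = \<Theta> B \<tau>)"

lemma same_act:
  assumes A: "A \<in> SL2Z"
  shows "same (mat_mod N (C ** A)) (mat_mod N (B ** A)) \<longleftrightarrow> same C B"
proof -
  have e: "\<Theta> (mat_mod N (C ** A)) \<tau> = \<Theta> C (mob A \<tau>)" if "\<tau> \<in> uhp" for C \<tau>
    unfolding F(2)[OF A that] by (rule F(1)[OF _ that]) simp
  obtain A' where A': "A' \<in> SL2Z" "A ** A' = mat 1" using SL2Z_inv[OF A] by blast
  have m: "mob A (mob A' \<tau>) = \<tau>" if "\<tau> \<in> uhp" for \<tau>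
    using mob_mult[OF A'(1) that, of A] unfolding A'(2) by simp
  show ?thesis
  proof
    assume s: "same (mat_mod N (C ** A)) (mat_mod N (B ** A))"
    show "same C B" unfolding same_def
    proof
      fix \<tau> assume \<tau>: "\<tau> \<in> uhp"
      have t': "mob A' \<tau> \<in> uhp" by (rule mob_in_uhp[OF A'(1) \<tau>])
      have "\<Theta> C (mob A (mob A' \<tau>)) = \<Theta> B (mob A (mob A' \<tau>))"
        using s t' unfolding same_def by (simp only: e[OF t', symmetric])
      then show "\<Theta> C \<tau> = \<Theta> B \<tau>" unfolding m[OF \<tau>] .
    qed
  next
    assume s: "same C B"
    show "same (mat_mod N (C ** A)) (mat_mod N (B ** A))"
      unfolding same_def using s by (auto simp: same_def e mob_in_uhp[OF A])
  qed
qed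

text \<open>The Lagrange denominator at the node theta: the product of its differences to all other
  nodes, with factor 1 for nodes of equal value. It is set up for every index A so that it forms a
  Galois-compatible family itself.\<close>

definition Dl :: "int^2^2 \<Rightarrow> complex \<Rightarrow> complex" where
  "Dl A \<tau> = (\<Prod>C\<in>SB N. if same C (mat 1) then 1 else \<Theta> A \<tau> + - \<Theta> (C ** A) \<tau>)"

definition DX :: "int^2^2 \<Rightarrow> complex fls" where
  "DX A = (\<Prod>C\<in>SB N. if same C (mat 1) then 1 else X A + - X (C ** A))"

lemma galfam_Dl: "galfam N Dl DX"
proof -
  have "galfam N (\<lambda>A \<tau>. \<Prod>C\<in>SB N. if same C (mat 1) then 1 else \<Theta> A \<tau> + - \<Theta> (C ** A) \<tau>)
    (\<lambda>A. \<Prod>C\<in>SB N. if same C (mat 1) then 1 else X A + - X (C ** A))"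
  proof (rule galfam_prod[OF N0])
    fix C
    show "galfam N (\<lambda>A \<tau>. if same C (mat 1) then 1 else \<Theta> A \<tau> + - \<Theta> (C ** A) \<tau>)
      (\<lambda>A. if same C (mat 1) then 1 else X A + - X (C ** A))"
    proof (cases "same C (mat 1)")
      case True
      then show ?thesis using galfam_of_int[OF N0, of 1] by simp
    next
      case False
      have "galfam N (\<lambda>A \<tau>. \<Theta> A \<tau> + - \<Theta> (C ** A) \<tau>) (\<lambda>A. X A + - X (C ** A))"
        by (intro galfam_add[OF N0] galfam_uminus[OF N0] galfam_mult_left gal)
      then show ?thesis using False by simp
    qed
  qed
  then show ?thesis unfolding Dl_def[abs_def] DX_def[abs_def] .
qed

text \<open>A vanishing difference of expansions means equal functions, and translation by A^(-1)
  turns this into the excluded equality with the identity node.\<close>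

lemma DX_nonzero:
  assumes A: "A \<in> SL2Z"
  shows "DX A \<noteq> 0"
proof -
  have "X A + - X (C ** A) \<noteq> 0" if C: "\<not> same C (mat 1)" for C
  proof
    assume 0: "X A + - X (C ** A) = 0"
    have q: "has_q_expansion N (\<lambda>\<tau>. \<Theta> A \<tau> + - \<Theta> (C ** A) \<tau>) (X A + - X (C ** A))"
      by (intro qexp_add[OF N0] qexp_uminus[OF N0] F(4))
    have hol: "(\<lambda>\<tau>. \<Theta> A \<tau> + - \<Theta> (C ** A) \<tau>) holomorphic_on uhp" by (intro holomorphic_intros F(3))
    have z: "\<Theta> A \<tau> + - \<Theta> (C ** A) \<tau> = 0" if "\<tau> \<in> uhp" for \<tau>
      by (rule holomorphic_qexp_zero[OF hol q[unfolded 0] that])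
    have "same (mat_mod N (C ** A)) (mat_mod N (mat 1 ** A))"
      unfolding same_def
    proof
      fix \<tau> assume \<tau>: "\<tau> \<in> uhp"
      have "\<Theta> (mat_mod N (C ** A)) \<tau> = \<Theta> (C ** A) \<tau>" "\<Theta> (mat_mod N (mat 1 ** A)) \<tau> = \<Theta> A \<tau>"
        by (rule F(1)[OF _ \<tau>], simp)+
      then show "\<Theta> (mat_mod N (C ** A)) \<tau> = \<Theta> (mat_mod N (mat 1 ** A)) \<tau>" using z[OF \<tau>] by simp
    qed
    then show False using C unfolding same_act[OF A] by blast
  qed
  then show ?thesis unfolding DX_def by (auto simp: prod_zero_iff[OF finite_SB[OF N0]])
qed

text \<open>The interpolation polynomial R, with nodes \<Theta> B and values the conjugates of D(j)
  f, is invariant under SL2(Z), which only permutes nodes and values together; so its coefficients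
  are polynomials in j. Evaluating at theta leaves the nodes equal to theta, and these come from
  +-1, where f is unchanged.\<close>

lemma lagrange_interpolation:
  assumes f: "modular_fun N f"
  obtains D :: "complex poly" and n p where "D \<noteq> 0"
    "\<And>\<tau>. \<tau> \<in> uhp \<Longrightarrow> poly D (j_inv \<tau>) * (Dl (mat 1) \<tau> * f \<tau>) = (\<Sum>i\<le>n. poly (p i) (j_inv \<tau>) * \<Theta> (mat 1) \<tau> ^ i)"
proof -
  obtain D :: "complex poly" where D: "D \<noteq> 0" "\<And>\<gamma>. \<gamma> \<in> SL2Z \<Longrightarrow> (\<lambda>\<tau>. poly D (j_inv \<tau>) * f (mob \<gamma> \<tau>)) holomorphic_on uhp"
    using clear_denominators[OF N0 f] by blast
  define L where "L = SL2Z_lift N"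
  note L = SL2Z_lift[of _ N, folded L_def]
  have fin: "finite (SB N)" by (rule finite_SB[OF N0])
  define ff where "ff = (\<lambda>B \<tau>. poly D (j_inv \<tau>) * f (mob (L B) \<tau>))"
  define q where "q = (\<lambda>B C \<tau>. if same C B then 1 else [:- \<Theta> C \<tau>, 1:])"
  define Q where "Q = (\<lambda>B \<tau>. \<Prod>C\<in>SB N. q B C \<tau>)"
  define R where "R = (\<lambda>\<tau>. \<Sum>B\<in>SB N. smult (ff B \<tau>) (Q B \<tau>))"
  have act: "mat_mod N (B ** A) \<in> SB N" if "B \<in> SB N" "A \<in> SL2Z" for A B
    using SB_bij[OF N0 that(2)] that(1) by (auto simp: bij_betw_def)
  have gU: "is_subring (UNIV :: complex set)" by simp
  have gq: "good N UNIV (\<lambda>\<tau>. coeff (q B C \<tau>) i)" for B C i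
  proof -
    have 1: "good N UNIV (\<lambda>\<tau>. - \<Theta> C \<tau>)"
      by (rule good_uminus[OF N0 gU]) (use F(3,4) in \<open>auto simp: good_def[OF N0]\<close>)
    note c = good_const[OF N0 gU UNIV_I]
    show ?thesis
    proof (cases "same C B")
      case True
      then show ?thesis using c by (simp add: q_def)
    next
      case False
      then show ?thesis using 1 c by (cases i) (simp_all add: q_def)
    qed
  qed
  have gf: "good N UNIV (ff B)" if B: "B \<in> SB N" for B
  proof -
    obtain FB where FB: "has_q_expansion N (\<lambda>\<tau>. f (mob (L B) \<tau>)) FB" using modular_funD(3)[OF f L(1)[OF B]] by blast
    have "has_q_expansion N (ff B) (PJ N (degree D) (coeff D) * FB)"
      unfolding ff_def poly_j_pj[OF order_refl] by (intro qexp_mult[OF N0] PJ_qexp[OF N0] FB)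
    then show ?thesis using D(2)[OF L(1)[OF B]] unfolding good_def[OF N0] ff_def by blast
  qed
  have gR: "good N UNIV (\<lambda>\<tau>. coeff (R \<tau>) i)" for i
  proof -
    have "good N UNIV (\<lambda>\<tau>. \<Sum>B\<in>SB N. ff B \<tau> * coeff (Q B \<tau>) i)"
      unfolding Q_def by (intro good_sum[OF N0 gU] good_mult[OF N0 gU] gf good_coeff_prod[OF N0 gU] gq)
    then show ?thesis unfolding R_def by (simp add: coeff_sum)
  qed
  have inv: "R (mob A \<tau>) = R \<tau>" if A: "A \<in> SL2Z" and \<tau>: "\<tau> \<in> uhp" for A \<tau>
  proof -
    define a where "a = (\<lambda>B. mat_mod N (B ** A))"
    have bij: "bij_betw a (SB N) (SB N)" unfolding a_def by (rule SB_bij[OF N0 A])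
    have 1: "ff B (mob A \<tau>) = ff (a B) \<tau>" if B: "B \<in> SB N" for B
    proof -
      have aB: "a B \<in> SB N" unfolding a_def by (rule act[OF B A])
      have "f (mob (L B) (mob A \<tau>)) = f (mob (L B ** A) \<tau>)" by (simp only: mob_mult[OF A \<tau>])
      also have "\<dots> = f (mob (L (a B)) \<tau>)"
      proof (rule modular_fun_cong[OF f SL2Z_mult[OF L(1)[OF B] A] L(1)[OF aB] _ \<tau>])
        have "mat_mod N (L B ** A) = mat_mod N (mat_mod N (L B) ** A)" by simp
        also have "\<dots> = a B" unfolding L(2)[OF B] a_def ..
        also have "\<dots> = mat_mod N (L (a B))" unfolding L(2)[OF aB] ..
        finally show "mat_mod N (L B ** A) = mat_mod N (L (a B))" .
      qed
      finally show ?thesis unfolding ff_def j_invariant[OF A \<tau>] by (simp only:)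
    qed
    have 2: "q B C (mob A \<tau>) = q (a B) (a C) \<tau>" for B C
    proof -
      have "\<Theta> C (mob A \<tau>) = \<Theta> (a C) \<tau>"
        unfolding F(2)[OF A \<tau>] a_def by (rule F(1)[OF _ \<tau>]) simp
      then show ?thesis unfolding q_def a_def same_act[OF A] by (simp only:)
    qed
    have 3: "Q B (mob A \<tau>) = Q (a B) \<tau>" for B
      unfolding Q_def 2 by (rule prod.reindex_bij_betw[OF bij, of "\<lambda>C. q (a B) C \<tau>"])
    have "R (mob A \<tau>) = (\<Sum>B\<in>SB N. smult (ff (a B) \<tau>) (Q (a B) \<tau>))"
      unfolding R_def 3 by (rule sum.cong[OF refl]) (simp only: 1)
    also have "\<dots> = R \<tau>" unfolding R_def by (rule sum.reindex_bij_betw[OF bij, of "\<lambda>B. smult (ff B \<tau>) (Q B \<tau>)"])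
    finally show ?thesis .
  qed
  have "\<exists>p. \<forall>\<tau>\<in>uhp. coeff (R \<tau>) i = poly p (j_inv \<tau>)" for i
  proof (rule good_invariant_poly_j[OF N0 gU gR[of i]])
    show "coeff (R (mob A \<tau>)) i = coeff (R \<tau>) i" if "A \<in> SL2Z" "\<tau> \<in> uhp" for A \<tau> using inv[OF that] by simp
  qed blast
  then obtain p where p: "\<And>i \<tau>. \<tau> \<in> uhp \<Longrightarrow> coeff (R \<tau>) i = poly (p i) (j_inv \<tau>)" by metis
  define n where "n = card (SB N)"
  have dQ: "degree (Q B \<tau>) \<le> n" for B \<tau>
  proof -
    have "degree (Q B \<tau>) \<le> (\<Sum>C\<in>SB N. degree (q B C \<tau>))" unfolding Q_def by (rule degree_prod_sum_le[OF fin, unfolded comp_def])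
    also have "\<dots> \<le> (\<Sum>C\<in>SB N. 1)" by (rule sum_mono) (simp add: q_def)
    finally show ?thesis by (simp add: n_def)
  qed
  have dR: "degree (R \<tau>) \<le> n" for \<tau>
    unfolding R_def by (rule degree_sum_le[OF fin]) (rule order_trans[OF degree_smult_le dQ])
  \<comment> \<open>All nodes equal to theta contribute the same term, so it occurs m times; m is
    absorbed into the polynomial in j on the left.\<close>
  define m where "m = card {B \<in> SB N. same B (mat 1)}"
  have one: "mat_mod N (mat 1) \<in> SB N" by (rule SB_one)
  have s1: "same (mat_mod N (mat 1)) (mat 1)"
    unfolding same_def using F(1)[of "mat_mod N (mat 1)" "mat 1"] by simp
  have "{B \<in> SB N. same B (mat 1)} \<noteq> {}" using one s1 by blast
  then have m0: "m \<noteq> 0" unfolding m_def using fin by simp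
  have val: "poly (R \<tau>) (\<Theta> (mat 1) \<tau>) = of_nat m * (poly D (j_inv \<tau>) * (Dl (mat 1) \<tau> * f \<tau>))" if \<tau>: "\<tau> \<in> uhp" for \<tau>
  proof -
    have trm: "ff B \<tau> * poly (Q B \<tau>) (\<Theta> (mat 1) \<tau>) =
        (if same B (mat 1) then poly D (j_inv \<tau>) * (Dl (mat 1) \<tau> * f \<tau>) else 0)" if B: "B \<in> SB N" for B
    proof (cases "same B (mat 1)")
      case False
      have "\<not> same (mat_mod N (mat 1)) B" using False s1 unfolding same_def by metis
      then have "poly (q B (mat_mod N (mat 1)) \<tau>) (\<Theta> (mat 1) \<tau>) = 0"
        using s1 \<tau> by (simp add: q_def same_def)
      then have "poly (Q B \<tau>) (\<Theta> (mat 1) \<tau>) = 0"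
        unfolding Q_def poly_prod using one by (auto simp: prod_zero_iff[OF fin])
      then show ?thesis using False by simp
    next
      case True
      have sC: "same C B \<longleftrightarrow> same C (mat 1)" for C using True unfolding same_def by metis
      have "poly (Q B \<tau>) (\<Theta> (mat 1) \<tau>) = Dl (mat 1) \<tau>"
        unfolding Q_def poly_prod Dl_def q_def sC by (rule prod.cong[OF refl]) simp
      moreover have "f (mob (L B) \<tau>) = f \<tau>"
      proof -
        have "\<Theta> (L B) \<tau> = \<Theta> (mat 1) \<tau>" if "\<tau> \<in> uhp" for \<tau>
        proof -
          have "\<Theta> (L B) \<tau> = \<Theta> B \<tau>"
            by (rule F(1)[OF _ that]) (use L(2)[OF B] mat_mod_idem[of N "L B"] in simp)
          then show ?thesis using True that unfolding same_def by simp
        qed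
        then have "mat_mod N (L B) = mat_mod N (mat 1) \<or> mat_mod N (L B) = mat_mod N (- mat 1)"
          using sep[OF L(1)[OF B]] by blast
        then show ?thesis
        proof
          assume h: "mat_mod N (L B) = mat_mod N (mat 1)"
          show ?thesis using modular_fun_cong[OF f L(1)[OF B] SL2Z_1 h \<tau>] by simp
        next
          assume h: "mat_mod N (L B) = mat_mod N (- mat 1)"
          have "- mat 1 \<in> SL2Z" by (simp add: SL2Z_iff)
          from modular_fun_cong[OF f L(1)[OF B] this h \<tau>] show ?thesis by (simp add: mob_def)
        qed
      qed
      ultimately show ?thesis using True unfolding ff_def by simp
    qed
    have "poly (R \<tau>) (\<Theta> (mat 1) \<tau>) = (\<Sum>B\<in>SB N. ff B \<tau> * poly (Q B \<tau>) (\<Theta> (mat 1) \<tau>))"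
      unfolding R_def poly_sum poly_smult ..
    also have "\<dots> = (\<Sum>B\<in>SB N. if same B (mat 1) then poly D (j_inv \<tau>) * (Dl (mat 1) \<tau> * f \<tau>) else 0)"
      by (rule sum.cong[OF refl trm])
    also have "\<dots> = of_nat m * (poly D (j_inv \<tau>) * (Dl (mat 1) \<tau> * f \<tau>))"
      unfolding m_def by (simp add: sum.If_cases[OF fin] Int_def)
    finally show ?thesis .
  qed
  have "poly (smult (of_nat m) D) (j_inv \<tau>) * (Dl (mat 1) \<tau> * f \<tau>) = (\<Sum>i\<le>n. poly (p i) (j_inv \<tau>) * \<Theta> (mat 1) \<tau> ^ i)"
    if \<tau>: "\<tau> \<in> uhp" for \<tau>
  proof -
    have "(\<Sum>i\<le>n. poly (p i) (j_inv \<tau>) * \<Theta> (mat 1) \<tau> ^ i) = (\<Sum>i\<le>n. coeff (R \<tau>) i * \<Theta> (mat 1) \<tau> ^ i)"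
      by (simp only: p[OF \<tau>])
    also have "\<dots> = poly (R \<tau>) (\<Theta> (mat 1) \<tau>)"
      unfolding poly_altdef by (rule sum.mono_neutral_right) (use dR in \<open>auto simp: coeff_eq_0\<close>)
    finally show ?thesis unfolding val[OF \<tau>] by simp
  qed
  moreover have "smult (of_nat m) D \<noteq> 0" using D(1) m0 by simp
  ultimately show ?thesis using that by blast
qed

text \<open>Interpolation yields complex coefficients. Comparing expansions turns them into unknowns
  of a linear system over Q(zeta_N), since j, theta, the denominator and f all have their
  coefficients there. Solvable over the complex numbers, it is solvable over Q(zeta_N); scaling the
  top coefficient to 1 beforehand keeps the relation nontrivial.\<close>

lemma descent_identity:
  assumes f: "modular_fun N f" and FX: "has_q_expansion N f FX" "\<And>k. fls_nth FX k \<in> Q_zeta N"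
  obtains n d m k e where "\<And>i. d i \<in> Q_zeta N" "d n = 1" "\<And>i l. e i l \<in> Q_zeta N"
    "PJ N n d * DX (mat 1) * FX = (\<Sum>i\<le>m. PJ N k (e i) * X (mat 1) ^ i)"
proof -
  let ?K = "Q_zeta N"
  have K: "is_subring ?K" by simp
  obtain D :: "complex poly" and m p where D: "D \<noteq> 0"
    and eq: "\<And>\<tau>. \<tau> \<in> uhp \<Longrightarrow> poly D (j_inv \<tau>) * (Dl (mat 1) \<tau> * f \<tau>) = (\<Sum>i\<le>m. poly (p i) (j_inv \<tau>) * \<Theta> (mat 1) \<tau> ^ i)"
    using lagrange_interpolation[OF f] by metis
  define n where "n = degree D"
  define l where "l = Max ((\<lambda>i. degree (p i)) ` {..m})"
  have l: "degree (p i) \<le> l" if "i \<le> m" for i unfolding l_def using that by (intro Max_ge) auto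
  define c where "c = coeff D n"
  have c0: "c \<noteq> 0" using D by (simp add: c_def n_def)
  define J where "J = jfls N"
  define W where "W = DX (mat 1) * FX"
  note DF = modfamD[OF galfamD(1)[OF galfam_Dl]]
  have id: "PJ N n (coeff D) * W = (\<Sum>i\<le>m. PJ N l (coeff (p i)) * X (mat 1) ^ i)"
  proof (rule qexp_unique[OF N0])
    show "has_q_expansion N (\<lambda>\<tau>. pj n (coeff D) \<tau> * (Dl (mat 1) \<tau> * f \<tau>)) (PJ N n (coeff D) * W)"
      unfolding W_def by (intro qexp_mult[OF N0] PJ_qexp[OF N0] DF(4) FX(1))
    have "has_q_expansion N (\<lambda>\<tau>. \<Sum>i\<le>m. pj l (coeff (p i)) \<tau> * \<Theta> (mat 1) \<tau> ^ i) (\<Sum>i\<le>m. PJ N l (coeff (p i)) * X (mat 1) ^ i)"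
      by (intro qexp_sum[OF N0] qexp_mult[OF N0] PJ_qexp[OF N0] qexp_power[OF N0] F(4))
    then show "has_q_expansion N (\<lambda>\<tau>. pj n (coeff D) \<tau> * (Dl (mat 1) \<tau> * f \<tau>)) (\<Sum>i\<le>m. PJ N l (coeff (p i)) * X (mat 1) ^ i)"
    proof (rule qexp_cong_uhp)
      fix \<tau> assume \<tau>: "\<tau> \<in> uhp"
      have "(\<Sum>i\<le>m. pj l (coeff (p i)) \<tau> * \<Theta> (mat 1) \<tau> ^ i) = (\<Sum>i\<le>m. poly (p i) (j_inv \<tau>) * \<Theta> (mat 1) \<tau> ^ i)"
        by (rule sum.cong[OF refl]) (simp add: poly_j_pj[OF l])
      then show "(\<Sum>i\<le>m. pj l (coeff (p i)) \<tau> * \<Theta> (mat 1) \<tau> ^ i) = pj n (coeff D) \<tau> * (Dl (mat 1) \<tau> * f \<tau>)"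
        using eq[OF \<tau>] unfolding poly_j_pj[of D n, OF eq_refl[OF n_def[symmetric]]] by simp
    qed
  qed
  have KJ: "fls_rel ?K (\<lambda>x. x) J J" unfolding fls_rel_id_iff J_def
    using jfls_coeffs(1)[OF N0] Ints_subset_subring[OF K] by blast
  have KW: "fls_rel ?K (\<lambda>x. x) W W" unfolding W_def
    using FX(2) subsetD[OF Zz_subset_Q_zeta DF(5)]
    by (intro fls_rel_mult[OF ring_emb_id[OF K]]) (simp_all add: fls_rel_id_iff)
  have KX: "fls_rel ?K (\<lambda>x. x) (X (mat 1)) (X (mat 1))"
    using subsetD[OF Zz_subset_Q_zeta F(5)] by (simp add: fls_rel_id_iff)
  \<comment> \<open>The unknowns on both sides in a single index set: \<open>Inl k\<close> for the
    lower coefficients on the left, brought over with a minus sign, \<open>Inr (i, k)\<close> for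
    those on the right.\<close>
  define a where "a = (\<lambda>s :: nat + nat \<times> nat. case s of Inl k \<Rightarrow> - (J ^ k * W) | Inr (i, k) \<Rightarrow> J ^ k * X (mat 1) ^ i)"
  define cc where "cc = (\<lambda>s :: nat + nat \<times> nat. case s of Inl k \<Rightarrow> coeff D k / c | Inr (i, k) \<Rightarrow> coeff (p i) k / c)"
  define I where "I = Inl ` {..<n} \<union> Inr ` ({..m} \<times> {..l})"
  have I: "finite I" by (simp add: I_def)
  have Isum: "(\<Sum>s\<in>I. g s) = (\<Sum>k<n. g (Inl k)) + (\<Sum>i\<le>m. \<Sum>k\<le>l. g (Inr (i, k)))" for g :: "nat + nat \<times> nat \<Rightarrow> complex fls"
    unfolding I_def
    by (subst sum.union_disjoint) (auto simp: sum.reindex sum.cartesian_product)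
  have expand: "PJ N n d * W = (\<Sum>k<n. fls_const (d k) * (J ^ k * W)) + fls_const (d n) * (J ^ n * W)" for d
    unfolding PJ_def J_def[symmetric] by (simp add: sum_distrib_right mult.assoc distrib_right flip: lessThan_Suc_atMost)
  have expand2: "(\<Sum>i\<le>m. PJ N l (e i) * X (mat 1) ^ i) = (\<Sum>i\<le>m. \<Sum>k\<le>l. fls_const (e i k) * (J ^ k * X (mat 1) ^ i))" for e
    unfolding PJ_def J_def[symmetric] by (simp add: sum_distrib_right mult.assoc)
  have equiv: "PJ N n d * W = (\<Sum>i\<le>m. PJ N l (e i) * X (mat 1) ^ i) \<longleftrightarrow>
      fls_const (d n) * (J ^ n * W) = (\<Sum>s\<in>I. fls_const (case s of Inl k \<Rightarrow> d k | Inr (i, k) \<Rightarrow> e i k) * a s)" for d e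
    unfolding expand expand2 Isum a_def by (simp add: sum_negf eq_diff_eq algebra_simps)
  have "fls_const c * (J ^ n * W) = (\<Sum>s\<in>I. fls_const (case s of Inl k \<Rightarrow> coeff D k | Inr (i, k) \<Rightarrow> coeff (p i) k) * a s)"
    using id unfolding equiv c_def .
  then have "fls_const (inverse c) * (fls_const c * (J ^ n * W)) = (\<Sum>s\<in>I. fls_const (inverse c) * (fls_const (case s of Inl k \<Rightarrow> coeff D k | Inr (i, k) \<Rightarrow> coeff (p i) k) * a s))"
    by (simp only: sum_distrib_left)
  moreover have "fls_const (inverse c) * (fls_const c * (J ^ n * W)) = J ^ n * W"
    using c0 by (simp add: fls_const_mult_const flip: mult.assoc)
  moreover have "fls_const (inverse c) * (fls_const (case s of Inl k \<Rightarrow> coeff D k | Inr (i, k) \<Rightarrow> coeff (p i) k) * a s) = fls_const (cc s) * a s" for s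
    unfolding cc_def by (simp add: fls_const_mult_const divide_inverse mult.commute split: sum.split flip: mult.assoc)
  ultimately have lin: "J ^ n * W = (\<Sum>s\<in>I. fls_const (cc s) * a s)" by (simp only:)
  have "\<exists>c'. (\<forall>s\<in>I. c' s \<in> ?K) \<and> (\<forall>t. fls_nth (J ^ n * W) t = (\<Sum>s\<in>I. c' s * fls_nth (a s) t))"
  proof (rule subfield_solution[OF K Q_zeta_inverse[OF N0] I])
    note e = ring_emb_id[OF K]
    have r: "fls_rel ?K (\<lambda>x. x) (J ^ k * W) (J ^ k * W)" "fls_rel ?K (\<lambda>x. x) (J ^ k * X (mat 1) ^ i) (J ^ k * X (mat 1) ^ i)" for i k
      by (intro fls_rel_mult[OF e] fls_rel_power[OF e] KJ KW KX)+
    show "fls_nth (J ^ n * W) t \<in> ?K" for t by (rule fls_relD(1)[OF r(1)])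
    show "fls_nth (a s) t \<in> ?K" for s t
      unfolding a_def using fls_relD(1)[OF r(1)] fls_relD(1)[OF r(2)] subring_uminus[OF K]
      by (auto split: sum.split)
    show "fls_nth (J ^ n * W) t = (\<Sum>s\<in>I. cc s * fls_nth (a s) t)" for t
      unfolding lin by (simp add: fls_nth_sum)
  qed
  then obtain c' where c': "\<And>s. s \<in> I \<Longrightarrow> c' s \<in> ?K" "\<And>t. fls_nth (J ^ n * W) t = (\<Sum>s\<in>I. c' s * fls_nth (a s) t)" by blast
  have K01: "(0 :: complex) \<in> ?K" "1 \<in> ?K" using subring_0[OF K] subring_1[OF K] by simp_all
  define c2 where "c2 = (\<lambda>s. if s \<in> I then c' s else 0)"
  have c2: "c2 s \<in> ?K" for s using c'(1) K01 by (simp add: c2_def)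
  define d where "d = (\<lambda>k. if k = n then 1 else c2 (Inl k))"
  define e where "e = (\<lambda>i k. c2 (Inr (i, k)))"
  have "J ^ n * W = (\<Sum>s\<in>I. fls_const (c' s) * a s)"
    by (rule fls_eqI) (simp add: fls_nth_sum c'(2))
  also have "\<dots> = (\<Sum>s\<in>I. fls_const (case s of Inl k \<Rightarrow> d k | Inr (i, k) \<Rightarrow> e i k) * a s)"
    by (rule sum.cong[OF refl]) (auto simp: d_def e_def c2_def I_def)
  finally have "PJ N n d * W = (\<Sum>i\<le>m. PJ N l (e i) * X (mat 1) ^ i)"
    unfolding equiv by (simp add: d_def)
  then have "PJ N n d * DX (mat 1) * FX = (\<Sum>i\<le>m. PJ N l (e i) * X (mat 1) ^ i)" by (simp add: W_def mult.assoc)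
  moreover have "d i \<in> ?K" "e i t \<in> ?K" for i t using c2 K01 by (simp_all add: d_def e_def)
  moreover have "d n = 1" by (simp add: d_def)
  ultimately show ?thesis using that[of d n e l m] by blast
qed

text \<open>Conjugating the descent identity of f gives one for u with index diag(1, d). The first
  is transported along \<delta>, the second along \<delta>'; the congruence between diag(1, d)
  \<delta>' and \<delta> diag(1, d) makes their known ingredients conjugate to each other, hence
  also the quotients F1 and U1.\<close>

lemma qexp_conjugate:
  assumes f: "modular_fun N f" "has_q_expansion N f FX" "\<And>k. fls_nth FX k \<in> Q_zeta N"
    and u: "modular_fun N u" "has_q_expansion N u U0" "\<And>k. fls_nth U0 k = \<sigma> (fls_nth FX k)"
    and \<sigma>: "\<sigma> \<in> Gal_Q" "\<sigma> (zeta N) = zeta N powi d"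
    and \<delta>: "\<delta> \<in> SL2Z" "\<delta>' \<in> SL2Z" "mat_mod N (diag1 d ** \<delta>') = mat_mod N (\<delta> ** diag1 d)"
    and q: "has_q_expansion N (\<lambda>\<tau>. f (mob \<delta> \<tau>)) F1" "has_q_expansion N (\<lambda>\<tau>. u (mob \<delta>' \<tau>)) U1"
  shows "fls_rel (Q_zeta N) \<sigma> F1 U1"
proof -
  let ?K = "Q_zeta N"
  have e: "ring_emb ?K \<sigma>" by (rule Gal_Q_ring_emb[OF \<sigma>(1) N0])
  obtain n a m k b where ab: "\<And>i. a i \<in> ?K" "a n = 1" "\<And>i l. b i l \<in> ?K"
    and id: "PJ N n a * DX (mat 1) * FX = (\<Sum>i\<le>m. PJ N k (b i) * X (mat 1) ^ i)"
    using descent_identity[OF f] by metis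
  have relZ: "fls_rel ?K \<sigma> F G" if "fls_rel (Zz N) \<sigma> F G" for F G
    using that Zz_subset_Q_zeta unfolding fls_rel_def by blast
  have rD: "fls_rel ?K \<sigma> (DX A) (DX (A ** diag1 d))" and rX: "fls_rel ?K \<sigma> (X A) (X (A ** diag1 d))" for A
    by (rule relZ, rule galfamD(2)[OF galfam_Dl \<sigma>], rule relZ, rule galfamD(2)[OF gal \<sigma>])
  have rP: "fls_rel ?K \<sigma> (PJ N n a) (PJ N n (\<lambda>i. \<sigma> (a i)))" "fls_rel ?K \<sigma> (PJ N k (b i)) (PJ N k (\<lambda>l. \<sigma> (b i l)))" for i
    by (rule PJ_rel[OF e ab(1) N0], rule PJ_rel[OF e ab(3) N0])
  have rR: "fls_rel ?K \<sigma> (\<Sum>i\<le>m. PJ N k (b i) * X A ^ i) (\<Sum>i\<le>m. PJ N k (\<lambda>l. \<sigma> (b i l)) * X (A ** diag1 d) ^ i)" for A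
    by (intro fls_rel_sum[OF e] fls_rel_mult[OF e] fls_rel_power[OF e] rP rX)
  have rF: "fls_rel ?K \<sigma> FX U0" unfolding fls_rel_def using f(3) u(3) by blast
  have "fls_rel ?K \<sigma> (PJ N n a * DX (mat 1) * FX) (PJ N n (\<lambda>i. \<sigma> (a i)) * DX (mat 1 ** diag1 d) * U0)"
    by (intro fls_rel_mult[OF e] rP rD rF)
  then have "PJ N n (\<lambda>i. \<sigma> (a i)) * DX (mat 1 ** diag1 d) * U0 = (\<Sum>i\<le>m. PJ N k (\<lambda>l. \<sigma> (b i l)) * X (mat 1 ** diag1 d) ^ i)"
    using rR[of "mat 1"] unfolding id by (rule fls_rel_unique)
  then have id': "PJ N n (\<lambda>i. \<sigma> (a i)) * DX (diag1 d) * U0 = (\<Sum>i\<le>m. PJ N k (\<lambda>l. \<sigma> (b i l)) * X (diag1 d) ^ i)"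
    by simp
  have t1: "PJ N n a * DX \<delta> * F1 = (\<Sum>i\<le>m. PJ N k (b i) * X \<delta> ^ i)"
    using transport_identity[OF N0 f(1,2) \<delta>(1) q(1) galfamD(1)[OF galfam_Dl] galfamD(1)[OF gal] id] by simp
  have t2: "PJ N n (\<lambda>i. \<sigma> (a i)) * DX (diag1 d ** \<delta>') * U1 = (\<Sum>i\<le>m. PJ N k (\<lambda>l. \<sigma> (b i l)) * X (diag1 d ** \<delta>') ^ i)"
    by (rule transport_identity[OF N0 u(1,2) \<delta>(2) q(2) galfamD(1)[OF galfam_Dl] galfamD(1)[OF gal] id'])
  have cX: "X (diag1 d ** \<delta>') = X (\<delta> ** diag1 d)" "DX (diag1 d ** \<delta>') = DX (\<delta> ** diag1 d)"
    by (rule modfam_qexp_cong[OF N0 galfamD(1)[OF gal] \<delta>(3)], rule modfam_qexp_cong[OF N0 galfamD(1)[OF galfam_Dl] \<delta>(3)])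
  have nz: "PJ N n a * DX \<delta> \<noteq> 0"
    using PJ_nonzero[OF N0, of a n] ab(2) DX_nonzero[OF \<delta>(1)] by simp
  show ?thesis
    by (rule fls_rel_quotient[OF e Q_zeta_inverse[OF N0] fls_rel_mult[OF e rP(1) rD[of \<delta>]] nz rR[of \<delta>] t1 t2[unfolded cX]])
qed

end

section \<open>The Galois action on the cusps\<close>

lemma mat_mod_eq_dvd: "mat_mod N A = mat_mod N B \<Longrightarrow> int N dvd A$i$j - B$i$j"
  by (metis mat_mod_nth mod_eq_dvd_iff)

lemma cusp_representative:
  assumes "p \<in> Pt ` \<rat> \<union> {I_inf}"
  obtains \<gamma> where "\<gamma> \<in> SL2Z" "p = mob_ext \<gamma> I_inf"
proof (cases p)
  case I_inf
  then show ?thesis using that[of "mat 1"] by simp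
next
  case (Pt z)
  then have "z \<in> \<rat>" using assms by auto
  then obtain r where r: "z = of_rat r" by (auto elim: Rats_cases)
  obtain a b where ab: "r = Fract a b" "b > 0" "coprime a b" by (cases r)
  obtain x y where xy: "a * x + b * y = 1" using ab(3) bezout_int[of a b] by (metis coprime_iff_gcd_eq_1 mult.commute)
  have "mat2 a (- y) b x \<in> SL2Z" using xy by (simp add: SL2Z_iff algebra_simps)
  moreover have "p = mob_ext (mat2 a (- y) b x) I_inf"
    using ab(2) unfolding Pt r ab(1) by (simp add: Fract_of_int_quotient of_rat_divide)
  ultimately show ?thesis by (rule that)
qed

lemma mob_ext_mult_I_inf:
  assumes "\<alpha> \<in> SL2Z" "\<gamma> \<in> SL2Z"
  shows "mob_ext \<alpha> (mob_ext \<gamma> I_inf) = mob_ext (\<alpha> ** \<gamma>) I_inf"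
proof (cases "\<gamma>$2$1 = 0")
  case True
  then have "\<gamma>$1$1 \<noteq> 0" using assms(2) by (auto simp: SL2Z_iff)
  then show ?thesis using True by (simp add: mult_nth2)
next
  case False
  define p r where "p = \<gamma>$1$1" and "r = \<gamma>$2$1"
  have r: "(of_int r :: complex) \<noteq> 0" using False by (simp add: r_def)
  have e: "of_int c * (of_int p / of_int r) + of_int d = (of_int (c * p + d * r) / of_int r :: complex)" for c d
    using r by (simp add: field_simps)
  have "mob_ext \<gamma> I_inf = Pt (of_int p / of_int r)" using False by (simp add: p_def r_def)
  moreover have c: "(x / of_int r) / (y / of_int r) = x / y" for x y :: complex using r by simp
  ultimately show ?thesis
    unfolding mob_ext.simps(2)[of "\<alpha> ** \<gamma>"] mult_nth2 p_def[symmetric] r_def[symmetric]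
    using r by (simp only: mob_ext.simps(1) mob_def e c divide_eq_0_iff of_int_eq_0_iff simp_thms)
qed

text \<open>A cusp determines the first column of its matrix as a primitive vector, and thus up to
  sign.\<close>

lemma mob_ext_eq_imp_columns:
  assumes "\<gamma>1 \<in> SL2Z" "\<gamma>2 \<in> SL2Z" "mob_ext \<gamma>1 I_inf = mob_ext \<gamma>2 I_inf"
  obtains e :: int where "e = 1 \<or> e = -1" "\<gamma>1$1$1 = e * \<gamma>2$1$1" "\<gamma>1$2$1 = e * \<gamma>2$2$1"
proof -
  define p1 q1 r1 s1 where "p1 = \<gamma>1$1$1" and "q1 = \<gamma>1$1$2" and "r1 = \<gamma>1$2$1" and "s1 = \<gamma>1$2$2"
  define p2 q2 r2 s2 where "p2 = \<gamma>2$1$1" and "q2 = \<gamma>2$1$2" and "r2 = \<gamma>2$2$1" and "s2 = \<gamma>2$2$2"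
  note defs = p1_def q1_def r1_def s1_def p2_def q2_def r2_def s2_def
  have d: "p1 * s1 - q1 * r1 = 1" "p2 * s2 - q2 * r2 = 1" using assms(1,2) by (simp_all add: SL2Z_iff defs)
  have pr: "p1 * r2 = p2 * r1"
  proof (cases "r1 = 0")
    case True
    then have "r2 = 0" using assms(3) by (auto simp: defs split: if_splits)
    then show ?thesis using True by simp
  next
    case False
    then have r2: "r2 \<noteq> 0" using assms(3) by (auto simp: defs split: if_splits)
    then have "of_int p1 / of_int r1 = (of_int p2 / of_int r2 :: complex)" using assms(3) False by (simp add: defs)
    then have "(of_int (p1 * r2) :: complex) = of_int (p2 * r1)" using False r2 by (simp add: field_simps)
    then show ?thesis by (simp only: of_int_eq_iff)
  qed
  define e where "e = s2 * p1 - q2 * r1"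
  have "e * (p2 * s1 - r2 * q1) = 1" unfolding e_def using d pr by algebra
  then have "e = 1 \<or> e = -1" using zmult_eq_1_iff by blast
  moreover have "p1 = e * p2" "r1 = e * r2" unfolding e_def using d pr by algebra+
  ultimately show ?thesis using that[of e] by (simp add: defs)
qed

context level_group
begin

text \<open>Since f is fixed by g, which is diag(1, d) \<beta> modulo N, f equals u o \<beta> with u
  the conjugate of f. As g \<gamma>' and \<gamma> agree in the first column, \<gamma>' can be
  changed by some T^k, which fixes infinity, so that g \<gamma>' T^k = \<gamma> diag(1, d) modulo N.
  Then \<open>qexp_conjugate\<close> compares the expansions at the two cusps.\<close>

lemma conjugate_value:
  assumes f: "f \<in> function_field N G" and g: "g \<in> G" and \<gamma>: "\<gamma> \<in> SL2Z" "\<gamma>' \<in> SL2Z"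
    and col: "int N dvd (g ** \<gamma>')$1$1 - \<gamma>$1$1" "int N dvd (g ** \<gamma>')$2$1 - \<gamma>$2$1"
    and v: "((\<lambda>\<tau>. f (mob \<gamma> \<tau>)) \<longlongrightarrow> v) at_i_inf"
  obtains \<sigma> where "\<sigma> \<in> Gal_Q" "\<sigma> (zeta N) = zeta N powi det g" "v \<in> Q_zeta N" "has_value f (mob_ext \<gamma>' I_inf) (\<sigma> v)"
proof -
  have fF: "f \<in> F_field N" and "GL2_maps N g f f" using f g unfolding function_field_def by blast+
  then obtain \<beta> \<sigma> u FX U0 where \<beta>: "\<beta> \<in> SL2Z" "mat_mod N (diag1 (det g) ** \<beta>) = mat_mod N g"
    and \<sigma>: "\<sigma> \<in> Gal_Q" "\<sigma> (zeta N) = zeta N powi det g"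
    and u: "u \<in> F_field N" "has_q_expansion N u U0" "\<forall>n. fls_nth U0 n = \<sigma> (fls_nth FX n)"
    and FX: "has_q_expansion N f FX" and fu: "\<forall>\<tau>\<in>uhp. f \<tau> = u (mob \<beta> \<tau>)"
    unfolding GL2_maps_def by blast
  have fm: "modular_fun N f" and um: "modular_fun N u" using fF u(1) unfolding F_field_def by blast+
  obtain FX' where "has_q_expansion N f FX'" "\<forall>n. fls_nth FX' n \<in> Q_zeta N" using fF unfolding F_field_def by blast
  then have FK: "fls_nth FX n \<in> Q_zeta N" for n using qexp_unique[OF N0 FX] by blast
  define d where "d = det g"
  define M where "M = g ** \<gamma>'"
  have dM: "M$1$1 * M$2$2 - M$1$2 * M$2$1 = d"
    using \<gamma>(2) unfolding d_def M_def by (simp add: det_mul SL2Z_def flip: det_2)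
  have d\<gamma>: "\<gamma>$1$1 * \<gamma>$2$2 - \<gamma>$1$2 * \<gamma>$2$1 = 1" using \<gamma>(1) unfolding SL2Z_iff .
  \<comment> \<open>Modulo N the matrix \<gamma>^(-1) M is upper triangular with diagonal (1, d) and
    corner -k, which T^k clears.\<close>
  define k where "k = \<gamma>$1$2 * M$2$2 - \<gamma>$2$2 * M$1$2"
  define \<epsilon> where "\<epsilon> = \<gamma>' ** Tmat k"
  have \<epsilon>: "\<epsilon> \<in> SL2Z" unfolding \<epsilon>_def by (rule SL2Z_mult[OF \<gamma>(2) Tmat_SL2Z])
  have comb: "int N dvd (M$1$1 - \<gamma>$1$1) * x + (M$2$1 - \<gamma>$2$1) * y" for x y
    using col unfolding M_def by (intro dvd_add dvd_mult2)
  have MT: "mat_mod N (M ** Tmat k) = mat_mod N (\<gamma> ** diag1 d)"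
  proof -
    have e0: "int N dvd (M ** Tmat k)$1$1 - (\<gamma> ** diag1 d)$1$1" "int N dvd (M ** Tmat k)$2$1 - (\<gamma> ** diag1 d)$2$1"
      using col unfolding M_def[symmetric] by (simp_all add: mult_nth2 Tmat_def)
    have e1: "(M ** Tmat k)$1$2 - (\<gamma> ** diag1 d)$1$2 = (M$1$1 - \<gamma>$1$1) * (k - \<gamma>$1$2 * M$2$2) + (M$2$1 - \<gamma>$2$1) * (\<gamma>$1$2 * M$1$2)"
      unfolding mult_nth2 Tmat_def mat2_nth diag1_nth dM[symmetric] k_def using d\<gamma> by algebra
    have e2: "(M ** Tmat k)$2$2 - (\<gamma> ** diag1 d)$2$2 = (M$1$1 - \<gamma>$1$1) * (- \<gamma>$2$2 * M$2$2) + (M$2$1 - \<gamma>$2$1) * (k + \<gamma>$2$2 * M$1$2)"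
      unfolding mult_nth2 Tmat_def mat2_nth diag1_nth dM[symmetric] k_def using d\<gamma> by algebra
    show ?thesis
      unfolding mat2_eq_iff[of "mat_mod N (M ** Tmat k)"] mat_mod_nth mod_eq_dvd_iff e1 e2
      by (intro conjI e0 comb)
  qed
  have \<beta>\<epsilon>: "\<beta> ** \<epsilon> \<in> SL2Z" by (rule SL2Z_mult[OF \<beta>(1) \<epsilon>])
  have "mat_mod N (diag1 d ** (\<beta> ** \<epsilon>)) = mat_mod N ((diag1 d ** \<beta>) ** \<epsilon>)" by (simp add: matrix_mul_assoc)
  also have "\<dots> = mat_mod N (g ** \<epsilon>)" by (rule mat_mod_mult_cong[OF \<beta>(2)[folded d_def] refl])
  also have "g ** \<epsilon> = M ** Tmat k" by (simp add: \<epsilon>_def M_def matrix_mul_assoc)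
  finally have cong: "mat_mod N (diag1 d ** (\<beta> ** \<epsilon>)) = mat_mod N (\<gamma> ** diag1 d)" unfolding MT .
  obtain F1 where F1: "has_q_expansion N (\<lambda>\<tau>. f (mob \<gamma> \<tau>)) F1" using modular_funD(3)[OF fm \<gamma>(1)] by blast
  obtain U1 where U1: "has_q_expansion N (\<lambda>\<tau>. u (mob (\<beta> ** \<epsilon>) \<tau>)) U1" using modular_funD(3)[OF um \<beta>\<epsilon>] by blast
  obtain \<Theta> X where "galfam N \<Theta> X"
    "\<And>B. B \<in> SL2Z \<Longrightarrow> (\<And>\<tau>. \<tau> \<in> uhp \<Longrightarrow> \<Theta> B \<tau> = \<Theta> (mat 1) \<tau>) \<Longrightarrow> mat_mod N B = mat_mod N (mat 1) \<or> mat_mod N B = mat_mod N (- mat 1)"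
    using separating_family[OF N2] by blast
  then interpret galois_descent N \<Theta> X by (unfold_locales) (use N2 in blast)+
  have rel: "fls_rel (Q_zeta N) \<sigma> F1 U1"
    by (rule qexp_conjugate[OF fm FX FK um u(2) _ \<sigma>[folded d_def] \<gamma>(1) \<beta>\<epsilon> cong F1 U1]) (use u(3) in blast)
  have emb: "ring_emb (Q_zeta N) \<sigma>" by (rule Gal_Q_ring_emb[OF \<sigma>(1) N0])
  have neg: "fls_nth F1 n = 0" if "n < 0" for n by (rule qexp_tendsto_imp(1)[OF N0 F1 v that])
  have v0: "v = fls_nth F1 0" by (rule qexp_tendsto_imp(2)[OF N0 F1 v])
  have neg': "fls_nth U1 n = 0" if "n < 0" for n
    using fls_relD(2)[OF rel, of n] neg[OF that] ring_embD(5)[OF emb] by simp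
  have "((\<lambda>\<tau>. u (mob (\<beta> ** \<epsilon>) \<tau>)) \<longlongrightarrow> fls_nth U1 0) at_i_inf" by (rule qexp_tendsto[OF N0 U1 neg'])
  then have lim: "((\<lambda>\<tau>. u (mob (\<beta> ** \<epsilon>) \<tau>)) \<longlongrightarrow> \<sigma> v) at_i_inf" unfolding fls_relD(2)[OF rel] v0 .
  have "\<forall>\<^sub>F \<tau> in at_i_inf. u (mob (\<beta> ** \<epsilon>) \<tau>) = f (mob \<epsilon> \<tau>)"
    using eventually_in_uhp by eventually_elim (simp add: fu mob_mult[OF \<epsilon>] mob_in_uhp[OF \<epsilon>])
  from tendsto_cong[OF this] have lim2: "((\<lambda>\<tau>. f (mob \<epsilon> \<tau>)) \<longlongrightarrow> \<sigma> v) at_i_inf" using lim by blast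
  have "mob_ext \<gamma>' I_inf = mob_ext \<epsilon> I_inf" by (simp add: \<epsilon>_def mult_nth2 Tmat_def)
  then have "has_value f (mob_ext \<gamma>' I_inf) (\<sigma> v)" unfolding has_value_def using \<epsilon> lim2 by blast
  moreover have "v \<in> Q_zeta N" unfolding v0 by (rule fls_relD(1)[OF rel])
  ultimately show ?thesis using that \<sigma> by blast
qed

lemma cusps_cases:
  assumes "C \<in> cusps N G"
  obtains \<gamma> where "\<gamma> \<in> SL2Z" "mob_ext \<gamma> I_inf \<in> C"
    "\<And>q. q \<in> C \<Longrightarrow> \<exists>\<alpha>\<in>Gamma_of N G. mob_ext (\<alpha> ** \<gamma>) I_inf = q"
proof -
  from assms obtain p where p: "p \<in> Pt ` \<rat> \<union> {I_inf}" "C = orbit_rel N G `` {p}"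
    unfolding cusps_def quotient_def by blast
  obtain \<gamma> where \<gamma>: "\<gamma> \<in> SL2Z" "p = mob_ext \<gamma> I_inf" using cusp_representative[OF p(1)] by blast
  have pb: "p \<in> uhp_bar" using p(1) unfolding uhp_bar_def by blast
  have "(p, p) \<in> orbit_rel N G" unfolding orbit_rel_def using pb Gamma_one mob_ext_one[of p] by blast
  then have mem: "mob_ext \<gamma> I_inf \<in> C" unfolding p(2) \<gamma>(2) by blast
  have "\<exists>\<alpha>\<in>Gamma_of N G. mob_ext (\<alpha> ** \<gamma>) I_inf = q" if "q \<in> C" for q
  proof -
    have "(p, q) \<in> orbit_rel N G" using that unfolding p(2) by blast
    then have "\<exists>\<alpha>\<in>Gamma_of N G. mob_ext \<alpha> p = q" unfolding orbit_rel_def by (simp only: mem_Collect_eq prod.case)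
    then obtain \<alpha> where \<alpha>: "\<alpha> \<in> Gamma_of N G" "mob_ext \<alpha> p = q" by (rule bexE)
    have "\<alpha> \<in> SL2Z" using \<alpha>(1) by (simp add: Gamma_of_def)
    from mob_ext_mult_I_inf[OF this \<gamma>(1)] show ?thesis using \<alpha> unfolding \<gamma>(2) by (intro bexI[of _ \<alpha>]) simp_all
  qed
  then show ?thesis using that[OF \<gamma>(1) mem] by blast
qed

lemma has_value_cusp:
  assumes "has_value f (mob_ext \<gamma> I_inf) v"
  obtains \<delta> where "\<delta> \<in> SL2Z" "mob_ext \<gamma> I_inf = mob_ext \<delta> I_inf" "((\<lambda>\<tau>. f (mob \<delta> \<tau>)) \<longlongrightarrow> v) at_i_inf"
proof -
  have "Im (of_int a / of_int b) = 0" for a b by (simp add: Im_divide)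
  then have "mob_ext \<gamma> I_inf \<noteq> Pt \<tau>" if "\<tau> \<in> uhp" for \<tau> using that by (auto simp: uhp_def)
  then show ?thesis using assms that unfolding has_value_def by blast
qed

text \<open>\<open>conjugate_value\<close> gives an automorphism that may depend on f and on the
  chosen representative of the cusp. On Q(zeta_N) it depends only on the determinant of the group
  element, and all elements that occur have the determinant of g0 modulo N. So one automorphism
  works for all functions.\<close>

lemma galois_transitive_if_transitive:
  assumes neg: "mat_mod N (- mat 1) \<in> G"
    and trans: "\<And>\<gamma> \<gamma>'. \<gamma> \<in> SL2Z \<Longrightarrow> \<gamma>' \<in> SL2Z \<Longrightarrow>
      \<exists>g\<in>G. int N dvd (g ** \<gamma>')$1$1 - \<gamma>$1$1 \<and> int N dvd (g ** \<gamma>')$2$1 - \<gamma>$2$1"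
  shows "galois_transitive_on_cusps N G"
  unfolding galois_transitive_on_cusps_def
proof (intro ballI)
  fix C C' assume C: "C \<in> cusps N G" "C' \<in> cusps N G"
  obtain \<gamma> where \<gamma>: "\<gamma> \<in> SL2Z" "\<And>q. q \<in> C \<Longrightarrow> \<exists>\<alpha>\<in>Gamma_of N G. mob_ext (\<alpha> ** \<gamma>) I_inf = q"
    using cusps_cases[OF C(1)] by metis
  obtain \<gamma>' where \<gamma>': "\<gamma>' \<in> SL2Z" "mob_ext \<gamma>' I_inf \<in> C'"
    using cusps_cases[OF C(2)] by metis
  obtain g0 where g0: "g0 \<in> G" "int N dvd (g0 ** \<gamma>')$1$1 - \<gamma>$1$1" "int N dvd (g0 ** \<gamma>')$2$1 - \<gamma>$2$1"
    using trans[OF \<gamma>(1) \<gamma>'(1)] by blast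
  show "\<exists>\<sigma>\<in>Gal_Q. galois_maps N G \<sigma> C C'"
  \<comment> \<open>With no functions to test, the condition on the automorphism is vacuous.\<close>
  proof (cases "function_field N G = {}")
    case True
    have "id \<in> Gal_Q" by (simp add: Gal_Q_def)
    then show ?thesis using True unfolding galois_maps_def by blast
  next
    case False
    then obtain f0 where "f0 \<in> function_field N G" by blast
    then obtain \<sigma>0 where \<sigma>0: "\<sigma>0 \<in> Gal_Q" "\<sigma>0 (zeta N) = zeta N powi det g0" using function_fieldD[OF _ g0(1)] by metis
    have "has_value_at f C' (\<sigma>0 v)" if f: "f \<in> function_field N G" and v: "has_value_at f C v" for f v
    proof -
      from v obtain p1 where p1: "p1 \<in> C" "has_value f p1 v" unfolding has_value_at_def by blast
      obtain \<alpha> where \<alpha>: "\<alpha> \<in> Gamma_of N G" "mob_ext (\<alpha> ** \<gamma>) I_inf = p1" using \<gamma>(2)[OF p1(1)] by blast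
      have \<alpha>S: "\<alpha> \<in> SL2Z" "mat_mod N \<alpha> \<in> G" using \<alpha>(1) by (simp_all add: Gamma_of_def)
      obtain \<delta> where \<delta>: "\<delta> \<in> SL2Z" "mob_ext (\<alpha> ** \<gamma>) I_inf = mob_ext \<delta> I_inf" "((\<lambda>\<tau>. f (mob \<delta> \<tau>)) \<longlongrightarrow> v) at_i_inf"
        using has_value_cusp[OF p1(2)[folded \<alpha>(2)]] by blast
      obtain e where e: "e = 1 \<or> e = -1" "\<delta>$1$1 = e * (\<alpha> ** \<gamma>)$1$1" "\<delta>$2$1 = e * (\<alpha> ** \<gamma>)$2$1"
        using mob_ext_eq_imp_columns[OF \<delta>(1) SL2Z_mult[OF \<alpha>S(1) \<gamma>(1)] \<delta>(2)[symmetric]] by blast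
      \<comment> \<open>The column of a cusp is known only up to sign; E absorbs the sign, and -1 is
        in G.\<close>
      define E where "E = mat2 e 0 0 e"
      have "mat2 1 0 0 1 = mat 1" "mat2 (-1) 0 0 (-1) = - mat 1" by (simp_all add: mat2_eq_iff)
      then have EG: "mat_mod N E \<in> G" using e(1) neg G_one unfolding E_def by auto
      define g where "g = mat_mod N (mat_mod N E ** mat_mod N (mat_mod N \<alpha> ** g0))"
      have gG: "g \<in> G" unfolding g_def by (intro G_closed EG \<alpha>S(2) g0(1))
      have g_eq: "mat_mod N g = mat_mod N (E ** (\<alpha> ** g0))" unfolding g_def by simp
      have "mat_mod N (g ** \<gamma>') = mat_mod N ((E ** (\<alpha> ** g0)) ** \<gamma>')" by (rule mat_mod_mult_cong[OF g_eq refl])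
      then have gg: "mat_mod N (g ** \<gamma>') = mat_mod N (E ** (\<alpha> ** (g0 ** \<gamma>')))" by (simp only: matrix_mul_assoc)
      have col: "int N dvd (g ** \<gamma>')$i$1 - e * (\<alpha> ** \<gamma>)$i$1" for i :: 2
      proof -
        define M where "M = g0 ** \<gamma>'"
        have E1: "(E ** (\<alpha> ** M))$i$1 = e * (\<alpha> ** M)$i$1"
          using exhaust_2[of i] by (auto simp: E_def mult_nth2)
        have "(g ** \<gamma>')$i$1 - e * (\<alpha> ** \<gamma>)$i$1 = ((g ** \<gamma>')$i$1 - (E ** (\<alpha> ** M))$i$1)
            + (e * \<alpha>$i$1 * (M$1$1 - \<gamma>$1$1) + e * \<alpha>$i$2 * (M$2$1 - \<gamma>$2$1))"
          unfolding E1 unfolding mult_nth2[of \<alpha>] by (simp add: algebra_simps)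
        moreover have "int N dvd (g ** \<gamma>')$i$1 - (E ** (\<alpha> ** M))$i$1" by (rule mat_mod_eq_dvd[OF gg[folded M_def]])
        moreover have "int N dvd e * \<alpha>$i$1 * (M$1$1 - \<gamma>$1$1) + e * \<alpha>$i$2 * (M$2$1 - \<gamma>$2$1)"
          by (rule dvd_add[OF dvd_mult[OF g0(2)[folded M_def]] dvd_mult[OF g0(3)[folded M_def]]])
        ultimately show ?thesis by (simp only: dvd_add)
      qed
      obtain \<sigma> where \<sigma>: "\<sigma> \<in> Gal_Q" "\<sigma> (zeta N) = zeta N powi det g" "v \<in> Q_zeta N" "has_value f (mob_ext \<gamma>' I_inf) (\<sigma> v)"
        using conjugate_value[OF f gG \<delta>(1) \<gamma>'(1) _ _ \<delta>(3)] col[of 1] col[of 2] unfolding e(2,3) by blast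
      have "det E = 1" using e(1) by (auto simp: E_def det_2)
      then have "det (E ** (\<alpha> ** g0)) = det g0" using \<alpha>S(1) by (simp add: det_mul SL2Z_def)
      then have "det g mod int N = det g0 mod int N" using det_mat_mod[of N g] det_mat_mod[of N "E ** (\<alpha> ** g0)"] unfolding g_eq by simp
      then have "zeta N powi det g = zeta N powi det g0" using zeta_powi_mod[OF N0] by metis
      then have "\<sigma> v = \<sigma>0 v" using \<sigma>(2) \<sigma>0(2) by (intro Gal_Q_eq_on_Q_zeta[OF \<sigma>(1) \<sigma>0(1) N0 _ \<sigma>(3)]) simp
      then show ?thesis using \<sigma>(4) \<gamma>'(2) unfolding has_value_at_def by auto
    qed
    then show ?thesis using \<sigma>0(1) unfolding galois_maps_def by blast
  qed
qed


end

section \<open>Estimates\<close>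

text \<open>The factors lie between 1 - t^(i+1) and 1 + t^(i+1). The lower product is at least 1 - s
  by the Weierstrass inequality, s being the geometric sum; multiplying the upper one by it gives
  factors (1 + t^(i+1))(1 - t^(i+1)) <= 1, hence the form of the second bound.\<close>

lemma Pf_norm_bounds:
  fixes c x :: complex
  assumes c: "norm c \<le> 1" and k: "\<And>n. n < k n" and t: "norm x \<le> t" "t < 1 / 2"
  defines "s \<equiv> t / (1 - t)"
  shows "1 - s \<le> norm (Pf c k x)" "norm (Pf c k x) * (1 - s) \<le> 1"
proof -
  have t0: "0 \<le> t" using t(1) norm_ge_zero order_trans by blast
  have x1: "norm x < 1" using t by simp
  have lim: "(\<lambda>n. norm (\<Prod>i\<le>n. 1 - c * x ^ k i)) \<longlonglongrightarrow> norm (Pf c k x)"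
    unfolding Pf_def
    by (rule tendsto_norm[OF convergent_prod_LIMSEQ[OF abs_summable_convergent_prod[OF Pf_summable[OF c k x1]]]])
  have a: "norm (c * x ^ k i) \<le> t ^ Suc i" for i
  proof -
    have "norm (c * x ^ k i) = norm c * norm x ^ k i" by (simp add: norm_mult norm_power)
    also have "\<dots> \<le> 1 * t ^ k i" using c t t0 by (intro mult_mono power_mono) auto
    also have "\<dots> \<le> 1 * t ^ Suc i" using k[of i] t t0 by (intro mult_left_mono power_decreasing) auto
    finally show ?thesis by simp
  qed
  have ti: "0 \<le> t ^ Suc i" "t ^ Suc i \<le> 1" for i using t t0 by (auto intro: power_le_one simp del: power_Suc)
  have sum: "(\<Sum>i\<le>n. t ^ Suc i) \<le> s" for n
  proof -
    have "(\<Sum>i\<le>n. t ^ Suc i) * (1 - t) = t * (1 - t ^ Suc n)"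
    proof (induction n)
      case (Suc n)
      have "(\<Sum>i\<le>Suc n. t ^ Suc i) * (1 - t) = (\<Sum>i\<le>n. t ^ Suc i) * (1 - t) + t ^ Suc (Suc n) * (1 - t)"
        by (simp only: sum.atMost_Suc distrib_right)
      also have "\<dots> = t * (1 - t ^ Suc n) + t ^ Suc (Suc n) * (1 - t)" by (simp only: Suc.IH)
      also have "\<dots> = t * (1 - t ^ Suc (Suc n))" by (simp add: algebra_simps)
      finally show ?case .
    qed (simp add: algebra_simps)
    also have "\<dots> \<le> t * 1" using t0 by (intro mult_left_mono) auto
    finally show ?thesis using t by (simp add: s_def pos_le_divide_eq)
  qed
  have low: "1 - s \<le> (\<Prod>i\<le>n. 1 - t ^ Suc i)" for n
    using Weierstrass_prod_ineq[of "{..n}" "\<lambda>i. t ^ Suc i"] ti sum[of n] by (fastforce simp del: power_Suc)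
  have p1: "(\<Prod>i\<le>n. 1 - t ^ Suc i) \<le> norm (\<Prod>i\<le>n. 1 - c * x ^ k i)" for n
    unfolding prod_norm[symmetric]
  proof (rule prod_mono)
    fix i
    have "norm (1::complex) - norm (c * x ^ k i) \<le> norm (1 - c * x ^ k i)" by (rule norm_triangle_ineq2)
    then show "0 \<le> 1 - t ^ Suc i \<and> 1 - t ^ Suc i \<le> norm (1 - c * x ^ k i)" using a[of i] ti[of i] by simp
  qed
  have p2: "norm (\<Prod>i\<le>n. 1 - c * x ^ k i) \<le> (\<Prod>i\<le>n. 1 + t ^ Suc i)" for n
    unfolding prod_norm[symmetric]
  proof (rule prod_mono)
    fix i
    have "norm (1 - c * x ^ k i) \<le> norm (1::complex) + norm (c * x ^ k i)" by (rule norm_triangle_ineq4)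
    then show "0 \<le> norm (1 - c * x ^ k i) \<and> norm (1 - c * x ^ k i) \<le> 1 + t ^ Suc i" using a[of i] by simp
  qed
  show "1 - s \<le> norm (Pf c k x)"
    by (rule LIMSEQ_le_const[OF lim]) (use order_trans[OF low p1] in blast)
  have s1: "0 \<le> 1 - s" using t t0 by (simp add: s_def field_simps)
  have up: "norm (\<Prod>i\<le>n. 1 - c * x ^ k i) * (1 - s) \<le> 1" for n
  proof -
    have "norm (\<Prod>i\<le>n. 1 - c * x ^ k i) * (1 - s) \<le> (\<Prod>i\<le>n. 1 + t ^ Suc i) * (\<Prod>i\<le>n. 1 - t ^ Suc i)"
      by (rule mult_mono[OF p2 low _ s1]) (use ti in \<open>auto intro!: prod_nonneg add_nonneg_nonneg simp del: power_Suc\<close>)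
    also have "\<dots> = (\<Prod>i\<le>n. (1 + t ^ Suc i) * (1 - t ^ Suc i))" by (rule prod.distrib[symmetric])
    also have "\<dots> \<le> 1"
    proof (rule prod_le_1)
      fix i
      have "(1 + t ^ Suc i) * (1 - t ^ Suc i) = 1 - t ^ Suc i * t ^ Suc i" by (simp add: algebra_simps)
      moreover have "0 \<le> t ^ Suc i * t ^ Suc i" "t ^ Suc i * t ^ Suc i \<le> 1" using ti[of i] by (simp_all del: power_Suc add: mult_le_one)
      ultimately show "0 \<le> (1 + t ^ Suc i) * (1 - t ^ Suc i) \<and> (1 + t ^ Suc i) * (1 - t ^ Suc i) \<le> 1" by linarith
    qed
    finally show ?thesis .
  qed
  show "norm (Pf c k x) * (1 - s) \<le> 1"
    by (rule LIMSEQ_le_const2[OF tendsto_mult_right[OF lim]]) (use up in blast)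
qed

text \<open>On the half-strip |q| <= exp(-5) <= 1/100. This gives |E4| <= 1 + 240/84 = 27/7, and at
  least (98/99)^24 >= 75/99 for the product of eta^24; the quotient (27/7)^3 * 99/75 is below
  100.\<close>

lemma j_upper_bound:
  assumes "\<tau> \<in> fund_region"
  shows "norm (j_inv \<tau>) \<le> 100 / norm (ee \<tau>)"
proof -
  have \<tau>: "\<tau> \<in> uhp" using assms fund_region_subset by blast
  define q y where "q = ee \<tau>" and "y = norm q"
  have "17/10 \<le> sqrt 3" by (rule real_le_rsqrt) (simp add: power2_eq_square)
  then have "3 * (17/10) \<le> pi * sqrt 3" using pi_gt3 by (intro mult_mono) auto
  moreover have "pi * sqrt 3 \<le> 2 * pi * Im \<tau>"
    using assms mult_left_mono[of "sqrt 3 / 2" "Im \<tau>" "2 * pi"] by (simp add: fund_region_def)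
  ultimately have im: "5 \<le> 2 * pi * Im \<tau>" by linarith
  have "(13/8 :: real) \<le> exp (1/2)" using exp_lower_Taylor_quadratic[of "1/2 :: real"] by (simp add: power2_eq_square)
  then have "(13/8 :: real) ^ 10 \<le> exp (1/2) ^ 10" by (intro power_mono) auto
  also have "exp (1/2 :: real) ^ 10 = exp 5" by (simp flip: exp_of_nat_mult)
  finally have "(13/8) ^ 10 \<le> exp (5 :: real)" .
  moreover have "100 \<le> (13/8 :: real) ^ 10" by (simp add: power_divide)
  ultimately have "100 \<le> exp (5 :: real)" by linarith
  also have "exp 5 \<le> exp (2 * pi * Im \<tau>)" using im by simp
  finally have e: "100 \<le> exp (2 * pi * Im \<tau>)" .
  have "y = inverse (exp (2 * pi * Im \<tau>))" by (simp add: y_def q_def norm_ee exp_minus)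
  also have "\<dots> \<le> inverse 100" using e by (intro le_imp_inverse_le) auto
  finally have y: "y \<le> 1/100" by simp
  have y0: "y > 0" by (simp add: y_def q_def)
  have q1: "norm q < 1" using y by (simp add: y_def)
  \<comment> \<open>The crude bound sigma_3(n + 1) <= (n + 1)^4 <= 16^n suffices: the series is
    dominated by a geometric one of ratio 16 y <= 16/100.\<close>
  have c: "norm (fps_nth (Sf 3) (Suc n)) \<le> 16 ^ n" for n
  proof -
    have "(\<Sum>d | d dvd Suc n. d ^ 3) \<le> (\<Sum>d\<in>{1..Suc n}. Suc n ^ 3)"
    proof (rule order_trans)
      show "(\<Sum>d | d dvd Suc n. d ^ 3) \<le> (\<Sum>d | d dvd Suc n. Suc n ^ 3)"
        by (intro sum_mono power_mono) (auto dest: dvd_imp_le)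
      show "(\<Sum>d | d dvd Suc n. Suc n ^ 3) \<le> (\<Sum>d\<in>{1..Suc n}. Suc n ^ 3)"
      proof (rule sum_mono2)
        show "{d. d dvd Suc n} \<subseteq> {1..Suc n}"
        proof
          fix d assume "d \<in> {d. d dvd Suc n}"
          then have d: "d dvd Suc n" by simp
          then show "d \<in> {1..Suc n}" using dvd_pos_nat[OF _ d] dvd_imp_le[OF d] by (simp add: Suc_le_eq)
        qed
      qed simp_all
    qed
    also have "\<dots> = Suc n ^ 4" by (simp add: power_numeral_reduce)
    also have "\<dots> \<le> 16 ^ n"
    proof (induction n)
      case (Suc n)
      have "Suc (Suc n) ^ 4 \<le> (2 * Suc n) ^ 4" by (rule power_mono) auto
      also have "\<dots> = 16 * Suc n ^ 4" by (simp only: power_mult_distrib) simp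
      also have "\<dots> \<le> 16 * 16 ^ n" using Suc.IH by simp
      finally show ?case by simp
    qed simp
    finally have "real (\<Sum>d | d dvd Suc n. d ^ 3) \<le> real (16 ^ n)" by (simp only: of_nat_le_iff)
    then show ?thesis unfolding Sf_def fps_nth_Abs_fps norm_of_nat by simp
  qed
  have "(\<lambda>k. fps_nth (Sf 3) k * q ^ k) sums eval_fps (Sf 3) q" using Lambert_has_sum(2)[OF q1, of 3] by simp
  moreover have "fps_nth (Sf 3) 0 = 0" by (simp add: Sf_def)
  ultimately have sums: "(\<lambda>k. fps_nth (Sf 3) (Suc k) * q ^ Suc k) sums eval_fps (Sf 3) q"
    using sums_Suc_iff[of "\<lambda>k. fps_nth (Sf 3) k * q ^ k"] by simp
  have le: "norm (fps_nth (Sf 3) (Suc k) * q ^ Suc k) \<le> y * (16 * y) ^ k" for k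
  proof -
    have "norm (fps_nth (Sf 3) (Suc k) * q ^ Suc k) \<le> 16 ^ k * y ^ Suc k"
      unfolding norm_mult norm_power y_def by (intro mult_right_mono c) auto
    then show ?thesis by (simp add: power_mult_distrib mult_ac)
  qed
  have g: "(\<lambda>k. y * (16 * y) ^ k) sums (y * (1 / (1 - 16 * y)))"
    using y y0 by (intro sums_mult geometric_sums) simp
  have sn: "summable (\<lambda>k. norm (fps_nth (Sf 3) (Suc k) * q ^ Suc k))"
    by (rule summable_comparison_test'[OF sums_summable[OF g], of 0]) (use le in simp)
  have "norm (eval_fps (Sf 3) q) = norm (\<Sum>k. fps_nth (Sf 3) (Suc k) * q ^ Suc k)" using sums_unique[OF sums] by simp
  also have "\<dots> \<le> (\<Sum>k. norm (fps_nth (Sf 3) (Suc k) * q ^ Suc k))" by (rule summable_norm[OF sn])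
  also have "\<dots> \<le> (\<Sum>k. y * (16 * y) ^ k)" by (rule suminf_le[OF le sn sums_summable[OF g]])
  also have "\<dots> = y * (1 / (1 - 16 * y))" by (rule sums_unique[OF g, symmetric])
  also have "\<dots> \<le> 1/84" using y y0 by (simp add: field_simps)
  finally have S: "norm (eval_fps (Sf 3) q) \<le> 1/84" .
  have "norm (E4 \<tau>) \<le> norm (1 :: complex) + norm (240 * eval_fps (Sf 3) q)"
    unfolding E4_def q_def[symmetric] eval_E46(1)[OF q1] by (rule norm_triangle_ineq)
  also have "\<dots> \<le> 27/7" using S by (simp add: norm_mult)
  finally have E4: "norm (E4 \<tau>) ^ 3 \<le> (27/7) ^ 3" by (intro power_mono) auto
  have P: "1 - y / (1 - y) \<le> norm (Pf 1 Suc q)"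
    by (rule Pf_norm_bounds(1)) (use y in \<open>auto simp: y_def\<close>)
  have "98/99 \<le> 1 - y / (1 - y)" using y y0 by (simp add: field_simps)
  then have "(98/99) ^ 24 \<le> norm (Pf 1 Suc q) ^ 24" using P by (intro power_mono) auto
  moreover have "75/99 \<le> (98/99 :: real) ^ 24" using Bernoulli_inequality[of "- 1/99 :: real" 24] by simp
  ultimately have eta: "75/99 \<le> norm (etaP q)" unfolding etaP_def norm_power by linarith
  have "norm (j_inv \<tau>) = norm (E4 \<tau>) ^ 3 / (y * norm (etaP q))"
    unfolding j_inv_eq[OF \<tau>] eta24_etaP q_def[symmetric] y_def by (simp add: norm_divide norm_mult norm_power)
  also have "\<dots> \<le> (27/7) ^ 3 / (y * (75/99))"
    using E4 eta y0 by (intro frac_le mult_left_mono mult_pos_pos) auto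
  also have "\<dots> \<le> 100 / y" using y0 by (simp add: field_simps)
  finally show ?thesis by (simp add: y_def q_def)
qed

text \<open>For the lower bound, N/(1 - w) is minus the sum of k w^k over k < N, whose modulus is at
  most N^2/2.\<close>

lemma hc_bounds:
  assumes N: "N \<ge> 2" and h: "hc N r s \<noteq> 0"
  shows "2 / real N \<le> norm (hc N r s)" "norm (hc N r s) \<le> 2"
proof -
  have N0: "N > 0" using N by simp
  show "norm (hc N r s) \<le> 2"
    unfolding hc_def using norm_triangle_ineq4[of 1 "zeta N powi s"] by simp
  show "2 / real N \<le> norm (hc N r s)"
  proof (cases "r mod int N = 0")
    case False
    then show ?thesis using N by (simp add: hc_def)
  next
    case True
    define w where "w = zeta N powi s"
    have hw: "hc N r s = 1 - w" using True by (simp add: hc_def w_def)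
    then have w1: "w \<noteq> 1" using h by auto
    then have "\<not> int N dvd s" unfolding w_def zeta_powi_eq_1_iff[OF N0] .
    from sum_k_roots_of_unity[OF N0 this]
    have "norm (of_nat N / (1 - w)) = norm (\<Sum>k<N. of_nat k * w ^ k)" unfolding w_def by (metis norm_minus_cancel)
    also have "\<dots> \<le> (\<Sum>k<N. norm (of_nat k * w ^ k))" by (rule norm_sum)
    also have "\<dots> = (\<Sum>k<N. real k)" by (simp add: norm_mult norm_power w_def)
    also have "\<dots> \<le> real N * real N / 2"
    proof -
      have "2 * (\<Sum>k<n. real k) \<le> real n * real n" for n by (induction n) (simp_all add: algebra_simps)
      from this[of N] show ?thesis by simp
    qed
    finally have "real N / norm (1 - w) \<le> real N * real N / 2" by (simp add: norm_divide)
    moreover have "norm (1 - w) > 0" using w1 by simp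
    ultimately show ?thesis unfolding hw using N0 by (simp add: field_simps)
  qed
qed

lemma ln_power_int: "t > 0 \<Longrightarrow> ln (t powi b) = of_int b * ln (t :: real)"
  by (cases b rule: int_cases2) (simp_all add: power_int_minus ln_inverse ln_realpow)

text \<open>For t <= 1/8 both infinite products lie between 6/7 and 7/6. With 2/N <= |hc| <= 2 their
  product with \<open>hc\<close> lies between 1/N and 3, and the exponent 12 N gives the two error
  terms.\<close>

lemma hh_log_bounds:
  assumes N: "N \<ge> 2" and \<tau>: "\<tau> \<in> uhp" and h: "hh N r s \<tau> \<noteq> 0"
  defines "t \<equiv> norm (ee (\<tau> / of_nat N))"
  assumes t: "t \<le> 1/8"
  shows "of_int (bq N r) * ln t - 12 * real N * ln (real N) \<le> ln (norm (hh N r s \<tau>))"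
    "ln (norm (hh N r s \<tau>)) \<le> of_int (bq N r) * ln t + 12 * real N * ln 3"
proof -
  have N0: "N > 0" using N by simp
  define x where "x = ee (\<tau> / of_nat N)"
  define p1 p2 where "p1 = norm (Pf (zeta N powi s) (ka N r) x)" and "p2 = norm (Pf (zeta N powi (- s)) (kb N r) x)"
  define b where "b = norm (hc N r s) * p1 * p2"
  have eq: "hh N r s \<tau> = x powi (bq N r) * (zeta N powi (6 * (r mod int N) * s) * hprod N r s x)"
    unfolding x_def by (rule hh_product[OF N0 \<tau>])
  have hp: "norm (hprod N r s x) = b ^ (12 * N)" by (simp add: hprod_def b_def p1_def p2_def norm_power norm_mult)
  have "hprod N r s x \<noteq> 0" using h unfolding eq by auto
  then have hc0: "hc N r s \<noteq> 0" using N0 by (auto simp: hprod_def)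
  have t0: "t > 0" by (simp add: t_def)
  have t': "t / (1 - t) \<le> 1/7" using t t0 by (simp add: field_simps)
  have "norm x \<le> t" "t < 1/2" using t by (simp_all add: x_def t_def)
  note B1 = Pf_norm_bounds[of "zeta N powi s" "ka N r", OF _ ka_gt[OF N0] this] and B2 = Pf_norm_bounds[of "zeta N powi (- s)" "kb N r", OF _ kb_gt[OF N0] this]
  have l: "6/7 \<le> p1" "6/7 \<le> p2" using B1(1) B2(1) t' unfolding p1_def p2_def by simp_all
  have u: "p \<le> 7/6" if "p * (1 - t / (1 - t)) \<le> 1" "6/7 \<le> p" for p :: real
  proof -
    have "p * (6/7) \<le> p * (1 - t / (1 - t))" using that t' by (intro mult_left_mono) auto
    then show ?thesis using that(1) by linarith
  qed
  have u': "p1 \<le> 7/6" "p2 \<le> 7/6" using u[OF _ l(1)] u[OF _ l(2)] B1(2) B2(2) unfolding p1_def p2_def by simp_all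
  have "(2 / real N) * (6/7) * (6/7) \<le> b"
    unfolding b_def by (intro mult_mono l hc_bounds[OF N hc0]) (use l in auto)
  moreover have "1 / real N \<le> (2 / real N) * (6/7) * (6/7)" using N0 by (simp add: field_simps)
  ultimately have b1: "1 / real N \<le> b" by linarith
  have "b \<le> 2 * (7/6) * (7/6)"
    unfolding b_def by (intro mult_mono u' hc_bounds[OF N hc0]) (use l in auto)
  then have b2: "b \<le> 3" by simp
  have b0: "b > 0" using b1 N0 by (meson less_le_trans of_nat_0_less_iff zero_less_divide_1_iff)
  have "norm (hh N r s \<tau>) = t powi (bq N r) * b ^ (12 * N)"
    unfolding eq norm_mult norm_zeta_powi hp by (simp add: norm_power_int t_def x_def)
  then have L: "ln (norm (hh N r s \<tau>)) = of_int (bq N r) * ln t + 12 * real N * ln b"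
    using t0 b0 by (simp add: ln_mult ln_power_int ln_realpow)
  have "- ln (real N) = ln (1 / real N)" using N0 by (simp add: ln_div)
  also have "\<dots> \<le> ln b" using b1 N0 b0 by (subst ln_le_cancel_iff) auto
  finally have "12 * real N * (- ln (real N)) \<le> 12 * real N * ln b" by (intro mult_left_mono) auto
  then show "of_int (bq N r) * ln t - 12 * real N * ln (real N) \<le> ln (norm (hh N r s \<tau>))" unfolding L by simp
  have "ln b \<le> ln 3" using b2 b0 by simp
  then have "12 * real N * ln b \<le> 12 * real N * ln 3" by (intro mult_left_mono) auto
  then show "ln (norm (hh N r s \<tau>)) \<le> of_int (bq N r) * ln t + 12 * real N * ln 3" unfolding L by simp
qed

section \<open>The height bound\<close>

lemma even_card_involution:
  assumes "finite A" "\<And>a. a \<in> A \<Longrightarrow> \<phi> a \<in> A \<and> \<phi> (\<phi> a) = a \<and> \<phi> a \<noteq> a"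
  shows "even (card A)"
  using assms
proof (induction "card A" arbitrary: A rule: less_induct)
  case less
  show ?case
  proof (cases "A = {}")
    case False
    then obtain a where a: "a \<in> A" by blast
    define B where "B = A - {a, \<phi> a}"
    have sub: "{a, \<phi> a} \<subseteq> A" and ne: "\<phi> a \<noteq> a" using less.prems(2)[OF a] a by auto
    have "card {a, \<phi> a} = 2" using ne by simp
    then have cA: "card A = card B + 2"
      using card_Diff_subset[OF _ sub] card_mono[OF less.prems(1) sub] by (simp add: B_def)
    have "even (card B)"
    proof (rule less.hyps)
      show "card B < card A" using cA by simp
      show "finite B" using less.prems(1) by (simp add: B_def)
      fix b assume "b \<in> B"
      then have b: "b \<in> A" "b \<noteq> a" "b \<noteq> \<phi> a" by (auto simp: B_def)
      note 1 = less.prems(2)[OF b(1)] and 2 = less.prems(2)[OF a]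
      have "\<phi> b \<noteq> a" "\<phi> b \<noteq> \<phi> a" using 1 2 b by metis+
      then show "\<phi> b \<in> B \<and> \<phi> (\<phi> b) = b \<and> \<phi> b \<noteq> b" using 1 by (simp add: B_def)
    qed
    then show ?thesis using cA by simp
  qed simp
qed

context level_group
begin

text \<open>If the function field were empty, \<open>galois_maps\<close> would hold vacuously for
  any two cusps.\<close>

lemma function_field_nonempty:
  assumes "\<not> galois_transitive_on_cusps N G"
  obtains f where "f \<in> function_field N G"
proof (cases "function_field N G = {}")
  case True
  have "id \<in> Gal_Q" by (simp add: Gal_Q_def)
  then have "galois_transitive_on_cusps N G"
    using True unfolding galois_transitive_on_cusps_def galois_maps_def by blast
  then show ?thesis using assms by blast
qed (use that in blast)

lemma G_uminus:
  assumes neg: "mat_mod N (- mat 1) \<in> G"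
  shows "bij_betw (\<lambda>g. mat_mod N (- g)) G G"
proof -
  have "mat_mod N (g ** mat_mod N (- mat 1)) = mat_mod N (- g)" for g
    by (simp add: mat2_eq_iff mult_nth2)
  then show ?thesis using G_bij[OF neg] by simp
qed

text \<open>Each \<open>bq\<close> has the parity of N, so the sum has the parity of |G| N. For odd
  N the involution g -> -g of G has no fixed point: 2 g = 0 modulo N would contradict the invertible
  determinant. Evenness improves a nonzero order to one of absolute value at least 2.\<close>

lemma order_sum_even:
  assumes neg: "mat_mod N (- mat 1) \<in> G"
  shows "even (\<Sum>g\<in>G. bq N (x g))"
proof -
  have b: "even (bq N r - int N)" for r by (simp add: bq_def)
  have "even (\<Sum>g\<in>G. bq N (x g) - int N)" by (rule dvd_sum) (rule b)
  moreover have "(\<Sum>g\<in>G. bq N (x g) - int N) = (\<Sum>g\<in>G. bq N (x g)) - int (card G * N)"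
    by (simp add: sum_subtractf)
  moreover have "even (card G * N)"
  proof (cases "even N")
    case False
    have "even (card G)"
    proof (rule even_card_involution[OF G_finite, of "\<lambda>g. mat_mod N (- g)"], intro conjI notI)
      fix g assume g: "g \<in> G"
      show "mat_mod N (- g) \<in> G" using bij_betwE[OF G_uminus[OF neg]] g by blast
      have "mat_mod N (- mat_mod N (- g)) = mat_mod N g"
        by (simp add: mat2_eq_iff mod_minus_eq)
      then show "mat_mod N (- mat_mod N (- g)) = g" using G_mod[OF g] by simp
      assume "mat_mod N (- g) = g"
      then have e: "mat_mod N (- g) = mat_mod N g" using G_mod[OF g] by simp
      have d: "int N dvd g$i$j" for i j
      proof -
        have "int N dvd (- g)$i$j - g$i$j" by (rule mat_mod_eq_dvd[OF e])
        then have "int N dvd 2 * g$i$j" by simp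
        moreover have "coprime (int N) 2" using False by simp
        ultimately show ?thesis by (simp add: coprime_dvd_mult_right_iff)
      qed
      have "int N dvd det g" unfolding det_2 by (intro dvd_diff dvd_mult d)
      then have "is_unit (int N)" using G_det[OF g] by (meson coprime_common_divisor dvd_refl)
      then show False using N2 by simp
    qed
    then show ?thesis by simp
  qed simp
  ultimately show ?thesis by simp
qed

text \<open>\<open>fourier_transitive\<close> moves the first column of A to that of \<gamma> by
  some g2 and to that of \<gamma>' by some g1; then g2 times the inverse of g1 is the required
  element. The symmetry it assumes is the bijection g -> -g of G.\<close>

lemma transitive_if_orders_vanish:
  assumes neg: "mat_mod N (- mat 1) \<in> G" and A: "A \<in> SL2Z"
    and H: "\<And>a b. \<not> (int N dvd a \<and> int N dvd b) \<Longrightarrow> (\<Sum>g\<in>G. bq N (a * (g ** A)$1$1 + b * (g ** A)$2$1)) = 0"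
    and \<gamma>: "\<gamma> \<in> SL2Z" "\<gamma>' \<in> SL2Z"
  shows "\<exists>g\<in>G. int N dvd (g ** \<gamma>')$1$1 - \<gamma>$1$1 \<and> int N dvd (g ** \<gamma>')$2$1 - \<gamma>$2$1"
proof -
  have tr: "int N dvd a - c" if "int N dvd a - b" "int N dvd b - c" for a b c
    using dvd_add[OF that] by simp
  have colc: "int N dvd (B ** M)$i$1 - (B ** M')$i$1" if "int N dvd M$1$1 - M'$1$1" "int N dvd M$2$1 - M'$2$1" for B M M' :: "int^2^2" and i :: 2
  proof -
    have "(B ** M)$i$1 - (B ** M')$i$1 = B$i$1 * (M$1$1 - M'$1$1) + B$i$2 * (M$2$1 - M'$2$1)"
      by (simp add: mult_nth2 algebra_simps)
    then show ?thesis using dvd_add[OF dvd_mult[OF that(1)] dvd_mult[OF that(2)]] by simp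
  qed
  have negc: "card {g\<in>G. int N dvd - (g ** A)$1$1 - s \<and> int N dvd - (g ** A)$2$1 - t} = card {g\<in>G. int N dvd (g ** A)$1$1 - s \<and> int N dvd (g ** A)$2$1 - t}" for s t
  proof -
    define P where "P = (\<lambda>g :: int^2^2. int N dvd (g ** A)$1$1 - s \<and> int N dvd (g ** A)$2$1 - t)"
    define \<phi> where "\<phi> = (\<lambda>g :: int^2^2. mat_mod N (- g))"
    have bij: "bij_betw \<phi> G G" unfolding \<phi>_def by (rule G_uminus[OF neg])
    have P\<phi>: "P (\<phi> g) \<longleftrightarrow> int N dvd - (g ** A)$1$1 - s \<and> int N dvd - (g ** A)$2$1 - t" for g
    proof -
      have m: "mat_mod N (\<phi> g ** A) = mat_mod N ((- g) ** A)" unfolding \<phi>_def by simp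
      have n: "((- g) ** A)$i$1 = - (g ** A)$i$1" for i :: 2 by (simp add: mult_nth2)
      have "int N dvd (\<phi> g ** A)$i$1 - z \<longleftrightarrow> int N dvd - (g ** A)$i$1 - z" for i :: 2 and z
        using mat_mod_eq_dvd[OF m, of i 1] mat_mod_eq_dvd[OF m[symmetric], of i 1] tr unfolding n by blast
      then show ?thesis unfolding P_def by simp
    qed
    have e: "{g\<in>G. int N dvd - (g ** A)$1$1 - s \<and> int N dvd - (g ** A)$2$1 - t} = {g\<in>G. P (\<phi> g)}" by (simp only: P\<phi>)
    have im: "\<phi> ` {g\<in>G. P (\<phi> g)} = {g\<in>G. P g}" 
    proof (intro equalityI subsetI)
      fix y assume "y \<in> \<phi> ` {g\<in>G. P (\<phi> g)}"
      then obtain g where "y = \<phi> g" "g \<in> G" "P (\<phi> g)" by blast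
      then show "y \<in> {g\<in>G. P g}" using bij_betwE[OF bij] by simp
    next
      fix y assume y: "y \<in> {g\<in>G. P g}"
      then have "y \<in> \<phi> ` G" using bij_betw_imp_surj_on[OF bij] by simp
      then obtain g where "y = \<phi> g" "g \<in> G" by (rule imageE)
      then show "y \<in> \<phi> ` {g\<in>G. P (\<phi> g)}" using y by simp
    qed
    have "inj_on \<phi> {g\<in>G. P (\<phi> g)}" by (rule inj_on_subset[OF bij_betw_imp_inj_on[OF bij]]) blast
    from card_image[OF this] have "card {g\<in>G. P (\<phi> g)} = card {g\<in>G. P g}" unfolding im by (rule sym)
    moreover have "{g\<in>G. P g} = {g\<in>G. int N dvd (g ** A)$1$1 - s \<and> int N dvd (g ** A)$2$1 - t}"
      by (simp only: P_def)
    ultimately show ?thesis unfolding e by (simp only:)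
  qed
  have orbit: "\<exists>g\<in>G. int N dvd (g ** A)$1$1 - \<delta>$1$1 \<and> int N dvd (g ** A)$2$1 - \<delta>$2$1" if \<delta>: "\<delta> \<in> SL2Z" for \<delta>
  proof (rule fourier_transitive[OF N2 G_finite _ negc H])
    show "G \<noteq> {}" using G_one by blast
    have "gcd (\<delta>$1$1) (\<delta>$2$1) dvd \<delta>$1$1 * \<delta>$2$2 - \<delta>$1$2 * \<delta>$2$1" by (intro dvd_diff dvd_mult dvd_mult2) auto
    then have "is_unit (gcd (\<delta>$1$1) (\<delta>$2$1))" using \<delta> unfolding SL2Z_iff by simp
    then have "gcd (\<delta>$1$1) (\<delta>$2$1) = 1" by simp
    then show "gcd (gcd (\<delta>$1$1) (\<delta>$2$1)) (int N) = 1" by simp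
  qed
  obtain g1 where g1: "g1 \<in> G" "int N dvd (g1 ** A)$1$1 - \<gamma>'$1$1" "int N dvd (g1 ** A)$2$1 - \<gamma>'$2$1" using orbit[OF \<gamma>(2)] by blast
  obtain g2 where g2: "g2 \<in> G" "int N dvd (g2 ** A)$1$1 - \<gamma>$1$1" "int N dvd (g2 ** A)$2$1 - \<gamma>$2$1" using orbit[OF \<gamma>(1)] by blast
  obtain k where k: "k \<in> G" "mat_mod N (k ** g1) = mat_mod N (mat 1)" using G_left_inverse[OF g1(1)] by blast
  have sw: "int N dvd b - a" if "int N dvd a - b" for a b using that by (simp add: dvd_diff_commute)
  have kA: "int N dvd (k ** \<gamma>')$i$1 - A$i$1" for i :: 2
  proof (rule tr)
    show "int N dvd (k ** \<gamma>')$i$1 - (k ** (g1 ** A))$i$1" by (rule colc[OF sw[OF g1(2)] sw[OF g1(3)]])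
    have "mat_mod N ((k ** g1) ** A) = mat_mod N (mat 1 ** A)" by (rule mat_mod_mult_cong[OF k(2) refl])
    then have "mat_mod N (k ** (g1 ** A)) = mat_mod N A" by (simp add: matrix_mul_assoc)
    then show "int N dvd (k ** (g1 ** A))$i$1 - A$i$1" by (rule mat_mod_eq_dvd)
  qed
  have fin: "int N dvd (mat_mod N (g2 ** k) ** \<gamma>')$i$1 - (g2 ** A)$i$1" for i :: 2
  proof (rule tr)
    have "mat_mod N (mat_mod N (g2 ** k) ** \<gamma>') = mat_mod N (g2 ** (k ** \<gamma>'))" by (simp add: matrix_mul_assoc)
    then show "int N dvd (mat_mod N (g2 ** k) ** \<gamma>')$i$1 - (g2 ** (k ** \<gamma>'))$i$1" by (rule mat_mod_eq_dvd)
    show "int N dvd (g2 ** (k ** \<gamma>'))$i$1 - (g2 ** A)$i$1" by (rule colc[OF kA kA])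
  qed
  show ?thesis
    using G_closed[OF g2(1) k(1)] tr[OF fin[of 1] g2(2)] tr[OF fin[of 2] g2(3)] by blast
qed

text \<open>As U and N^(12 N |G|)/U are nonzero integers, log|U| lies between 0 and 12 N |G| log N.
  Near the cusp it is S log t up to an error, S being the nonzero order, so -log t is bounded for
  either sign of S; q = x^N supplies the last factor N.\<close>

lemma height_bound:
  assumes neg: "mat_mod N (- mat 1) \<in> G" and nt: "\<not> galois_transitive_on_cusps N G"
    and P: "rational_point N G P" "Pt (mob A \<tau>0) \<in> P" and j: "j_inv (mob A \<tau>0) \<in> \<int>"
    and A: "A \<in> SL2Z" and \<tau>0: "\<tau>0 \<in> uhp"
  shows "- ln (norm (ee \<tau>0)) \<le> 12 * (real N)\<^sup>2 * real (card G) * ln (real N)"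
proof -
  define t where "t = norm (ee (\<tau>0 / of_nat N))"
  have t0: "t > 0" by (simp add: t_def)
  have "ee \<tau>0 = ee (\<tau>0 / of_nat N) ^ N" using N0 by (simp add: ee_power)
  then have L: "- ln (norm (ee \<tau>0)) = real N * (- ln t)" using t0 by (simp add: norm_power t_def ln_realpow)
  define M where "M = real (card G)"
  have "card G > 0" using G_finite G_one by (auto simp: card_gt_0_iff)
  then have M1: "M \<ge> 1" by (simp add: M_def)
  have N2': "real N \<ge> 2" using N2 by simp
  have ln2: "ln 2 \<le> ln (real N)" using N2 by simp
  have lnN: "ln (real N) > 0" using N2' by simp
  have NM: "1 \<le> real N * M" using mult_mono[of 1 "real N" 1 M] N2' M1 by simp
  have "- ln t \<le> 12 * (real N * M) * ln (real N)"
  proof (cases "t \<le> 1/8")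
    \<comment> \<open>Away from the cusp there is nothing to prove: -log t < 3 log 2.\<close>
    case False
    have "- ln t \<le> - ln (1/8)" using False t0 by simp
    also have "\<dots> = 3 * ln 2" using ln_realpow[of 2 3] by (simp add: ln_div)
    also have "\<dots> \<le> 12 * ln (real N)" using ln2 lnN by linarith
    also have "\<dots> \<le> 12 * (real N * M) * ln (real N)"
      using mult_right_mono[OF NM, of "12 * ln (real N)"] lnN by (simp add: mult_ac)
    finally show ?thesis .
  next
    case True
    have "\<exists>u v. \<not> (int N dvd u \<and> int N dvd v) \<and> (\<Sum>g\<in>G. bq N (u * (g ** A)$1$1 + v * (g ** A)$2$1)) \<noteq> 0"
    proof (rule ccontr)
      assume none: "\<not> ?thesis"
      have "galois_transitive_on_cusps N G"
        by (rule galois_transitive_if_transitive[OF neg], rule transitive_if_orders_vanish[OF neg A]) (use none in blast)+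
      then show False using nt by blast
    qed
    then obtain u v where uv: "\<not> (int N dvd u \<and> int N dvd v)" "(\<Sum>g\<in>G. bq N (u * (g ** A)$1$1 + v * (g ** A)$2$1)) \<noteq> 0"
      by blast
    define r where "r = (\<lambda>g :: int^2^2. u * (g ** A)$1$1 + v * (g ** A)$2$1)"
    define S where "S = (\<Sum>g\<in>G. bq N (r g))"
    have S0: "S \<noteq> 0" using uv(2) by (simp add: S_def r_def)
    have "even S" unfolding S_def by (rule order_sum_even[OF neg])
    then have S2: "S \<ge> 2 \<or> S \<le> -2" using S0 by presburger
    obtain f0 where f0: "f0 \<in> function_field N G" using function_field_nonempty[OF nt] by blast
    define U where "U = Uf N G u v (mat 1) (mob A \<tau>0)"
    have mA: "mob A \<tau>0 \<in> uhp" by (rule mob_in_uhp[OF A \<tau>0])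
    have Uz: "U \<in> \<int>" "of_nat N ^ (12 * N * card G) * inverse U \<in> \<int>"
      unfolding U_def by (rule Uf_integer[OF P(1) f0 mA P(2) j])+
    have Unz: "U \<noteq> 0" unfolding U_def by (rule Uf_nonzero[OF mA SL2Z_1 uv(1)])
    have int1: "1 \<le> norm z" if "z \<in> \<int>" "z \<noteq> 0" for z :: complex
      using that by (auto elim!: Ints_cases)
    have U1: "0 \<le> ln (norm U)" using int1[OF Uz(1) Unz] by simp
    have "1 \<le> norm (of_nat N ^ (12 * N * card G) * inverse U)" by (rule int1[OF Uz(2)]) (use Unz N0 in simp)
    then have "norm U \<le> real N ^ (12 * N * card G)" using Unz unfolding norm_mult norm_power norm_inverse norm_of_nat by (simp add: field_simps)
    then have "ln (norm U) \<le> ln (real N ^ (12 * N * card G))" using Unz N0 by simp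
    also have "\<dots> = 12 * (real N * M) * ln (real N)" using N0 by (simp add: ln_realpow M_def)
    finally have U2: "ln (norm U) \<le> 12 * (real N * M) * ln (real N)" .
    define s where "s = (\<lambda>g :: int^2^2. u * (g ** A)$1$2 + v * (g ** A)$2$2)"
    have UU: "U = (\<Prod>g\<in>G. hh N (r g) (s g) \<tau>0)"
    proof -
      have "U = Uf N G u v (mat 1 ** A) \<tau>0" unfolding U_def by (rule modfamD(2)[OF galfamD(1)[OF galfam_Uf] A \<tau>0])
      then show ?thesis unfolding Uf_def hfam_def[OF N0] r_def s_def by simp
    qed
    have hnz: "hh N (r g) (s g) \<tau>0 \<noteq> 0" if "g \<in> G" for g
      using Unz that unfolding UU by (auto simp: prod_zero_iff[OF G_finite])
    have lnU: "ln (norm U) = (\<Sum>g\<in>G. ln (norm (hh N (r g) (s g) \<tau>0)))"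
      unfolding UU prod_norm[symmetric] by (rule ln_prod[OF G_finite]) (use hnz in simp)
    note hb = hh_log_bounds[OF N2 \<tau>0 hnz, folded t_def, OF _ True]
    have lo: "of_int S * ln t - 12 * (real N * M) * ln (real N) \<le> ln (norm U)"
    proof -
      have "(\<Sum>g\<in>G. of_int (bq N (r g)) * ln t - 12 * real N * ln (real N)) \<le> ln (norm U)"
        unfolding lnU by (rule sum_mono) (rule hb(1))
      then show ?thesis by (simp add: sum_subtractf S_def M_def mult_ac sum_distrib_left)
    qed
    have hi: "ln (norm U) \<le> of_int S * ln t + 12 * (real N * M) * ln 3"
    proof -
      have "ln (norm U) \<le> (\<Sum>g\<in>G. of_int (bq N (r g)) * ln t + 12 * real N * ln 3)"
        unfolding lnU by (rule sum_mono) (rule hb(2))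
      then show ?thesis by (simp add: sum.distrib S_def M_def mult_ac sum_distrib_left)
    qed
    have lt: "ln t < 0" using True t0 by simp
    from S2 show ?thesis
    proof
      \<comment> \<open>A zero makes U small, so |U| >= 1 is the binding constraint. The error log 3
        is at most 2 log N since 3 <= N^2.\<close>
      assume "S \<ge> 2"
      then have "2 * (- ln t) \<le> of_int S * (- ln t)" using lt by (intro mult_right_mono) auto
      also have "\<dots> \<le> 12 * (real N * M) * ln 3" using hi U1 by simp
      also have "\<dots> \<le> 12 * (real N * M) * (2 * ln (real N))"
      proof (intro mult_left_mono)
        have "3 \<le> real N ^ 2" using power_mono[OF N2', of 2] by simp
        then have "ln 3 \<le> ln (real N ^ 2)" using N0 by (subst ln_le_cancel_iff) auto
        then show "ln 3 \<le> 2 * ln (real N)" using N0 by (simp add: ln_realpow)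
      qed (use NM in simp)
      finally show ?thesis by (simp add: mult_ac)
    next
      \<comment> \<open>A pole makes U large, so the upper bound from the complementary integer is
        used; its size and the error are both 12 N |G| log N, and the 2 on the left absorbs the
        doubling.\<close>
      assume "S \<le> -2"
      then have "2 * (- ln t) \<le> (- of_int S) * (- ln t)" using lt by (intro mult_right_mono) auto
      also have "\<dots> \<le> 12 * (real N * M) * ln (real N) + 12 * (real N * M) * ln (real N)" using lo U2 by linarith
      finally show ?thesis by (simp add: mult_ac)
    qed
  qed
  then have "real N * (- ln t) \<le> real N * (12 * (real N * M) * ln (real N))" by (rule mult_left_mono) simp
  then show ?thesis unfolding L M_def by (simp add: power2_eq_square mult_ac)
qed

end

theorem theorem1p1:
  fixes N :: nat and G :: "(int^2^2) set" and P :: "ext_point set"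
  assumes "N \<ge> 2"
    and "subgroup G (GL2 N)"
    and "mat_mod N (- mat 1) \<in> G"
    and "defined_over_Q N G"
    and "\<not> galois_transitive_on_cusps N G"
    and "P \<in> Y_integral N G"
  shows "ln (cmod (j_at P)) \<le> 12 * real (card G) * (real N)\<^sup>2 * ln (3 * real N)"
proof -
  interpret level_group N G by (rule level_group.intro[OF assms(1,2)])
  have P: "P \<in> Y_curve N G" "rational_point N G P" "j_at P \<in> \<int>"
    using assms(6) by (simp_all add: Y_integral_def Y_rational_def)
  obtain \<tau> where \<tau>: "\<tau> \<in> uhp" "Pt \<tau> \<in> P" "j_at P = j_inv \<tau>" using Y_curve_point[OF P(1)] by blast
  obtain B where B: "B \<in> SL2Z" "mob B \<tau> \<in> fund_region" using ex_fund_region[OF \<tau>(1)] by blast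
  \<comment> \<open>The first column of A represents the cusp nearest to P.\<close>
  obtain A where A: "A \<in> SL2Z" "A ** B = mat 1" using SL2Z_inv[OF B(1)] by blast
  define \<tau>0 where "\<tau>0 = mob B \<tau>"
  have \<tau>0: "\<tau>0 \<in> uhp" unfolding \<tau>0_def by (rule mob_in_uhp[OF B(1) \<tau>(1)])
  have A\<tau>: "mob A \<tau>0 = \<tau>" using mob_mult[OF B(1) \<tau>(1), of A] by (simp add: A(2) \<tau>0_def)
  have jj: "j_inv \<tau>0 = j_at P" unfolding \<tau>0_def j_invariant[OF B(1) \<tau>(1)] \<tau>(3) ..
  define L where "L = - ln (norm (ee \<tau>0))"
  have hb: "L \<le> 12 * (real N)\<^sup>2 * real (card G) * ln (real N)"
    unfolding L_def by (rule height_bound[OF assms(3,5) P(2) _ _ A(1) \<tau>0]) (use \<tau> P(3) in \<open>simp_all add: A\<tau>\<close>)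
  have "card G > 0" using G_finite G_one by (auto simp: card_gt_0_iff)
  then have M1: "real (card G) \<ge> 1" by simp
  define W where "W = 12 * (real N)\<^sup>2 * real (card G)"
  have "12 * 4 * 1 \<le> W" unfolding W_def
    using power_mono[of 2 "real N" 2] M1 assms(1) by (intro mult_mono) auto
  then have W: "48 \<le> W" by simp
  have ln3: "1 \<le> ln (3::real)" using exp_le by (simp add: ln_ge_iff)
  \<comment> \<open>The part with log N bounds log(1/|q|); the part W log 3, at least 48, is left
    over for the constant log 100.\<close>
  have rhs: "12 * real (card G) * (real N)\<^sup>2 * ln (3 * real N) = W * ln 3 + W * ln (real N)"
    using assms(1) by (simp add: W_def ln_mult algebra_simps)
  have W3: "48 \<le> W * ln 3" using mult_mono[OF W ln3] W by simp
  have lnN: "0 \<le> W * ln (real N)" using W assms(1) by simp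
  show ?thesis
  proof (cases "j_at P = 0")
    \<comment> \<open>Here \<open>ln 0 = 0\<close>, and the right side is nonnegative.\<close>
    case True
    then show ?thesis unfolding rhs using W3 lnN by simp
  next
    case False
    have "norm (j_at P) \<le> 100 / norm (ee \<tau>0)" unfolding jj[symmetric] using j_upper_bound B(2) by (simp add: \<tau>0_def)
    then have "ln (norm (j_at P)) \<le> ln (100 / norm (ee \<tau>0))"
      by (subst ln_le_cancel_iff) (use False in simp_all)
    also have "\<dots> = ln 100 + L" by (subst ln_div) (simp_all add: L_def)
    also have "ln 100 \<le> (48 :: real)"
    proof -
      have "ln (100 :: real) = 2 * ln 10" using ln_realpow[of 10 2] by simp
      also have "ln (10 :: real) \<le> 9" using ln_le_minus_one[of "10 :: real"] by simp
      finally show ?thesis by simp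
    qed
    finally show ?thesis unfolding rhs using hb[folded W_def] W3 by linarith
  qed
qed

end
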